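(* Let $m\ge1$ be an integer. Let $(\zeta^{\rm in},q^{\rm in})\in H^m(\mathcal E_-)\times H^{m+1}(\mathcal E_-)$ and $(\overline\zeta^{\rm in},\overline\zeta_1^{\rm in})\in\mathbb R^2$ be such that $$\inf_{\mathcal E_-}(1+\varepsilon\zeta^{\rm in})>0,\qquad h_{\rm wc}^{\rm in}=1+\varepsilon\eta_{\rm eq}+\varepsilon\overline\zeta^{\rm in}>0\qquad\text{and}\qquad q^{\rm in}=|\mathcal E_+|\,\overline\zeta_1^{\rm in}\ \text{ at }x=-r .$$ Then, for any $\varepsilon\in(0,1]$ and $\widetilde\mu>0$, there exists $T>0$ such that the system $$\begin{cases}\partial_t\zeta+\partial_xq=0\\ (1-\widetilde\mu^2\partial_x^2)\partial_tq+\varepsilon\partial_x\big(\frac{q^2}h\big)+h\,\partial_x\zeta=0\end{cases}\ \text{in }\mathcal E_-,\qquad(\zeta,q)\to(0,0)\ \text{as }x\to-\infty,\qquad q=\frac{d\overline\zeta}{dt}|\mathcal E_+|\ \text{at }x=-r,$$ $$\mathcal T^2_{\widetilde\mu,\rm buo}(h,h_{\rm wc})\frac{d^2\overline\zeta}{dt^2}=-(1+P_0)\overline\zeta+\kappa P_0\mathcal D\overline\zeta+\varepsilon\widetilde\beta(h,h_{\rm wc})\Big(\frac{d\overline\zeta}{dt}\Big)^2+\mathcal F(-r)$$ admits a unique solution $(\zeta,q,\overline\zeta)\in C^1\big([0,T);H^m(\mathcal E_-)\times H^{m+1}(\mathcal E_-)\big)\times C^2([0,T);\mathbb R)$ satisfying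 the initial conditions $(\zeta,q)(0,\cdot)=(\zeta^{\rm in},q^{\rm in})$ in $\mathcal E_-$ and $\big(\overline\zeta,\frac{d\overline\zeta}{dt}\big)(0)=(\overline\zeta^{\rm in},\overline\zeta_1^{\rm in})$. In addition, denoting by $T_{\rm max}$ the maximal existence time, if $T_{\rm max}$ is finite then $$\limsup_{t\to T_{\rm max}^-}\Big(\Big\|\zeta(t),q(t),\frac1{h(t)}\Big\|_{L^\infty(\mathcal E_-)}+\Big|\frac{d\overline\zeta}{dt}(t)\Big|+\Big|\frac1{h_{\rm wc}(\overline\zeta(t))}\Big|\Big)=+\infty .$$
   Context: Parameters: $0<r<\ell$, $\mathcal E_-=(-\infty,-r)$, $|\mathcal E_+|=\ell-r$; constants $\alpha>0$, $T_{\rm buo}^2>0$, $P_0>0$, $\kappa\ge0$, $\eta_{\rm eq}<0$. $h=1+\varepsilon\zeta$, $h_{\rm wc}=h_{\rm wc}(\overline\zeta)=1+\varepsilon\eta_{\rm eq}+\varepsilon\overline\zeta$, $\mathcal Df(t)=\int_0^te^{-\kappa(t-s)}f(s)\,ds$; evaluation at $-r$ denotes the trace at $x=-r$; $$\mathcal T^2_{\widetilde\mu,\rm buo}(h,h_{\rm wc})=T_{\rm buo}^2+\alpha|\mathcal E_+|+\frac{|\mathcal E_+|^2}{3h_{\rm wc}}+\frac{\widetilde\mu|\mathcal E_+|}{h(-r)}+\frac{\widetilde\mu^2}{h_{\rm wc}},\qquad\widetilde\beta(h,h_{\rm wc})=\frac{|\mathcal E_+|^2}2\Big(-\frac1{h^2(-r)}+\frac1{3h_{\rm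 wc}^2}\Big),$$ $$\mathcal F=\frac1h\Big(\varepsilon\frac{\zeta^2}2+R_1\varphi\Big),\qquad\varphi=\zeta+\varepsilon\frac{\zeta^2}2+\varepsilon\frac{q^2}h,$$ where $u=R_1v$ on $\mathcal E_-$ iff $(I-\widetilde\mu^2\partial_x^2)u=v$ in $\mathcal E_-$, $\partial_xu\to0$ as $x\to-\infty$ and $\partial_xu=0$ at $x=-r$ (in $L^2$-based Sobolev spaces). The norm $\|f_1,f_2,f_3\|_{L^\infty}$ denotes the $L^\infty$ norm of the triple. *)

theory Defs
  imports "HOL-Analysis.Analysis" "HOL-Probability.Essential_Supremum"
begin

text \<open>
  Elements of Lebesgue and Sobolev spaces are represented by functions, which matter only up to
  equality almost everywhere on the open set under consideration. All notions below respect this.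
\<close>

section \<open>Sobolev spaces on open subsets of the real line\<close>

definition test_function :: "real set \<Rightarrow> (real \<Rightarrow> real) \<Rightarrow> bool" where
  "test_function E \<phi> \<longleftrightarrow>
     (\<forall>n x. (deriv ^^ n) \<phi> field_differentiable at x) \<and>
     (\<exists>K. compact K \<and> K \<subseteq> E \<and> (\<forall>x. x \<notin> K \<longrightarrow> \<phi> x = 0))"

definition locally_integrable :: "real set \<Rightarrow> (real \<Rightarrow> real) \<Rightarrow> bool" where
  "locally_integrable E u \<longleftrightarrow> (\<forall>K. compact K \<and> K \<subseteq> E \<longrightarrow> set_integrable lebesgue K u)"

definition has_weak_deriv :: "real set \<Rightarrow> nat \<Rightarrow> (real \<Rightarrow> real) \<Rightarrow> (real \<Rightarrow> real) \<Rightarrow> bool" where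
  "has_weak_deriv E k u v \<longleftrightarrow>
     locally_integrable E u \<and> locally_integrable E v \<and>
     (\<forall>\<phi>. test_function E \<phi> \<longrightarrow>
        (LINT x|lebesgue_on E. u x * (deriv ^^ k) \<phi> x) =
        (-1) ^ k * (LINT x|lebesgue_on E. v x * \<phi> x))"

definition weak_deriv :: "real set \<Rightarrow> nat \<Rightarrow> (real \<Rightarrow> real) \<Rightarrow> real \<Rightarrow> real" where
  "weak_deriv E k u = (SOME v. has_weak_deriv E k u v)"

definition L2 :: "real set \<Rightarrow> (real \<Rightarrow> real) set" where
  "L2 E = {u. u \<in> borel_measurable (lebesgue_on E) \<and> integrable (lebesgue_on E) (\<lambda>x. (u x)\<^sup>2)}"

definition sobolev :: "real set \<Rightarrow> nat \<Rightarrow> (real \<Rightarrow> real) set" where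
  "sobolev E m = {u \<in> L2 E. \<forall>k\<le>m. \<exists>v\<in>L2 E. has_weak_deriv E k u v}"

definition sobolev_norm :: "real set \<Rightarrow> nat \<Rightarrow> (real \<Rightarrow> real) \<Rightarrow> real" where
  "sobolev_norm E m u = sqrt (\<Sum>k\<le>m. LINT x|lebesgue_on E. (weak_deriv E k u x)\<^sup>2)"

text \<open>\<open>u\<close> is of class \<open>C\<^sup>1\<close> on the time interval \<open>I\<close> with values in \<open>H\<^sup>m(E)\<close>, and \<open>ut\<close> is its
  time derivative; both the limit of the difference quotients and continuity of \<open>ut\<close> are in the
  norm of \<open>H\<^sup>m(E)\<close>, one-sided at an end point belonging to \<open>I\<close>.\<close>

definition C1_sobolev ::
    "real set \<Rightarrow> nat \<Rightarrow> real set \<Rightarrow> (real \<Rightarrow> real \<Rightarrow> real) \<Rightarrow> (real \<Rightarrow> real \<Rightarrow> real) \<Rightarrow> bool" where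
  "C1_sobolev E m I u ut \<longleftrightarrow>
     (\<forall>t\<in>I. u t \<in> sobolev E m \<and> ut t \<in> sobolev E m \<and>
        ((\<lambda>s. sobolev_norm E m (\<lambda>x. (u s x - u t x) / (s - t) - ut t x)) \<longlongrightarrow> 0) (at t within I) \<and>
        ((\<lambda>s. sobolev_norm E m (\<lambda>x. ut s x - ut t x)) \<longlongrightarrow> 0) (at t within I))"

definition Linf_norm :: "real set \<Rightarrow> (real \<Rightarrow> 'a::real_normed_vector) \<Rightarrow> ereal" where
  "Linf_norm E f = esssup (lebesgue_on E) (\<lambda>x. ereal (norm (f x)))"


section \<open>The exterior half-line\<close>

abbreviation Eminus :: "real \<Rightarrow> real set" where
  "Eminus r \<equiv> {..< - r}"

text \<open>Value at \<open>-r\<close> of the representative that is continuous up to the boundary; it exists and is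
  unique for elements of \<open>H\<^sup>1\<close>, and for constants plus elements of \<open>H\<^sup>1\<close>.\<close>

definition bdry_trace :: "real \<Rightarrow> (real \<Rightarrow> real) \<Rightarrow> real" where
  "bdry_trace r u = (THE c. \<exists>v. continuous_on {.. - r} v \<and>
      (AE x in lebesgue_on (Eminus r). v x = u x) \<and> v (- r) = c)"

definition vanishes_at_minus_infinity :: "real \<Rightarrow> (real \<Rightarrow> real) \<Rightarrow> bool" where
  "vanishes_at_minus_infinity r u \<longleftrightarrow>
     (\<forall>e>0. \<exists>M. AE x in lebesgue_on (Eminus r). x < M \<longrightarrow> \<bar>u x\<bar> < e)"

definition positive_infimum :: "real \<Rightarrow> (real \<Rightarrow> real) \<Rightarrow> bool" where
  "positive_infimum r u \<longleftrightarrow> (\<exists>c>0. AE x in lebesgue_on (Eminus r). c \<le> u x)"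

text \<open>The inverse \<open>R\<^sub>1\<close> of \<open>1 - \<mu>\<^sup>2 \<partial>\<^sub>x\<^sup>2\<close> with homogeneous Neumann condition at \<open>-r\<close>.\<close>

definition R1 :: "real \<Rightarrow> real \<Rightarrow> (real \<Rightarrow> real) \<Rightarrow> real \<Rightarrow> real" where
  "R1 r \<mu> v = (SOME u. u \<in> sobolev (Eminus r) 2 \<and>
      (AE x in lebesgue_on (Eminus r). u x - \<mu>\<^sup>2 * weak_deriv (Eminus r) 2 u x = v x) \<and>
      vanishes_at_minus_infinity r (weak_deriv (Eminus r) 1 u) \<and>
      bdry_trace r (weak_deriv (Eminus r) 1 u) = 0)"


section \<open>The wave-structure system\<close>

definition depth :: "real \<Rightarrow> (real \<Rightarrow> real) \<Rightarrow> real \<Rightarrow> real" where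
  "depth \<epsilon> \<zeta> x = 1 + \<epsilon> * \<zeta> x"

definition h_wc :: "real \<Rightarrow> real \<Rightarrow> real \<Rightarrow> real" where
  "h_wc \<epsilon> \<eta>eq b = 1 + \<epsilon> * \<eta>eq + \<epsilon> * b"

definition duhamel :: "real \<Rightarrow> (real \<Rightarrow> real) \<Rightarrow> real \<Rightarrow> real" where
  "duhamel \<kappa> f t = integral {0..t} (\<lambda>s. exp (- \<kappa> * (t - s)) * f s)"

text \<open>In the next two definitions \<open>Lp\<close> stands for the length \<open>\<bar>\<E>\<^sub>+\<bar>\<close>, \<open>h\<close> for the depth function on
  \<open>\<E>\<^sub>-\<close> and \<open>hw\<close> for the value of \<open>h\<^sub>w\<^sub>c\<close>.\<close>

definition period_sq ::
    "real \<Rightarrow> real \<Rightarrow> real \<Rightarrow> real \<Rightarrow> real \<Rightarrow> (real \<Rightarrow> real) \<Rightarrow> real \<Rightarrow> real" where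
  "period_sq r Lp \<alpha> Tbuo \<mu> h hw =
     Tbuo\<^sup>2 + \<alpha> * Lp + Lp\<^sup>2 / (3 * hw) + \<mu> * Lp / bdry_trace r h + \<mu>\<^sup>2 / hw"

definition beta :: "real \<Rightarrow> real \<Rightarrow> (real \<Rightarrow> real) \<Rightarrow> real \<Rightarrow> real" where
  "beta r Lp h hw = Lp\<^sup>2 / 2 * (- 1 / (bdry_trace r h)\<^sup>2 + 1 / (3 * hw\<^sup>2))"

definition phi :: "real \<Rightarrow> (real \<Rightarrow> real) \<Rightarrow> (real \<Rightarrow> real) \<Rightarrow> real \<Rightarrow> real" where
  "phi \<epsilon> \<zeta> q x = \<zeta> x + \<epsilon> * (\<zeta> x)\<^sup>2 / 2 + \<epsilon> * (q x)\<^sup>2 / depth \<epsilon> \<zeta> x"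

definition forcing ::
    "real \<Rightarrow> real \<Rightarrow> real \<Rightarrow> (real \<Rightarrow> real) \<Rightarrow> (real \<Rightarrow> real) \<Rightarrow> real \<Rightarrow> real" where
  "forcing r \<epsilon> \<mu> \<zeta> q x = 1 / depth \<epsilon> \<zeta> x * (\<epsilon> * (\<zeta> x)\<^sup>2 / 2 + R1 r \<mu> (phi \<epsilon> \<zeta> q) x)"

definition time_interval :: "ereal \<Rightarrow> real set" where
  "time_interval T = {t. 0 \<le> t \<and> ereal t < T}"

text \<open>
  \<open>(\<zeta>, q, b)\<close>, where \<open>b\<close> is the vertical displacement \<open>\<zeta>\<close>-bar of the object, solves the initial
  value problem on \<open>[0,T)\<close>, where \<open>T\<close> may be \<open>\<infinity>\<close>. Since the equations divide by \<open>h\<close> and \<open>h\<^sub>w\<^sub>c\<close>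
  (and division by zero yields zero in HOL), positivity of both is part of being a solution.
\<close>

definition wave_structure_solution ::
    "real \<Rightarrow> real \<Rightarrow> real \<Rightarrow> real \<Rightarrow> real \<Rightarrow> real \<Rightarrow> real \<Rightarrow> real \<Rightarrow> real \<Rightarrow> nat \<Rightarrow>
     (real \<Rightarrow> real) \<Rightarrow> (real \<Rightarrow> real) \<Rightarrow> real \<Rightarrow> real \<Rightarrow>
     ereal \<Rightarrow> (real \<Rightarrow> real \<Rightarrow> real) \<Rightarrow> (real \<Rightarrow> real \<Rightarrow> real) \<Rightarrow> (real \<Rightarrow> real) \<Rightarrow> bool" where
  "wave_structure_solution r l \<alpha> Tbuo P0 \<kappa> \<eta>eq \<epsilon> \<mu> m \<zeta>in qin bin b1in T \<zeta> q b \<longleftrightarrow>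
     (\<exists>\<zeta>t qt b' b''.
        \<comment> \<open>regularity\<close>
        C1_sobolev (Eminus r) m (time_interval T) \<zeta> \<zeta>t \<and>
        C1_sobolev (Eminus r) (m + 1) (time_interval T) q qt \<and>
        (\<forall>t\<in>time_interval T. (b has_real_derivative b' t) (at t within time_interval T)) \<and>
        (\<forall>t\<in>time_interval T. (b' has_real_derivative b'' t) (at t within time_interval T)) \<and>
        continuous_on (time_interval T) b'' \<and>
        \<comment> \<open>equations, boundary conditions and positive depths\<close>
        (\<forall>t\<in>time_interval T.
           positive_infimum r (depth \<epsilon> (\<zeta> t)) \<and>
           h_wc \<epsilon> \<eta>eq (b t) > 0 \<and>
           (AE x in lebesgue_on (Eminus r). \<zeta>t t x + weak_deriv (Eminus r) 1 (q t) x = 0) \<and>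
           (AE x in lebesgue_on (Eminus r).
              (qt t x - \<mu>\<^sup>2 * weak_deriv (Eminus r) 2 (qt t) x)
              + \<epsilon> * weak_deriv (Eminus r) 1 (\<lambda>y. (q t y)\<^sup>2 / depth \<epsilon> (\<zeta> t) y) x
              + depth \<epsilon> (\<zeta> t) x * weak_deriv (Eminus r) 1 (\<zeta> t) x = 0) \<and>
           vanishes_at_minus_infinity r (\<zeta> t) \<and>
           vanishes_at_minus_infinity r (q t) \<and>
           bdry_trace r (q t) = b' t * (l - r) \<and>
           period_sq r (l - r) \<alpha> Tbuo \<mu> (depth \<epsilon> (\<zeta> t)) (h_wc \<epsilon> \<eta>eq (b t)) * b'' t =
             - (1 + P0) * b t + \<kappa> * P0 * duhamel \<kappa> b t
             + \<epsilon> * beta r (l - r) (depth \<epsilon> (\<zeta> t)) (h_wc \<epsilon> \<eta>eq (b t)) * (b' t)\<^sup>2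
             + bdry_trace r (forcing r \<epsilon> \<mu> (\<zeta> t) (q t))) \<and>
        \<comment> \<open>initial conditions\<close>
        (AE x in lebesgue_on (Eminus r). \<zeta> 0 x = \<zeta>in x) \<and>
        (AE x in lebesgue_on (Eminus r). q 0 x = qin x) \<and>
        b 0 = bin \<and> b' 0 = b1in)"

text \<open>For a family \<open>Sol\<close> of solution predicates indexed by the existence time: \<open>(\<zeta>, q, b)\<close> is the
  only solution on \<open>[0,T)\<close>, as a function of \<open>t \<in> [0,T)\<close> with values in the Sobolev spaces.\<close>

definition is_unique_solution ::
    "real \<Rightarrow> (ereal \<Rightarrow> (real \<Rightarrow> real \<Rightarrow> real) \<Rightarrow> (real \<Rightarrow> real \<Rightarrow> real) \<Rightarrow> (real \<Rightarrow> real) \<Rightarrow> bool) \<Rightarrow>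
     ereal \<Rightarrow> (real \<Rightarrow> real \<Rightarrow> real) \<Rightarrow> (real \<Rightarrow> real \<Rightarrow> real) \<Rightarrow> (real \<Rightarrow> real) \<Rightarrow> bool" where
  "is_unique_solution r Sol T \<zeta> q b \<longleftrightarrow>
     Sol T \<zeta> q b \<and>
     (\<forall>\<zeta>2 q2 b2. Sol T \<zeta>2 q2 b2 \<longrightarrow>
        (\<forall>t\<in>time_interval T.
           (AE x in lebesgue_on (Eminus r). \<zeta>2 t x = \<zeta> t x) \<and>
           (AE x in lebesgue_on (Eminus r). q2 t x = q t x) \<and>
           b2 t = b t))"

definition max_existence_time ::
    "(ereal \<Rightarrow> (real \<Rightarrow> real \<Rightarrow> real) \<Rightarrow> (real \<Rightarrow> real \<Rightarrow> real) \<Rightarrow> (real \<Rightarrow> real) \<Rightarrow> bool) \<Rightarrow> ereal" where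
  "max_existence_time Sol = Sup {T. 0 < T \<and> (\<exists>\<zeta> q b. Sol T \<zeta> q b)}"

end

theory Submission
  imports Defs
begin

text \<open>
  With the trace \<open>q(-r) = (l - r) b'\<close> as boundary datum the operator \<open>1 - \<mu>\<^sup>2 \<partial>\<^sup>2\<close> can be inverted, and
  the momentum equation becomes \<open>\<partial>\<^sub>t q = (l - r) b'' e\<^bsup>(x+r)/\<mu>\<^esup> - \<partial> R\<^sub>1 \<phi>\<close>. As \<open>\<partial> R\<^sub>1\<close> gains a derivative,
  the whole system is an ordinary differential equation with a locally Lipschitz vector field on
  \<open>H\<^sup>m \<times> H\<^bsup>m+1\<^esup> \<times> \<real>\<^sup>3\<close>, the third scalar being the Duhamel integral. To keep the nonlinearity polynomial,
  \<open>w = 1/h - 1\<close> is carried along as an additional unknown; the relation \<open>(1 + w) h = 1\<close> and the trace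
  condition are preserved by the flow. Since \<open>S = (1 + \<partial>)\<^sup>-\<^sup>1\<close> maps \<open>H\<^sup>k\<close> onto \<open>H\<^bsup>k+1\<^esup>\<close>, all spaces are
  identified with the single Banach algebra \<open>H\<^sup>1\<close> carrying different products.

  For the blow-up criterion, the tame product estimate shows that under bounds in \<open>L\<^sup>\<infinity>\<close> the vector
  field grows at most linearly, first in \<open>H\<^sup>1\<close> and then, inductively, in each higher regularity. So a
  solution that does not blow up in \<open>L\<^sup>\<infinity>\<close> has a limit in the domain of the vector field and can be
  continued.
\<close>

section \<open>Autonomous differential equations in Banach spaces\<close>

text \<open>No derivative is lost in the momentum equation because
  \<open>\<epsilon> (q^2/h)_x + h \<zeta>_x\<close> is the exact derivative of the same
  \<open>\<phi>\<close> that enters the forcing, and none in the continuity equation because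
  \<open>q\<close> is one derivative smoother than \<open>\<zeta>\<close>. A Banach space is here a
  type, which cannot depend on \<open>m\<close>; hence a single type of \<open>H^1\<close>
  functions, in which \<open>m = k + 1\<close> is visible only through the products. Constants are
  not square integrable, so this algebra has no unit: \<open>1/h\<close> enters as
  \<open>1 + w\<close>, and polynomials in it are expanded. In infinite dimension a bounded
  trajectory need not converge. The alternative at the maximal time is therefore the absence of a
  limit inside the domain, and a limit is produced by bounding the velocity. The delicate quantity
  is \<open>q_x\<close>, which the criterion does not control. Its time derivative is
  \<open>(c/\<mu>) e^{x/\<mu>} - (R1 \<phi> - \<phi>)/\<mu>^2\<close> with
  \<open>c = (l - r) b''\<close>. This contains no derivative of the unknowns in space, and
  \<open>R1\<close> does not increase the supremum norm, so bounds in the supremum norm carry over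
  to \<open>q_x\<close>.\<close>

definition loclip_on :: "'a::metric_space set \<Rightarrow> ('a \<Rightarrow> 'b::metric_space) \<Rightarrow> bool" where
  "loclip_on U f \<longleftrightarrow> (\<forall>x\<in>U. \<exists>e>0. \<exists>L. L-lipschitz_on (ball x e \<inter> U) f)"

lemma loclip_on_const: "loclip_on U (\<lambda>x. c)"
  unfolding loclip_on_def by (metis lipschitz_on_constant zero_less_one)

lemma lipschitz_imp_loclip_on: "(\<And>x. x \<in> U \<Longrightarrow> \<exists>L. L-lipschitz_on U f) \<Longrightarrow> loclip_on U f"
  unfolding loclip_on_def
  by (metis inf.cobounded2 lipschitz_on_subset zero_less_one)

lemma loclip_on_bounded_linear:
  assumes "bounded_linear f" shows "loclip_on U f"
proof -
  obtain B where "B-lipschitz_on U f"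
    using bounded_linear.lipschitz_boundE[OF assms] by metis
  then show ?thesis by (intro lipschitz_imp_loclip_on) auto
qed

lemma loclip_onE:
  assumes "loclip_on U f" "x \<in> U" "d > 0"
  obtains e L where "e > 0" "e \<le> d" "L-lipschitz_on (ball x e \<inter> U) f"
proof -
  obtain e L where e: "e > 0" "L-lipschitz_on (ball x e \<inter> U) f"
    using assms by (auto simp: loclip_on_def)
  have "L-lipschitz_on (ball x (min e d) \<inter> U) f"
    by (rule lipschitz_on_subset[OF e(2)]) auto
  then show ?thesis using that[of "min e d" L] assms(3) e by auto
qed

lemma loclip_on_compose:
  assumes f: "loclip_on U f" and g: "loclip_on V g" and im: "f ` U \<subseteq> V"
  shows "loclip_on U (\<lambda>x. g (f x))"
  unfolding loclip_on_def
proof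
  fix x assume x: "x \<in> U"
  then have "f x \<in> V" using im by auto
  then obtain e L where e: "e > 0" "L-lipschitz_on (ball (f x) e \<inter> V) g"
    using g unfolding loclip_on_def by blast
  obtain e1 L1 where e1: "e1 > 0" "L1-lipschitz_on (ball x e1 \<inter> U) f"
    using f x unfolding loclip_on_def by blast
  have L1: "L1 \<ge> 0" using e1(2) lipschitz_on_nonneg by blast
  define d where "d = min e1 (e / (L1 + 1))"
  have d: "d > 0" "d \<le> e1" using e e1 L1 by (auto simp: d_def)
  have sub: "f ` (ball x d \<inter> U) \<subseteq> ball (f x) e \<inter> V"
  proof clarify
    fix y assume y: "y \<in> ball x d" "y \<in> U"
    have "dist (f x) (f y) \<le> L1 * dist x y"
      using lipschitz_onD[OF e1(2)] x y d e1 by auto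
    also have "\<dots> \<le> L1 * (e / (L1 + 1))"
      using y L1 by (intro mult_left_mono) (auto simp: d_def)
    also have "\<dots> < e" using e L1 by (simp add: field_simps)
    finally show "f y \<in> ball (f x) e \<inter> V" using im y by auto
  qed
  have "(L * L1)-lipschitz_on (ball x d \<inter> U) (\<lambda>x. g (f x))"
    by (rule lipschitz_on_compose2[OF lipschitz_on_subset[OF e1(2)] lipschitz_on_subset[OF e(2) sub]])
       (use d in auto)
  then show "\<exists>e>0. \<exists>L. L-lipschitz_on (ball x e \<inter> U) (\<lambda>x. g (f x))" using d by blast
qed

lemma loclip_on_Pair:
  assumes "loclip_on U f" "loclip_on U g" shows "loclip_on U (\<lambda>x. (f x, g x))"
  unfolding loclip_on_def
proof
  fix x assume x: "x \<in> U"
  obtain e L where e: "e > 0" "L-lipschitz_on (ball x e \<inter> U) f"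
    using assms(1) x by (auto simp: loclip_on_def)
  obtain e1 L1 where e1: "e1 > 0" "L1-lipschitz_on (ball x e1 \<inter> U) g"
    using assms(2) x by (auto simp: loclip_on_def)
  have "(sqrt (L\<^sup>2 + L1\<^sup>2))-lipschitz_on (ball x (min e e1) \<inter> U) (\<lambda>x. (f x, g x))"
    by (intro lipschitz_on_Pair lipschitz_on_subset[OF e(2)] lipschitz_on_subset[OF e1(2)]) auto
  then show "\<exists>e>0. \<exists>L. L-lipschitz_on (ball x e \<inter> U) (\<lambda>x. (f x, g x))"
    using e(1) e1(1) by (metis min_less_iff_conj)
qed

lemma loclip_on_bounded_linear_compose:
  assumes "bounded_linear h" "loclip_on U f" shows "loclip_on U (\<lambda>x. h (f x))"
  by (rule loclip_on_compose[OF assms(2) loclip_on_bounded_linear[OF assms(1), of UNIV]]) auto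

lemma loclip_on_bilinear:
  fixes f :: "'a::metric_space \<Rightarrow> 'b::real_normed_vector" and g :: "'a \<Rightarrow> 'c::real_normed_vector"
    and M :: "'b \<Rightarrow> 'c \<Rightarrow> 'd::real_normed_vector"
  assumes "bounded_bilinear M" "loclip_on U f" "loclip_on U g"
  shows "loclip_on U (\<lambda>x. M (f x) (g x))"
  unfolding loclip_on_def
proof
  interpret bounded_bilinear M by fact
  obtain K where K: "K > 0" "\<And>a b. norm (M a b) \<le> norm a * norm b * K"
    using pos_bounded by blast
  fix x assume x: "x \<in> U"
  \<comment> \<open>A radius of at most 1 turns the Lipschitz constants of \<open>f\<close> and
    \<open>g\<close> into bounds for their oscillation on the ball, hence into bounds for the
    undifferenced factors below.\<close>
  obtain e L where e: "e > 0" "e \<le> 1" "L-lipschitz_on (ball x e \<inter> U) f"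
    using loclip_onE[OF assms(2) x, of 1] by auto
  obtain e1 L1 where e1: "e1 > 0" "e1 \<le> e" "L1-lipschitz_on (ball x e1 \<inter> U) g"
    using loclip_onE[OF assms(3) x, of e] e by auto
  have L: "L \<ge> 0" "L1 \<ge> 0" using e e1 lipschitz_on_nonneg by blast+
  let ?B = "ball x e1 \<inter> U"
  have f: "norm (f y) \<le> norm (f x) + L" if "y \<in> ?B" for y
  proof -
    have "norm (f y - f x) \<le> L * dist y x"
      using lipschitz_onD[OF e(3)] that x e e1 by (auto simp: dist_norm)
    also have "\<dots> \<le> L * 1" using that e e1 L by (intro mult_left_mono) (auto simp: dist_commute)
    finally show ?thesis by norm
  qed
  have g: "norm (g y) \<le> norm (g x) + L1" if "y \<in> ?B" for y
  proof -
    have "norm (g y - g x) \<le> L1 * dist y x"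
      using lipschitz_onD[OF e1(3)] that x e e1 by (auto simp: dist_norm)
    also have "\<dots> \<le> L1 * 1" using that e e1 L by (intro mult_left_mono) (auto simp: dist_commute)
    finally show ?thesis by norm
  qed
  define C where "C = L * (norm (g x) + L1) * K + (norm (f x) + L) * L1 * K"
  have "C-lipschitz_on ?B (\<lambda>x. M (f x) (g x))"
  proof (rule lipschitz_onI)
    fix y z assume yz: "y \<in> ?B" "z \<in> ?B"
    have "M (f y) (g y) - M (f z) (g z) = M (f y - f z) (g y) + M (f z) (g y - g z)"
      by (simp add: diff_left diff_right)
    then have "dist (M (f y) (g y)) (M (f z) (g z))
        \<le> norm (f y - f z) * norm (g y) * K + norm (f z) * norm (g y - g z) * K"
      unfolding dist_norm by (metis K(2) add_mono norm_triangle_le)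
    also have "\<dots> \<le> (L * dist y z) * (norm (g x) + L1) * K + (norm (f x) + L) * (L1 * dist y z) * K"
      using yz f g K L lipschitz_onD[OF e(3), of y z] lipschitz_onD[OF e1(3), of y z] e1 e
      by (intro add_mono mult_mono mult_nonneg_nonneg add_nonneg_nonneg) (auto simp: dist_norm)
    finally show "dist (M (f y) (g y)) (M (f z) (g z)) \<le> C * dist y z"
      by (simp add: C_def algebra_simps)
  qed (use L K in \<open>auto simp: C_def\<close>)
  then show "\<exists>e>0. \<exists>L. L-lipschitz_on (ball x e \<inter> U) (\<lambda>x. M (f x) (g x))"
    using e1 by blast
qed

lemma loclip_on_add:
  fixes f :: "'a::metric_space \<Rightarrow> 'b::real_normed_vector"
  assumes "loclip_on U f" "loclip_on U g" shows "loclip_on U (\<lambda>x. f x + g x)"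
  using loclip_on_bounded_linear_compose[OF _ loclip_on_Pair[OF assms],
      of "\<lambda>p. fst p + snd p"]
  by (simp add: bounded_linear_add bounded_linear_fst bounded_linear_snd)

lemma loclip_on_minus:
  fixes f :: "'a::metric_space \<Rightarrow> 'b::real_normed_vector"
  assumes "loclip_on U f" shows "loclip_on U (\<lambda>x. - f x)"
  using loclip_on_bounded_linear_compose[OF bounded_linear_minus[OF bounded_linear_ident] assms] .

lemma loclip_on_diff:
  fixes f :: "'a::metric_space \<Rightarrow> 'b::real_normed_vector"
  assumes "loclip_on U f" "loclip_on U g" shows "loclip_on U (\<lambda>x. f x - g x)"
  using loclip_on_add[OF assms(1) loclip_on_minus[OF assms(2)]] by simp

lemma loclip_on_scaleR:
  fixes f :: "'a::metric_space \<Rightarrow> 'b::real_normed_vector"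
  assumes "loclip_on U f" shows "loclip_on U (\<lambda>x. c *\<^sub>R f x)"
  using loclip_on_bounded_linear_compose[OF bounded_linear_scaleR_right assms] .

lemmas loclip_on_mult = loclip_on_bilinear[OF bounded_bilinear_mult]

lemma loclip_on_inverse:
  fixes f :: "'a::metric_space \<Rightarrow> real"
  assumes f: "loclip_on U f" and nz: "\<And>x. x \<in> U \<Longrightarrow> f x \<noteq> 0"
  shows "loclip_on U (\<lambda>x. inverse (f x))"
proof -
  have "loclip_on (- {0::real}) inverse"
    unfolding loclip_on_def
  proof
    fix x :: real assume "x \<in> - {0}" then have x: "x \<noteq> 0" by auto
    let ?B = "ball x (\<bar>x\<bar> / 2) \<inter> - {0}"
    \<comment> \<open>On the ball of radius \<open>\<bar>x\<bar> / 2\<close> both arguments keep at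
      least half the modulus of \<open>x\<close>, and \<open>\<bar>1/y - 1/z\<bar> = \<bar>y -
      z\<bar> / (\<bar>y\<bar> \<bar>z\<bar>)\<close>.\<close>
    have "(4 / x\<^sup>2)-lipschitz_on ?B inverse"
    proof (rule lipschitz_onI)
      fix y z assume yz: "y \<in> ?B" "z \<in> ?B"
      then have h: "\<bar>y\<bar> \<ge> \<bar>x\<bar> / 2" "\<bar>z\<bar> \<ge> \<bar>x\<bar> / 2" unfolding Int_iff mem_ball dist_real_def by arith+
      have yz0: "y \<noteq> 0" "z \<noteq> 0" using yz by auto
      have "dist (inverse y) (inverse z) = dist y z * (1 / (\<bar>y\<bar> * \<bar>z\<bar>))"
      proof -
        have "inverse y - inverse z = (z - y) / (y * z)" using yz0 by (simp add: field_simps)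
        then show ?thesis by (simp add: dist_real_def abs_mult abs_minus_commute)
      qed
      also have "\<dots> \<le> dist y z * (1 / ((\<bar>x\<bar> / 2) * (\<bar>x\<bar> / 2)))"
        using h x yz0 by (intro mult_left_mono divide_left_mono mult_mono mult_pos_pos) auto
      also have "\<dots> = 4 / x\<^sup>2 * dist y z" by (simp add: power2_eq_square)
      finally show "dist (inverse y) (inverse z) \<le> 4 / x\<^sup>2 * dist y z" .
    qed simp
    then show "\<exists>e>0. \<exists>L. L-lipschitz_on (ball x e \<inter> - {0}) inverse"
      using x by (metis half_gt_zero_iff zero_less_abs_iff)
  qed
  from loclip_on_compose[OF f this] nz show ?thesis by fastforce
qed

lemma loclip_on_divide:
  fixes f g :: "'a::metric_space \<Rightarrow> real"
  assumes "loclip_on U f" "loclip_on U g" "\<And>x. x \<in> U \<Longrightarrow> g x \<noteq> 0"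
  shows "loclip_on U (\<lambda>x. f x / g x)"
  unfolding divide_inverse by (intro loclip_on_mult loclip_on_inverse assms)

lemma loclip_on_power:
  fixes f :: "'a::metric_space \<Rightarrow> real"
  assumes "loclip_on U f" shows "loclip_on U (\<lambda>x. f x ^ n)"
  by (induction n) (auto intro: loclip_on_const loclip_on_mult assms)

lemma loclip_on_continuous_on:
  assumes "loclip_on U f" "open U" shows "continuous_on U f"
proof -
  have "isCont f x" if x: "x \<in> U" for x
  proof -
    obtain e L where e: "e > 0" "L-lipschitz_on (ball x e \<inter> U) f"
      using assms(1) x by (auto simp: loclip_on_def)
    have "continuous_on (ball x e \<inter> U) f" using e(2) lipschitz_on_continuous_on by blast
    then show ?thesis using assms(2) x e(1)
      by (metis IntI centre_in_ball continuous_on_eq_continuous_at open_Int open_ball)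
  qed
  then show ?thesis by (simp add: continuous_at_imp_continuous_on)
qed

text \<open>One existence time \<tau> serves all initial values near \<open>y1\<close>. Continuation
  past a limit \<open>y1\<close> depends on this uniformity: the restart is made from a point of the
  trajectory that is close to \<open>y1\<close> and less than \<tau> before the end.\<close>

lemma picard_lindelof_local:
  fixes F :: "'a::banach \<Rightarrow> 'a"
  assumes "open U" "loclip_on U F" "y1 \<in> U"
  obtains \<rho> \<tau> where "\<rho> > 0" "\<tau> > 0"
    "\<And>y0. y0 \<in> ball y1 \<rho> \<Longrightarrow> \<exists>v. v 0 = y0 \<and>
       (\<forall>t\<in>{0..\<tau>}. v t \<in> U \<and> (v has_vector_derivative F (v t)) (at t within {0..\<tau>}))"
proof -
  obtain e L where e: "e > 0" and L0: "L-lipschitz_on (ball y1 e \<inter> U) F"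
    using assms by (auto simp: loclip_on_def)
  obtain e' where e': "e' > 0" "ball y1 e' \<subseteq> U" using assms(1,3) open_contains_ball by blast
  \<comment> \<open>A third, so that the closed ball of radius \<open>2 * \<rho>\<close> lies in
    both open balls: one \<rho> is for the initial value, the other for the excursion of the
    solution.\<close>
  define \<rho> where "\<rho> = min e e' / 3"
  have \<rho>: "\<rho> > 0" using e e' by (simp add: \<rho>_def)
  let ?D = "cball y1 (2 * \<rho>)"
  have DU: "?D \<subseteq> ball y1 e \<inter> U" using e e' by (auto simp: \<rho>_def subset_iff)
  have L: "L-lipschitz_on ?D F" by (rule lipschitz_on_subset[OF L0 DU])
  have Lnn: "L \<ge> 0" using L lipschitz_on_nonneg by blast
  define K where "K = norm (F y1) + 2 * L * \<rho>"
  have K: "norm (F y) \<le> K" if "y \<in> ?D" for y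
  proof -
    have "norm (F y - F y1) \<le> L * dist y y1"
      using lipschitz_onD[OF L that, of y1] \<rho> by (auto simp: dist_norm)
    also have "\<dots> \<le> L * (2 * \<rho>)" using that Lnn by (intro mult_left_mono) (auto simp: dist_commute)
    finally have "norm (F y - F y1) \<le> L * (2 * \<rho>)" .
    then show ?thesis unfolding K_def by norm
  qed
  have Knn: "K \<ge> 0" using Lnn \<rho> by (simp add: K_def)
  have Fc: "continuous_on ?D F" using L lipschitz_on_continuous_on by blast
  \<comment> \<open>The first entry keeps an iterate within \<rho> of \<open>y0\<close>, the second
    makes the integral operator a contraction with factor 1/2. The added ones avoid division by
    zero.\<close>
  define \<tau> where "\<tau> = min (\<rho> / (K + 1)) (1 / (2 * (L + 1)))"
  have \<tau>: "\<tau> > 0" using \<rho> Knn Lnn by (simp add: \<tau>_def)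
  have \<tau>K: "\<tau> * K \<le> \<rho>"
  proof -
    have "\<tau> * K \<le> \<rho> / (K + 1) * K" using Knn by (intro mult_right_mono) (auto simp: \<tau>_def)
    also have "\<dots> \<le> \<rho>" using Knn \<rho> by (simp add: field_simps)
    finally show ?thesis .
  qed
  have \<tau>L: "\<tau> * L \<le> 1 / 2"
  proof -
    have "\<tau> * L \<le> 1 / (2 * (L + 1)) * L" using Lnn by (intro mult_right_mono) (auto simp: \<tau>_def)
    also have "\<dots> \<le> 1 / 2" using Lnn by (simp add: field_simps)
    finally show ?thesis .
  qed
  show ?thesis
  proof (rule that[OF \<rho> \<tau>])
    fix y0 assume y0: "y0 \<in> ball y1 \<rho>"
    \<comment> \<open>Freezing time outside \<open>[0, \<tau>]\<close> makes every iterate a bounded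
      continuous function on the whole line, so that the fixed point can be sought in the complete
      space of such functions.\<close>
    define c where "c t = max 0 (min \<tau> t)" for t
    have c: "c t \<in> {0..\<tau>}" for t using \<tau> by (auto simp: c_def)
    have cc: "continuous_on UNIV c" unfolding c_def by (intro continuous_intros)
    define I where "I g t = y0 + integral {0..c t} (\<lambda>s. F (apply_bcontfun g s))" for g t
    define S where "S = {g::real \<Rightarrow>\<^sub>C 'a. \<forall>t. apply_bcontfun g t \<in> ?D}"
    have cont: "continuous_on A (\<lambda>s. F (apply_bcontfun g s))" if "g \<in> S" for g A
      by (rule continuous_on_compose2[OF Fc])
         (use that in \<open>auto simp: S_def intro: continuous_on_subset[OF continuous_on_apply_bcontfun]\<close>)
    have int: "(\<lambda>s. F (apply_bcontfun g s)) integrable_on {a..b}" if "g \<in> S" for g a b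
      by (rule integrable_continuous_interval[OF cont[OF that]])
    have ID: "dist (I g t) y0 \<le> \<rho>" if g: "g \<in> S" for g t
    proof -
      have "norm (integral {0..c t} (\<lambda>s. F (apply_bcontfun g s))) \<le> K * (c t - 0)"
        by (rule integral_bound) (use c[of t] g K cont in \<open>auto simp: S_def\<close>)
      also have "\<dots> \<le> K * \<tau>" using c[of t] Knn by (intro mult_left_mono) auto
      finally show ?thesis using \<tau>K by (simp add: I_def dist_norm mult.commute)
    qed
    have ID2: "I g t \<in> ?D" if g: "g \<in> S" for g t
      using ID[OF g, of t] y0 dist_triangle[of y1 "I g t" y0] by (auto simp: dist_commute)
    have Ib: "I g \<in> bcontfun" if g: "g \<in> S" for g
    proof (rule bcontfun_normI)
      have "continuous_on {0..\<tau>} (\<lambda>x. integral {0..x} (\<lambda>s. F (apply_bcontfun g s)))"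
        by (rule indefinite_integral_continuous_1[OF int[OF g]])
      then show "continuous_on UNIV (I g)" unfolding I_def
        by (intro continuous_intros continuous_on_compose2[OF _ cc]) (use c in auto)
      show "norm (I g x) \<le> norm y1 + 2 * \<rho>" for x
        using ID2[OF g, of x] by (simp add: dist_norm) norm
    qed
    define G where "G g = Bcontfun (I g)" for g
    have G: "apply_bcontfun (G g) = I g" if "g \<in> S" for g
      using Ib[OF that] by (simp add: G_def Bcontfun_inverse)
    have "\<exists>!g\<in>S. G g = g"
    proof (rule Banach_fix[of S "1/2"])
      have Sc: "S = (\<Inter>t. {g. apply_bcontfun g t \<in> ?D})" by (auto simp: S_def)
      have "closed {g::real \<Rightarrow>\<^sub>C 'a. apply_bcontfun g t \<in> ?D}" for t
      proof -
        have "continuous_on UNIV (\<lambda>g::real \<Rightarrow>\<^sub>C 'a. apply_bcontfun g t)"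
          unfolding continuous_on_iff by (metis UNIV_I dist_bounded order_le_less_trans)
        from continuous_closed_preimage[OF this closed_UNIV closed_cball]
        show ?thesis by (simp add: vimage_def)
      qed
      then have "closed S" unfolding Sc by blast
      then show "complete S" by (simp add: complete_eq_closed)
      show "S \<noteq> {}" using \<rho> by (auto simp: S_def intro!: exI[of _ "const_bcontfun y1"])
      show "G ` S \<subseteq> S"
      proof clarify
        fix g assume "g \<in> S" then show "G g \<in> S" using ID2 G unfolding S_def by auto
      qed
      show "dist (G f) (G g) \<le> 1/2 * dist f g" if fg: "f \<in> S" "g \<in> S" for f g
      proof (rule dist_bound)
        fix t
        have "I f t - I g t = integral {0..c t} (\<lambda>s. F (apply_bcontfun f s) - F (apply_bcontfun g s))"
          unfolding I_def by (simp add: Henstock_Kurzweil_Integration.integral_diff int fg)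
        also have "norm \<dots> \<le> (L * dist f g) * (c t - 0)"
        proof (rule integral_bound)
          show "continuous_on {0..c t} (\<lambda>s. F (apply_bcontfun f s) - F (apply_bcontfun g s))"
            by (intro continuous_intros cont fg)
          show "norm (F (apply_bcontfun f s) - F (apply_bcontfun g s)) \<le> L * dist f g" for s
          proof -
            have "dist (F (apply_bcontfun f s)) (F (apply_bcontfun g s))
                \<le> L * dist (apply_bcontfun f s) (apply_bcontfun g s)"
              using lipschitz_onD[OF L] fg by (auto simp: S_def)
            also have "\<dots> \<le> L * dist f g" by (intro mult_left_mono dist_bounded Lnn)
            finally show ?thesis by (simp add: dist_norm)
          qed
        qed (use c[of t] in auto)
        also have "\<dots> \<le> (L * dist f g) * \<tau>" using c[of t] Lnn by (intro mult_left_mono) auto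
        also have "\<dots> = (\<tau> * L) * dist f g" by simp
        also have "\<dots> \<le> 1/2 * dist f g" by (rule mult_right_mono[OF \<tau>L]) simp
        finally show "dist (apply_bcontfun (G f) t) (apply_bcontfun (G g) t) \<le> 1/2 * dist f g"
          by (simp add: G fg dist_norm)
      qed
    qed auto
    then obtain g where g: "g \<in> S" "G g = g" by blast
    define v where "v = apply_bcontfun g"
    have v: "v t = y0 + integral {0..t} (\<lambda>s. F (v s))" if "t \<in> {0..\<tau>}" for t
    proof -
      have "c t = t" using that by (auto simp: c_def)
      moreover have "apply_bcontfun g t = I g t" using G[OF g(1)] unfolding g(2) by (rule fun_cong)
      ultimately show ?thesis unfolding I_def v_def by simp
    qed
    have "(v has_vector_derivative F (v t)) (at t within {0..\<tau>})" if t: "t \<in> {0..\<tau>}" for t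
    proof -
      have "((\<lambda>t. y0 + integral {0..t} (\<lambda>s. F (v s))) has_vector_derivative F (v t)) (at t within {0..\<tau>})"
        using integral_has_vector_derivative[OF cont[OF g(1)] t]
        by (auto intro!: derivative_eq_intros simp: v_def)
      then show ?thesis using v t
        by (rule_tac has_vector_derivative_transform[rotated 2]) auto
    qed
    moreover have "v 0 = y0" using v[of 0] \<tau> by simp
    moreover have "v t \<in> U" for t using g(1) DU by (auto simp: S_def v_def)
    ultimately show "\<exists>v. v 0 = y0 \<and>
       (\<forall>t\<in>{0..\<tau>}. v t \<in> U \<and> (v has_vector_derivative F (v t)) (at t within {0..\<tau>}))"
      by blast
  qed
qed

section \<open>Gronwall-type estimates\<close>

lemma vector_derivative_bound:
  fixes y :: "real \<Rightarrow> 'a::real_normed_vector"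
  assumes "a \<le> b" and der: "\<And>t. t \<in> {a..b} \<Longrightarrow> (y has_vector_derivative y' t) (at t within {a..b})"
    and B: "\<And>t. t \<in> {a..b} \<Longrightarrow> norm (y' t) \<le> K"
  shows "norm (y b - y a) \<le> K * (b - a)"
proof -
  have "norm (y b - y a) \<le> K * norm (b - a)"
  proof (rule differentiable_bound[of "{a..b}" y "\<lambda>t h. h *\<^sub>R y' t"])
    fix t assume t: "t \<in> {a..b}"
    show "(y has_derivative (\<lambda>h. h *\<^sub>R y' t)) (at t within {a..b})"
      using der[OF t] by (simp add: has_vector_derivative_def)
    show "onorm (\<lambda>h. h *\<^sub>R y' t) \<le> K"
      using B[OF t] by (simp add: onorm_scaleR_left onorm_id bounded_linear_ident)
  qed (use assms in auto)
  then show ?thesis using assms(1) by simp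
qed

text \<open>A Gronwall argument without exponentials. Time is cut into steps of length \<delta> with
  \<open>\<delta> * \<bar>C\<bar> \<le> 1/2\<close>. At the maximum \<open>m\<close> of the norm
  over one step the mean value inequality gives \<open>m \<le> B + (1 + m)/2\<close>, so the bound
  \<open>B\<close> becomes \<open>2 * B + 1\<close>, and finitely many steps reach \<open>T\<close>.
  The interval is half-open because nothing is known about \<open>y\<close> at
  \<open>T\<close>.\<close>

lemma linear_growth_bounded:
  fixes y :: "real \<Rightarrow> 'a::real_normed_vector"
  assumes der: "\<And>t. t \<in> {0..<T} \<Longrightarrow> (y has_vector_derivative y' t) (at t within {0..<T})"
    and C: "\<And>t. t \<in> {0..<T} \<Longrightarrow> norm (y' t) \<le> C * (1 + norm (y t))"
  obtains B where "B \<ge> 0" "\<And>t. t \<in> {0..<T} \<Longrightarrow> norm (y t) \<le> B"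
proof -
  define \<delta> where "\<delta> = 1 / (2 * (\<bar>C\<bar> + 1))"
  have \<delta>: "\<delta> > 0" "\<delta> * \<bar>C\<bar> \<le> 1 / 2" by (auto simp: \<delta>_def field_simps)
  have step: "\<exists>B\<ge>0. \<forall>t\<in>{0..<T}. t \<le> real n * \<delta> \<longrightarrow> norm (y t) \<le> B" for n
  proof (induction n)
    case 0
    show ?case by (rule exI[of _ "norm (y 0)"]) auto
  next
    case (Suc n)
    then obtain B where B: "B \<ge> 0" "\<And>t. t \<in> {0..<T} \<Longrightarrow> t \<le> real n * \<delta> \<Longrightarrow> norm (y t) \<le> B" by blast
    have "norm (y t) \<le> 2 * B + 1" if t: "t \<in> {0..<T}" "t \<le> real (Suc n) * \<delta>" for t
    proof (cases "t \<le> real n * \<delta>")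
      case True then show ?thesis using B t by fastforce
    next
      case False
      define s where "s = real n * \<delta>"
      have s: "0 \<le> s" "s < t" using False \<delta> by (auto simp: s_def)
      have sub: "{s..t} \<subseteq> {0..<T}" using s t by auto
      have d: "(y has_vector_derivative y' u) (at u within {s..t})" if "u \<in> {s..t}" for u
        using has_vector_derivative_within_subset[OF der sub] that sub by auto
      have "continuous_on {s..t} y"
        using d has_vector_derivative_continuous continuous_on_eq_continuous_within by blast
      then have "continuous_on {s..t} (\<lambda>u. norm (y u))" by (intro continuous_intros)
      then obtain u where u: "u \<in> {s..t}" "\<And>v. v \<in> {s..t} \<Longrightarrow> norm (y v) \<le> norm (y u)"
        using continuous_attains_sup[of "{s..t}" "\<lambda>u. norm (y u)"] s by auto
      define m where "m = norm (y u)"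
      have "norm (y u - y s) \<le> \<bar>C\<bar> * (1 + m) * (u - s)"
      proof (rule vector_derivative_bound)
        fix v assume v: "v \<in> {s..u}"
        then have v': "v \<in> {s..t}" using u by auto
        show "(y has_vector_derivative y' v) (at v within {s..u})"
          by (rule has_vector_derivative_within_subset[OF d[OF v']]) (use u in auto)
        have "norm (y' v) \<le> C * (1 + norm (y v))" using C v' sub by auto
        also have "\<dots> \<le> \<bar>C\<bar> * (1 + m)"
          by (intro mult_mono) (use u(2)[OF v'] in \<open>auto simp: m_def\<close>)
        finally show "norm (y' v) \<le> \<bar>C\<bar> * (1 + m)" .
      qed (use u in auto)
      also have "\<dots> \<le> \<bar>C\<bar> * (1 + m) * \<delta>"
      proof (rule mult_left_mono)
        have "u \<le> t" using u by auto
        also have "\<dots> \<le> s + \<delta>" using t(2) by (simp add: s_def algebra_simps)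
        finally show "u - s \<le> \<delta>" by simp
      qed (auto simp: m_def)
      also have "\<dots> = (\<delta> * \<bar>C\<bar>) * (1 + m)" by simp
      also have "\<dots> \<le> 1 / 2 * (1 + m)" by (rule mult_right_mono[OF \<delta>(2)]) (simp add: m_def)
      finally have "norm (y u - y s) \<le> 1 / 2 * (1 + m)" .
      moreover have "norm (y s) \<le> B" using B(2)[of s] s t unfolding s_def by auto
      moreover have "norm (y u) \<le> norm (y s) + norm (y u - y s)" by norm
      ultimately have "m \<le> 2 * B + 1" unfolding m_def by (simp add: field_simps)
      then show ?thesis using u(2)[of t] s unfolding m_def by auto
    qed
    then show ?case using B(1) by (intro exI[of _ "2 * B + 1"]) auto
  qed
  obtain n where "T / \<delta> \<le> real n" using real_arch_simple by blast
  then have n: "T \<le> real n * \<delta>" using \<delta> by (simp add: field_simps)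
  from step[of n] obtain B where "B \<ge> 0" "\<forall>t\<in>{0..<T}. t \<le> real n * \<delta> \<longrightarrow> norm (y t) \<le> B" by blast
  then show ?thesis using n that[of B] by force
qed

text \<open>The same stepping: if \<open>y\<close> vanishes at the start of a step, the maximum of
  its norm over that step is at most half of itself.\<close>

lemma linear_ode_zero:
  fixes y :: "real \<Rightarrow> 'a::real_normed_vector"
  assumes der: "\<And>t. t \<in> {a..b} \<Longrightarrow> (y has_vector_derivative y' t) (at t within {a..b})"
    and L: "\<And>t. t \<in> {a..b} \<Longrightarrow> norm (y' t) \<le> L * norm (y t)"
    and "y a = 0" and t: "t \<in> {a..b}"
  shows "y t = 0"
proof -
  define \<delta> where "\<delta> = 1 / (2 * (\<bar>L\<bar> + 1))"
  have \<delta>: "\<delta> > 0" "\<delta> * \<bar>L\<bar> \<le> 1 / 2" by (auto simp: \<delta>_def field_simps)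
  have step: "\<forall>t\<in>{a..b}. t \<le> a + real n * \<delta> \<longrightarrow> y t = 0" for n
  proof (induction n)
    case 0 show ?case using assms(3) by auto
  next
    case (Suc n)
    have "y t = 0" if t: "t \<in> {a..b}" "t \<le> a + real (Suc n) * \<delta>" for t
    proof (cases "t \<le> a + real n * \<delta>")
      case True then show ?thesis using Suc t by fastforce
    next
      case False
      define s where "s = a + real n * \<delta>"
      have s: "a \<le> s" "s < t" using False \<delta> by (auto simp: s_def)
      have sub: "{s..t} \<subseteq> {a..b}" using s t by auto
      have d: "(y has_vector_derivative y' u) (at u within {s..t})" if "u \<in> {s..t}" for u
        using has_vector_derivative_within_subset[OF der sub] that sub by auto
      have "continuous_on {s..t} y"
        using d has_vector_derivative_continuous continuous_on_eq_continuous_within by blast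
      then have "continuous_on {s..t} (\<lambda>u. norm (y u))" by (intro continuous_intros)
      then obtain u where u: "u \<in> {s..t}" "\<And>v. v \<in> {s..t} \<Longrightarrow> norm (y v) \<le> norm (y u)"
        using continuous_attains_sup[of "{s..t}" "\<lambda>u. norm (y u)"] s by auto
      have ys: "y s = 0" using Suc sub s by (auto simp: s_def)
      have "norm (y u - y s) \<le> \<bar>L\<bar> * norm (y u) * (u - s)"
      proof (rule vector_derivative_bound)
        fix v assume v: "v \<in> {s..u}"
        then have v': "v \<in> {s..t}" using u by auto
        show "(y has_vector_derivative y' v) (at v within {s..u})"
          by (rule has_vector_derivative_within_subset[OF d[OF v']]) (use u in auto)
        have "norm (y' v) \<le> L * norm (y v)" using L v' sub by auto
        also have "\<dots> \<le> \<bar>L\<bar> * norm (y u)"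
          by (intro mult_mono) (use u(2)[OF v'] in auto)
        finally show "norm (y' v) \<le> \<bar>L\<bar> * norm (y u)" .
      qed (use u in auto)
      also have "\<dots> \<le> \<bar>L\<bar> * norm (y u) * \<delta>"
      proof (rule mult_left_mono)
        have "u \<le> t" using u by auto
        also have "\<dots> \<le> s + \<delta>" using t(2) by (simp add: s_def algebra_simps)
        finally show "u - s \<le> \<delta>" by simp
      qed auto
      also have "\<dots> = (\<delta> * \<bar>L\<bar>) * norm (y u)" by simp
      also have "\<dots> \<le> 1 / 2 * norm (y u)" by (rule mult_right_mono[OF \<delta>(2)]) simp
      finally have "norm (y u) \<le> 0" using ys by simp
      then show ?thesis using u(2)[of t] s by auto
    qed
    then show ?case by auto
  qed
  obtain n where "(b - a) / \<delta> \<le> real n" using real_arch_simple by blast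
  then have n: "b \<le> a + real n * \<delta>" using \<delta> by (simp add: field_simps)
  with step[of n] t show ?thesis by auto
qed

section \<open>Maximal solutions and their continuation\<close>

definition ode_sol :: "('a::real_normed_vector \<Rightarrow> 'a) \<Rightarrow> 'a set \<Rightarrow> 'a \<Rightarrow> ereal \<Rightarrow> (real \<Rightarrow> 'a) \<Rightarrow> bool" where
  "ode_sol F U y0 T y \<longleftrightarrow> y 0 = y0 \<and>
     (\<forall>t\<in>time_interval T. y t \<in> U \<and> (y has_vector_derivative F (y t)) (at t within time_interval T))"

lemma time_interval_mono: "S \<le> T \<Longrightarrow> time_interval S \<subseteq> time_interval T"
  by (auto simp: time_interval_def)

lemma time_interval_Icc: "t \<in> time_interval T \<Longrightarrow> {0..t} \<subseteq> time_interval T"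
  by (auto simp: time_interval_def elim: order.strict_trans1[rotated])

lemma time_interval_real [simp]: "time_interval (ereal T) = {0..<T}"
  by (auto simp: time_interval_def)

text \<open>Two half-open intervals coincide near every point of the smaller one. A restricted or
  prolonged solution therefore has the same derivatives, including the one-sided one at 0.\<close>

lemma at_within_time_interval:
  assumes "S \<le> T" "t \<in> time_interval S"
  shows "at t within time_interval T = at t within time_interval S"
proof (rule at_within_nhd)
  show "t \<in> {s. ereal s < S}" using assms by (auto simp: time_interval_def)
  show "open {s. ereal s < S}"
    by (cases S) (auto simp: lessThan_def[symmetric])
  show "time_interval T \<inter> {s. ereal s < S} - {t} = time_interval S \<inter> {s. ereal s < S} - {t}"
    using assms by (auto simp: time_interval_def)
qed

lemma ode_sol_restrict: "ode_sol F U y0 T y \<Longrightarrow> S \<le> T \<Longrightarrow> ode_sol F U y0 S y"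
  unfolding ode_sol_def using time_interval_mono at_within_time_interval by (metis subsetD)

lemma ode_sol_cong:
  assumes "ode_sol F U y0 T y" "\<And>t. t \<in> time_interval T \<Longrightarrow> z t = y t" "z 0 = y0"
  shows "ode_sol F U y0 T z"
  unfolding ode_sol_def
proof (intro conjI ballI)
  fix t assume t: "t \<in> time_interval T"
  show "z t \<in> U" using assms t by (auto simp: ode_sol_def)
  have "(y has_vector_derivative F (z t)) (at t within time_interval T)"
    using assms t by (auto simp: ode_sol_def)
  then show "(z has_vector_derivative F (z t)) (at t within time_interval T)"
    by (rule has_vector_derivative_transform[OF t, rotated]) (use assms in auto)
qed (use assms in auto)

lemma ode_sol_Icc:
  assumes "v 0 = y0" "\<And>t. t \<in> {0..\<tau>} \<Longrightarrow> v t \<in> U"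
    "\<And>t. t \<in> {0..\<tau>} \<Longrightarrow> (v has_vector_derivative F (v t)) (at t within {0..\<tau>})"
  shows "ode_sol F U y0 (ereal \<tau>) v"
  unfolding ode_sol_def time_interval_real
proof (intro conjI ballI)
  fix t assume t: "t \<in> {0..<\<tau>}"
  show "v t \<in> U" using assms(2) t by auto
  show "(v has_vector_derivative F (v t)) (at t within {0..<\<tau>})"
    by (rule has_vector_derivative_within_subset[OF assms(3)]) (use t in auto)
qed (fact assms(1))

lemma ode_sol_continuous_on: "ode_sol F U y0 T y \<Longrightarrow> continuous_on (time_interval T) y"
  unfolding ode_sol_def
  using has_vector_derivative_continuous continuous_on_eq_continuous_within by blast

text \<open>At the infimum \<open>s\<close> of the times of disagreement the solutions still agree:
  by the initial condition if \<open>s = 0\<close>, by continuity from the left otherwise. Both then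
  remain for a while in a ball where \<open>F\<close> is Lipschitz, so agreement extends beyond
  \<open>s\<close>.\<close>

lemma ode_sol_unique:
  assumes "open U" "loclip_on U F" and y: "ode_sol F U y0 T y" and z: "ode_sol F U y0 T z"
    and t1: "t1 \<in> time_interval T"
  shows "y t1 = z t1"
proof (rule ccontr)
  assume ne: "y t1 \<noteq> z t1"
  define B where "B = {t\<in>{0..t1}. y t \<noteq> z t}"
  define s where "s = Inf B"
  have t10: "t1 \<ge> 0" using t1 by (auto simp: time_interval_def)
  have B: "t1 \<in> B" "bdd_below B" "B \<noteq> {}" using ne t10 by (auto simp: B_def intro!: bdd_belowI[of _ 0])
  have s: "0 \<le> s" "s \<le> t1"
    unfolding s_def by (rule cInf_greatest[OF B(3)], simp add: B_def, rule cInf_lower[OF B(1,2)])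
  have before: "y t = z t" if "t \<in> {0..<s}" for t
  proof (rule ccontr)
    assume "y t \<noteq> z t" then have "t \<in> B" using that s by (auto simp: B_def)
    then show False using cInf_lower[of t B] B that by (auto simp: s_def)
  qed
  have sub: "{0..t1} \<subseteq> time_interval T" by (rule time_interval_Icc[OF t1])
  have dy: "(y has_vector_derivative F (y t)) (at t within {0..t1})" "y t \<in> U" if "t \<in> {0..t1}" for t
    using y that sub has_vector_derivative_within_subset[OF _ sub] unfolding ode_sol_def by blast+
  have dz: "(z has_vector_derivative F (z t)) (at t within {0..t1})" "z t \<in> U" if "t \<in> {0..t1}" for t
    using z that sub has_vector_derivative_within_subset[OF _ sub] unfolding ode_sol_def by blast+
  have c: "continuous_on {0..t1} y" "continuous_on {0..t1} z"
    using ode_sol_continuous_on[OF y] ode_sol_continuous_on[OF z] sub continuous_on_subset by blast+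
  have ys: "y s = z s"
  proof (cases "s = 0")
    case True then show ?thesis using y z by (auto simp: ode_sol_def)
  next
    case False
    have "continuous_on {0..s} (\<lambda>t. y t - z t)"
      using s by (intro continuous_intros continuous_on_subset[OF c(1)] continuous_on_subset[OF c(2)]) auto
    then have "((\<lambda>t. y t - z t) \<longlongrightarrow> y s - z s) (at s within {0..s})"
      using s by (auto simp: continuous_on_def)
    moreover have "((\<lambda>t. y t - z t) \<longlongrightarrow> 0) (at s within {0..s})"
      by (rule tendsto_eventually) (auto simp: eventually_at_filter before)
    moreover have "at s within {0..s} \<noteq> bot"
      using False s by (simp add: at_within_Icc_at_left)
    ultimately show ?thesis using tendsto_unique by fastforce
  qed
  obtain e L where e: "e > 0" "L-lipschitz_on (ball (y s) e \<inter> U) F"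
    using assms(2) dy(2)[of s] s unfolding loclip_on_def by auto
  obtain d1 where d1: "d1 > 0" "\<And>t. t \<in> {0..t1} \<Longrightarrow> dist t s < d1 \<Longrightarrow> dist (y t) (y s) < e"
    using c(1) e(1) s unfolding continuous_on_iff by (metis atLeastAtMost_iff)
  obtain d2 where d2: "d2 > 0" "\<And>t. t \<in> {0..t1} \<Longrightarrow> dist t s < d2 \<Longrightarrow> dist (z t) (z s) < e"
    using c(2) e(1) s unfolding continuous_on_iff by (metis atLeastAtMost_iff)
  \<comment> \<open>Half of the smaller radius keeps the distances strictly below \<open>d1\<close>
    and \<open>d2\<close> up to and including the end point \<open>b\<close>.\<close>
  define b where "b = min t1 (s + min d1 d2 / 2)"
  have b: "b \<ge> s" "b \<le> t1" using s d1 d2 by (auto simp: b_def)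
  have near: "y t \<in> ball (y s) e \<inter> U" "z t \<in> ball (y s) e \<inter> U" if "t \<in> {s..b}" for t
  proof -
    have "dist t s < d1" "dist t s < d2" "t \<in> {0..t1}"
      using that s b d1 d2 unfolding b_def dist_real_def by (auto simp: min_def split: if_splits)
    then show "y t \<in> ball (y s) e \<inter> U" "z t \<in> ball (y s) e \<inter> U"
      using d1(2)[of t] d2(2)[of t] dy(2)[of t] dz(2)[of t] by (auto simp: ys dist_commute)
  qed
  have agree: "y t - z t = 0" if "t \<in> {s..b}" for t
  proof (rule linear_ode_zero[where a = s and b = b and y = "\<lambda>t. y t - z t"
        and y' = "\<lambda>t. F (y t) - F (z t)" and L = L])
    fix t assume t: "t \<in> {s..b}"
    have sb: "{s..b} \<subseteq> {0..t1}" using s b by auto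
    show "((\<lambda>t. y t - z t) has_vector_derivative F (y t) - F (z t)) (at t within {s..b})"
      using t sb by (intro has_vector_derivative_diff has_vector_derivative_within_subset[OF dy(1) sb]
          has_vector_derivative_within_subset[OF dz(1) sb]) auto
    show "norm (F (y t) - F (z t)) \<le> L * norm (y t - z t)"
      using lipschitz_on_normD[OF e(2) near[OF t]] .
  qed (use ys that in auto)
  have "s < t1" using ne ys s by (cases "s = t1") auto
  then have bs: "s < b" using d1 d2 by (auto simp: b_def)
  have "b \<le> Inf B"
  proof (rule cInf_greatest[OF B(3)])
    fix t assume "t \<in> B"
    then show "b \<le> t" using before[of t] agree[of t] by (force simp: B_def)
  qed
  then show False using bs by (simp add: s_def)
qed

lemma ode_sol_unique_min:
  assumes "open U" "loclip_on U F" and y: "ode_sol F U y0 T y" and z: "ode_sol F U y0 S z"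
    and t: "t \<in> time_interval T" "t \<in> time_interval S"
  shows "y t = z t"
  using ode_sol_unique[OF assms(1,2), of y0 "min T S" y z t] ode_sol_restrict[OF y, of "min T S"]
    ode_sol_restrict[OF z, of "min T S"] t by (auto simp: time_interval_def)

text \<open>\<open>Tm\<close> is the supremum of all existence times, and uniqueness glues the
  solutions together. If \<open>y\<close> had a limit in \<open>U\<close> at a finite
  \<open>Tm\<close>, the uniform existence time around that limit would permit a restart shortly
  before the end, and the prolonged solution would outlive \<open>Tm\<close>.\<close>

theorem maximal_ode_sol:
  fixes F :: "'a::banach \<Rightarrow> 'a"
  assumes U: "open U" and F: "loclip_on U F" and y0: "y0 \<in> U"
  obtains Tm y where "Tm > 0" "ode_sol F U y0 Tm y"
    "\<And>T z. T > 0 \<Longrightarrow> ode_sol F U y0 T z \<Longrightarrow> T \<le> Tm"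
    "\<And>T y1. Tm = ereal T \<Longrightarrow> y1 \<in> U \<Longrightarrow> \<not> (y \<longlongrightarrow> y1) (at_left T)"
proof -
  define Ts where "Ts = {T. 0 < T \<and> (\<exists>y. ode_sol F U y0 T y)}"
  define Tm where "Tm = Sup Ts"
  define g where "g T = (SOME y. ode_sol F U y0 T y)" for T
  have g: "ode_sol F U y0 T (g T)" if "T \<in> Ts" for T
  proof -
    from that obtain y where "ode_sol F U y0 T y" by (auto simp: Ts_def)
    then show ?thesis unfolding g_def by (rule someI[of "ode_sol F U y0 T"])
  qed
  \<comment> \<open>At each time the value is taken from some solution that still exists there. By
    \<open>ode_sol_unique_min\<close> the choice does not matter.\<close>
  define y where "y t = g (SOME T. T \<in> Ts \<and> ereal t < T) t" for t
  have y_eq: "y t = z t" if "ode_sol F U y0 T z" "0 < T" "t \<in> time_interval T" for t T z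
  proof -
    have "\<exists>T. T \<in> Ts \<and> ereal t < T" using that by (auto simp: Ts_def time_interval_def)
    from someI_ex[OF this] have S: "(SOME T. T \<in> Ts \<and> ereal t < T) \<in> Ts" (is "?S \<in> _")
      "ereal t < (SOME T. T \<in> Ts \<and> ereal t < T)" by auto
    then have "t \<in> time_interval ?S" using that by (auto simp: time_interval_def)
    from ode_sol_unique_min[OF U F g[OF S(1)] that(1) this that(3)] show ?thesis
      by (simp add: y_def)
  qed
  obtain \<rho> \<tau> where pl: "\<rho> > 0" "\<tau> > 0"
    "\<And>y1. y1 \<in> ball y0 \<rho> \<Longrightarrow> \<exists>v. v 0 = y1 \<and>
       (\<forall>t\<in>{0..\<tau>}. v t \<in> U \<and> (v has_vector_derivative F (v t)) (at t within {0..\<tau>}))"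
    using picard_lindelof_local[OF U F y0] by metis
  from pl(3)[of y0] pl(1) obtain v where v: "v 0 = y0"
    "\<And>t. t \<in> {0..\<tau>} \<Longrightarrow> v t \<in> U \<and> (v has_vector_derivative F (v t)) (at t within {0..\<tau>})"
    by auto
  have "ode_sol F U y0 (ereal \<tau>) v" by (rule ode_sol_Icc) (use v in auto)
  then have "ereal \<tau> \<in> Ts" using pl(2) by (auto simp: Ts_def)
  then have Tm0: "Tm > 0" unfolding Tm_def using pl(2)
    by (metis Sup_upper ereal_less(2) order_less_le_trans)
  have ub: "T \<le> Tm" if "T > 0" "ode_sol F U y0 T z" for T z
    unfolding Tm_def by (rule Sup_upper) (use that in \<open>auto simp: Ts_def\<close>)
  have sol: "ode_sol F U y0 Tm y"
    unfolding ode_sol_def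
  proof (intro conjI ballI)
    show "y 0 = y0"
      using y_eq[OF g[OF \<open>ereal \<tau> \<in> Ts\<close>], of 0] g[OF \<open>ereal \<tau> \<in> Ts\<close>] pl(2) by (auto simp: ode_sol_def)
    fix t assume t: "t \<in> time_interval Tm"
    then have "ereal t < Sup Ts" by (auto simp: time_interval_def Tm_def)
    then obtain T where T: "T \<in> Ts" "ereal t < T" by (auto simp: less_Sup_iff)
    then have tT: "t \<in> time_interval T" using t by (auto simp: time_interval_def)
    have T0: "0 < T" using T by (auto simp: Ts_def)
    have y0': "y 0 = y0"
      using y_eq[OF g[OF T(1)] T0, of 0] g[OF T(1)] T0
      by (auto simp: ode_sol_def time_interval_def zero_ereal_def)
    have "ode_sol F U y0 T y"
      by (rule ode_sol_cong[OF g[OF T(1)] y_eq[OF g[OF T(1)] T0] y0'])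
    then show "y t \<in> U" "(y has_vector_derivative F (y t)) (at t within time_interval Tm)"
      using at_within_time_interval[OF ub[OF T0 g[OF T(1)]] tT] tT by (auto simp: ode_sol_def)
  qed
  have blowup: False if T: "Tm = ereal T" and y1: "y1 \<in> U" and lim: "(y \<longlongrightarrow> y1) (at_left T)" for T y1
  proof -
    have T0: "T > 0" using Tm0 T by simp
    obtain \<rho> \<tau> where pl: "\<rho> > 0" "\<tau> > 0"
      "\<And>y0. y0 \<in> ball y1 \<rho> \<Longrightarrow> \<exists>v. v 0 = y0 \<and>
         (\<forall>t\<in>{0..\<tau>}. v t \<in> U \<and> (v has_vector_derivative F (v t)) (at t within {0..\<tau>}))"
      using picard_lindelof_local[OF U F y1] by metis
    have "eventually (\<lambda>t. y t \<in> ball y1 \<rho> \<and> t > max 0 (T - \<tau>)) (at_left T)"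
    proof (rule eventually_conj)
      show "eventually (\<lambda>t. y t \<in> ball y1 \<rho>) (at_left T)"
        using tendstoD[OF lim pl(1)] by (simp add: dist_commute)
      show "eventually (\<lambda>t. t > max 0 (T - \<tau>)) (at_left T)"
        using T0 pl(2) by (auto intro!: eventually_at_leftI[of "max 0 (T - \<tau>)"])
    qed
    moreover have "eventually (\<lambda>t. t < T) (at_left T)"
      by (simp add: eventually_at_filter)
    ultimately have "eventually (\<lambda>t. y t \<in> ball y1 \<rho> \<and> t > max 0 (T - \<tau>) \<and> t < T) (at_left T)"
      by eventually_elim auto
    from eventually_happens'[OF trivial_limit_at_left_real this]
    obtain t0 where t0: "y t0 \<in> ball y1 \<rho>" "t0 > 0" "t0 > T - \<tau>" "t0 < T"
      by auto
    from pl(3)[OF t0(1)] obtain v where v: "v 0 = y t0"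
      "\<And>t. t \<in> {0..\<tau>} \<Longrightarrow> v t \<in> U" "\<And>t. t \<in> {0..\<tau>} \<Longrightarrow> (v has_vector_derivative F (v t)) (at t within {0..\<tau>})"
      by blast
    have ysol: "y t \<in> U" "(y has_vector_derivative F (y t)) (at t within {0..<T})" if "t \<in> {0..<T}" for t
      using sol that T by (auto simp: ode_sol_def)
    \<comment> \<open>The equation is autonomous, so the shifted trajectory is again a solution and
      can be compared with \<open>v\<close> from time 0 on.\<close>
    have s1: "ode_sol F U (y t0) (ereal (T - t0)) (\<lambda>s. y (s + t0))"
      unfolding ode_sol_def
    proof (intro conjI ballI)
      fix s assume s: "s \<in> time_interval (ereal (T - t0))"
      then have st: "s + t0 \<in> {0..<T}" using t0 by auto
      show "y (s + t0) \<in> U" by (rule ysol(1)[OF st])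
      have d: "(y has_vector_derivative F (y (s + t0))) (at (s + t0) within (\<lambda>s. s + t0) ` {0..<T - t0})"
        by (rule has_vector_derivative_within_subset[OF ysol(2)[OF st]]) (use t0 in auto)
      have "((\<lambda>s. s + t0) has_vector_derivative 1) (at s within {0..<T - t0})"
        by (auto intro!: derivative_eq_intros)
      from vector_diff_chain_within[OF this d] show
        "((\<lambda>s. y (s + t0)) has_vector_derivative F (y (s + t0))) (at s within time_interval (ereal (T - t0)))"
        by (simp add: o_def)
    qed simp
    have s2: "ode_sol F U (y t0) (ereal \<tau>) v" by (rule ode_sol_Icc) (use v in auto)
    have eq: "y t = v (t - t0)" if "t \<in> {t0..<T}" for t
      using ode_sol_unique_min[OF U F s1 s2, of "t - t0"] that t0 by auto
    define c where "c t = (if t < T then y t else v (t - t0))" for t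
    have cv: "c t = v (t - t0)" if "t \<ge> t0" for t using eq that by (auto simp: c_def)
    have "ode_sol F U y0 (ereal (t0 + \<tau>)) c"
      unfolding ode_sol_def
    proof (intro conjI ballI)
      show "c 0 = y0" using sol T0 by (auto simp: ode_sol_def c_def)
      fix t assume "t \<in> time_interval (ereal (t0 + \<tau>))"
      then have t: "0 \<le> t" "t < t0 + \<tau>" by auto
      show "c t \<in> U"
        using t ysol(1)[of t] v(2)[of "t - t0"] t0 by (auto simp: c_def)
      show "(c has_vector_derivative F (c t)) (at t within time_interval (ereal (t0 + \<tau>)))"
      proof (cases "t < T")
        case True
        have "(c has_vector_derivative F (y t)) (at t within {0..<T})"
          by (rule has_vector_derivative_transform[OF _ _ ysol(2)]) (use t True in \<open>auto simp: c_def\<close>)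
        moreover have "at t within time_interval (ereal (t0 + \<tau>)) = at t within {0..<T}"
          using at_within_time_interval[of "ereal T" "ereal (t0 + \<tau>)" t] t0 True t by auto
        ultimately show ?thesis using True by (simp add: c_def)
      next
        case False
        then have tt: "t0 < t" using t0 by simp
        have "(v has_vector_derivative F (v (t - t0))) (at (t - t0) within {0..\<tau>})"
          by (rule v(3)) (use tt t in auto)
        then have "(v has_vector_derivative F (v (t - t0))) (at (t - t0))"
          using tt t by (simp add: at_within_Icc_at)
        then have "((\<lambda>t. v (t - t0)) has_vector_derivative F (v (t - t0))) (at t)"
        proof -
          have "((\<lambda>t. t - t0) has_vector_derivative 1) (at t)" by (auto intro!: derivative_eq_intros)
          from vector_diff_chain_at[OF this] \<open>(v has_vector_derivative F (v (t - t0))) (at (t - t0))\<close>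
          show ?thesis by (simp add: o_def)
        qed
        then have "(c has_vector_derivative F (v (t - t0))) (at t)"
          by (rule has_vector_derivative_transform_within_open[of _ _ _ "{t0<..}"])
             (use tt cv in auto)
        then show ?thesis using tt cv has_vector_derivative_at_within by fastforce
      qed
    qed
    from ub[OF _ this] t0 T show False using pl(2) by simp
  qed
  show ?thesis by (rule that[OF Tm0 sol]) (use ub blowup in auto)
qed

section \<open>Square integrable functions\<close>

definition square_integrable :: "'a measure \<Rightarrow> ('a \<Rightarrow> real) \<Rightarrow> bool" where
  "square_integrable M f \<longleftrightarrow> f \<in> borel_measurable M \<and> integrable M (\<lambda>x. (f x)\<^sup>2)"

definition l2n :: "'a measure \<Rightarrow> ('a \<Rightarrow> real) \<Rightarrow> real" where
  "l2n M f = sqrt (LINT x|M. (f x)\<^sup>2)"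

lemma l2n_nonneg [simp]: "l2n M f \<ge> 0"
  by (simp add: l2n_def)

lemma l2n_sq: "(l2n M f)\<^sup>2 = (LINT x|M. (f x)\<^sup>2)"
  by (simp add: l2n_def)

lemma square_integrable_zero [simp]: "square_integrable M (\<lambda>x. 0)"
  by (simp add: square_integrable_def)

lemma l2n_zero [simp]: "l2n M (\<lambda>x. 0) = 0"
  by (simp add: l2n_def)

lemma square_integrable_cong_AE:
  assumes "square_integrable M f" "g \<in> borel_measurable M" "AE x in M. f x = g x"
  shows "square_integrable M g"
proof -
  have "AE x in M. (f x)\<^sup>2 = (g x)\<^sup>2" using assms(3) by eventually_elim simp
  then show ?thesis
    using assms(1,2) integrable_cong_AE[of "\<lambda>x. (f x)\<^sup>2" M "\<lambda>x. (g x)\<^sup>2"]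
    by (auto simp: square_integrable_def)
qed

lemma l2n_cong_AE:
  assumes "f \<in> borel_measurable M" "g \<in> borel_measurable M" "AE x in M. f x = g x"
  shows "l2n M f = l2n M g"
  unfolding l2n_def using assms by (intro arg_cong[where f = sqrt] integral_cong_AE) auto

lemma square_integrable_bound:
  assumes "square_integrable M g" "f \<in> borel_measurable M" "AE x in M. \<bar>f x\<bar> \<le> \<bar>g x\<bar>"
  shows "square_integrable M f" "l2n M f \<le> l2n M g"
proof -
  have g: "integrable M (\<lambda>x. (g x)\<^sup>2)" using assms by (simp add: square_integrable_def)
  have le: "AE x in M. (f x)\<^sup>2 \<le> (g x)\<^sup>2"
    using assms(3) by eventually_elim (simp add: abs_le_square_iff)
  have f: "integrable M (\<lambda>x. (f x)\<^sup>2)"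
    by (rule Bochner_Integration.integrable_bound[OF g]) (use assms(2) le in auto)
  then show "square_integrable M f" using assms by (simp add: square_integrable_def)
  show "l2n M f \<le> l2n M g"
    unfolding l2n_def by (intro real_sqrt_le_mono integral_mono_AE f g le)
qed

lemma square_integrable_scale:
  assumes "square_integrable M f"
  shows "square_integrable M (\<lambda>x. c * f x)" "l2n M (\<lambda>x. c * f x) = \<bar>c\<bar> * l2n M f"
  using assms by (auto simp: square_integrable_def l2n_def power_mult_distrib real_sqrt_mult)

lemma square_integrable_mult:
  assumes "square_integrable M f" "square_integrable M g"
  shows "integrable M (\<lambda>x. f x * g x)"
proof (rule Bochner_Integration.integrable_bound[of M "\<lambda>x. (f x)\<^sup>2 + (g x)\<^sup>2"])
  have "\<bar>a * b\<bar> \<le> a\<^sup>2 + b\<^sup>2" for a b :: real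
  proof -
    have "0 \<le> \<bar>a\<bar> * \<bar>b\<bar>" by simp
    then show ?thesis using sum_squares_bound[of "\<bar>a\<bar>" "\<bar>b\<bar>"] by (simp only: abs_mult power2_abs)
  qed
  then show "AE x in M. norm (f x * g x) \<le> norm ((f x)\<^sup>2 + (g x)\<^sup>2)" by simp
qed (use assms in \<open>auto simp: square_integrable_def\<close>)

lemma square_integrable_add:
  assumes "square_integrable M f" "square_integrable M g"
  shows "square_integrable M (\<lambda>x. f x + g x)"
  using assms square_integrable_mult[OF assms]
  by (auto simp: square_integrable_def power2_sum mult.assoc)

lemma square_integrable_diff:
  assumes "square_integrable M f" "square_integrable M g"
  shows "square_integrable M (\<lambda>x. f x - g x)"
  using square_integrable_add[OF assms(1) square_integrable_scale(1)[OF assms(2), of "-1"]] by simp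

lemma l2n_eq_0_iff:
  assumes "square_integrable M f" shows "l2n M f = 0 \<longleftrightarrow> (AE x in M. f x = 0)"
  using assms integral_nonneg_eq_0_iff_AE[of M "\<lambda>x. (f x)\<^sup>2"]
  by (auto simp: square_integrable_def l2n_def)

lemma l2_Cauchy_Schwarz:
  assumes f: "square_integrable M f" and g: "square_integrable M g"
  shows "\<bar>LINT x|M. f x * g x\<bar> \<le> l2n M f * l2n M g"
proof (cases "l2n M g = 0")
  case True
  then have "AE x in M. f x * g x = 0" using l2n_eq_0_iff[OF g] by auto
  then have "(LINT x|M. f x * g x) = 0" by (rule integral_eq_zero_AE)
  then show ?thesis by simp
next
  case False
  define I where "I = (LINT x|M. f x * g x)"
  \<comment> \<open>The coefficient of the projection of \<open>f\<close> onto \<open>g\<close>, for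
    which the integral of the square of \<open>f - c g\<close> is smallest.\<close>
  define c where "c = I / (l2n M g)\<^sup>2"
  have fg: "integrable M (\<lambda>x. f x * g x)" by (rule square_integrable_mult[OF f g])
  have f2: "integrable M (\<lambda>x. (f x)\<^sup>2)" "integrable M (\<lambda>x. (g x)\<^sup>2)"
    using f g by (auto simp: square_integrable_def)
  have "0 \<le> (LINT x|M. (f x - c * g x)\<^sup>2)" by simp
  also have "\<dots> = (LINT x|M. (f x)\<^sup>2 + (c\<^sup>2 * (g x)\<^sup>2 - 2 * c * (f x * g x)))"
    by (intro Bochner_Integration.integral_cong refl) (simp add: power2_eq_square algebra_simps)
  also have "\<dots> = (l2n M f)\<^sup>2 + (c\<^sup>2 * (l2n M g)\<^sup>2 - 2 * c * I)"
    using f2 fg by (simp add: l2n_sq I_def)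
  also have "\<dots> = (l2n M f)\<^sup>2 - I\<^sup>2 / (l2n M g)\<^sup>2"
    using False by (simp add: c_def power2_eq_square field_simps)
  finally have "I\<^sup>2 \<le> (l2n M f * l2n M g)\<^sup>2"
    using False by (simp add: field_simps)
  then have "\<bar>I\<bar> \<le> \<bar>l2n M f * l2n M g\<bar>" using abs_le_square_iff by blast
  then show ?thesis by (simp add: I_def)
qed

lemma l2_Cauchy_Schwarz_abs:
  assumes f: "square_integrable M f" and g: "square_integrable M g"
  shows "(LINT x|M. \<bar>f x * g x\<bar>) \<le> l2n M f * l2n M g"
proof -
  have a: "square_integrable M (\<lambda>x. \<bar>h x\<bar>)" "l2n M (\<lambda>x. \<bar>h x\<bar>) = l2n M h"
    if "square_integrable M h" for h
    using that by (auto simp: square_integrable_def l2n_def)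
  show ?thesis using l2_Cauchy_Schwarz[OF a(1)[OF f] a(1)[OF g]] by (simp add: abs_mult a f g)
qed

lemma l2n_triangle:
  assumes f: "square_integrable M f" and g: "square_integrable M g"
  shows "l2n M (\<lambda>x. f x + g x) \<le> l2n M f + l2n M g"
proof -
  have fg: "integrable M (\<lambda>x. f x * g x)" by (rule square_integrable_mult[OF f g])
  have f2: "integrable M (\<lambda>x. (f x)\<^sup>2)" "integrable M (\<lambda>x. (g x)\<^sup>2)"
    using f g by (auto simp: square_integrable_def)
  have "(l2n M (\<lambda>x. f x + g x))\<^sup>2 = (LINT x|M. (f x)\<^sup>2 + (2 * (f x * g x) + (g x)\<^sup>2))"
    unfolding l2n_sq by (intro Bochner_Integration.integral_cong refl) (simp add: power2_eq_square algebra_simps)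
  also have "\<dots> = (l2n M f)\<^sup>2 + (2 * (LINT x|M. f x * g x) + (l2n M g)\<^sup>2)"
    using fg f2 by (simp add: l2n_sq)
  also have "\<dots> \<le> (l2n M f + l2n M g)\<^sup>2"
    using l2_Cauchy_Schwarz[OF f g] by (simp add: power2_sum)
  finally show ?thesis by (rule power2_le_imp_le) simp
qed

lemma l2n_mult_bounded:
  assumes f: "square_integrable M f" and k: "k \<in> borel_measurable M" "AE x in M. \<bar>k x\<bar> \<le> C" "C \<ge> 0"
  shows "square_integrable M (\<lambda>x. k x * f x)" "l2n M (\<lambda>x. k x * f x) \<le> C * l2n M f"
proof -
  have le: "AE x in M. \<bar>k x * f x\<bar> \<le> \<bar>C * f x\<bar>"
    using k(2) by eventually_elim (use k(3) in \<open>simp add: abs_mult mult_right_mono\<close>)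
  have m: "(\<lambda>x. k x * f x) \<in> borel_measurable M" using f borel_measurable_times[OF k(1)] by (auto simp: square_integrable_def)
  note b = square_integrable_bound[OF square_integrable_scale(1)[OF f, of C] m le]
  show "square_integrable M (\<lambda>x. k x * f x)" by (rule b)
  show "l2n M (\<lambda>x. k x * f x) \<le> C * l2n M f"
    using b(2) square_integrable_scale(2)[OF f, of C] k(3) by simp
qed

text \<open>Completeness (Riesz--Fischer). Along a subsequence the weighted increments
  \<open>\<Sum>\<^sub>k 2\<^sup>k (f\<^bsub>k+1\<^esub> - f\<^sub>k)\<^sup>2\<close> have finite integral, whence the subsequence converges a.e.;
  the rest is Fatou's lemma.\<close>

theorem l2_complete:
  assumes f: "\<And>n. square_integrable M (f n)"
    and Cauchy: "\<And>e. e > 0 \<Longrightarrow> \<exists>N. \<forall>m\<ge>N. \<forall>n\<ge>N. l2n M (\<lambda>x. f m x - f n x) < e"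
  obtains g where "square_integrable M g" "(\<lambda>n. l2n M (\<lambda>x. f n x - g x)) \<longlonglongrightarrow> 0"
proof -
  have [measurable]: "f n \<in> borel_measurable M" for n using f by (simp add: square_integrable_def)
  \<comment> \<open>Increments below \<open>4^-k\<close> stay summable after squaring and weighting,
    since \<open>2^k 16^-k = 8^-k\<close>. The weight \<open>2^k\<close> then forces geometric decay
    of the increments at almost every point.\<close>
  have "\<forall>k. \<exists>N. \<forall>m\<ge>N. \<forall>n\<ge>N. l2n M (\<lambda>x. f m x - f n x) < (1/4) ^ k"
    using Cauchy by simp
  then obtain N where N: "\<And>k m n. m \<ge> N k \<Longrightarrow> n \<ge> N k \<Longrightarrow> l2n M (\<lambda>x. f m x - f n x) < (1/4) ^ k"
    by metis
  define r where "r k = (\<Sum>i\<le>k. N i) + k" for k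
  have rN: "r k \<ge> N k" for k unfolding r_def by (simp add: member_le_sum trans_le_add1)
  have rS: "r (Suc k) \<ge> r k" for k by (simp add: r_def)
  define d where "d k x = f (r (Suc k)) x - f (r k) x" for k x
  have [measurable]: "d k \<in> borel_measurable M" for k unfolding d_def by measurable
  have nn: "(\<integral>\<^sup>+x. ennreal ((f m x - f n x)\<^sup>2) \<partial>M) = ennreal ((l2n M (\<lambda>x. f m x - f n x))\<^sup>2)" for m n
    unfolding l2n_sq using square_integrable_diff[OF f f]
    by (intro nn_integral_eq_integral) (auto simp: square_integrable_def)
  have dk: "(\<integral>\<^sup>+x. ennreal (2 ^ k * (d k x)\<^sup>2) \<partial>M) \<le> ennreal ((1/8) ^ k)" for k
  proof -
    have "(\<integral>\<^sup>+x. ennreal (2 ^ k * (d k x)\<^sup>2) \<partial>M) = ennreal (2 ^ k) * (\<integral>\<^sup>+x. ennreal ((d k x)\<^sup>2) \<partial>M)"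
      by (subst nn_integral_cmult[symmetric]) (auto simp: ennreal_mult)
    also have "\<dots> = ennreal (2 ^ k * (l2n M (\<lambda>x. f (r (Suc k)) x - f (r k) x))\<^sup>2)"
      unfolding d_def nn by (simp add: ennreal_mult)
    also have "\<dots> \<le> ennreal (2 ^ k * ((1/4) ^ k)\<^sup>2)"
      using N[of k "r (Suc k)" "r k"] rN[of k] rS[of k]
      by (intro ennreal_leI mult_left_mono power_mono) auto
    also have "2 ^ k * ((1/4) ^ k)\<^sup>2 = ((1/8) ^ k :: real)"
      by (simp add: power2_eq_square flip: power_mult_distrib)
    finally show ?thesis .
  qed
  have "(\<integral>\<^sup>+x. (\<Sum>k. ennreal (2 ^ k * (d k x)\<^sup>2)) \<partial>M) = (\<Sum>k. \<integral>\<^sup>+x. ennreal (2 ^ k * (d k x)\<^sup>2) \<partial>M)"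
    by (rule nn_integral_suminf) measurable
  also have "\<dots> \<le> (\<Sum>k. ennreal ((1/8) ^ k))"
    by (rule suminf_le[OF dk]) auto
  also have "\<dots> = ennreal (\<Sum>k. (1/8) ^ k)"
    by (rule suminf_ennreal2) (auto intro: summable_geometric)
  also have "\<dots> < \<infinity>" by simp
  finally have "AE x in M. (\<Sum>k. ennreal (2 ^ k * (d k x)\<^sup>2)) \<noteq> \<infinity>"
    by (intro nn_integral_PInf_AE) auto
  then have conv: "AE x in M. convergent (\<lambda>k. f (r k) x)"
  proof eventually_elim
    fix x assume "(\<Sum>k. ennreal (2 ^ k * (d k x)\<^sup>2)) \<noteq> \<infinity>"
    then have "summable (\<lambda>k. 2 ^ k * (d k x)\<^sup>2)"
      using summable_suminf_not_top[of "\<lambda>k. 2 ^ k * (d k x)\<^sup>2"] by auto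
    from summable_imp_Bseq[OF this] obtain C where C: "\<And>k. norm (2 ^ k * (d k x)\<^sup>2) \<le> C"
      unfolding Bseq_def by blast
    have "\<bar>d k x\<bar> \<le> sqrt C * (1 / sqrt 2) ^ k" for k
    proof -
      have "\<bar>d k x\<bar> = sqrt ((d k x)\<^sup>2)" by simp
      also have "\<dots> \<le> sqrt (C / 2 ^ k)" using C[of k] by (intro real_sqrt_le_mono) (simp add: field_simps)
      also have "\<dots> = sqrt C * (1 / sqrt 2) ^ k"
        by (simp add: real_sqrt_divide real_sqrt_power power_one_over field_simps)
      finally show ?thesis .
    qed
    moreover have "summable (\<lambda>k. sqrt C * (1 / sqrt 2) ^ k)"
      by (intro summable_mult summable_geometric) (simp add: real_less_rsqrt)
    ultimately have "summable (\<lambda>k. d k x)"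
      by (rule_tac summable_comparison_test'[of "\<lambda>k. sqrt C * (1 / sqrt 2) ^ k" 0]) auto
    then have "convergent (\<lambda>n. \<Sum>k<n. d k x)" by (simp add: summable_iff_convergent)
    moreover have "(\<Sum>k<n. d k x) = f (r n) x - f (r 0) x" for n
      unfolding d_def by (rule sum_lessThan_telescope[of "\<lambda>k. f (r k) x"])
    ultimately have "convergent (\<lambda>n. f (r n) x - f (r 0) x + f (r 0) x)"
      by (intro convergent_add convergent_const) auto
    then show "convergent (\<lambda>k. f (r k) x)" by simp
  qed
  define g where "g x = lim (\<lambda>k. f (r k) x)" for x
  have [measurable]: "g \<in> borel_measurable M" unfolding g_def by measurable
  have lim: "AE x in M. (\<lambda>k. f (r k) x) \<longlonglongrightarrow> g x"
    using conv by eventually_elim (simp add: g_def convergent_LIMSEQ_iff)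
  \<comment> \<open>Stated with nonnegative integrals because square integrability of
    \<open>g\<close> is not known yet; it is read off from this very estimate.\<close>
  have est: "(\<integral>\<^sup>+x. ennreal ((f n x - g x)\<^sup>2) \<partial>M) \<le> ennreal (((1/4) ^ j)\<^sup>2)" if n: "n \<ge> N j" for n j
  proof -
    have "(\<integral>\<^sup>+x. ennreal ((f n x - g x)\<^sup>2) \<partial>M)
        = (\<integral>\<^sup>+x. liminf (\<lambda>k. ennreal ((f n x - f (r k) x)\<^sup>2)) \<partial>M)"
    proof (rule nn_integral_cong_AE)
      show "AE x in M. ennreal ((f n x - g x)\<^sup>2) = liminf (\<lambda>k. ennreal ((f n x - f (r k) x)\<^sup>2))"
        using lim
      proof eventually_elim
        case (elim x)
        then have "(\<lambda>k. ennreal ((f n x - f (r k) x)\<^sup>2)) \<longlonglongrightarrow> ennreal ((f n x - g x)\<^sup>2)"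
          by (intro tendsto_intros)
        then show ?case using lim_imp_Liminf[OF sequentially_bot] by metis
      qed
    qed
    also have "\<dots> \<le> liminf (\<lambda>k. \<integral>\<^sup>+x. ennreal ((f n x - f (r k) x)\<^sup>2) \<partial>M)"
      by (rule nn_integral_liminf) measurable
    also have "\<dots> \<le> liminf (\<lambda>k::nat. ennreal (((1/4) ^ j)\<^sup>2))"
    proof (rule Liminf_mono)
      show "\<forall>\<^sub>F k in sequentially. (\<integral>\<^sup>+x. ennreal ((f n x - f (r k) x)\<^sup>2) \<partial>M) \<le> ennreal (((1/4) ^ j)\<^sup>2)"
        unfolding nn
      proof (rule eventually_sequentiallyI[of "N j"])
        fix k assume "N j \<le> k"
        then have "r k \<ge> N j" by (simp add: r_def)
        then show "ennreal ((l2n M (\<lambda>x. f n x - f (r k) x))\<^sup>2) \<le> ennreal (((1/4) ^ j)\<^sup>2)"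
          using N[OF n, of "r k"] by (intro ennreal_leI power_mono) auto
      qed
    qed
    also have "\<dots> = ennreal (((1/4) ^ j)\<^sup>2)" by (simp add: Liminf_const)
    finally show ?thesis .
  qed
  have sq: "square_integrable M (\<lambda>x. f n x - g x)" if "n \<ge> N 0" for n
    using est[OF that] unfolding square_integrable_def
    by (auto simp: integrable_iff_bounded intro: order_le_less_trans)
  have "square_integrable M (\<lambda>x. f (N 0) x - (f (N 0) x - g x))"
    by (intro square_integrable_diff f sq) simp
  then have g: "square_integrable M g" by simp
  moreover have "(\<lambda>n. l2n M (\<lambda>x. f n x - g x)) \<longlonglongrightarrow> 0"
  proof (rule LIMSEQ_I)
    fix e :: real assume "e > 0"
    then obtain j where j: "(1/4) ^ j < e" using real_arch_pow_inv[of e "1/4"] by auto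
    have "norm (l2n M (\<lambda>x. f n x - g x) - 0) < e" if n: "n \<ge> N j" for n
    proof -
      have "ennreal ((l2n M (\<lambda>x. f n x - g x))\<^sup>2) = (\<integral>\<^sup>+x. ennreal ((f n x - g x)\<^sup>2) \<partial>M)"
        unfolding l2n_sq using square_integrable_diff[OF f g]
        by (intro nn_integral_eq_integral[symmetric]) (auto simp: square_integrable_def)
      also have "\<dots> \<le> ennreal (((1/4) ^ j)\<^sup>2)" by (rule est[OF n])
      finally have "(l2n M (\<lambda>x. f n x - g x))\<^sup>2 \<le> ((1/4) ^ j)\<^sup>2"
        by (rule ennreal_le_iff[THEN iffD1, rotated]) simp
      then have "l2n M (\<lambda>x. f n x - g x) \<le> (1/4) ^ j" by (rule power2_le_imp_le) simp
      then show ?thesis using j by simp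
    qed
    then show "\<exists>no. \<forall>n\<ge>no. norm (l2n M (\<lambda>x. f n x - g x) - 0) < e" by blast
  qed
  ultimately show ?thesis by (rule that)
qed

section \<open>Absolutely continuous functions on the half-line\<close>

text \<open>A density instead of a restricted space: the underlying space remains the whole line, so
  measurability is plain Borel measurability and functions carry no domain.\<close>

definition hl :: "real measure" where "hl = density lborel (\<lambda>x. ennreal (indicator {..<0} x))"

lemma sets_hl [simp, measurable_cong]: "sets hl = sets borel"
  by (simp add: hl_def)

lemma space_hl [simp]: "space hl = UNIV"
  by (simp add: hl_def)

lemma borel_measurable_hl [simp]: "borel_measurable hl = borel_measurable borel"
  by (rule measurable_cong_sets) auto

lemma AE_hl: "(AE x in hl. P x) \<longleftrightarrow> (AE x in lborel. x < 0 \<longrightarrow> P x)"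
  unfolding hl_def by (subst AE_density) (auto simp: indicator_def elim!: eventually_mono)

lemma AE_hlI: "(\<And>x. x < 0 \<Longrightarrow> P x) \<Longrightarrow> AE x in hl. P x"
  by (simp add: AE_hl)

lemma integrable_hl:
  fixes f :: "real \<Rightarrow> real"
  shows "f \<in> borel_measurable borel \<Longrightarrow> integrable hl f \<longleftrightarrow> set_integrable lborel {..<0} f"
  unfolding hl_def set_integrable_def by (subst integrable_density) auto

lemma integral_hl:
  fixes f :: "real \<Rightarrow> real"
  shows "f \<in> borel_measurable borel \<Longrightarrow> integral\<^sup>L hl f = (LINT x:{..<0}|lborel. f x)"
  unfolding hl_def set_lebesgue_integral_def by (subst integral_density) auto

lemma hl_set_integrable:
  fixes f :: "real \<Rightarrow> real"
  assumes "integrable hl f" "S \<in> sets borel" "S \<subseteq> {..0}"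
  shows "set_integrable lborel S f"
proof -
  have f: "f \<in> borel_measurable borel" using borel_measurable_integrable[OF assms(1)] by simp
  have "set_integrable lborel {..<0} f" using assms(1) integrable_hl[OF f] by simp
  then have "set_integrable lborel (S - {0}) f"
    by (rule set_integrable_subset) (use assms in auto)
  moreover have "AE x in lborel. indicator (S - {0}) x *\<^sub>R f x = indicator S x *\<^sub>R f x"
    using AE_lborel_singleton[of 0] by eventually_elim (simp add: indicator_def)
  moreover have "(\<lambda>x. indicator (S - {0}) x *\<^sub>R f x) \<in> borel_measurable lborel"
    "(\<lambda>x. indicator S x *\<^sub>R f x) \<in> borel_measurable lborel"
    using f assms(2) by auto
  ultimately show ?thesis unfolding set_integrable_def
    by (subst (asm) integrable_cong_AE) simp_all
qed

text \<open>\<open>v\<close> is the a.e. derivative of the absolutely continuous function \<open>u\<close> on \<open>(-\<infinity>,0]\<close>;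
  functions on the half-line are extended by their value at 0.\<close>

definition prim :: "(real \<Rightarrow> real) \<Rightarrow> (real \<Rightarrow> real) \<Rightarrow> bool" where
  "prim u v \<longleftrightarrow> (\<forall>x>0. u x = u 0) \<and> v \<in> borel_measurable borel \<and>
     (\<forall>a b. a \<le> b \<and> b \<le> 0 \<longrightarrow> set_integrable lborel {a..b} v \<and> u b - u a = (LINT x:{a..b}|lborel. v x))"

lemma primD:
  assumes "prim u v"
  shows "v \<in> borel_measurable borel" "x > 0 \<Longrightarrow> u x = u 0"
    "a \<le> b \<Longrightarrow> b \<le> 0 \<Longrightarrow> set_integrable lborel {a..b} v"
    "a \<le> b \<Longrightarrow> b \<le> 0 \<Longrightarrow> u b - u a = (LINT x:{a..b}|lborel. v x)"
  using assms unfolding prim_def by blast+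

lemma prim_continuous: assumes "prim u v" shows "continuous_on UNIV u"
proof -
  note p = primD[OF assms]
  have c: "continuous_on {a..0} u" for a
  proof (cases "a \<le> 0")
    case True
    have "v integrable_on {a..0}" using p(3)[OF True] by (auto intro: set_borel_integral_eq_integral)
    then have "continuous_on {a..0} (\<lambda>x. u a + integral {a..x} v)"
      by (intro continuous_intros indefinite_integral_continuous_1)
    moreover have "u a + integral {a..x} v = u x" if "x \<in> {a..0}" for x
      using p(4)[of a x] set_borel_integral_eq_integral(2)[OF p(3), of a x] that by auto
    ultimately show ?thesis by (rule continuous_on_eq)
  qed auto
  have "isCont u x" for x
  proof -
    define a where "a = min x 0 - 1"
    have "continuous_on {a..0} u" by (rule c)
    \<comment> \<open>Composition with the clamp to \<open>[a, 0]\<close>. Near \<open>x\<close> it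
      does not change \<open>u\<close>, because \<open>u\<close> is constant to the right of
      0.\<close>
    then have "continuous_on UNIV (\<lambda>x. u (max a (min x 0)))"
      by (rule continuous_on_compose2[of _ u]) (auto intro!: continuous_intros simp: a_def)
    then have "isCont (\<lambda>x. u (max a (min x 0))) x" by (simp add: continuous_on_eq_continuous_at)
    moreover have "\<forall>\<^sub>F y in nhds x. u (max a (min y 0)) = u y"
    proof (rule eventually_nhds_in_open[of "{a<..}", THEN eventually_mono])
      show "x \<in> {a<..}" by (simp add: a_def)
      fix y assume "y \<in> {a<..}"
      then show "u (max a (min y 0)) = u y"
        using p(2)[of y] by (cases "y \<le> 0") (auto simp: a_def max_def min_def)
    qed simp
    ultimately show ?thesis using isCont_cong by fastforce
  qed
  then show ?thesis by (simp add: continuous_on_eq_continuous_at)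
qed

lemma prim_measurable: "prim u v \<Longrightarrow> u \<in> borel_measurable borel"
  by (rule borel_measurable_continuous_onI[OF prim_continuous])

lemma prim_const: "prim (\<lambda>x. c) (\<lambda>x. 0)"
  by (simp add: prim_def set_integrable_def)

lemma prim_add:
  assumes "prim u v" "prim w z" shows "prim (\<lambda>x. u x + w x) (\<lambda>x. v x + z x)"
  unfolding prim_def
proof (intro conjI allI impI)
  fix a b :: real assume ab: "a \<le> b \<and> b \<le> 0"
  then show "set_integrable lborel {a..b} (\<lambda>x. v x + z x)"
    using primD(3)[OF assms(1)] primD(3)[OF assms(2)] by auto
  show "u b + w b - (u a + w a) = (LINT x:{a..b}|lborel. v x + z x)"
    using primD(3,4)[OF assms(1), of a b] primD(3,4)[OF assms(2), of a b] ab by (simp add: set_integral_add)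
qed (use primD[OF assms(1)] primD[OF assms(2)] in auto)

lemma prim_scale:
  assumes "prim u v" shows "prim (\<lambda>x. c * u x) (\<lambda>x. c * v x)"
  unfolding prim_def
proof (intro conjI allI impI)
  fix a b :: real assume ab: "a \<le> b \<and> b \<le> 0"
  then show "set_integrable lborel {a..b} (\<lambda>x. c * v x)"
    using primD(3)[OF assms(1)] by auto
  show "c * u b - c * u a = (LINT x:{a..b}|lborel. c * v x)"
    using primD(4)[OF assms(1), of a b] ab by (simp flip: right_diff_distrib)
qed (use primD[OF assms(1)] in auto)

lemma prim_diff:
  assumes "prim u v" "prim w z" shows "prim (\<lambda>x. u x - w x) (\<lambda>x. v x - z x)"
  using prim_add[OF assms(1) prim_scale[OF assms(2), of "-1"]] by simp

lemma prim_cong_AE: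
  assumes "prim u v" "z \<in> borel_measurable borel" "AE x in hl. v x = z x"
  shows "prim u z"
  unfolding prim_def
proof (intro conjI allI impI)
  fix a b :: real assume ab: "a \<le> b \<and> b \<le> 0"
  have ae: "AE x in lborel. indicator {a..b} x *\<^sub>R v x = indicator {a..b} x *\<^sub>R z x"
    using assms(3) AE_lborel_singleton[of 0] unfolding AE_hl by eventually_elim (use ab in \<open>auto simp: indicator_def\<close>)
  note v = primD(1)[OF assms(1)]
  show "set_integrable lborel {a..b} z"
    using primD(3)[OF assms(1), of a b] ab ae v assms(2) unfolding set_integrable_def
    by (subst integrable_cong_AE[OF _ _ ae, symmetric]) auto
  show "u b - u a = (LINT x:{a..b}|lborel. z x)"
    using primD(4)[OF assms(1), of a b] ab ae v assms(2) unfolding set_lebesgue_integral_def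
    by (subst integral_cong_AE[OF _ _ ae, symmetric]) auto
qed (use primD[OF assms(1)] assms(2) in auto)

text \<open>Integration by parts for absolutely continuous functions, from Fubini on the triangle
  \<open>t \<le> s\<close> inside the square over \<open>[a, b]\<close>. One order of integration of
  \<open>v s * z t\<close> produces \<open>v s * (w s - w a)\<close>, the other
  \<open>z t * (u b - u t)\<close>.\<close>

lemma prim_mult:
  assumes u: "prim u v" and w: "prim w z"
  shows "prim (\<lambda>x. u x * w x) (\<lambda>x. v x * w x + u x * z x)"
  unfolding prim_def
proof (intro conjI allI impI)
  note [measurable] = primD(1)[OF u] primD(1)[OF w] prim_measurable[OF u] prim_measurable[OF w]
  show "(\<lambda>x. v x * w x + u x * z x) \<in> borel_measurable borel" by measurable
  fix a b :: real assume ab: "a \<le> b \<and> b \<le> 0"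
  have bd: "set_integrable lborel {a..b} (\<lambda>x. k x * f x)"
    if k: "continuous_on UNIV k" and f: "set_integrable lborel {a..b} f" for k f :: "real \<Rightarrow> real"
  proof -
    have "compact (k ` {a..b})" by (intro compact_continuous_image continuous_on_subset[OF k]) auto
    then have "bounded (k ` {a..b})" by (rule compact_imp_bounded)
    then obtain C where "\<forall>y\<in>k ` {a..b}. norm y \<le> C" unfolding bounded_iff by (rule exE)
    then have C: "\<And>x. x \<in> {a..b} \<Longrightarrow> \<bar>k x\<bar> \<le> C" by simp
    have km: "k \<in> borel_measurable borel" by (rule borel_measurable_continuous_onI[OF k])
    have "set_integrable lborel {a..b} (\<lambda>x. C * f x)" using f by simp
    moreover have "set_borel_measurable lborel {a..b} (\<lambda>x. k x * f x)"
    proof -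
      have "(\<lambda>x. k x * (indicator {a..b} x * f x)) \<in> borel_measurable lborel"
        using km borel_measurable_integrable[OF f[unfolded set_integrable_def]]
        by (rule_tac borel_measurable_times) simp_all
      then show ?thesis by (simp add: set_borel_measurable_def mult.left_commute)
    qed
    ultimately show ?thesis
      by (rule set_integrable_bound) (use C in \<open>auto simp: abs_mult intro!: AE_I2 mult_right_mono order_trans[OF C abs_ge_self]\<close>)
  qed
  note c = prim_continuous[OF u] prim_continuous[OF w]
  have iv: "set_integrable lborel {a..b} v" "set_integrable lborel {a..b} z"
    using primD(3)[OF u] primD(3)[OF w] ab by auto
  have i1: "set_integrable lborel {a..b} (\<lambda>x. v x * w x)" using bd[OF c(2) iv(1)] by (simp add: mult.commute)
  have i2: "set_integrable lborel {a..b} (\<lambda>x. u x * z x)" by (rule bd[OF c(1) iv(2)])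
  show "set_integrable lborel {a..b} (\<lambda>x. v x * w x + u x * z x)" using i1 i2 by auto
  define V where "V s = indicator {a..b} s * v s" for s
  define Z where "Z s = indicator {a..b} s * z s" for s
  have VZ: "integrable lborel V" "integrable lborel Z"
    using iv by (simp_all add: set_integrable_def V_def[abs_def] Z_def[abs_def])
  have [measurable]: "V \<in> borel_measurable borel" "Z \<in> borel_measurable borel"
    unfolding V_def[abs_def] Z_def[abs_def] by measurable
  define K where "K s t = V s * Z t * indicator {..s} t" for s t :: real
  have K: "(\<lambda>p::real \<times> real. indicator {.. fst p} (snd p) :: real) \<in> borel_measurable (lborel \<Otimes>\<^sub>M lborel)"
  proof -
    have eq: "(\<lambda>p::real \<times> real. indicator {.. fst p} (snd p) :: real) = indicator {p. snd p \<le> fst p}"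
      by (auto simp: indicator_def fun_eq_iff)
    have "{p::real \<times> real. snd p \<le> fst p} \<in> sets (borel \<Otimes>\<^sub>M borel)"
      unfolding borel_prod by (intro borel_closed closed_Collect_le continuous_intros)
    then have "{p::real \<times> real. snd p \<le> fst p} \<in> sets (lborel \<Otimes>\<^sub>M lborel)"
      by (simp add: sets_pair_measure_cong[OF sets_lborel sets_lborel])
    then show ?thesis unfolding eq by (rule borel_measurable_indicator)
  qed
  have Km: "(\<lambda>p. K (fst p) (snd p)) \<in> borel_measurable (lborel \<Otimes>\<^sub>M lborel)"
    unfolding K_def using K by measurable
  have Kle: "\<bar>K s t\<bar> \<le> \<bar>V s\<bar> * \<bar>Z t\<bar>" for s t
    by (auto simp: K_def abs_mult indicator_def)
  have Kt: "integrable lborel (K s)" for s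
  proof -
    have "integrable lborel (\<lambda>t. indicator {..s} t *\<^sub>R Z t)"
      by (rule integrable_mult_indicator[OF _ VZ(2)]) simp
    then have "integrable lborel (\<lambda>t. V s * (indicator {..s} t *\<^sub>R Z t))" by simp
    then show ?thesis unfolding K_def[abs_def] by (simp add: ac_simps)
  qed
  have "integrable (lborel \<Otimes>\<^sub>M lborel) (\<lambda>p. K (fst p) (snd p))"
  proof (rule lborel_pair.Fubini_integrable[OF Km])
    show "integrable lborel (\<lambda>s. LINT t|lborel. norm (K (fst (s, t)) (snd (s, t))))"
    proof (rule Bochner_Integration.integrable_bound[of _ "\<lambda>s. \<bar>V s\<bar> * (LINT t|lborel. \<bar>Z t\<bar>)"])
      show "integrable lborel (\<lambda>s. \<bar>V s\<bar> * (LINT t|lborel. \<bar>Z t\<bar>))" using VZ by simp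
      have "(LINT t|lborel. \<bar>K s t\<bar>) \<le> (LINT t|lborel. \<bar>V s\<bar> * \<bar>Z t\<bar>)" for s
        by (rule integral_mono) (use Kt VZ Kle in auto)
      then show "AE s in lborel. norm (LINT t|lborel. norm (K (fst (s, t)) (snd (s, t))))
          \<le> norm (\<bar>V s\<bar> * (LINT t|lborel. \<bar>Z t\<bar>))" by simp
      have "(\<lambda>p. norm (K (fst p) (snd p))) \<in> borel_measurable (lborel \<Otimes>\<^sub>M lborel)"
        using Km by measurable
      then have "(\<lambda>(s,t). norm (K s t)) \<in> borel_measurable (lborel \<Otimes>\<^sub>M lborel)"
        by (simp add: split_beta')
      from lborel.borel_measurable_lebesgue_integral[OF this]
      show "(\<lambda>s. LINT t|lborel. norm (K (fst (s, t)) (snd (s, t)))) \<in> borel_measurable lborel"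
        by simp
    qed
    show "AE s in lborel. integrable lborel (\<lambda>t. K (fst (s, t)) (snd (s, t)))" using Kt by simp
  qed
  then have swap: "(LINT t|lborel. LINT s|lborel. K s t) = (LINT s|lborel. LINT t|lborel. K s t)"
    by (intro lborel_pair.Fubini_integral) (simp add: split_beta')
  have "(LINT t|lborel. K s t) = indicator {a..b} s * (v s * (w s - w a))" for s
  proof (cases "s \<in> {a..b}")
    case True
    have "(LINT t|lborel. K s t) = (LINT t|lborel. V s * (indicator {a..s} t * z t))"
      by (rule Bochner_Integration.integral_cong) (use True in \<open>auto simp: K_def Z_def indicator_def\<close>)
    also have "\<dots> = V s * (w s - w a)"
      using primD(4)[OF w, of a s] True ab by (simp add: set_lebesgue_integral_def)
    finally show ?thesis using True by (simp add: V_def)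
  qed (simp add: K_def V_def)
  then have e1: "(LINT s|lborel. LINT t|lborel. K s t) = (LINT s:{a..b}|lborel. v s * (w s - w a))"
    by (simp add: set_lebesgue_integral_def)
  have "(LINT s|lborel. K s t) = indicator {a..b} t * (z t * (u b - u t))" for t
  proof (cases "t \<in> {a..b}")
    case True
    have "(LINT s|lborel. K s t) = (LINT s|lborel. Z t * (indicator {t..b} s * v s))"
      by (rule Bochner_Integration.integral_cong) (use True in \<open>auto simp: K_def V_def indicator_def\<close>)
    also have "\<dots> = Z t * (u b - u t)"
      using primD(4)[OF u, of t b] True ab by (simp add: set_lebesgue_integral_def)
    finally show ?thesis using True by (simp add: Z_def)
  qed (simp add: K_def Z_def)
  then have e2: "(LINT t|lborel. LINT s|lborel. K s t) = (LINT t:{a..b}|lborel. z t * (u b - u t))"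
    by (simp add: set_lebesgue_integral_def)
  have "(LINT s:{a..b}|lborel. v s * (w s - w a)) = (LINT s:{a..b}|lborel. v s * w s) - w a * (u b - u a)"
  proof -
    have "(LINT s:{a..b}|lborel. v s * (w s - w a)) = (LINT s:{a..b}|lborel. v s * w s - w a * v s)"
      by (simp add: algebra_simps)
    also have "\<dots> = (LINT s:{a..b}|lborel. v s * w s) - (LINT s:{a..b}|lborel. w a * v s)"
      by (rule set_integral_diff) (use i1 iv in auto)
    finally show ?thesis using primD(4)[OF u, of a b] ab by simp
  qed
  moreover have "(LINT s:{a..b}|lborel. z s * (u b - u s)) = u b * (w b - w a) - (LINT s:{a..b}|lborel. u s * z s)"
  proof -
    have "(LINT s:{a..b}|lborel. z s * (u b - u s)) = (LINT s:{a..b}|lborel. u b * z s - u s * z s)"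
      by (simp add: algebra_simps)
    also have "\<dots> = (LINT s:{a..b}|lborel. u b * z s) - (LINT s:{a..b}|lborel. u s * z s)"
      by (rule set_integral_diff) (use i2 iv in auto)
    finally show ?thesis using primD(4)[OF w, of a b] ab by simp
  qed
  moreover have "(LINT x:{a..b}|lborel. v x * w x + u x * z x)
      = (LINT s:{a..b}|lborel. v s * w s) + (LINT s:{a..b}|lborel. u s * z s)"
    by (rule set_integral_add) (use i1 i2 in auto)
  ultimately show "u b * w b - u a * w a = (LINT x:{a..b}|lborel. v x * w x + u x * z x)"
    using swap e1 e2 by (simp add: algebra_simps)
qed (use primD(2)[OF u] primD(2)[OF w] in \<open>simp add: less_imp_le\<close>)

lemma prim_C1:
  assumes der: "\<And>a x. a \<le> x \<Longrightarrow> x \<le> 0 \<Longrightarrow> (u has_real_derivative v x) (at x within {a..0})"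
    and c: "continuous_on UNIV v" and ext: "\<And>x. x > 0 \<Longrightarrow> u x = u 0"
  shows "prim u v"
  unfolding prim_def
proof (intro conjI allI impI)
  show "v \<in> borel_measurable borel" by (rule borel_measurable_continuous_onI[OF c])
  fix a b :: real assume ab: "a \<le> b \<and> b \<le> 0"
  have 1: "(u has_vector_derivative v x) (at x within {a..b})" if "a \<le> x" "x \<le> b" for x
    using der[of a x] that ab
    by (auto simp: has_real_derivative_iff_has_vector_derivative intro: has_vector_derivative_within_subset)
  have 2: "continuous_on {a..b} v" by (rule continuous_on_subset[OF c]) auto
  show "set_integrable lborel {a..b} v" unfolding set_integrable_def
    using has_bochner_integral_FTC_Icc[of a b u v, OF _ 1 2] ab by (simp add: has_bochner_integral_iff)
  show "u b - u a = (LINT x:{a..b}|lborel. v x)" unfolding set_lebesgue_integral_def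
    using integral_FTC_Icc[of a b u v, OF _ 1 2] ab by simp
next
  fix x :: real assume "x > 0" then show "u x = u 0" by (rule ext)
qed

text \<open>Closed intervals are an intersection-stable generator of the Borel sets, so a Dynkin
  argument extends the vanishing to all Borel sets. Complements require the integral over the whole
  line, a dominated limit of those over \<open>[-n, n]\<close>.\<close>

lemma AE_zero_if_interval_integrals_zero:
  fixes f :: "real \<Rightarrow> real"
  assumes f: "integrable lborel f" and zero: "\<And>a b. (LINT x:{a..b}|lborel. f x) = 0"
  shows "AE x in lborel. f x = 0"
proof (rule density_unique_real[OF f integrable_zero])
  have si: "set_integrable lborel A f" if "A \<in> sets borel" for A
    unfolding set_integrable_def using f that by (intro integrable_mult_indicator) auto
  have total: "(LINT x|lborel. f x) = 0"
  proof -
    have "(\<lambda>n. LINT x|lborel. indicator {-real n..real n} x * f x) \<longlonglongrightarrow> (LINT x|lborel. f x)"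
    proof (rule integral_dominated_convergence[where w = "\<lambda>x. \<bar>f x\<bar>"])
      have "(\<lambda>n. indicator {-real n..real n} x * f x) \<longlonglongrightarrow> f x" for x
      proof (rule tendsto_eventually)
        obtain N where "\<bar>x\<bar> \<le> real N" using real_arch_simple by blast
        then show "\<forall>\<^sub>F n in sequentially. indicator {-real n..real n} x * f x = f x"
          by (intro eventually_sequentiallyI[of N]) (auto simp: indicator_def)
      qed
      then show "AE x in lborel. (\<lambda>n. indicator {-real n..real n} x * f x) \<longlonglongrightarrow> f x" by simp
    qed (use f in \<open>auto simp: indicator_def\<close>)
    moreover have "(LINT x|lborel. indicator {-real n..real n} x * f x) = 0" for n
      using zero[of "-real n" "real n"] by (simp add: set_lebesgue_integral_def)
    ultimately show ?thesis by (simp add: LIMSEQ_const_iff)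
  qed
  let ?G = "range (\<lambda>(a, b). {a..b::real})"
  fix A :: "real set" assume "A \<in> sets lborel"
  have "Int_stable ?G" by (auto simp: Int_stable_def image_iff Int_atLeastAtMost)
  moreover have "?G \<subseteq> Pow UNIV" by simp
  moreover have "A \<in> sigma_sets UNIV ?G"
    using \<open>A \<in> sets lborel\<close> by (simp add: borel_eq_atLeastAtMost)
  ultimately have "set_lebesgue_integral lborel A f = 0"
  proof (induction rule: sigma_sets_induct_disjoint)
    case (basic A) then show ?case using zero by auto
  next
    case empty show ?case by (simp add: set_lebesgue_integral_def)
  next
    case (compl A)
    then have A: "A \<in> sets borel" by (simp add: borel_eq_atLeastAtMost)
    have "set_lebesgue_integral lborel (A \<union> (UNIV - A)) f
        = set_lebesgue_integral lborel A f + set_lebesgue_integral lborel (UNIV - A) f"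
      by (rule set_integral_Un) (use si A in auto)
    then show ?case using compl total by (simp add: set_lebesgue_integral_def)
  next
    case (union A)
    have "range A \<subseteq> sets borel" using union by (auto simp: borel_eq_atLeastAtMost)
    then have "set_lebesgue_integral lborel (\<Union>i. A i) f = (\<Sum>i. set_lebesgue_integral lborel (A i) f)"
      using union by (intro lebesgue_integral_countable_add si) (auto simp: disjoint_family_on_def)
    then show ?case using union by simp
  qed
  then show "set_lebesgue_integral lborel A f = set_lebesgue_integral lborel A (\<lambda>x. 0)" by simp
qed

text \<open>The difference of the two derivatives has zero integral over every interval in the
  half-line. Cutting it off to \<open>[-n, 0]\<close> makes it integrable on the line.\<close>

lemma prim_unique_AE:
  assumes "prim u v" "prim u z" shows "AE x in hl. v x = z x"
proof -
  note [measurable] = primD(1)[OF assms(1)] primD(1)[OF assms(2)]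
  define d where "d x = v x - z x" for x
  have [measurable]: "d \<in> borel_measurable borel" unfolding d_def by measurable
  have p: "prim (\<lambda>x. 0) d" using prim_diff[OF assms] by (simp add: d_def[abs_def])
  have "AE x in lborel. indicator {-real n..0} x * d x = 0" for n :: nat
  proof -
    let ?f = "\<lambda>x. indicator {-real n..0} x * d x"
    have f: "integrable lborel ?f" using primD(3)[OF p, of "-real n" 0] by (simp add: set_integrable_def)
    show ?thesis
    proof (rule AE_zero_if_interval_integrals_zero[OF f])
      fix a b
      have "(LINT x:{a..b}|lborel. ?f x) = (LINT x:{max a (-real n)..min b 0}|lborel. d x)"
        unfolding set_lebesgue_integral_def
        by (rule Bochner_Integration.integral_cong) (auto simp: indicator_def)
      also have "\<dots> = 0"
        using primD(4)[OF p, of "max a (-real n)" "min b 0"]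
        by (cases "max a (-real n) \<le> min b 0") (auto simp: set_lebesgue_integral_def)
      finally show "(LINT x:{a..b}|lborel. ?f x) = 0" .
    qed
  qed
  then have "AE x in lborel. \<forall>n. indicator {-real n..0} x * d x = 0" by (subst AE_all_countable) blast
  then show ?thesis unfolding AE_hl
  proof eventually_elim
    fix x assume *: "\<forall>n. indicator {-real n..0} x * d x = 0"
    show "x < 0 \<longrightarrow> v x = z x"
    proof
      assume "x < 0"
      obtain n where "- x \<le> real n" using real_arch_simple by blast
      then show "v x = z x" using spec[OF *, of n] \<open>x < 0\<close> by (simp add: d_def indicator_def)
    qed
  qed
qed

section \<open>The Banach algebra of \<open>H\<^sup>1\<close> functions on the half-line\<close>

lemma hl_interval_integral:
  fixes f :: "real \<Rightarrow> real"
  assumes f: "integrable hl f" and ab: "a \<le> b" "b \<le> 0"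
  shows "(LINT x:{a..b}|lborel. f x) = (LINT x|hl. indicator {a..b} x * f x)"
    "integrable hl (\<lambda>x. indicator {a..b} x * f x)"
proof -
  have m: "f \<in> borel_measurable borel" using borel_measurable_integrable[OF f] by simp
  show i: "integrable hl (\<lambda>x. indicator {a..b} x * f x)"
    using integrable_mult_indicator[OF _ f, of "{a..b}"] by simp
  have "(LINT x|hl. indicator {a..b} x * f x) = (LINT x:{..<0}|lborel. indicator {a..b} x * f x)"
    using m by (intro integral_hl) measurable
  also have "\<dots> = (LINT x:{a..b}|lborel. f x)"
    unfolding set_lebesgue_integral_def
  proof (rule integral_cong_AE)
    show "AE x in lborel. indicator {..<0} x *\<^sub>R (indicator {a..b} x * f x) = indicator {a..b} x *\<^sub>R f x"
      using AE_lborel_singleton[of 0] by eventually_elim (use ab in \<open>auto simp: indicator_def\<close>)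
  qed (use m in measurable)
  finally show "(LINT x:{a..b}|lborel. f x) = (LINT x|hl. indicator {a..b} x * f x)" by simp
qed

lemma hl_indicator:
  assumes "a \<le> b" "b \<le> 0"
  shows "square_integrable hl (indicator {a..b})" "l2n hl (indicator {a..b}) = sqrt (b - a)"
proof -
  have sq: "(indicator {a..b} x)\<^sup>2 = (indicator {a..b} x :: real)" for x by (simp add: indicator_def)
  have fin: "integrable hl (indicator {a..b} :: real \<Rightarrow> real)"
  proof (subst integrable_hl)
    have "emeasure lborel ({..<0} \<inter> {a..b}) \<le> emeasure lborel {a..b}" by (rule emeasure_mono) auto
    also have "\<dots> < \<infinity>" using assms by simp
    finally have "integrable lborel (indicator ({..<0} \<inter> {a..b}) :: real \<Rightarrow> real)"
      by (intro integrable_real_indicator) auto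
    then show "set_integrable lborel {..<0} (indicator {a..b} :: real \<Rightarrow> real)"
      by (simp add: set_integrable_def flip: indicator_inter_arith)
  qed simp
  then show "square_integrable hl (indicator {a..b})" by (simp add: square_integrable_def sq)
  have "(LINT x|hl. (indicator {a..b} x :: real)) = (LINT x:{a..b}|lborel. indicator {a..b} x)"
    by (subst hl_interval_integral(1)[OF fin assms]) (simp flip: indicator_inter_arith)
  also have "\<dots> = b - a" using assms by (simp add: set_lebesgue_integral_def flip: indicator_inter_arith)
  finally show "l2n hl (indicator {a..b}) = sqrt (b - a)" by (simp add: l2n_def sq)
qed

text \<open>This comes from integrating \<open>(u^2)' = 2 u u'\<close> from minus infinity, without
  knowing beforehand that \<open>u\<close> vanishes there: if the bound failed by an amount
  \<delta>, then \<open>u^2\<close> would be at least \<delta> on all of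
  \<open>(-\<infinity>, x]\<close>, against square integrability.\<close>

lemma prim_sq_le:
  assumes p: "prim u v" and u: "square_integrable hl u" and v: "square_integrable hl v" and x: "x \<le> 0"
  shows "(u x)\<^sup>2 \<le> 2 * (LINT y|hl. indicator {..x} y * \<bar>u y * v y\<bar>)"
proof (rule ccontr)
  define I where "I = (LINT y|hl. indicator {..x} y * \<bar>u y * v y\<bar>)"
  have uv: "integrable hl (\<lambda>y. u y * v y)" by (rule square_integrable_mult[OF u v])
  then have iI: "integrable hl (\<lambda>y. indicator {..x} y * \<bar>u y * v y\<bar>)"
    using integrable_mult_indicator[of "{..x}" hl "\<lambda>y. \<bar>u y * v y\<bar>"] by simp
  assume "\<not> (u x)\<^sup>2 \<le> 2 * (LINT y|hl. indicator {..x} y * \<bar>u y * v y\<bar>)"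
  then have gt: "(u x)\<^sup>2 > 2 * I" by (simp add: I_def)
  define \<delta> where "\<delta> = (u x)\<^sup>2 - 2 * I"
  have low: "(u a)\<^sup>2 \<ge> \<delta>" if a: "a \<le> x" for a
  proof -
    have "(u x)\<^sup>2 - (u a)\<^sup>2 = (LINT y:{a..x}|lborel. v y * u y + u y * v y)"
      using primD(4)[OF prim_mult[OF p p] a x] by (simp add: power2_eq_square)
    also have "\<dots> = (LINT y|hl. indicator {a..x} y * (v y * u y + u y * v y))"
      using uv by (intro hl_interval_integral a x) (simp add: mult.commute)
    also have "\<dots> \<le> (LINT y|hl. 2 * (indicator {..x} y * \<bar>u y * v y\<bar>))"
    proof (rule integral_mono)
      show "integrable hl (\<lambda>y. indicator {a..x} y * (v y * u y + u y * v y))"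
        using uv by (intro hl_interval_integral a x) (simp add: mult.commute)
      show "integrable hl (\<lambda>y. 2 * (indicator {..x} y * \<bar>u y * v y\<bar>))" using iI by simp
    qed (auto simp: indicator_def mult.commute)
    finally show ?thesis by (simp add: \<delta>_def I_def)
  qed
  have u2: "integrable hl (\<lambda>y. (u y)\<^sup>2)" using u by (simp add: square_integrable_def)
  have "\<delta> * real n \<le> (LINT y|hl. (u y)\<^sup>2)" for n :: nat
  proof -
    let ?J = "{x - real n..x}"
    have "\<delta> * real n = \<delta> * (l2n hl (indicator ?J))\<^sup>2"
      using hl_indicator(2)[of "x - real n" x] x by simp
    also have "(l2n hl (indicator ?J))\<^sup>2 = (LINT y|hl. indicator ?J y)"
      unfolding l2n_sq by (rule Bochner_Integration.integral_cong) (simp_all add: indicator_def)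
    also have "\<delta> * (LINT y|hl. indicator ?J y) = (LINT y|hl. \<delta> * indicator ?J y)"
      by (rule integral_mult_right_zero[symmetric])
    also have "\<dots> \<le> (LINT y|hl. (u y)\<^sup>2)"
    proof (rule integral_mono)
      show "integrable hl (\<lambda>y. \<delta> * indicator ?J y)"
        using hl_indicator(1)[of "x - real n" x] x
        by (auto simp: square_integrable_def power2_eq_square simp flip: indicator_inter_arith)
      show "\<delta> * indicator ?J y \<le> (u y)\<^sup>2" for y
        using low[of y] by (auto simp: indicator_def)
    qed (fact u2)
    finally show ?thesis .
  qed
  moreover have "\<delta> > 0" using gt by (simp add: \<delta>_def)
  ultimately have "real n \<le> (LINT y|hl. (u y)\<^sup>2) / \<delta>" for n
    by (simp add: field_simps)
  then show False using reals_Archimedean2 by (metis not_le)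
qed

text \<open>The Sobolev embedding of \<open>H^1\<close> into the bounded functions, with constant 1
  because \<open>2 a b \<le> (a + b)^2\<close> for nonnegative \<open>a\<close> and
  \<open>b\<close>.\<close>

lemma prim_sup_bound:
  assumes p: "prim u v" and u: "square_integrable hl u" and v: "square_integrable hl v"
  shows "\<bar>u x\<bar> \<le> l2n hl u + l2n hl v"
proof -
  have *: "\<bar>u x\<bar> \<le> l2n hl u + l2n hl v" if x: "x \<le> 0" for x
  proof -
    have uv: "integrable hl (\<lambda>y. \<bar>u y * v y\<bar>)" using square_integrable_mult[OF u v] by simp
    have "(u x)\<^sup>2 \<le> 2 * (LINT y|hl. indicator {..x} y * \<bar>u y * v y\<bar>)"
      by (rule prim_sq_le[OF p u v x])
    also have "(LINT y|hl. indicator {..x} y * \<bar>u y * v y\<bar>) \<le> (LINT y|hl. \<bar>u y * v y\<bar>)"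
    proof (rule integral_mono[OF _ uv])
      show "integrable hl (\<lambda>y. indicator {..x} y * \<bar>u y * v y\<bar>)"
        using integrable_mult_indicator[OF _ uv, of "{..x}"] by simp
    qed (simp add: indicator_def)
    also have "\<dots> \<le> l2n hl u * l2n hl v" by (rule l2_Cauchy_Schwarz_abs[OF u v])
    finally have "(u x)\<^sup>2 \<le> 2 * l2n hl u * l2n hl v" by simp
    also have "\<dots> \<le> (l2n hl u + l2n hl v)\<^sup>2" by (simp add: power2_sum)
    finally show ?thesis using abs_le_square_iff[of "u x" "l2n hl u + l2n hl v"] by simp
  qed
  show ?thesis using *[of x] *[of 0] primD(2)[OF p, of x] by (cases "x \<le> 0") auto
qed

lemma prim_vanishes:
  assumes p: "prim u v" and u: "square_integrable hl u" and v: "square_integrable hl v" and "e > 0"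
  obtains M where "\<And>x. x < M \<Longrightarrow> \<bar>u x\<bar> < e"
proof -
  have uv: "integrable hl (\<lambda>y. \<bar>u y * v y\<bar>)" using square_integrable_mult[OF u v] by simp
  have i: "integrable hl (\<lambda>y. indicator {..x} y * \<bar>u y * v y\<bar>)" for x
    using integrable_mult_indicator[OF _ uv, of "{..x}"] by simp
  have "(\<lambda>n. LINT y|hl. indicator {..- real n} y * \<bar>u y * v y\<bar>) \<longlonglongrightarrow> (LINT y|hl. 0)"
  proof (rule integral_dominated_convergence[where w = "\<lambda>y. \<bar>u y * v y\<bar>"])
    have "(\<lambda>n. indicator {..- real n} y * \<bar>u y * v y\<bar>) \<longlonglongrightarrow> 0" for y
    proof (rule tendsto_eventually)
      obtain N where "- y < real N" using reals_Archimedean2 by blast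
      then show "\<forall>\<^sub>F n in sequentially. indicator {..- real n} y * \<bar>u y * v y\<bar> = 0"
        by (intro eventually_sequentiallyI[of N]) (auto simp: indicator_def)
    qed
    then show "AE y in hl. (\<lambda>n. indicator {..- real n} y * \<bar>u y * v y\<bar>) \<longlonglongrightarrow> 0" by simp
  qed (use uv i in \<open>auto simp: indicator_def dest: borel_measurable_integrable\<close>)
  then have "(\<lambda>n. LINT y|hl. indicator {..- real n} y * \<bar>u y * v y\<bar>) \<longlonglongrightarrow> 0" by simp
  from LIMSEQ_D[OF this, of "e\<^sup>2 / 2"] obtain n
    where n: "norm (LINT y|hl. indicator {..- real n} y * \<bar>u y * v y\<bar>) < e\<^sup>2 / 2"
    using \<open>e > 0\<close> by auto
  show ?thesis
  proof (rule that[of "- real n"])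
    fix x assume x: "x < - real n"
    have "(u x)\<^sup>2 \<le> 2 * (LINT y|hl. indicator {..x} y * \<bar>u y * v y\<bar>)"
      by (rule prim_sq_le[OF p u v]) (use x in simp)
    also have "(LINT y|hl. indicator {..x} y * \<bar>u y * v y\<bar>) \<le> (LINT y|hl. indicator {..- real n} y * \<bar>u y * v y\<bar>)"
      by (rule integral_mono[OF i i]) (use x in \<open>auto simp: indicator_def\<close>)
    finally have "(u x)\<^sup>2 < e\<^sup>2" using n by simp
    then show "\<bar>u x\<bar> < e" using \<open>e > 0\<close> abs_square_less_1 power2_less_imp_less[of "\<bar>u x\<bar>" e] by simp
  qed
qed

text \<open>The elements are the continuous representatives, extended by a constant beyond 0.
  Equality in the type is thus equality of functions, and no quotient is formed.\<close>

typedef h1 = "{u. \<exists>v. prim u v \<and> square_integrable hl u \<and> square_integrable hl v}"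
  morphisms fn Abs_h1
  by (rule exI[of _ "\<lambda>x. 0"]) (use prim_const[of 0] in auto)

text \<open>The derivative is determined only almost everywhere, so the rules for \<open>dv\<close>
  are almost-everywhere statements. For derivatives that lie in \<open>h1\<close> again,
  \<open>dr\<close> gives an exact relation with a unique derivative.\<close>

definition dv :: "h1 \<Rightarrow> real \<Rightarrow> real" where
  "dv f = (SOME v. prim (fn f) v \<and> square_integrable hl v)"

lemma prim_dv: "prim (fn f) (dv f)" and sq_dv: "square_integrable hl (dv f)"
  and sq_fn: "square_integrable hl (fn f)"
proof -
  have *: "\<exists>v. prim (fn f) v \<and> square_integrable hl (fn f) \<and> square_integrable hl v" using fn[of f] by simp
  then have "\<exists>v. prim (fn f) v \<and> square_integrable hl v" by blast
  from someI_ex[OF this] show "prim (fn f) (dv f)" "square_integrable hl (dv f)" by (auto simp: dv_def)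
  show "square_integrable hl (fn f)" using * by blast
qed

lemma dv_AE: "prim (fn f) v \<Longrightarrow> AE x in hl. dv f x = v x"
  by (rule prim_unique_AE[OF prim_dv])

lemma fn_Abs_h1:
  "prim u v \<Longrightarrow> square_integrable hl u \<Longrightarrow> square_integrable hl v \<Longrightarrow> fn (Abs_h1 u) = u"
  by (rule Abs_h1_inverse) auto

lemma h1_obtain:
  assumes "prim u v" "square_integrable hl u" "square_integrable hl v"
  obtains f where "fn f = u" "AE x in hl. dv f x = v x"
  using that[of "Abs_h1 u"] dv_AE[of "Abs_h1 u" v] fn_Abs_h1[OF assms] assms(1) by simp

lemma fn_continuous: "continuous_on A (fn f)"
  using prim_continuous[OF prim_dv] continuous_on_subset by blast

lemma fn_measurable [measurable]: "fn f \<in> borel_measurable borel"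
  by (rule prim_measurable[OF prim_dv])

lemma dv_measurable [measurable]: "dv f \<in> borel_measurable borel"
  by (rule primD(1)[OF prim_dv])

lemma fn_pos: "x > 0 \<Longrightarrow> fn f x = fn f 0"
  by (rule primD(2)[OF prim_dv])

lemma h1_eqI: "(\<And>x. x \<le> 0 \<Longrightarrow> fn f x = fn g x) \<Longrightarrow> f = g"
proof -
  assume *: "\<And>x. x \<le> 0 \<Longrightarrow> fn f x = fn g x"
  have "fn f x = fn g x" for x using *[of x] *[of 0] fn_pos[of x f] fn_pos[of x g] by (cases "x \<le> 0") auto
  then show ?thesis by (simp add: fn_inject[symmetric] fun_eq_iff)
qed

instantiation h1 :: "{real_vector, comm_ring}"
begin

definition "0 = Abs_h1 (\<lambda>x. 0)"
definition "f + g = Abs_h1 (\<lambda>x. fn f x + fn g x)"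
definition "f - g = Abs_h1 (\<lambda>x. fn f x - fn g x)"
definition "- f = Abs_h1 (\<lambda>x. - fn f x)"
definition "c *\<^sub>R f = Abs_h1 (\<lambda>x. c * fn f x)"
definition "f * g = Abs_h1 (\<lambda>x. fn f x * fn g x)"

lemma fn_zero [simp]: "fn 0 = (\<lambda>x. 0)"
  unfolding zero_h1_def by (rule fn_Abs_h1[OF prim_const]) auto

lemma fn_add [simp]: "fn (f + g) = (\<lambda>x. fn f x + fn g x)"
  unfolding plus_h1_def
  by (rule fn_Abs_h1[OF prim_add[OF prim_dv prim_dv]]) (auto intro: square_integrable_add sq_fn sq_dv)

lemma fn_diff [simp]: "fn (f - g) = (\<lambda>x. fn f x - fn g x)"
  unfolding minus_h1_def
  by (rule fn_Abs_h1[OF prim_diff[OF prim_dv prim_dv]]) (auto intro: square_integrable_diff sq_fn sq_dv)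

lemma fn_scaleR [simp]: "fn (c *\<^sub>R f) = (\<lambda>x. c * fn f x)"
  unfolding scaleR_h1_def
  by (rule fn_Abs_h1[OF prim_scale[OF prim_dv]]) (auto intro: square_integrable_scale sq_fn sq_dv)

lemma fn_minus [simp]: "fn (- f) = (\<lambda>x. - fn f x)"
  using fn_scaleR[of "-1" f] by (simp add: uminus_h1_def scaleR_h1_def)

lemma fn_bound: "\<bar>fn f x\<bar> \<le> l2n hl (fn f) + l2n hl (dv f)"
  by (rule prim_sup_bound[OF prim_dv sq_fn sq_dv])

lemma sq_mult_fn:
  assumes "square_integrable hl v" "\<And>x. x < 0 \<Longrightarrow> \<bar>fn f x\<bar> \<le> C" "C \<ge> 0"
  shows "square_integrable hl (\<lambda>x. fn f x * v x)" "l2n hl (\<lambda>x. fn f x * v x) \<le> C * l2n hl v"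
  by (rule l2n_mult_bounded[OF assms(1) _ AE_hlI]; use assms in simp)+

lemma sq_mult_fn': "square_integrable hl v \<Longrightarrow> square_integrable hl (\<lambda>x. fn f x * v x)"
  by (rule sq_mult_fn(1)[OF _ fn_bound]) auto

lemma fn_mult [simp]: "fn (f * g) = (\<lambda>x. fn f x * fn g x)"
  unfolding times_h1_def
proof (rule fn_Abs_h1[OF prim_mult[OF prim_dv prim_dv]])
  show "square_integrable hl (\<lambda>x. fn f x * fn g x)" by (intro sq_mult_fn' sq_fn)
  show "square_integrable hl (\<lambda>x. dv f x * fn g x + fn f x * dv g x)"
    using square_integrable_add[OF sq_mult_fn'[OF sq_dv, of g f] sq_mult_fn'[OF sq_dv, of f g]]
    by (simp add: mult.commute)
qed

instance
  by standard (auto intro!: h1_eqI simp: algebra_simps)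

end

lemma dv_add: "AE x in hl. dv (f + g) x = dv f x + dv g x"
  by (rule dv_AE) (simp add: prim_add[OF prim_dv prim_dv])

lemma dv_diff: "AE x in hl. dv (f - g) x = dv f x - dv g x"
  by (rule dv_AE) (simp add: prim_diff[OF prim_dv prim_dv])

lemma dv_scaleR: "AE x in hl. dv (c *\<^sub>R f) x = c * dv f x"
  by (rule dv_AE) (simp add: prim_scale[OF prim_dv])

lemma dv_mult: "AE x in hl. dv (f * g) x = dv f x * fn g x + fn f x * dv g x"
  by (rule dv_AE) (simp add: prim_mult[OF prim_dv prim_dv])

lemma dv_zero: "AE x in hl. dv 0 x = 0"
  by (rule dv_AE) (simp add: prim_const)

instantiation h1 :: real_normed_algebra
begin

definition "norm f = 2 * (l2n hl (fn f) + l2n hl (dv f))"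
definition "dist f g = norm (f - g)" for f g :: h1
definition "sgn f = f /\<^sub>R norm f" for f :: h1
definition [code del]: "uniformity = (INF e\<in>{0<..}. principal {(x, y :: h1). dist x y < e})"
definition [code del]: "open U \<longleftrightarrow> (\<forall>x\<in>U. \<forall>\<^sub>F (x', y) in uniformity. x' = x \<longrightarrow> y \<in> U)" for U :: "h1 set"

lemma fn_norm_half: "\<bar>fn f x\<bar> \<le> norm f / 2"
  using fn_bound[of f x] by (simp add: norm_h1_def)

lemma l2n_dv_add: "l2n hl (dv (f + g)) \<le> l2n hl (dv f) + l2n hl (dv g)"
  using l2n_triangle[OF sq_dv sq_dv, of f g]
  by (subst l2n_cong_AE[OF _ _ dv_add]) auto

text \<open>The factor 2 in the norm makes it submultiplicative.\<close>

lemma norm_mult_tame: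
  assumes A: "\<And>x. x < 0 \<Longrightarrow> \<bar>fn f x\<bar> \<le> A" "A \<ge> 0" and B: "\<And>x. x < 0 \<Longrightarrow> \<bar>fn g x\<bar> \<le> B" "B \<ge> 0"
  shows "norm (f * g) \<le> A * norm g + B * (2 * l2n hl (dv f))"
proof -
  have "l2n hl (dv (f * g)) = l2n hl (\<lambda>x. fn g x * dv f x + fn f x * dv g x)"
    by (rule l2n_cong_AE) (use dv_mult[of f g] in \<open>auto simp: mult.commute\<close>)
  also have "\<dots> \<le> l2n hl (\<lambda>x. fn g x * dv f x) + l2n hl (\<lambda>x. fn f x * dv g x)"
    by (intro l2n_triangle sq_mult_fn' sq_dv)
  also have "\<dots> \<le> B * l2n hl (dv f) + A * l2n hl (dv g)"
    by (intro add_mono sq_mult_fn sq_dv A B)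
  finally have "l2n hl (dv (f * g)) \<le> B * l2n hl (dv f) + A * l2n hl (dv g)" .
  moreover have "l2n hl (fn (f * g)) \<le> A * l2n hl (fn g)"
    unfolding fn_mult by (intro sq_mult_fn sq_fn A)
  ultimately show ?thesis unfolding norm_h1_def by (simp add: algebra_simps)
qed

instance
proof
  fix f g h :: h1 and c :: real
  show "(norm f = 0) = (f = 0)"
  proof
    assume "norm f = 0"
    then have "fn f x = 0" for x using fn_norm_half[of f x] by simp
    then show "f = 0" by (intro h1_eqI) simp
  next
    assume "f = 0"
    then show "norm f = 0" using l2n_cong_AE[OF _ _ dv_zero] by (simp add: norm_h1_def)
  qed
  show "norm (f + g) \<le> norm f + norm g"
    using l2n_triangle[OF sq_fn sq_fn, of f g] l2n_dv_add[of f g] by (simp add: norm_h1_def)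
  show "norm (c *\<^sub>R f) = \<bar>c\<bar> * norm f"
    using l2n_cong_AE[OF _ _ dv_scaleR[of c f]] square_integrable_scale(2)[OF sq_fn, of c f]
      square_integrable_scale(2)[OF sq_dv, of c f] by (simp add: norm_h1_def algebra_simps)
  show "norm (f * g) \<le> norm f * norm g"
  proof -
    have "norm (f * g) \<le> norm f / 2 * norm g + norm g / 2 * (2 * l2n hl (dv f))"
      by (rule norm_mult_tame; (rule fn_norm_half)?) (simp_all add: norm_h1_def)
    also have "\<dots> \<le> norm f / 2 * norm g + norm g / 2 * norm f"
      using fn_norm_half[of g 0] by (intro add_left_mono mult_left_mono) (auto simp: norm_h1_def)
    finally show ?thesis by (simp add: algebra_simps)
  qed
qed (auto simp: dist_h1_def sgn_h1_def uniformity_h1_def open_h1_def intro!: h1_eqI simp: algebra_simps)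

end

lemma fn_norm: "\<bar>fn f x\<bar> \<le> norm f"
  using fn_norm_half[of f x] by (simp add: norm_h1_def)

lemma bounded_linear_fn: "bounded_linear (\<lambda>f. fn f x)"
  by (rule bounded_linear_intro[where K = 1]) (auto simp: fn_norm)

lemma h1_norm_le: "l2n hl (fn f) \<le> norm f" "l2n hl (dv f) \<le> norm f"
  by (auto simp: norm_h1_def)

text \<open>Functions and derivatives converge separately in \<open>L^2\<close>, to \<open>g\<close>
  and \<open>v\<close>, and the pointwise limit \<open>U\<close> exists because evaluation is
  bounded by the norm. It remains to see that \<open>U\<close> is a primitive of \<open>v\<close>,
  by Cauchy-Schwarz against indicators of intervals, and that \<open>U = g\<close> almost
  everywhere, by uniform convergence on each \<open>[-n, 0]\<close>.\<close>

instance h1 :: banach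
proof
  fix X :: "nat \<Rightarrow> h1" assume X: "Cauchy X"
  have C: "\<exists>N. \<forall>m\<ge>N. \<forall>n\<ge>N. norm (X m - X n) < e" if "e > 0" for e
    using X that unfolding Cauchy_def dist_norm by blast
  have dd: "l2n hl (\<lambda>x. dv (X m) x - dv (X n) x) = l2n hl (dv (X m - X n))" for m n
    by (rule l2n_cong_AE) (use dv_diff[of "X m" "X n"] in \<open>auto simp: eq_commute\<close>)
  obtain v where v: "square_integrable hl v" "(\<lambda>n. l2n hl (\<lambda>x. dv (X n) x - v x)) \<longlonglongrightarrow> 0"
  proof (rule l2_complete[of hl "\<lambda>n. dv (X n)"])
    fix e :: real assume "e > 0"
    from C[OF this] show "\<exists>N. \<forall>m\<ge>N. \<forall>n\<ge>N. l2n hl (\<lambda>x. dv (X m) x - dv (X n) x) < e"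
      unfolding dd using h1_norm_le(2) order_le_less_trans by blast
  qed (auto intro: sq_dv)
  obtain g where g: "square_integrable hl g" "(\<lambda>n. l2n hl (\<lambda>x. fn (X n) x - g x)) \<longlonglongrightarrow> 0"
  proof (rule l2_complete[of hl "\<lambda>n. fn (X n)"])
    fix e :: real assume "e > 0"
    have "l2n hl (\<lambda>x. fn (X m) x - fn (X n) x) \<le> norm (X m - X n)" for m n
      using h1_norm_le(1)[of "X m - X n"] by simp
    with C[OF \<open>e > 0\<close>] show "\<exists>N. \<forall>m\<ge>N. \<forall>n\<ge>N. l2n hl (\<lambda>x. fn (X m) x - fn (X n) x) < e"
      using order_le_less_trans by blast
  qed (auto intro: sq_fn)
  define vb where "vb = v"
  have vm: "v \<in> borel_measurable borel" "g \<in> borel_measurable borel"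
    using v(1) g(1) by (auto simp: square_integrable_def)
  have "Cauchy (\<lambda>n. fn (X n) x)" for x
    unfolding Cauchy_def dist_norm
  proof (intro allI impI)
    fix e :: real assume "e > 0"
    have "norm (fn (X m) x - fn (X n) x) \<le> norm (X m - X n)" for m n
      using fn_norm[of "X m - X n" x] by simp
    with C[OF \<open>e > 0\<close>] show "\<exists>M. \<forall>m\<ge>M. \<forall>n\<ge>M. norm (fn (X m) x - fn (X n) x) < e"
      using order_le_less_trans by blast
  qed
  then have "convergent (\<lambda>n. fn (X n) x)" for x by (simp add: Cauchy_convergent_iff)
  then obtain U where U: "\<And>x. (\<lambda>n. fn (X n) x) \<longlonglongrightarrow> U x" unfolding convergent_def by metis
  have ce: "l2n hl (\<lambda>x. v x - dv (X n) x) = l2n hl (\<lambda>x. dv (X n) x - v x)" for n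
    by (simp add: l2n_def power2_commute)
  have p: "prim U v"
    unfolding prim_def
  proof (intro conjI allI impI)
    fix x :: real assume "x > 0"
    then have "fn (X n) x = fn (X n) 0" for n by (rule fn_pos)
    then show "U x = U 0" using U[of x] U[of 0] LIMSEQ_unique by simp
  next
    fix a b :: real assume ab: "a \<le> b \<and> b \<le> 0"
    then have ind: "square_integrable hl (indicator {a..b})" by (intro hl_indicator) auto
    have sI: "integrable hl (\<lambda>x. indicator {a..b} x * w x)"
      "set_integrable lborel {a..b} w"
      "(LINT x:{a..b}|lborel. w x) = (LINT x|hl. indicator {a..b} x * w x)"
      if w: "square_integrable hl w" for w
    proof -
      show i: "integrable hl (\<lambda>x. indicator {a..b} x * w x)" by (rule square_integrable_mult[OF ind w])
      have "set_integrable lborel {a..b} (\<lambda>x. indicator {a..b} x * w x)"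
        by (rule hl_set_integrable[OF i]) (use ab in auto)
      then show "set_integrable lborel {a..b} w"
        unfolding set_integrable_def by (simp flip: mult.assoc indicator_inter_arith)
      have "(LINT x:{a..b}|lborel. w x) = (LINT x:{a..b}|lborel. indicator {a..b} x * w x)"
        by (rule set_lebesgue_integral_cong) auto
      also have "\<dots> = (LINT x|hl. indicator {a..b} x * (indicator {a..b} x * w x))"
        by (rule hl_interval_integral[OF i]) (use ab in auto)
      finally show "(LINT x:{a..b}|lborel. w x) = (LINT x|hl. indicator {a..b} x * w x)"
        by (simp flip: mult.assoc indicator_inter_arith)
    qed
    show "set_integrable lborel {a..b} v" by (rule sI(2)[OF v(1)])
    have "(\<lambda>n. LINT x|hl. indicator {a..b} x * dv (X n) x) \<longlonglongrightarrow> (LINT x|hl. indicator {a..b} x * v x)"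
    proof (rule Lim_null[THEN iffD2], rule Lim_null_comparison)
      show "\<forall>\<^sub>F n in sequentially. norm ((LINT x|hl. indicator {a..b} x * dv (X n) x) - (LINT x|hl. indicator {a..b} x * v x))
          \<le> l2n hl (indicator {a..b}) * l2n hl (\<lambda>x. dv (X n) x - v x)"
      proof (intro always_eventually allI)
        fix n
        have "(LINT x|hl. indicator {a..b} x * dv (X n) x) - (LINT x|hl. indicator {a..b} x * v x)
            = (LINT x|hl. indicator {a..b} x * (dv (X n) x - v x))"
          using sI(1)[OF sq_dv] sI(1)[OF v(1)] by (simp add: right_diff_distrib)
        then show "norm ((LINT x|hl. indicator {a..b} x * dv (X n) x) - (LINT x|hl. indicator {a..b} x * v x))
          \<le> l2n hl (indicator {a..b}) * l2n hl (\<lambda>x. dv (X n) x - v x)"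
          using l2_Cauchy_Schwarz[OF ind square_integrable_diff[OF sq_dv v(1)]] by simp
      qed
      show "(\<lambda>n. l2n hl (indicator {a..b}) * l2n hl (\<lambda>x. dv (X n) x - v x)) \<longlonglongrightarrow> 0"
        using tendsto_mult_left[OF v(2)] by simp
    qed
    moreover have "(LINT x|hl. indicator {a..b} x * dv (X n) x) = fn (X n) b - fn (X n) a" for n
      using primD(4)[OF prim_dv, of a b "X n"] ab sI(3)[OF sq_dv] by simp
    ultimately have "(\<lambda>n. fn (X n) b - fn (X n) a) \<longlonglongrightarrow> (LINT x:{a..b}|lborel. v x)"
      using sI(3)[OF v(1)] by simp
    moreover have "(\<lambda>n. fn (X n) b - fn (X n) a) \<longlonglongrightarrow> U b - U a" by (intro tendsto_diff U)
    ultimately show "U b - U a = (LINT x:{a..b}|lborel. v x)" using LIMSEQ_unique by blast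
  qed (use vm in simp)
  note [measurable] = prim_measurable[OF p] vm
  have Ug: "AE x in hl. g x = U x"
  proof -
    have "AE x in hl. indicator {-real n..0} x * (g x - U x) = 0" for n
    proof -
      have unif: "\<exists>N. \<forall>k\<ge>N. \<forall>x. \<bar>fn (X k) x - U x\<bar> \<le> e" if e: "e > 0" for e
      proof -
        obtain N where N: "\<And>i j. i \<ge> N \<Longrightarrow> j \<ge> N \<Longrightarrow> norm (X i - X j) < e" using C[OF e] by blast
        have "\<bar>fn (X k) x - U x\<bar> \<le> e" if k: "k \<ge> N" for k x
        proof (rule LIMSEQ_le_const2)
          show "(\<lambda>j. \<bar>fn (X k) x - fn (X j) x\<bar>) \<longlonglongrightarrow> \<bar>fn (X k) x - U x\<bar>"
            by (intro tendsto_intros U)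
          show "\<exists>M. \<forall>j\<ge>M. \<bar>fn (X k) x - fn (X j) x\<bar> \<le> e"
            using N[OF k] fn_norm[of "X k - X _" x] by (intro exI[of _ N]) (force intro: less_imp_le order_trans)
        qed
        then show ?thesis by blast
      qed
      have i: "square_integrable hl (indicator {-real n..0})" by (intro hl_indicator) auto
      let ?d = "\<lambda>x. indicator {-real n..0} x * (g x - U x)"
      have key: "square_integrable hl ?d \<and> l2n hl ?d \<le> e" if e: "e > 0" for e
      proof -
        \<comment> \<open>The \<open>L^2\<close> norm of the indicator of \<open>[-n, 0]\<close> is
          \<open>sqrt n\<close>, so a uniform error \<open>e'\<close> contributes at most
          \<open>e / 2\<close>.\<close>
        define e' where "e' = e / (2 * (sqrt (real n) + 1))"
        have "2 + sqrt (real n) * 2 > 0" by (simp add: add_pos_nonneg)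
        then have e': "e' > 0" "sqrt (real n) * e' \<le> e / 2"
          using e by (simp_all add: e'_def field_simps)
        obtain N where N: "\<And>k x. k \<ge> N \<Longrightarrow> \<bar>fn (X k) x - U x\<bar> \<le> e'" using unif[OF e'(1)] by blast
        have "\<forall>\<^sub>F k in sequentially. l2n hl (\<lambda>x. fn (X k) x - g x) < e / 2"
          by (rule order_tendstoD(2)[OF g(2)]) (use e in simp)
        then obtain N' where N': "\<And>k. k \<ge> N' \<Longrightarrow> l2n hl (\<lambda>x. fn (X k) x - g x) < e / 2"
          unfolding eventually_sequentially by blast
        define k where "k = max N N'"
        have 1: "square_integrable hl (\<lambda>x. indicator {-real n..0} x * (g x - fn (X k) x))"
          "l2n hl (\<lambda>x. indicator {-real n..0} x * (g x - fn (X k) x)) \<le> 1 * l2n hl (\<lambda>x. g x - fn (X k) x)"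
        proof -
          have k: "indicator {-real n..0} \<in> borel_measurable hl"
            "AE x in hl. \<bar>indicator {-real n..0} x :: real\<bar> \<le> 1" by (auto simp: indicator_def)
          show "square_integrable hl (\<lambda>x. indicator {-real n..0} x * (g x - fn (X k) x))"
            "l2n hl (\<lambda>x. indicator {-real n..0} x * (g x - fn (X k) x)) \<le> 1 * l2n hl (\<lambda>x. g x - fn (X k) x)"
            using l2n_mult_bounded[OF square_integrable_diff[OF g(1) sq_fn] k] by auto
        qed
        have 2: "square_integrable hl (\<lambda>x. (fn (X k) x - U x) * indicator {-real n..0} x)"
          "l2n hl (\<lambda>x. (fn (X k) x - U x) * indicator {-real n..0} x) \<le> e' * l2n hl (indicator {-real n..0})"
        proof -
          have k: "(\<lambda>x. fn (X k) x - U x) \<in> borel_measurable hl" "AE x in hl. \<bar>fn (X k) x - U x\<bar> \<le> e'" "0 \<le> e'"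
            using N e' by (auto simp: k_def)
          show "square_integrable hl (\<lambda>x. (fn (X k) x - U x) * indicator {-real n..0} x)"
            "l2n hl (\<lambda>x. (fn (X k) x - U x) * indicator {-real n..0} x) \<le> e' * l2n hl (indicator {-real n..0})"
            using l2n_mult_bounded[OF i k] by auto
        qed
        have eq: "?d = (\<lambda>x. indicator {-real n..0} x * (g x - fn (X k) x) + (fn (X k) x - U x) * indicator {-real n..0} x)"
          by (auto simp: fun_eq_iff algebra_simps)
        have "l2n hl ?d \<le> 1 * l2n hl (\<lambda>x. g x - fn (X k) x) + e' * l2n hl (indicator {-real n..0})"
          unfolding eq using l2n_triangle[OF 1(1) 2(1)] 1(2) 2(2) by linarith
        also have "l2n hl (\<lambda>x. g x - fn (X k) x) = l2n hl (\<lambda>x. fn (X k) x - g x)"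
          by (simp add: l2n_def power2_commute)
        also have "1 * \<dots> + e' * l2n hl (indicator {-real n..0}) \<le> e"
          using N'[of k] e'(2) by (subst hl_indicator(2)) (auto simp: k_def mult.commute)
        finally show ?thesis unfolding eq using square_integrable_add[OF 1(1) 2(1)] by simp
      qed
      have "l2n hl ?d \<le> 0"
      proof (rule field_le_epsilon)
        fix e :: real assume "0 < e"
        from key[OF this] show "l2n hl ?d \<le> 0 + e" by simp
      qed
      then have "l2n hl ?d = 0" by (simp add: order_antisym)
      moreover have "square_integrable hl ?d" using key[of 1] by simp
      ultimately show ?thesis using l2n_eq_0_iff by blast
    qed
    then have "AE x in hl. \<forall>n. indicator {-real n..0} x * (g x - U x) = 0" by (subst AE_all_countable) blast
    then show ?thesis unfolding AE_hl
    proof eventually_elim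
      case (elim x)
      show ?case
      proof
        assume "x < 0"
        obtain n where "- x \<le> real n" using real_arch_simple by blast
        then show "g x = U x" using \<open>x < 0\<close> elim by (auto simp: indicator_def dest!: spec[of _ n])
      qed
    qed
  qed
  have Us: "square_integrable hl U" by (rule square_integrable_cong_AE[OF g(1) _ Ug]) simp
  obtain f where f: "fn f = U" "AE x in hl. dv f x = v x" using h1_obtain[OF p Us v(1)] by blast
  have "X \<longlonglongrightarrow> f"
  proof (rule LIM_zero_cancel, rule tendsto_norm_zero_cancel)
    have "norm (X n - f) = 2 * (l2n hl (\<lambda>x. fn (X n) x - g x) + l2n hl (\<lambda>x. dv (X n) x - v x))" for n
    proof -
      have "l2n hl (fn (X n - f)) = l2n hl (\<lambda>x. fn (X n) x - g x)"
        by (rule l2n_cong_AE) (use Ug f(1) in auto)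
      moreover have "l2n hl (dv (X n - f)) = l2n hl (\<lambda>x. dv (X n) x - v x)"
      proof (rule l2n_cong_AE)
        show "AE x in hl. dv (X n - f) x = dv (X n) x - v x"
          using dv_diff[of "X n" f] f(2) by eventually_elim simp
      qed auto
      ultimately show ?thesis by (simp add: norm_h1_def)
    qed
    moreover have "(\<lambda>n. 2 * (l2n hl (\<lambda>x. fn (X n) x - g x) + l2n hl (\<lambda>x. dv (X n) x - v x))) \<longlonglongrightarrow> 2 * (0 + 0)"
      by (intro tendsto_intros g v)
    ultimately show "(\<lambda>n. norm (X n - f)) \<longlonglongrightarrow> 0" by simp
  qed
  then show "convergent X" by (auto simp: convergent_def)
qed

section \<open>Resolvents of the derivative on the half-line\<close>

text \<open>The boundary point 0 is covered although the measure lives on the negative reals: a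
  disagreement at \<open>x\<close> persists on an interval to the left of \<open>x\<close>, which
  has positive measure.\<close>

lemma AE_hl_continuous_eq:
  fixes u v :: "real \<Rightarrow> real"
  assumes c: "continuous_on UNIV u" "continuous_on UNIV v" and ae: "AE x in hl. u x = v x" and x: "x \<le> 0"
  shows "u x = v x"
proof (rule ccontr)
  assume "u x \<noteq> v x"
  moreover have "isCont (\<lambda>x. u x - v x) x"
    using c by (intro continuous_intros) (auto simp: continuous_on_eq_continuous_at)
  ultimately obtain d where d: "d > 0" "\<And>y. dist y x < d \<Longrightarrow> u y - v y \<noteq> 0"
    using continuous_at_avoid[of x "\<lambda>x. u x - v x" 0] by (auto simp: dist_commute)
  have "AE y in lborel. y \<notin> {x - d<..<x}"
    using ae unfolding AE_hl
  proof eventually_elim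
    case (elim y)
    then show ?case using d(2)[of y] x by (auto simp: dist_real_def)
  qed
  then have "{x - d<..<x} \<in> null_sets lborel" by (subst (asm) AE_iff_null_sets[symmetric]) auto
  then show False using d(1) by (auto simp: null_sets_def)
qed

lemma fn_AE_eqI: "AE x in hl. fn f x = fn g x \<Longrightarrow> f = g"
  by (rule h1_eqI, rule AE_hl_continuous_eq) (auto intro: fn_continuous)

text \<open>Fatou's lemma along the exhaustion by \<open>[-n, 0]\<close>. It converts bounds on
  compact intervals that are uniform in the length into membership in \<open>L^2\<close>.\<close>

lemma square_integrable_exhaust:
  assumes m: "u \<in> borel_measurable borel"
    and i: "\<And>n::nat. set_integrable lborel {-real n..0} (\<lambda>x. (u x)\<^sup>2)"
    and b: "\<And>n::nat. (LINT x:{-real n..0}|lborel. (u x)\<^sup>2) \<le> C\<^sup>2" and C: "C \<ge> 0"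
  shows "square_integrable hl u" "l2n hl u \<le> C"
proof -
  note [measurable] = m
  have nn: "(\<integral>\<^sup>+x. ennreal (indicator {-real n..0} x * (u x)\<^sup>2) \<partial>lborel) \<le> ennreal (C\<^sup>2)" for n :: nat
  proof -
    have "(\<integral>\<^sup>+x. ennreal (indicator {-real n..0} x * (u x)\<^sup>2) \<partial>lborel) = ennreal (LINT x:{-real n..0}|lborel. (u x)\<^sup>2)"
      using i[of n] by (subst nn_integral_eq_integral) (auto simp: set_integrable_def set_lebesgue_integral_def)
    then show ?thesis using b[of n] by (simp add: ennreal_leI)
  qed
  have "(\<integral>\<^sup>+x. ennreal ((u x)\<^sup>2) \<partial>hl) = (\<integral>\<^sup>+x. ennreal (indicator {..<0} x) * ennreal ((u x)\<^sup>2) \<partial>lborel)"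
    unfolding hl_def by (rule nn_integral_density) auto
  also have "\<dots> \<le> (\<integral>\<^sup>+x. liminf (\<lambda>n. ennreal (indicator {-real n..0} x * (u x)\<^sup>2)) \<partial>lborel)"
  proof (rule nn_integral_mono)
    fix x
    have "liminf (\<lambda>n. ennreal (indicator {-real n..0} x * (u x)\<^sup>2)) = ennreal ((u x)\<^sup>2)" if "x < 0"
    proof (rule lim_imp_Liminf[OF sequentially_bot], rule tendsto_eventually)
      obtain N where "- x \<le> real N" using real_arch_simple by blast
      then show "\<forall>\<^sub>F n in sequentially. ennreal (indicator {-real n..0} x * (u x)\<^sup>2) = ennreal ((u x)\<^sup>2)"
        using that by (intro eventually_sequentiallyI[of N]) (auto simp: indicator_def)
    qed
    then show "ennreal (indicator {..<0} x) * ennreal ((u x)\<^sup>2) \<le> liminf (\<lambda>n. ennreal (indicator {-real n..0} x * (u x)\<^sup>2))"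
      by (cases "x < 0") auto
  qed
  also have "\<dots> \<le> liminf (\<lambda>n. \<integral>\<^sup>+x. ennreal (indicator {-real n..0} x * (u x)\<^sup>2) \<partial>lborel)"
    by (rule nn_integral_liminf) auto
  also have "\<dots> \<le> liminf (\<lambda>n::nat. ennreal (C\<^sup>2))"
    by (rule Liminf_mono) (use nn in auto)
  also have "\<dots> = ennreal (C\<^sup>2)" by (simp add: Liminf_const)
  finally have fin: "(\<integral>\<^sup>+x. ennreal ((u x)\<^sup>2) \<partial>hl) \<le> ennreal (C\<^sup>2)" .
  then have "integrable hl (\<lambda>x. (u x)\<^sup>2)"
    by (auto simp: integrable_iff_bounded intro: order_le_less_trans)
  then show "square_integrable hl u" by (simp add: square_integrable_def)
  have "ennreal ((l2n hl u)\<^sup>2) \<le> ennreal (C\<^sup>2)"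
    using fin nn_integral_eq_integral[OF \<open>integrable hl (\<lambda>x. (u x)\<^sup>2)\<close>] by (simp add: l2n_sq)
  then have "(l2n hl u)\<^sup>2 \<le> C\<^sup>2" by (rule ennreal_le_iff[THEN iffD1, rotated]) simp
  then show "l2n hl u \<le> C" by (rule power2_le_imp_le) (rule C)
qed

lemma prim_exp: "prim (\<lambda>x. exp (c * min x 0)) (\<lambda>x. c * exp (c * min x 0))"
proof (rule prim_C1)
  fix a x :: real assume x: "a \<le> x" "x \<le> 0"
  have "((\<lambda>x. exp (c * x)) has_real_derivative c * exp (c * min x 0)) (at x within {a..0})"
    using x by (auto intro!: derivative_eq_intros)
  then show "((\<lambda>x. exp (c * min x 0)) has_real_derivative c * exp (c * min x 0)) (at x within {a..0})"
    by (rule has_field_derivative_transform_within[of _ _ _ _ 1]) (use x in auto)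
qed (auto intro!: continuous_intros)

lemma prim_indefinite_integral:
  assumes c: "continuous_on UNIV w"
  shows "prim (\<lambda>x. integral {min x 0..0} w) (\<lambda>x. - w x)"
  unfolding prim_def
proof (intro conjI allI impI)
  show "(\<lambda>x. - w x) \<in> borel_measurable borel"
    using borel_measurable_continuous_onI[OF c] by simp
  fix a b :: real assume ab: "a \<le> b \<and> b \<le> 0"
  have i: "set_integrable lborel {s..t} w" for s t
    by (rule borel_integrable_atLeastAtMost') (use c continuous_on_subset in blast)
  then show "set_integrable lborel {a..b} (\<lambda>x. - w x)" by (auto simp: set_integrable_def)
  have "w integrable_on {a..0}" by (intro integrable_continuous_interval continuous_on_subset[OF c]) auto
  then have "integral {a..b} w + integral {b..0} w = integral {a..0} w"
    using ab by (intro Henstock_Kurzweil_Integration.integral_combine) auto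
  moreover have "(LINT x:{a..b}|lborel. w x) = integral {a..b} w"
    by (rule set_borel_integral_eq_integral[OF i])
  ultimately show "integral {min b 0..0} w - integral {min a 0..0} w = (LINT x:{a..b}|lborel. - w x)"
    using ab i[of a b] by (simp add: set_integral_uminus min_absorb1)
qed auto

lemma prim_improper_integral:
  assumes i: "integrable hl w"
  shows "prim (\<lambda>x. LINT y|hl. indicator {..x} y * w y) w"
  unfolding prim_def
proof (intro conjI allI impI)
  show m: "w \<in> borel_measurable borel" using borel_measurable_integrable[OF i] by simp
  have ind: "integrable hl (\<lambda>y. indicator S y * w y)" if "S \<in> sets borel" for S
    using integrable_mult_indicator[OF _ i, of S] that by simp
  show "(LINT y|hl. indicator {..x} y * w y) = (LINT y|hl. indicator {..0} y * w y)" if "0 < x" for x :: real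
    by (rule integral_cong_AE) (use m that in \<open>auto intro!: AE_hlI simp: indicator_def\<close>)
  fix a b :: real assume ab: "a \<le> b \<and> b \<le> 0"
  show "set_integrable lborel {a..b} w" by (rule hl_set_integrable[OF i]) (use ab in auto)
  have "(LINT y|hl. indicator {..b} y * w y) - (LINT y|hl. indicator {..a} y * w y)
      = (LINT y|hl. indicator {..b} y * w y - indicator {..a} y * w y)"
    using ind by simp
  also have "\<dots> = (LINT y|hl. indicator {a..b} y * w y)"
  proof (rule integral_cong_AE)
    show "AE y in hl. indicator {..b} y * w y - indicator {..a} y * w y = indicator {a..b} y * w y"
      unfolding AE_hl using AE_lborel_singleton[of a]
      by eventually_elim (use ab in \<open>auto simp: indicator_def\<close>)
  qed (use m in auto)
  also have "\<dots> = (LINT x:{a..b}|lborel. w x)"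
    using ab by (intro hl_interval_integral(1)[OF i, symmetric]) auto
  finally show "(LINT y|hl. indicator {..b} y * w y) - (LINT y|hl. indicator {..a} y * w y) = (LINT x:{a..b}|lborel. w x)" .
qed

lemma tail_tendsto_0:
  fixes w :: "real \<Rightarrow> real"
  assumes i: "integrable hl w"
  shows "(\<lambda>n. LINT y|hl. indicator {..- real n} y * w y) \<longlonglongrightarrow> 0"
proof -
  have m: "w \<in> borel_measurable hl" by (rule borel_measurable_integrable[OF i])
  have "(\<lambda>n. LINT y|hl. indicator {..- real n} y * w y) \<longlonglongrightarrow> (LINT y|hl. 0)"
  proof (rule integral_dominated_convergence[where w = "\<lambda>y. \<bar>w y\<bar>"])
    have "(\<lambda>n. indicator {..- real n} y * w y) \<longlonglongrightarrow> 0" for y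
    proof (rule tendsto_eventually)
      obtain N where "- y < real N" using reals_Archimedean2 by blast
      then show "\<forall>\<^sub>F n in sequentially. indicator {..- real n} y * w y = 0"
        by (intro eventually_sequentiallyI[of N]) (auto simp: indicator_def)
    qed
    then show "AE y in hl. (\<lambda>n. indicator {..- real n} y * w y) \<longlonglongrightarrow> 0" by simp
  qed (use i m in \<open>auto simp: indicator_def\<close>)
  then show ?thesis by simp
qed

text \<open>Energy estimate for \<open>\<plusminus> \<nu> u' + u = f\<close>.\<close>

lemma resolvent_energy:
  assumes p: "prim u (\<lambda>x. \<sigma> * (f x - u x) / \<nu>)" and \<sigma>: "\<bar>\<sigma>\<bar> = 1" and \<nu>: "\<nu> > 0"
    and f: "square_integrable hl f" and M: "\<And>x. \<bar>u x\<bar> \<le> M"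
  shows "square_integrable hl u" "l2n hl u \<le> l2n hl f + sqrt \<nu> * M"
proof -
  have M0: "M \<ge> 0" using M[of 0] by simp
  define C where "C = l2n hl f + sqrt \<nu> * M"
  have C: "C \<ge> 0" "(l2n hl f)\<^sup>2 + \<nu> * M\<^sup>2 \<le> C\<^sup>2"
    using M0 \<nu> by (auto simp: C_def power2_sum power_mult_distrib)
  have m: "u \<in> borel_measurable borel" by (rule prim_measurable[OF p])
  have c: "continuous_on UNIV u" by (rule prim_continuous[OF p])
  have i: "set_integrable lborel {-real n..0} (\<lambda>x. (u x)\<^sup>2)" for n
    by (rule borel_integrable_atLeastAtMost') (intro continuous_intros continuous_on_subset[OF c], auto)
  have f2: "integrable hl (\<lambda>x. (f x)\<^sup>2)" using f by (simp add: square_integrable_def)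
  have b: "(LINT x:{-real n..0}|lborel. (u x)\<^sup>2) \<le> C\<^sup>2" for n
  proof -
    let ?I = "{-real n..0::real}"
    have n0: "- real n \<le> 0" by simp
    define a where "a = (LINT x:?I|lborel. (u x)\<^sup>2)"
    have fi: "set_integrable lborel ?I (\<lambda>x. (f x)\<^sup>2)" by (rule hl_set_integrable[OF f2]) auto
    have F: "(LINT x:?I|lborel. (f x)\<^sup>2) \<le> (l2n hl f)\<^sup>2"
    proof -
      have "(LINT x:?I|lborel. (f x)\<^sup>2) = (LINT x|hl. indicator ?I x * (f x)\<^sup>2)"
        by (rule hl_interval_integral(1)[OF f2 n0]) simp
      also have "\<dots> \<le> (LINT x|hl. (f x)\<^sup>2)"
        by (rule integral_mono[OF hl_interval_integral(2)[OF f2 n0] f2]) (auto simp: indicator_def)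
      finally show ?thesis by (simp add: l2n_sq)
    qed
    note pd = primD(3,4)[OF prim_mult[OF p p] n0 order_refl]
    have pi: "set_integrable lborel ?I (\<lambda>x. - \<sigma> * \<nu> * (\<sigma> * (f x - u x) / \<nu> * u x + u x * (\<sigma> * (f x - u x) / \<nu>)))"
      by (rule set_integrable_mult_right) (use pd(1) in simp)
    have s2: "\<sigma> * \<sigma> = 1" using \<sigma> by (cases "\<sigma> \<ge> 0") auto
    \<comment> \<open>The energy identity: \<open>2 u^2 - 2 f u\<close> is a multiple of the
      derivative of \<open>u^2\<close>, so its integral is a boundary term, at most
      \<open>\<nu> M^2\<close> for either sign of \<sigma>. On the other hand it dominates
      \<open>u^2 - f^2\<close>.\<close>
    have eq: "- \<sigma> * \<nu> * (\<sigma> * (f x - u x) / \<nu> * u x + u x * (\<sigma> * (f x - u x) / \<nu>)) = 2 * (u x)\<^sup>2 - 2 * (f x * u x)" for x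
    proof -
      have "- \<sigma> * \<nu> * (\<sigma> * (f x - u x) / \<nu> * u x + u x * (\<sigma> * (f x - u x) / \<nu>))
          = (\<sigma> * \<sigma>) * (2 * (u x - f x) * u x)" using \<nu> by (simp add: field_simps)
      then show ?thesis using s2 by (simp add: power2_eq_square algebra_simps)
    qed
    have "(LINT x:?I|lborel. (u x)\<^sup>2 - (f x)\<^sup>2) \<le> (LINT x:?I|lborel. 2 * (u x)\<^sup>2 - 2 * (f x * u x))"
    proof (rule set_integral_mono)
      show "set_integrable lborel ?I (\<lambda>x. (u x)\<^sup>2 - (f x)\<^sup>2)" using i fi by auto
      show "set_integrable lborel ?I (\<lambda>x. 2 * (u x)\<^sup>2 - 2 * (f x * u x))" using pi unfolding eq .
      show "(u x)\<^sup>2 - (f x)\<^sup>2 \<le> 2 * (u x)\<^sup>2 - 2 * (f x * u x)" for x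
        using zero_le_power2[of "u x - f x"] by (simp add: power2_diff mult.commute)
    qed
    also have "\<dots> = - \<sigma> * \<nu> * (u 0 * u 0 - u (- real n) * u (- real n))"
      unfolding eq[symmetric] using pd(2) by (simp only: set_integral_mult_right)
    also have "\<dots> \<le> \<nu> * M\<^sup>2"
    proof -
      have sq: "0 \<le> u x * u x" "u x * u x \<le> M\<^sup>2" for x
        using M[of x] abs_le_square_iff[of "u x" M] M0 by (auto simp: power2_eq_square)
      have "- \<sigma> * (u 0 * u 0 - u (- real n) * u (- real n)) \<le> M\<^sup>2"
      proof -
        have "- \<sigma> * (a - b) \<le> N" if "0 \<le> a" "a \<le> N" "0 \<le> b" "b \<le> N" for a b N :: real
          using \<sigma> that by (cases "\<sigma> \<ge> 0") auto
        then show ?thesis using sq by blast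
      qed
      from mult_left_mono[OF this, of \<nu>] \<nu> show ?thesis by (simp add: algebra_simps)
    qed
    finally have "a - (LINT x:?I|lborel. (f x)\<^sup>2) \<le> \<nu> * M\<^sup>2"
      unfolding a_def using i fi by (simp add: set_integral_diff)
    then show ?thesis using F C(2) by (simp add: a_def)
  qed
  from square_integrable_exhaust[OF m i b C(1)]
  show "square_integrable hl u" "l2n hl u \<le> l2n hl f + sqrt \<nu> * M" by (auto simp: C_def)
qed

text \<open>With the integrating factor \<open>exp (- c * x)\<close> the product has zero
  derivative.\<close>

lemma prim_exp_unique:
  assumes p: "prim u (\<lambda>x. c * u x)" and x: "x \<le> 0"
  shows "u x = u 0 * exp (c * x)"
proof -
  have "prim (\<lambda>x. u x * exp (- c * min x 0)) (\<lambda>x. (c * u x) * exp (- c * min x 0) + u x * (- c * exp (- c * min x 0)))"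
    by (rule prim_mult[OF p prim_exp])
  from primD(4)[OF this x order_refl] x have "u 0 - u x * exp (- c * x) = 0"
    by (simp add: set_lebesgue_integral_def min_absorb1)
  then have "u 0 * exp (c * x) = u x * (exp (- c * x) * exp (c * x))" by simp
  then show ?thesis by (simp flip: exp_add)
qed

lemma set_integrable_minus: "set_integrable M A f \<Longrightarrow> set_integrable M A (\<lambda>x. - f x :: real)"
  by (simp add: set_integrable_def)

section \<open>Exact derivatives and the first-order resolvents\<close>

definition dr :: "h1 \<Rightarrow> h1 \<Rightarrow> bool" where "dr f g \<longleftrightarrow> prim (fn f) (fn g)"

lemma dr_add: "dr f g \<Longrightarrow> dr f' g' \<Longrightarrow> dr (f + f') (g + g')"
  by (simp add: dr_def prim_add)

lemma dr_diff: "dr f g \<Longrightarrow> dr f' g' \<Longrightarrow> dr (f - f') (g - g')"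
  by (simp add: dr_def prim_diff)

lemma dr_scaleR: "dr f g \<Longrightarrow> dr (c *\<^sub>R f) (c *\<^sub>R g)"
  by (simp add: dr_def prim_scale)

lemma dr_mult: "dr f g \<Longrightarrow> dr f' g' \<Longrightarrow> dr (f * f') (g * f' + f * g')"
  by (simp add: dr_def prim_mult)

lemma dr_dv: "dr f g \<Longrightarrow> AE x in hl. dv f x = fn g x"
  unfolding dr_def by (rule dv_AE)

lemma dr_unique:
  assumes "dr f g" "dr f g'" shows "g = g'"
proof (rule fn_AE_eqI)
  show "AE x in hl. fn g x = fn g' x" using dr_dv[OF assms(1)] dr_dv[OF assms(2)] by eventually_elim simp
qed

text \<open>Solutions are multiples of \<open>exp (- x/\<nu>)\<close>, which is unbounded at minus
  infinity. Uniqueness and commutation statements below are often reduced to this by showing that a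
  defect satisfies such an equation.\<close>

lemma dr_decay_zero:
  assumes d: "dr w (- (1 / \<nu>) *\<^sub>R w)" and \<nu>: "\<nu> > 0" shows "w = 0"
proof -
  have eq: "fn w x = fn w 0 * exp (- (1 / \<nu>) * x)" if "x \<le> 0" for x
    by (rule prim_exp_unique[OF _ that]) (use d in \<open>simp add: dr_def\<close>)
  have "fn w 0 = 0"
  proof (rule ccontr)
    assume nz: "fn w 0 \<noteq> 0"
    have "\<bar>fn w 0\<bar> * (real n / \<nu>) \<le> norm w" for n :: nat
    proof -
      have "real n / \<nu> \<le> exp (real n / \<nu>)" using exp_ge_add_one_self[of "real n / \<nu>"] by linarith
      then have "\<bar>fn w 0\<bar> * (real n / \<nu>) \<le> \<bar>fn w 0\<bar> * exp (real n / \<nu>)" by (intro mult_left_mono) auto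
      also have "\<dots> = \<bar>fn w (- real n)\<bar>" using eq[of "- real n"] by (simp add: abs_mult)
      also have "\<dots> \<le> norm w" by (rule fn_norm)
      finally show ?thesis .
    qed
    then have "real n \<le> norm w * \<nu> / \<bar>fn w 0\<bar>" for n using nz \<nu> by (simp add: field_simps)
    then show False using reals_Archimedean2 by (metis not_le)
  qed
  then have z: "fn w x = 0" if "x \<le> 0" for x using eq[OF that] by simp
  show ?thesis by (rule h1_eqI) (simp add: z)
qed

text \<open>The boundary layer: the solution of \<open>(1 - \<mu>^2 \<partial>^2) u = 0\<close> that
  decays at minus infinity, normalised to 1 at the boundary.\<close>

definition expo :: "real \<Rightarrow> h1" where "expo \<mu> = Abs_h1 (\<lambda>x. exp ((1 / \<mu>) * min x 0))"

lemma fn_expo: assumes "\<mu> > 0" shows "fn (expo \<mu>) = (\<lambda>x. exp ((1 / \<mu>) * min x 0))"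
proof -
  let ?u = "\<lambda>x. exp ((1 / \<mu>) * min x 0)"
  have p: "prim ?u (\<lambda>x. (1 / \<mu>) * ?u x)" by (rule prim_exp)
  have s: "square_integrable hl ?u"
    by (rule resolvent_energy[of _ "-1" "\<lambda>x. 0" \<mu> 1])
       (use p assms in \<open>auto simp: divide_nonpos_nonneg mult_nonneg_nonpos divide_le_0_iff\<close>)
  show ?thesis unfolding expo_def
    by (rule fn_Abs_h1[OF p s square_integrable_scale(1)[OF s]])
qed

lemma dr_expo: "\<mu> > 0 \<Longrightarrow> dr (expo \<mu>) ((1 / \<mu>) *\<^sub>R expo \<mu>)"
  unfolding dr_def fn_scaleR fn_expo by (rule prim_exp)

lemma fn_expo_0 [simp]: "\<mu> > 0 \<Longrightarrow> fn (expo \<mu>) 0 = 1"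
  by (simp add: fn_expo)

lemma dr_expo_unique:
  assumes d: "dr w ((1 / \<mu>) *\<^sub>R w)" and \<mu>: "\<mu> > 0" shows "w = fn w 0 *\<^sub>R expo \<mu>"
proof (rule h1_eqI)
  fix x :: real assume x: "x \<le> 0"
  have "fn w x = fn w 0 * exp ((1 / \<mu>) * x)"
    by (rule prim_exp_unique[OF _ x]) (use d in \<open>simp add: dr_def\<close>)
  then show "fn w x = fn (fn w 0 *\<^sub>R expo \<mu>) x" using x \<mu> by (simp add: fn_expo min_absorb1)
qed

text \<open>Common to both resolvents, with \<sigma> equal to 1 or -1. The energy estimate with
  \<open>M = norm f / 2\<close> bounds the \<open>L^2\<close> norm of \<open>u\<close>, and the
  equation then bounds that of \<open>u'\<close>; the constant is a crude combination of the
  two.\<close>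

lemma resolvent_h1:
  assumes p: "prim u (\<lambda>x. \<sigma> * (fn f x - u x) / \<nu>)" and \<sigma>: "\<bar>\<sigma>\<bar> = 1" and \<nu>: "\<nu> > 0"
    and M: "\<And>x. \<bar>u x\<bar> \<le> norm f / 2"
  obtains U where "fn U = u" "dr U ((\<sigma> / \<nu>) *\<^sub>R (f - U))"
    "norm U \<le> (4 * (1 + sqrt \<nu>) * (1 + 1 / \<nu>)) * norm f"
proof -
  note en = resolvent_energy[OF p \<sigma> \<nu> sq_fn M]
  note su = en(1)
  have sv: "square_integrable hl (\<lambda>x. \<sigma> * (fn f x - u x) / \<nu>)"
    using square_integrable_scale(1)[OF square_integrable_diff[OF sq_fn su], of "\<sigma> / \<nu>" f] by simp
  obtain U where U: "fn U = u" "AE x in hl. dv U x = \<sigma> * (fn f x - u x) / \<nu>"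
    using h1_obtain[OF p su sv] by blast
  have a: "l2n hl u \<le> (1 + sqrt \<nu>) * (norm f / 2)"
  proof -
    have "l2n hl u \<le> l2n hl (fn f) + sqrt \<nu> * (norm f / 2)" by (rule en)
    also have "l2n hl (fn f) \<le> norm f / 2" by (simp add: norm_h1_def)
    finally show ?thesis by (simp add: algebra_simps)
  qed
  have "l2n hl (dv U) = l2n hl (\<lambda>x. \<sigma> / \<nu> * (fn f x + -1 * u x))"
    by (rule l2n_cong_AE) (use U(2) prim_measurable[OF p] in auto)
  also have "\<dots> = 1 / \<nu> * l2n hl (\<lambda>x. fn f x + -1 * u x)"
    using \<nu> \<sigma> by (subst square_integrable_scale(2)) (auto intro!: square_integrable_diff sq_fn su)
  also have "l2n hl (\<lambda>x. fn f x + -1 * u x) \<le> l2n hl (fn f) + l2n hl (\<lambda>x. -1 * u x)"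
    by (intro l2n_triangle sq_fn square_integrable_scale su)
  also have "l2n hl (\<lambda>x. -1 * u x) = l2n hl u" by (subst square_integrable_scale(2)[OF su]) simp
  also have "l2n hl (fn f) + l2n hl u \<le> (1 + sqrt \<nu>) * norm f"
  proof -
    have "l2n hl (fn f) \<le> norm f / 2" by (simp add: norm_h1_def)
    moreover have "0 \<le> sqrt \<nu> * norm f" using \<nu> by (simp add: norm_h1_def)
    ultimately show ?thesis using a by (simp add: algebra_simps)
  qed
  finally have "l2n hl (dv U) \<le> 1 / \<nu> * ((1 + sqrt \<nu>) * norm f)" using \<nu> by (simp add: divide_right_mono)
  then have "norm U \<le> 2 * ((1 + sqrt \<nu>) * (norm f / 2) + 1 / \<nu> * ((1 + sqrt \<nu>) * norm f))"
    using a by (simp add: norm_h1_def[of U] U(1))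
  also have "\<dots> = ((1 + sqrt \<nu>) * norm f) * (1 + 2 / \<nu>)" by (simp add: algebra_simps)
  also have "\<dots> \<le> ((1 + sqrt \<nu>) * norm f) * (4 * (1 + 1 / \<nu>))"
    using \<nu> by (intro mult_left_mono) (auto simp: field_simps)
  finally have "norm U \<le> (4 * (1 + sqrt \<nu>) * (1 + 1 / \<nu>)) * norm f" by (simp add: algebra_simps)
  moreover have "dr U ((\<sigma> / \<nu>) *\<^sub>R (f - U))" using p by (simp add: dr_def U)
  ultimately show ?thesis using that U by blast
qed

text \<open>The solution is \<open>(1/\<nu>)\<close> times the integral of
  \<open>e^{(y-x)/\<nu>} f(y)\<close> over \<open>y < x\<close>. Starting at minus infinity selects
  the only solution in \<open>H^1\<close>, and since the kernel has total mass 1 the supremum of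
  \<open>f\<close> bounds that of \<open>u\<close>.\<close>

lemma forward_resolvent_ex:
  assumes \<nu>: "\<nu> > 0"
  shows "\<exists>u. dr u ((1 / \<nu>) *\<^sub>R (f - u)) \<and> (\<forall>M. (\<forall>x\<le>0. \<bar>fn f x\<bar> \<le> M) \<longrightarrow> (\<forall>x. \<bar>fn u x\<bar> \<le> M)) \<and>
    norm u \<le> (4 * (1 + sqrt \<nu>) * (1 + 1 / \<nu>)) * norm f"
proof -
  define w where "w y = exp ((1 / \<nu>) * min y 0) * fn f y" for y
  have "integrable hl w"
    using square_integrable_mult[OF sq_fn sq_fn, of "expo \<nu>" f] \<nu> by (simp add: w_def[abs_def] fn_expo)
  note iw = this
  define J where "J x = (LINT y|hl. indicator {..x} y * w y)" for x
  have pJ: "prim J w" unfolding J_def[abs_def] by (rule prim_improper_integral[OF iw])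
  define u where "u x = exp (- (1 / \<nu>) * min x 0) * (1 / \<nu> * J x)" for x
  have ew: "exp (- (1 / \<nu>) * min x 0) * w x = fn f x" for x
    by (simp add: w_def flip: mult.assoc exp_add)
  have p0: "prim u (\<lambda>x. (- (1 / \<nu>) * exp (- (1 / \<nu>) * min x 0)) * (1 / \<nu> * J x)
      + exp (- (1 / \<nu>) * min x 0) * (1 / \<nu> * w x))"
    unfolding u_def[abs_def] by (intro prim_mult prim_exp prim_scale pJ)
  have "(- (1 / \<nu>) * exp (- (1 / \<nu>) * min x 0)) * (1 / \<nu> * J x) + exp (- (1 / \<nu>) * min x 0) * (1 / \<nu> * w x)
      = 1 * (fn f x - u x) / \<nu>" for x
    using ew[of x] by (simp add: u_def algebra_simps diff_divide_distrib)
  with p0 have p: "prim u (\<lambda>x. 1 * (fn f x - u x) / \<nu>)" by simp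
  have sup: "\<bar>u x\<bar> \<le> M" if M: "\<forall>x\<le>0. \<bar>fn f x\<bar> \<le> M" and x: "x \<le> 0" for x M
  proof -
    have M0: "M \<ge> 0" using M[rule_format, of 0] by auto
    \<comment> \<open>On \<open>[-n, x]\<close> the integrand is compared with the derivative of
      \<open>M \<nu> e^{y/\<nu>}\<close>. The remainder \<open>J (-n)\<close> disappears in the
      limit.\<close>
    have Ja: "\<bar>J x\<bar> \<le> M * \<nu> * exp ((1 / \<nu>) * x) + \<bar>J (- real n)\<bar>" if n: "- real n \<le> x" for n
    proof -
      have e1: "J x - J (- real n) = (LINT y:{-real n..x}|lborel. w y)"
        and i1: "set_integrable lborel {-real n..x} w" using primD(3,4)[OF pJ n x] by auto
      note pe = prim_scale[OF prim_exp[of "1 / \<nu>"], of "M * \<nu>"]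
      have e2: "M * \<nu> * exp ((1 / \<nu>) * x) - M * \<nu> * exp ((1 / \<nu>) * - real n)
          = (LINT y:{-real n..x}|lborel. M * \<nu> * ((1 / \<nu>) * exp ((1 / \<nu>) * min y 0)))"
        and i2: "set_integrable lborel {-real n..x} (\<lambda>y. M * \<nu> * ((1 / \<nu>) * exp ((1 / \<nu>) * min y 0)))"
        using primD(3,4)[OF pe n x] x by (auto simp: min_absorb1)
      have wb: "\<bar>w y\<bar> \<le> M * \<nu> * ((1 / \<nu>) * exp ((1 / \<nu>) * min y 0))" if "y \<in> {-real n..x}" for y
      proof -
        have "\<bar>w y\<bar> \<le> exp ((1 / \<nu>) * min y 0) * M"
          unfolding w_def abs_mult using M that x by (intro mult_mono) auto
        then show ?thesis using \<nu> by (simp add: field_simps)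
      qed
      have "(LINT y:{-real n..x}|lborel. w y) \<le> (LINT y:{-real n..x}|lborel. M * \<nu> * ((1 / \<nu>) * exp ((1 / \<nu>) * min y 0)))"
        by (rule set_integral_mono[OF i1 i2 abs_le_D1[OF wb]])
      moreover have "(LINT y:{-real n..x}|lborel. - w y) \<le> (LINT y:{-real n..x}|lborel. M * \<nu> * ((1 / \<nu>) * exp ((1 / \<nu>) * min y 0)))"
        by (rule set_integral_mono[OF set_integrable_minus[OF i1] i2 abs_le_D2[OF wb]])
      moreover have "0 \<le> M * \<nu> * exp ((1 / \<nu>) * - real n)" using M0 \<nu> by simp
      ultimately show ?thesis using e1 e2 set_integral_uminus[OF i1] by linarith
    qed
    have "\<bar>J x\<bar> \<le> M * \<nu> * exp ((1 / \<nu>) * x)"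
    proof (rule LIMSEQ_le_const)
      have "(\<lambda>n. M * \<nu> * exp ((1 / \<nu>) * x) + \<bar>J (- real n)\<bar>) \<longlonglongrightarrow> M * \<nu> * exp ((1 / \<nu>) * x) + \<bar>0\<bar>"
        unfolding J_def by (intro tendsto_intros tail_tendsto_0[OF iw])
      then show "(\<lambda>n. M * \<nu> * exp ((1 / \<nu>) * x) + \<bar>J (- real n)\<bar>) \<longlonglongrightarrow> M * \<nu> * exp ((1 / \<nu>) * x)" by simp
      obtain N where "- x \<le> real N" using real_arch_simple by blast
      then show "\<exists>N. \<forall>n\<ge>N. \<bar>J x\<bar> \<le> M * \<nu> * exp ((1 / \<nu>) * x) + \<bar>J (- real n)\<bar>"
        by (intro exI[of _ N] allI impI Ja) linarith
    qed
    moreover have "\<bar>u x\<bar> = exp (- (1 / \<nu>) * x) * (1 / \<nu> * \<bar>J x\<bar>)"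
      using x \<nu> by (simp add: u_def abs_mult min_absorb1)
    ultimately have "\<bar>u x\<bar> \<le> exp (- (1 / \<nu>) * x) * (1 / \<nu> * (M * \<nu> * exp ((1 / \<nu>) * x)))"
      using \<nu> by (simp only: ) (intro mult_left_mono; simp)
    also have "\<dots> = M * (exp (- (1 / \<nu>) * x) * exp ((1 / \<nu>) * x))" using \<nu> by simp
    also have "\<dots> = M" by (simp flip: exp_add)
    finally show ?thesis .
  qed
  have sup': "\<bar>u x\<bar> \<le> M" if M: "\<forall>x\<le>0. \<bar>fn f x\<bar> \<le> M" for x M
    using sup[OF M, of x] sup[OF M, of 0] primD(2)[OF p, of x] by (cases "x \<le> 0") auto
  have us: "\<bar>u x\<bar> \<le> norm f / 2" for x by (rule sup') (use fn_norm_half in auto)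
  obtain U where "fn U = u" "dr U (((1) / \<nu>) *\<^sub>R (f - U))" "norm U \<le> (4 * (1 + sqrt \<nu>) * (1 + 1 / \<nu>)) * norm f"
    using resolvent_h1[OF p _ \<nu> us] by auto
  then show ?thesis using sup' by auto
qed

text \<open>Here every value at 0 is compatible with decay. The choice \<open>u(0) = f(0)\<close>
  makes \<open>u' = (u - f)/\<nu>\<close> vanish at the boundary, which is the source of the Neumann
  condition for \<open>Rop\<close>, and it respects the supremum bound as well.\<close>

lemma backward_resolvent_ex:
  assumes \<nu>: "\<nu> > 0"
  shows "\<exists>u. dr u ((1 / \<nu>) *\<^sub>R (u - f)) \<and> fn u 0 = fn f 0 \<and>
    (\<forall>M. (\<forall>x\<le>0. \<bar>fn f x\<bar> \<le> M) \<longrightarrow> (\<forall>x. \<bar>fn u x\<bar> \<le> M)) \<and>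
    norm u \<le> (4 * (1 + sqrt \<nu>) * (1 + 1 / \<nu>)) * norm f"
proof -
  define w where "w y = exp (- (1 / \<nu>) * min y 0) * fn f y" for y
  have cw: "continuous_on UNIV w" unfolding w_def[abs_def] by (intro continuous_intros fn_continuous)
  define K where "K x = fn f 0 + 1 / \<nu> * integral {min x 0..0} w" for x
  have pK: "prim K (\<lambda>x. 0 + 1 / \<nu> * - w x)"
    unfolding K_def[abs_def] by (intro prim_add prim_const prim_scale prim_indefinite_integral cw)
  define u where "u x = exp ((1 / \<nu>) * min x 0) * K x" for x
  have ew: "exp ((1 / \<nu>) * min x 0) * w x = fn f x" for x
    by (simp add: w_def flip: mult.assoc exp_add)
  have p0: "prim u (\<lambda>x. ((1 / \<nu>) * exp ((1 / \<nu>) * min x 0)) * K x + exp ((1 / \<nu>) * min x 0) * (0 + 1 / \<nu> * - w x))"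
    unfolding u_def[abs_def] by (intro prim_mult prim_exp pK)
  have "((1 / \<nu>) * exp ((1 / \<nu>) * min x 0)) * K x + exp ((1 / \<nu>) * min x 0) * (0 + 1 / \<nu> * - w x)
      = -1 * (fn f x - u x) / \<nu>" for x
    using ew[of x] by (simp add: u_def algebra_simps diff_divide_distrib)
  with p0 have p: "prim u (\<lambda>x. -1 * (fn f x - u x) / \<nu>)" by simp
  have u0: "u 0 = fn f 0" by (simp add: u_def K_def)
  have sup: "\<bar>u x\<bar> \<le> M" if M: "\<forall>x\<le>0. \<bar>fn f x\<bar> \<le> M" and x: "x \<le> 0" for x M
  proof -
    have M0: "M \<ge> 0" using M[rule_format, of 0] by auto
    have e1: "K 0 - K x = (LINT y:{x..0}|lborel. 0 + 1 / \<nu> * - w y)"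
      and i1: "set_integrable lborel {x..0} (\<lambda>y. 0 + 1 / \<nu> * - w y)" using primD(3,4)[OF pK x] by auto
    note pe = prim_scale[OF prim_exp[of "- (1 / \<nu>)"], of "- M"]
    have e2: "- M - - M * exp (- (1 / \<nu>) * x)
        = (LINT y:{x..0}|lborel. - M * (- (1 / \<nu>) * exp (- (1 / \<nu>) * min y 0)))"
      and i2: "set_integrable lborel {x..0} (\<lambda>y. - M * (- (1 / \<nu>) * exp (- (1 / \<nu>) * min y 0)))"
      using primD(3,4)[OF pe x] x by (auto simp: min_absorb1)
    have wb: "\<bar>0 + 1 / \<nu> * - w y\<bar> \<le> - M * (- (1 / \<nu>) * exp (- (1 / \<nu>) * min y 0))" if "y \<in> {x..0}" for y
    proof -
      have "\<bar>w y\<bar> \<le> exp (- (1 / \<nu>) * min y 0) * M"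
        unfolding w_def abs_mult using M that x by (intro mult_mono) auto
      then show ?thesis using \<nu> by (simp add: abs_mult field_simps)
    qed
    have "(LINT y:{x..0}|lborel. 0 + 1 / \<nu> * - w y) \<le> (LINT y:{x..0}|lborel. - M * (- (1 / \<nu>) * exp (- (1 / \<nu>) * min y 0)))"
      by (rule set_integral_mono[OF i1 i2 abs_le_D1[OF wb]])
    moreover have "(LINT y:{x..0}|lborel. - (0 + 1 / \<nu> * - w y)) \<le> (LINT y:{x..0}|lborel. - M * (- (1 / \<nu>) * exp (- (1 / \<nu>) * min y 0)))"
      by (rule set_integral_mono[OF set_integrable_minus[OF i1] i2 abs_le_D2[OF wb]])
    moreover have "\<bar>K 0\<bar> \<le> M" using M by (simp add: K_def)
    ultimately have "\<bar>K x\<bar> \<le> M * exp (- (1 / \<nu>) * x)"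
      using e1 e2 set_integral_uminus[OF i1] by linarith
    then have "\<bar>u x\<bar> \<le> exp ((1 / \<nu>) * x) * (M * exp (- (1 / \<nu>) * x))"
      using x by (simp add: u_def abs_mult min_absorb1)
    also have "\<dots> = M * (exp (- (1 / \<nu>) * x) * exp ((1 / \<nu>) * x))" by simp
    also have "\<dots> = M" by (simp flip: exp_add)
    finally show ?thesis .
  qed
  have sup': "\<bar>u x\<bar> \<le> M" if M: "\<forall>x\<le>0. \<bar>fn f x\<bar> \<le> M" for x M
    using sup[OF M, of x] sup[OF M, of 0] primD(2)[OF p, of x] by (cases "x \<le> 0") auto
  have us: "\<bar>u x\<bar> \<le> norm f / 2" for x by (rule sup') (use fn_norm_half in auto)
  obtain U where "fn U = u" "dr U (((-1) / \<nu>) *\<^sub>R (f - U))" "norm U \<le> (4 * (1 + sqrt \<nu>) * (1 + 1 / \<nu>)) * norm f"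
    using resolvent_h1[OF p _ \<nu> us] by auto
  moreover have "((-1) / \<nu>) *\<^sub>R (f - U) = (1 / \<nu>) *\<^sub>R (U - f)" by (simp add: scaleR_diff_right)
  ultimately show ?thesis using sup' u0 by (intro exI[of _ U]) simp
qed

definition Fres :: "real \<Rightarrow> h1 \<Rightarrow> h1" where
  "Fres \<nu> f = (SOME u. dr u ((1 / \<nu>) *\<^sub>R (f - u)) \<and> (\<forall>M. (\<forall>x\<le>0. \<bar>fn f x\<bar> \<le> M) \<longrightarrow> (\<forall>x. \<bar>fn u x\<bar> \<le> M)) \<and>
    norm u \<le> (4 * (1 + sqrt \<nu>) * (1 + 1 / \<nu>)) * norm f)"

definition Bres :: "real \<Rightarrow> h1 \<Rightarrow> h1" where
  "Bres \<nu> f = (SOME u. dr u ((1 / \<nu>) *\<^sub>R (u - f)) \<and> fn u 0 = fn f 0 \<and>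
    (\<forall>M. (\<forall>x\<le>0. \<bar>fn f x\<bar> \<le> M) \<longrightarrow> (\<forall>x. \<bar>fn u x\<bar> \<le> M)) \<and>
    norm u \<le> (4 * (1 + sqrt \<nu>) * (1 + 1 / \<nu>)) * norm f)"

lemma Fres:
  assumes "\<nu> > 0"
  shows "dr (Fres \<nu> f) ((1 / \<nu>) *\<^sub>R (f - Fres \<nu> f))"
    "(\<And>x. x \<le> 0 \<Longrightarrow> \<bar>fn f x\<bar> \<le> M) \<Longrightarrow> \<bar>fn (Fres \<nu> f) x\<bar> \<le> M"
    "norm (Fres \<nu> f) \<le> (4 * (1 + sqrt \<nu>) * (1 + 1 / \<nu>)) * norm f"
  using someI_ex[OF forward_resolvent_ex[OF assms, of f]] unfolding Fres_def[symmetric] by blast+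

lemma Bres:
  assumes "\<nu> > 0"
  shows "dr (Bres \<nu> f) ((1 / \<nu>) *\<^sub>R (Bres \<nu> f - f))" "fn (Bres \<nu> f) 0 = fn f 0"
    "(\<And>x. x \<le> 0 \<Longrightarrow> \<bar>fn f x\<bar> \<le> M) \<Longrightarrow> \<bar>fn (Bres \<nu> f) x\<bar> \<le> M"
    "norm (Bres \<nu> f) \<le> (4 * (1 + sqrt \<nu>) * (1 + 1 / \<nu>)) * norm f"
  using someI_ex[OF backward_resolvent_ex[OF assms, of f]] unfolding Bres_def[symmetric] by blast+

lemma Fres_unique:
  assumes \<nu>: "\<nu> > 0" and d: "dr u ((1 / \<nu>) *\<^sub>R (f - u))" shows "u = Fres \<nu> f"
proof -
  have "dr (u - Fres \<nu> f) ((1 / \<nu>) *\<^sub>R (f - u) - (1 / \<nu>) *\<^sub>R (f - Fres \<nu> f))"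
    by (rule dr_diff[OF d Fres(1)[OF \<nu>]])
  then have "dr (u - Fres \<nu> f) (- (1 / \<nu>) *\<^sub>R (u - Fres \<nu> f))" by (simp add: algebra_simps)
  from dr_decay_zero[OF this \<nu>] show ?thesis by simp
qed

lemma Bres_unique:
  assumes \<nu>: "\<nu> > 0" and d: "dr u ((1 / \<nu>) *\<^sub>R (u - f))" "fn u 0 = fn f 0" shows "u = Bres \<nu> f"
proof -
  have "dr (u - Bres \<nu> f) ((1 / \<nu>) *\<^sub>R (u - f) - (1 / \<nu>) *\<^sub>R (Bres \<nu> f - f))"
    by (rule dr_diff[OF d(1) Bres(1)[OF \<nu>]])
  then have "dr (u - Bres \<nu> f) ((1 / \<nu>) *\<^sub>R (u - Bres \<nu> f))" by (simp add: algebra_simps)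
  from dr_expo_unique[OF this \<nu>] have "u - Bres \<nu> f = 0" using d(2) Bres(2)[OF \<nu>] by simp
  then show ?thesis by simp
qed

text \<open>An operator defined by choice inherits linearity from uniqueness: sums and multiples of
  solutions solve the equation for the combined data.\<close>

lemma bounded_linear_Fres: assumes \<nu>: "\<nu> > 0" shows "bounded_linear (Fres \<nu>)"
proof (rule bounded_linear_intro)
  show "Fres \<nu> (f + g) = Fres \<nu> f + Fres \<nu> g" for f g
    by (rule Fres_unique[OF \<nu>, symmetric])
       (use dr_add[OF Fres(1)[OF \<nu>, of f] Fres(1)[OF \<nu>, of g]] in \<open>simp add: algebra_simps\<close>)
  show "Fres \<nu> (c *\<^sub>R f) = c *\<^sub>R Fres \<nu> f" for c f
    by (rule Fres_unique[OF \<nu>, symmetric])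
       (use dr_scaleR[OF Fres(1)[OF \<nu>, of f], of c] in \<open>simp add: algebra_simps\<close>)
  show "norm (Fres \<nu> f) \<le> norm f * (4 * (1 + sqrt \<nu>) * (1 + 1 / \<nu>))" for f
    using Fres(3)[OF \<nu>, of f] by (simp add: mult.commute)
qed

lemma bounded_linear_Bres: assumes \<nu>: "\<nu> > 0" shows "bounded_linear (Bres \<nu>)"
proof (rule bounded_linear_intro)
  show "Bres \<nu> (f + g) = Bres \<nu> f + Bres \<nu> g" for f g
    by (rule Bres_unique[OF \<nu>, symmetric])
       (use dr_add[OF Bres(1)[OF \<nu>, of f] Bres(1)[OF \<nu>, of g]] Bres(2)[OF \<nu>] in \<open>simp_all add: algebra_simps\<close>)
  show "Bres \<nu> (c *\<^sub>R f) = c *\<^sub>R Bres \<nu> f" for c f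
    by (rule Bres_unique[OF \<nu>, symmetric])
       (use dr_scaleR[OF Bres(1)[OF \<nu>, of f], of c] Bres(2)[OF \<nu>] in \<open>simp_all add: algebra_simps\<close>)
  show "norm (Bres \<nu> f) \<le> norm f * (4 * (1 + sqrt \<nu>) * (1 + 1 / \<nu>))" for f
    using Bres(4)[OF \<nu>, of f] by (simp add: mult.commute)
qed

section \<open>The isomorphism \<open>S\<close>, its powers and the transported products\<close>

definition S :: "h1 \<Rightarrow> h1" where "S = Fres 1"

lemma dr_S: "dr (S f) (f - S f)"
  using Fres(1)[of 1 f] by (simp add: S_def)

lemma bounded_linear_S: "bounded_linear S"
  unfolding S_def by (rule bounded_linear_Fres) simp

lemmas S_linear = linear_add[OF bounded_linear.linear[OF bounded_linear_S]]
  linear_diff[OF bounded_linear.linear[OF bounded_linear_S]]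
  linear_scale[OF bounded_linear.linear[OF bounded_linear_S]]
  linear_neg[OF bounded_linear.linear[OF bounded_linear_S]]
  linear_0[OF bounded_linear.linear[OF bounded_linear_S]]

lemma S_eqI: "dr u v \<Longrightarrow> u = S (u + v)"
  unfolding S_def by (rule Fres_unique) auto

lemma S_inject: "S f = S g \<Longrightarrow> f = g"
  using dr_unique[OF dr_S[of f], of "g - S g"] dr_S[of g] by simp

text \<open>The derivative of \<open>S a * S b\<close> is
  \<open>(a - S a) * S b + S a * (b - S b)\<close>. Adding \<open>S a * S b\<close> itself gives the
  argument of \<open>S\<close> on the left, and \<open>S\<close> inverts
  \<open>1 + \<partial>\<close>.\<close>

lemma Rota_Baxter: "S (a * S b + S a * b - S a * S b) = S a * S b"
  using S_eqI[OF dr_mult[OF dr_S[of a] dr_S[of b]]] by (simp add: algebra_simps)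

lemma bounded_linear_funpow:
  fixes f :: "'a::real_normed_vector \<Rightarrow> 'a"
  shows "bounded_linear f \<Longrightarrow> bounded_linear (f ^^ n)"
proof (induction n)
  case (Suc n)
  then show ?case using bounded_linear_compose[OF Suc.prems Suc.IH[OF Suc.prems]] by (simp add: o_def)
qed (simp add: bounded_linear_ident id_def)

abbreviation Sn :: "nat \<Rightarrow> h1 \<Rightarrow> h1" where "Sn k \<equiv> S ^^ k"

lemma bounded_linear_Sn: "bounded_linear (Sn k)"
  by (rule bounded_linear_funpow[OF bounded_linear_S])

lemmas Sn_linear = linear_add[OF bounded_linear.linear[OF bounded_linear_Sn]]
  linear_diff[OF bounded_linear.linear[OF bounded_linear_Sn]]
  linear_scale[OF bounded_linear.linear[OF bounded_linear_Sn]]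
  linear_neg[OF bounded_linear.linear[OF bounded_linear_Sn]]
  linear_0[OF bounded_linear.linear[OF bounded_linear_Sn]]

lemma Sn_S: "Sn k (S f) = S (Sn k f)"
  by (simp add: funpow_swap1)

lemma Sn_inject: "Sn k f = Sn k g \<Longrightarrow> f = g"
  by (induction k) (auto dest: S_inject)

text \<open>\<open>mk k\<close> is the product of \<open>H\<^bsup>k+1\<^esup>\<close> transported to \<open>H\<^sup>1\<close> by the isomorphism
  \<open>S\<^sup>k = (1 + \<partial>)\<^bsup>-k\<^esup>\<close>; the recursion is the Rota--Baxter identity.\<close>

fun mk :: "nat \<Rightarrow> h1 \<Rightarrow> h1 \<Rightarrow> h1" where
  "mk 0 u v = u * v"
| "mk (Suc k) u v = mk k u (S v) + mk k (S u) v - mk k (S u) (S v)"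

lemma Sn_mk: "Sn k (mk k u v) = Sn k u * Sn k v"
proof (induction k arbitrary: u v)
  case (Suc k)
  show ?case using Rota_Baxter[of "Sn k u" "Sn k v"] by (simp add: Sn_linear Suc Sn_S)
qed simp

lemma bounded_bilinear_mk: "bounded_bilinear (mk k)"
proof (induction k)
  case 0
  have "mk 0 = (*)" by (simp add: fun_eq_iff)
  then show ?case by (simp add: bounded_bilinear_mult)
next
  case (Suc k)
  interpret m: bounded_bilinear "mk k" by fact
  have 1: "bounded_bilinear (\<lambda>u v. mk k u (S v))"
    using m.comp[OF bounded_linear_ident bounded_linear_S] .
  have 2: "bounded_bilinear (\<lambda>u v. mk k (S u) v)"
    using m.comp[OF bounded_linear_S bounded_linear_ident] .
  have 3: "bounded_bilinear (\<lambda>u v. mk k (S u) (S v))"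
    using m.comp[OF bounded_linear_S bounded_linear_S] .
  obtain K1 where K1: "\<And>u v. norm (mk k u (S v)) \<le> norm u * norm v * K1" using bounded_bilinear.bounded[OF 1] by blast
  obtain K2 where K2: "\<And>u v. norm (mk k (S u) v) \<le> norm u * norm v * K2" using bounded_bilinear.bounded[OF 2] by blast
  obtain K3 where K3: "\<And>u v. norm (mk k (S u) (S v)) \<le> norm u * norm v * K3" using bounded_bilinear.bounded[OF 3] by blast
  show ?case
  proof (rule bounded_bilinear.intro)
    show "\<exists>K. \<forall>a b. norm (mk (Suc k) a b) \<le> norm a * norm b * K"
    proof (intro exI allI)
      fix a b
      have "norm (mk (Suc k) a b) \<le> norm (mk k a (S b)) + norm (mk k (S a) b) + norm (mk k (S a) (S b))"
        by (simp add: norm_triangle_le norm_triangle_le_diff)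
      also have "\<dots> \<le> norm a * norm b * K1 + norm a * norm b * K2 + norm a * norm b * K3"
        by (intro add_mono K1 K2 K3)
      finally show "norm (mk (Suc k) a b) \<le> norm a * norm b * (K1 + K2 + K3)" by (simp add: algebra_simps)
    qed
  qed (simp_all add: S_linear m.add_left m.add_right m.scaleR_left m.scaleR_right algebra_simps)
qed

text \<open>Identities between transported products are checked after applying the injective
  \<open>Sn k\<close>, which turns them into identities between pointwise products. This one lets
  solutions descend from one regularity to the next lower one.\<close>

lemma S_mk_Suc: "S (mk (Suc k) u v) = mk k (S u) (S v)"
proof (rule Sn_inject[of k])
  have "Sn k (S (mk (Suc k) u v)) = Sn (Suc k) (mk (Suc k) u v)" by (simp add: Sn_S)
  also have "\<dots> = Sn k (S u) * Sn k (S v)" by (subst Sn_mk) (simp add: Sn_S)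
  finally show "Sn k (S (mk (Suc k) u v)) = Sn k (mk k (S u) (S v))" by (simp add: Sn_mk)
qed

text \<open>Each of the three products in the recursion has a factor smoothed by \<open>S\<close>.
  When \<open>norm (S f)\<close> is already bounded, the product therefore grows only linearly in
  the full norm; the induction over the regularity lives on this.\<close>

lemma mk_Suc_tame:
  obtains K where "K \<ge> 0" "\<And>u v. norm (mk (Suc k) u v) \<le> K * (norm u * norm (S v) + norm (S u) * norm v + norm (S u) * norm (S v))"
proof -
  interpret m: bounded_bilinear "mk k" by (rule bounded_bilinear_mk)
  obtain K where K: "K \<ge> 0" "\<And>u v. norm (mk k u v) \<le> norm u * norm v * K" using m.nonneg_bounded by blast
  have "norm (mk (Suc k) u v) \<le> K * (norm u * norm (S v) + norm (S u) * norm v + norm (S u) * norm (S v))" for u v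
  proof -
    have "norm (mk (Suc k) u v) \<le> norm (mk k u (S v)) + norm (mk k (S u) v) + norm (mk k (S u) (S v))"
      by (simp add: norm_triangle_le norm_triangle_le_diff)
    also have "\<dots> \<le> norm u * norm (S v) * K + norm (S u) * norm v * K + norm (S u) * norm (S v) * K"
      by (intro add_mono K)
    finally show ?thesis by (simp add: algebra_simps)
  qed
  then show ?thesis using that K by blast
qed

section \<open>The elliptic operator with Neumann condition\<close>

text \<open>\<open>W - \<mu> V\<close> satisfies the first-order equation of
  \<open>dr_decay_zero\<close> and so vanishes. What is left is \<open>\<mu> W' = W\<close>, whose
  solutions are the multiples of the boundary layer.\<close>

lemma elliptic_kernel:
  assumes \<mu>: "\<mu> > 0" and d: "dr W V" "dr V ((1 / \<mu>\<^sup>2) *\<^sub>R W)"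
  shows "W = fn W 0 *\<^sub>R expo \<mu>" "V = (1 / \<mu>) *\<^sub>R W"
proof -
  define b where "b = W - \<mu> *\<^sub>R V"
  have "dr b (V - \<mu> *\<^sub>R ((1 / \<mu>\<^sup>2) *\<^sub>R W))" unfolding b_def by (intro dr_diff dr_scaleR d)
  moreover have "V - \<mu> *\<^sub>R ((1 / \<mu>\<^sup>2) *\<^sub>R W) = - (1 / \<mu>) *\<^sub>R b"
    using \<mu> by (simp add: b_def algebra_simps power2_eq_square)
  ultimately have "b = 0" using dr_decay_zero \<mu> by metis
  then have "W = \<mu> *\<^sub>R V" by (simp add: b_def)
  then show V: "V = (1 / \<mu>) *\<^sub>R W" using \<mu> by simp
  show "W = fn W 0 *\<^sub>R expo \<mu>" by (rule dr_expo_unique[OF _ \<mu>]) (use d(1) V in simp)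
qed

text \<open>\<open>Rop \<mu>\<close> inverts \<open>1 - \<mu>\<^sup>2 \<partial>\<^sup>2 = (1 + \<mu> \<partial>)(1 - \<mu> \<partial>)\<close> with Neumann condition, and \<open>Pop \<mu> = \<partial> Rop \<mu>\<close>.\<close>

definition Rop :: "real \<Rightarrow> h1 \<Rightarrow> h1" where "Rop \<mu> f = Bres \<mu> (Fres \<mu> f)"
definition Pop :: "real \<Rightarrow> h1 \<Rightarrow> h1" where "Pop \<mu> f = (1 / \<mu>) *\<^sub>R (Rop \<mu> f - Fres \<mu> f)"

context
  fixes \<mu> :: real assumes \<mu>: "\<mu> > 0"
begin

lemma dr_Rop: "dr (Rop \<mu> f) (Pop \<mu> f)"
  using Bres(1)[OF \<mu>] by (simp add: Rop_def Pop_def)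

lemma dr_Pop: "dr (Pop \<mu> f) ((1 / \<mu>\<^sup>2) *\<^sub>R (Rop \<mu> f - f))"
proof -
  have "dr (Pop \<mu> f) ((1 / \<mu>) *\<^sub>R (Pop \<mu> f - (1 / \<mu>) *\<^sub>R (f - Fres \<mu> f)))"
    unfolding Pop_def[of \<mu> f] by (intro dr_scaleR dr_diff dr_Rop[unfolded Pop_def] Fres(1)[OF \<mu>])
  moreover have "(1 / \<mu>) *\<^sub>R (Pop \<mu> f - (1 / \<mu>) *\<^sub>R (f - Fres \<mu> f)) = (1 / \<mu>\<^sup>2) *\<^sub>R (Rop \<mu> f - f)"
    by (simp add: Pop_def algebra_simps power2_eq_square)
  ultimately show ?thesis by simp
qed

lemma Pop_0: "fn (Pop \<mu> f) 0 = 0"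
  by (simp add: Pop_def Rop_def Bres(2)[OF \<mu>])

text \<open>A maximum principle: both first-order factors preserve supremum bounds. It makes the
  nonlocal term controllable by \<open>L^\<infinity>\<close> data alone.\<close>

lemma Rop_sup: "(\<And>x. x \<le> 0 \<Longrightarrow> \<bar>fn f x\<bar> \<le> M) \<Longrightarrow> \<bar>fn (Rop \<mu> f) x\<bar> \<le> M"
  unfolding Rop_def by (rule Bres(3)[OF \<mu>], rule Fres(2)[OF \<mu>])

lemma bounded_linear_Rop: "bounded_linear (Rop \<mu>)"
  unfolding Rop_def[abs_def] by (rule bounded_linear_compose[OF bounded_linear_Bres[OF \<mu>] bounded_linear_Fres[OF \<mu>]])

lemma bounded_linear_Pop: "bounded_linear (Pop \<mu>)"
  unfolding Pop_def[abs_def]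
  by (rule bounded_linear_compose[OF bounded_linear_scaleR_right bounded_linear_sub[OF bounded_linear_Rop bounded_linear_Fres[OF \<mu>]]])

lemma Rop_unique:
  assumes d: "dr u v" "dr v ((1 / \<mu>\<^sup>2) *\<^sub>R (u - f))" and v0: "fn v 0 = 0"
  shows "u = Rop \<mu> f" "v = Pop \<mu> f"
proof -
  have 1: "dr (u - Rop \<mu> f) (v - Pop \<mu> f)" by (intro dr_diff d dr_Rop)
  have "dr (v - Pop \<mu> f) ((1 / \<mu>\<^sup>2) *\<^sub>R (u - f) - (1 / \<mu>\<^sup>2) *\<^sub>R (Rop \<mu> f - f))" by (intro dr_diff d dr_Pop)
  then have 2: "dr (v - Pop \<mu> f) ((1 / \<mu>\<^sup>2) *\<^sub>R (u - Rop \<mu> f))" by (simp add: algebra_simps)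
  note ek = elliptic_kernel[OF \<mu> 1 2]
  have "fn (u - Rop \<mu> f) 0 = \<mu> * fn (v - Pop \<mu> f) 0" using arg_cong[OF ek(2), of "\<lambda>h. fn h 0"] \<mu> by simp
  then have "fn (u - Rop \<mu> f) 0 = 0" using v0 Pop_0 by simp
  with ek(1) have "u - Rop \<mu> f = 0" by (metis scaleR_zero_left)
  then show u: "u = Rop \<mu> f" by simp
  show "v = Pop \<mu> f" by (rule dr_unique[OF d(1)]) (simp add: u dr_Rop)
qed

lemma S_expo: "S (expo \<mu>) = (\<mu> / (1 + \<mu>)) *\<^sub>R expo \<mu>"
proof -
  have "expo \<mu> = S ((1 + 1 / \<mu>) *\<^sub>R expo \<mu>)"
    using S_eqI[OF dr_expo[OF \<mu>]] by (simp add: algebra_simps)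
  then have "expo \<mu> = (1 + 1 / \<mu>) *\<^sub>R S (expo \<mu>)" by (simp add: S_linear)
  then have "(\<mu> / (1 + \<mu>)) *\<^sub>R expo \<mu> = (\<mu> / (1 + \<mu>) * (1 + 1 / \<mu>)) *\<^sub>R S (expo \<mu>)" by (metis scaleR_scaleR)
  moreover have "\<mu> / (1 + \<mu>) * (1 + 1 / \<mu>) = 1"
    using \<mu> add_pos_pos[OF \<mu> mult_pos_pos[OF \<mu> \<mu>]] by (simp add: field_simps)
  ultimately show ?thesis by (metis scaleR_one)
qed

text \<open>\<open>\<partial> R\<^sub>1\<close> commutes with \<open>S\<close> up to a boundary layer.\<close>

definition bl :: "h1 \<Rightarrow> real" where "bl x = ((1 + \<mu>) / \<mu>) * fn (S (Pop \<mu> x)) 0"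

lemma bounded_linear_bl: "bounded_linear bl"
  unfolding bl_def[abs_def]
  by (rule bounded_linear_const_mult[OF bounded_linear_compose[OF bounded_linear_fn
        bounded_linear_compose[OF bounded_linear_S bounded_linear_Pop]]])

text \<open>\<open>S\<close> commutes with \<open>1 - \<mu>^2 \<partial>^2\<close> but does not
  respect the Neumann condition. Adding the right multiple of \<open>expo \<mu>\<close> to
  \<open>Rop \<mu> x\<close> keeps the elliptic equation and makes the derivative of the
  \<open>S\<close>-image vanish at 0. Uniqueness for the Neumann problem then identifies that
  derivative as \<open>Pop \<mu> (S x)\<close>.\<close>

lemma Pop_S: "Pop \<mu> (S x) = S (Pop \<mu> x - bl x *\<^sub>R expo \<mu>)"
proof -
  define c where "c = - \<mu> * bl x"
  define y where "y = Rop \<mu> x + c *\<^sub>R expo \<mu>"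
  define y1 where "y1 = Pop \<mu> x + c *\<^sub>R ((1 / \<mu>) *\<^sub>R expo \<mu>)"
  define y2 where "y2 = (1 / \<mu>\<^sup>2) *\<^sub>R (Rop \<mu> x - x) + c *\<^sub>R ((1 / \<mu>) *\<^sub>R ((1 / \<mu>) *\<^sub>R expo \<mu>))"
  have y1: "y1 = Pop \<mu> x - bl x *\<^sub>R expo \<mu>" using \<mu> by (simp add: y1_def c_def)
  have dy: "dr y y1" unfolding y_def y1_def by (intro dr_add dr_scaleR dr_Rop dr_expo \<mu>)
  have dy1: "dr y1 y2" unfolding y1_def y2_def by (intro dr_add dr_scaleR dr_Pop dr_expo \<mu>)
  define u where "u = S y"
  define v where "v = S y1"
  have "y - S y = S y1" using S_eqI[OF dy] by (metis S_linear(1) add_diff_cancel_left')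
  then have du: "dr u v" using dr_S[of y] by (simp add: u_def v_def)
  have dv': "dr v (y1 - v)" using dr_S[of y1] by (simp add: v_def)
  \<comment> \<open>The defect in the elliptic equation for \<open>S y\<close> with datum
    \<open>S x\<close>. Since \<open>y\<close> has no defect for the datum \<open>x\<close>, this
    one satisfies \<open>e' = - e\<close>.\<close>
  define e where "e = u - \<mu>\<^sup>2 *\<^sub>R (y1 - v) - S x"
  have "dr e (v - \<mu>\<^sup>2 *\<^sub>R (y2 - (y1 - v)) - (x - S x))"
    unfolding e_def by (intro dr_diff dr_scaleR du dv' dy1 dr_S)
  moreover have "v - \<mu>\<^sup>2 *\<^sub>R (y2 - (y1 - v)) - (x - S x) = - (1 / 1) *\<^sub>R e"
  proof -
    have "\<mu>\<^sup>2 *\<^sub>R y2 = y - x" using \<mu> by (simp add: y2_def y_def algebra_simps power2_eq_square)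
    moreover have "v = y - u" using \<open>y - S y = S y1\<close> by (simp add: u_def v_def)
    ultimately show ?thesis by (simp add: e_def algebra_simps)
  qed
  ultimately have "e = 0" using dr_decay_zero[of e 1] by simp
  then have "\<mu>\<^sup>2 *\<^sub>R (y1 - v) = u - S x" by (simp add: e_def algebra_simps)
  then have "(1 / \<mu>\<^sup>2) *\<^sub>R (\<mu>\<^sup>2 *\<^sub>R (y1 - v)) = (1 / \<mu>\<^sup>2) *\<^sub>R (u - S x)" by simp
  then have "y1 - v = (1 / \<mu>\<^sup>2) *\<^sub>R (u - S x)" using \<mu> by simp
  then have dv2: "dr v ((1 / \<mu>\<^sup>2) *\<^sub>R (u - S x))" using dv' by simp
  have "fn v 0 = fn (S (Pop \<mu> x)) 0 - bl x * (\<mu> / (1 + \<mu>))"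
    using \<mu> by (simp add: v_def y1 S_linear S_expo)
  also have "\<dots> = 0" using \<mu> by (simp add: bl_def)
  finally have "v = Pop \<mu> (S x)" by (rule Rop_unique(2)[OF du dv2])
  then show ?thesis by (simp add: v_def y1)
qed

text \<open>The preimage of \<open>expo \<mu>\<close> under \<open>Sn (Suc k)\<close>: the boundary
  layer is an eigenvector of \<open>S\<close> with eigenvalue
  \<open>\<mu> / (1 + \<mu>)\<close>.\<close>

definition Ek :: "nat \<Rightarrow> h1" where "Ek k = (1 + 1 / \<mu>) ^ Suc k *\<^sub>R expo \<mu>"

lemma S_Ek: "S (Ek (Suc k)) = Ek k" "S (Ek 0) = expo \<mu>"
proof -
  have *: "(1 + 1 / \<mu>) * (\<mu> / (1 + \<mu>)) = 1"
    using \<mu> add_pos_pos[OF \<mu> mult_pos_pos[OF \<mu> \<mu>]] by (simp add: field_simps)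
  have "S (Ek 0) = ((1 + 1 / \<mu>) * (\<mu> / (1 + \<mu>))) *\<^sub>R expo \<mu>"
    by (simp only: Ek_def power_Suc power_0 mult_1_right S_linear S_expo scaleR_scaleR)
  then show "S (Ek 0) = expo \<mu>" by (simp only: * scaleR_one)
  have "S (Ek (Suc k)) = ((1 + 1 / \<mu>) ^ Suc k * ((1 + 1 / \<mu>) * (\<mu> / (1 + \<mu>)))) *\<^sub>R expo \<mu>"
    by (simp only: Ek_def power_Suc S_linear S_expo scaleR_scaleR mult_ac)
  then show "S (Ek (Suc k)) = Ek k" unfolding * by (simp add: Ek_def)
qed

lemma Sn_Ek: "Sn (Suc k) (Ek k) = expo \<mu>"
proof (induction k)
  case 0 then show ?case by (simp add: S_Ek)
next
  case (Suc k)
  have "Sn (Suc (Suc k)) (Ek (Suc k)) = Sn (Suc k) (S (Ek (Suc k)))" by (simp add: Sn_S)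
  then show ?case using Suc by (simp add: S_Ek)
qed

text \<open>The preimage of \<open>Pop \<mu> (Sn k f)\<close> under \<open>Sn (Suc k)\<close>, which
  expresses the gain of one derivative. The base case is \<open>(1 + \<partial>)\<close> applied to
  \<open>Pop \<mu> f\<close>; every further level subtracts the boundary layer found in
  \<open>Pop_S\<close>.\<close>

fun gk :: "nat \<Rightarrow> h1 \<Rightarrow> h1" where
  "gk 0 f = Pop \<mu> f + (1 / \<mu>\<^sup>2) *\<^sub>R (Rop \<mu> f - f)"
| "gk (Suc k) f = gk k f - bl (Sn k f) *\<^sub>R Ek k"

lemma Sn_gk: "Sn (Suc k) (gk k f) = Pop \<mu> (Sn k f)"
proof (induction k)
  case 0 show ?case using S_eqI[OF dr_Pop[of f]] by simp
next
  case (Suc k)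
  have "Sn (Suc (Suc k)) (gk (Suc k) f) = S (Sn (Suc k) (gk k f) - bl (Sn k f) *\<^sub>R Sn (Suc k) (Ek k))"
    by (simp add: Sn_linear S_linear)
  also have "\<dots> = S (Pop \<mu> (Sn k f) - bl (Sn k f) *\<^sub>R expo \<mu>)" by (simp only: Suc Sn_Ek)
  also have "\<dots> = Pop \<mu> (Sn (Suc k) f)" by (simp add: Pop_S)
  finally show ?case .
qed

lemma bounded_linear_gk: "bounded_linear (gk k)"
proof (induction k)
  case 0
  have "bounded_linear (\<lambda>f. Pop \<mu> f + (1 / \<mu>\<^sup>2) *\<^sub>R (Rop \<mu> f - f))"
    by (intro bounded_linear_add bounded_linear_Pop bounded_linear_compose[OF bounded_linear_scaleR_right]
        bounded_linear_sub bounded_linear_Rop bounded_linear_ident)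
  then show ?case by (simp add: gk.simps(1)[abs_def])
next
  case (Suc k)
  have "bounded_linear (\<lambda>f. gk k f - bl (Sn k f) *\<^sub>R Ek k)"
    by (intro bounded_linear_sub Suc bounded_linear_compose[OF bounded_linear_scaleR_left]
        bounded_linear_compose[OF bounded_linear_bl] bounded_linear_Sn)
  moreover have "gk (Suc k) = (\<lambda>f. gk k f - bl (Sn k f) *\<^sub>R Ek k)" by (simp add: fun_eq_iff)
  ultimately show ?case by simp
qed

lemma S_gk_Suc: "S (gk (Suc k) f) = gk k (S f)"
proof (rule Sn_inject[of "Suc k"])
  have "Sn (Suc k) (S (gk (Suc k) f)) = Sn (Suc (Suc k)) (gk (Suc k) f)" by (simp add: Sn_S)
  also have "\<dots> = Pop \<mu> (Sn k (S f))" by (subst Sn_gk) (simp add: Sn_S)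
  also have "\<dots> = Sn (Suc k) (gk k (S f))" by (rule Sn_gk[symmetric])
  finally show "Sn (Suc k) (S (gk (Suc k) f)) = Sn (Suc k) (gk k (S f))" .
qed

end

section \<open>The system as an ordinary differential equation\<close>

text \<open>Space is shifted so that the boundary point is 0. A state \<open>((z, w, g), (b, b1, d))\<close> encodes
  \<open>\<zeta> = S\<^sup>k z\<close>, \<open>1/h - 1 = S\<^sup>k w\<close>, \<open>q = S\<^bsup>k+1\<^esup> g\<close>, the displacement \<open>b\<close>, its velocity \<open>b1\<close> and
  its Duhamel integral \<open>d\<close>.\<close>

type_synonym state = "(h1 \<times> h1 \<times> h1) \<times> (real \<times> real \<times> real)"

abbreviation cz :: "state \<Rightarrow> h1" where "cz y \<equiv> fst (fst y)"
abbreviation cw :: "state \<Rightarrow> h1" where "cw y \<equiv> fst (snd (fst y))"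
abbreviation cg :: "state \<Rightarrow> h1" where "cg y \<equiv> snd (snd (fst y))"
abbreviation cb :: "state \<Rightarrow> real" where "cb y \<equiv> fst (snd y)"
abbreviation cb1 :: "state \<Rightarrow> real" where "cb1 y \<equiv> fst (snd (snd y))"
abbreviation cd :: "state \<Rightarrow> real" where "cd y \<equiv> snd (snd (snd y))"

lemma bounded_linear_components:
  "bounded_linear cz" "bounded_linear cw" "bounded_linear cg"
  "bounded_linear cb" "bounded_linear cb1" "bounded_linear cd"
  by (intro bounded_linear_compose[OF bounded_linear_fst] bounded_linear_compose[OF bounded_linear_snd]
      bounded_linear_fst bounded_linear_snd)+

lemma norm_components:
  "norm (cz y) \<le> norm y" "norm (cw y) \<le> norm y" "norm (cg y) \<le> norm y"
  "\<bar>cb y\<bar> \<le> norm y" "\<bar>cb1 y\<bar> \<le> norm y" "\<bar>cd y\<bar> \<le> norm y"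
proof -
  have f: "norm (fst p) \<le> norm p" and s: "norm (snd p) \<le> norm p"
    for p :: "'a::real_normed_vector \<times> 'b::real_normed_vector"
    by (metis norm_fst_le prod.collapse, metis norm_snd_le prod.collapse)
  show "norm (cz y) \<le> norm y" "norm (cw y) \<le> norm y" "norm (cg y) \<le> norm y"
    by (meson f s order_trans)+
  have "norm (cb y) \<le> norm y" "norm (cb1 y) \<le> norm y" "norm (cd y) \<le> norm y"
    by (meson f s order_trans)+
  then show "\<bar>cb y\<bar> \<le> norm y" "\<bar>cb1 y\<bar> \<le> norm y" "\<bar>cd y\<bar> \<le> norm y" by simp_all
qed

lemma norm_state_le:
  "norm (y::state) \<le> norm (cz y) + norm (cw y) + norm (cg y) + \<bar>cb y\<bar> + \<bar>cb1 y\<bar> + \<bar>cd y\<bar>"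
proof -
  have p: "norm p \<le> norm (fst p) + norm (snd p)" for p :: "'a::real_normed_vector \<times> 'b::real_normed_vector"
    by (cases p) (simp add: norm_Pair sqrt_sum_squares_le_sum)
  show ?thesis
    using p[of y] p[of "fst y"] p[of "snd (fst y)"] p[of "snd y"] p[of "snd (snd y)"] by simp
qed

text \<open>This is \<open>\<partial> S\<close>, a bounded operator because \<open>S\<close> gains a
  derivative: for \<open>q = Sn (Suc k) g\<close> one has \<open>q_x = Sn k (pc g)\<close>.\<close>

definition pc :: "h1 \<Rightarrow> h1" where "pc g = g - S g"
definition tr :: "nat \<Rightarrow> h1 \<Rightarrow> real" where "tr k f = fn (Sn k f) 0"

lemma bounded_linear_pc: "bounded_linear pc"
  unfolding pc_def[abs_def] by (intro bounded_linear_sub bounded_linear_ident bounded_linear_S)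

lemma bounded_linear_tr: "bounded_linear (tr k)"
  unfolding tr_def[abs_def] by (rule bounded_linear_compose[OF bounded_linear_fn bounded_linear_Sn])

lemma S_pc: "S (pc g) = pc (S g)" by (simp add: pc_def S_linear)

lemma tr_S: "tr k (S f) = tr (Suc k) f" by (simp add: tr_def Sn_S)

section \<open>The vector field and its descent in regularity\<close>

locale wave_params =
  fixes Lp \<alpha> Tbuo P0 \<kappa> \<eta>eq \<epsilon> \<mu> :: real
  assumes Lp: "Lp > 0" and \<alpha>: "\<alpha> > 0" and Tbuo: "Tbuo\<^sup>2 > 0" and \<kappa>: "\<kappa> \<ge> 0" and \<epsilon>: "\<epsilon> > 0" and \<mu>: "\<mu> > 0"
begin

text \<open>The transported form of \<open>\<epsilon> q_x (1 + w)^2\<close>, which is the time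
  derivative of \<open>1/h\<close> by the continuity equation, multiplied out.\<close>

definition wt :: "nat \<Rightarrow> h1 \<Rightarrow> h1 \<Rightarrow> h1" where
  "wt k w g = \<epsilon> *\<^sub>R (mk k (mk k w w) (pc g) + 2 *\<^sub>R mk k w (pc g) + pc g)"

definition Phi :: "nat \<Rightarrow> h1 \<Rightarrow> h1 \<Rightarrow> h1 \<Rightarrow> h1" where
  "Phi k z w g = z + (\<epsilon> / 2) *\<^sub>R mk k z z + \<epsilon> *\<^sub>R (mk k (S g) (S g) + mk k (mk k (S g) (S g)) w)"

definition T2 :: "real \<Rightarrow> real \<Rightarrow> real" where
  "T2 w0 b = Tbuo\<^sup>2 + \<alpha> * Lp + Lp\<^sup>2 / (3 * h_wc \<epsilon> \<eta>eq b) + \<mu> * Lp * (1 + w0) + \<mu>\<^sup>2 / h_wc \<epsilon> \<eta>eq b"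

text \<open>The right-hand side of the oscillator equation. \<open>z0\<close> and \<open>w0\<close>
  are the boundary values of \<open>\<zeta>\<close> and \<open>w\<close>, \<open>f0\<close> is that
  of \<open>R1 \<phi>\<close>, and \<open>d\<close> stands for the Duhamel integral;
  \<open>1 + w0\<close> replaces the reciprocal of the boundary depth.\<close>

definition num :: "real \<Rightarrow> real \<Rightarrow> real \<Rightarrow> real \<times> real \<times> real \<Rightarrow> real" where
  "num z0 w0 f0 = (\<lambda>(b, b1, d). - (1 + P0) * b + \<kappa> * P0 * d
     + \<epsilon> * (Lp\<^sup>2 / 2 * (- (1 + w0)\<^sup>2 + 1 / (3 * (h_wc \<epsilon> \<eta>eq b)\<^sup>2))) * b1\<^sup>2
     + (1 + w0) * (\<epsilon> * z0\<^sup>2 / 2 + f0))"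

definition acc :: "nat \<Rightarrow> state \<Rightarrow> real" where
  "acc k y = num (tr k (cz y)) (tr k (cw y)) (fn (Rop \<mu> (Sn k (Phi k (cz y) (cw y) (cg y)))) 0) (snd y)
     / T2 (tr k (cw y)) (cb y)"

definition F :: "nat \<Rightarrow> state \<Rightarrow> state" where
  "F k y = ((- pc (cg y), wt k (cw y) (cg y),
       (Lp * acc k y) *\<^sub>R Ek \<mu> k - gk \<mu> k (Phi k (cz y) (cw y) (cg y))),
     (cb1 y, acc k y, cb y - \<kappa> * cd y))"

text \<open>Positivity of \<open>1 + w\<close> is asked only at the boundary point, which is an open
  condition and suffices for a positive coefficient of the acceleration. Under the constraint
  \<open>cst\<close> it spreads to the whole half-line, see \<open>cst_pos\<close>.\<close>

definition dom :: "nat \<Rightarrow> state set" where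
  "dom k = {y. h_wc \<epsilon> \<eta>eq (cb y) > 0 \<and> 1 + tr k (cw y) > 0}"

text \<open>\<open>sh\<close> carries the system at regularity \<open>k + 1\<close> to the one at regularity \<open>k\<close>, because \<open>S\<close>
  intertwines the products \<open>mk\<close>.\<close>

definition sh :: "state \<Rightarrow> state" where
  "sh y = ((S (cz y), S (cw y), S (cg y)), snd y)"

text \<open>All remaining terms are nonnegative. The coefficient of the acceleration is thus bounded
  below independently of the solution, which yields the a priori bound on the acceleration.\<close>

lemma T2_ge: "h_wc \<epsilon> \<eta>eq b > 0 \<Longrightarrow> 1 + w0 > 0 \<Longrightarrow> T2 w0 b \<ge> Tbuo\<^sup>2"
proof -
  assume h: "h_wc \<epsilon> \<eta>eq b > 0" "1 + w0 > 0"
  then have "0 \<le> \<alpha> * Lp" "0 \<le> Lp\<^sup>2 / (3 * h_wc \<epsilon> \<eta>eq b)" "0 \<le> \<mu> * Lp * (1 + w0)" "0 \<le> \<mu>\<^sup>2 / h_wc \<epsilon> \<eta>eq b"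
    using Lp \<alpha> \<mu> by auto
  then show ?thesis by (simp add: T2_def)
qed

lemma T2_pos: "y \<in> dom k \<Longrightarrow> T2 (tr k (cw y)) (cb y) > 0"
  using order_less_le_trans[OF Tbuo T2_ge[of "cb y" "tr k (cw y)"]] by (simp add: dom_def)

lemma open_dom: "open (dom k)"
proof -
  have "dom k = {y. h_wc \<epsilon> \<eta>eq (cb y) > 0} \<inter> {y. 1 + tr k (cw y) > 0}" by (auto simp: dom_def)
  moreover have "open {y. h_wc \<epsilon> \<eta>eq (cb y) > 0}"
    unfolding h_wc_def by (intro open_Collect_less continuous_intros linear_continuous_on bounded_linear_components)
  moreover have "open {y. 1 + tr k (cw y) > 0}"
    by (intro open_Collect_less continuous_intros linear_continuous_on
        bounded_linear_compose[OF bounded_linear_tr] bounded_linear_components)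
  ultimately show ?thesis by auto
qed

lemmas loclip_lin = loclip_on_bounded_linear_compose
lemmas loclip_c = bounded_linear_components[THEN loclip_on_bounded_linear]

lemma loclip_Phi: "loclip_on U (\<lambda>y. Phi k (cz y) (cw y) (cg y))"
  unfolding Phi_def
  by (intro loclip_on_add loclip_on_scaleR loclip_on_bilinear[OF bounded_bilinear_mk]
      loclip_lin[OF bounded_linear_S] loclip_c)

lemma loclip_acc: "loclip_on (dom k) (acc k)"
  unfolding acc_def[abs_def]
proof (rule loclip_on_divide)
  have h: "loclip_on (dom k) (\<lambda>y. h_wc \<epsilon> \<eta>eq (cb y))"
    unfolding h_wc_def by (intro loclip_on_add loclip_on_const loclip_on_mult loclip_c)
  have h0: "h_wc \<epsilon> \<eta>eq (cb y) \<noteq> 0" if "y \<in> dom k" for y using that by (auto simp: dom_def)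
  note i = loclip_on_add loclip_on_const loclip_on_mult loclip_on_divide loclip_on_power loclip_on_minus
    h loclip_lin[OF bounded_linear_tr] loclip_c loclip_lin[OF bounded_linear_fn]
    loclip_lin[OF bounded_linear_Rop[OF \<mu>]] loclip_lin[OF bounded_linear_Sn] loclip_Phi
  show "loclip_on (dom k) (\<lambda>y. T2 (tr k (cw y)) (cb y))"
    unfolding T2_def by (intro i) (use h0 in auto)
  show "loclip_on (dom k) (\<lambda>y. num (tr k (cz y)) (tr k (cw y))
     (fn (Rop \<mu> (Sn k (Phi k (cz y) (cw y) (cg y)))) 0) (snd y))"
    unfolding num_def split_beta by (intro i) (use h0 in auto)
  show "T2 (tr k (cw y)) (cb y) \<noteq> 0" if "y \<in> dom k" for y using T2_pos[OF that] by simp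
qed

lemma loclip_F: "loclip_on (dom k) (F k)"
  unfolding F_def[abs_def] wt_def
  by (intro loclip_on_Pair loclip_on_add loclip_on_diff loclip_on_minus loclip_on_scaleR
      loclip_on_bilinear[OF bounded_bilinear_mk] loclip_on_bilinear[OF bounded_bilinear_scaleR] loclip_acc
      loclip_on_mult loclip_on_const loclip_c
      loclip_lin[OF bounded_linear_pc] loclip_lin[OF bounded_linear_gk[OF \<mu>]] loclip_Phi)

lemma S_Phi: "S (Phi (Suc k) z w g) = Phi k (S z) (S w) (S g)"
  by (simp only: Phi_def S_linear S_mk_Suc)

lemma S_wt: "S (wt (Suc k) w g) = wt k (S w) (S g)"
  by (simp only: wt_def S_linear S_mk_Suc S_pc)

lemma acc_sh: "acc k (sh y) = acc (Suc k) y"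
  by (simp add: acc_def sh_def tr_S S_Phi[symmetric] Sn_S)

lemma F_sh: "F k (sh y) = sh (F (Suc k) y)"
proof -
  have "snd (F k (sh y)) = snd (sh (F (Suc k) y))" by (simp add: F_def acc_sh) (simp add: sh_def)
  moreover have "fst (F k (sh y)) = fst (sh (F (Suc k) y))"
    unfolding F_def acc_sh
    by (simp add: sh_def S_linear S_pc S_wt S_gk_Suc[OF \<mu>] S_Ek[OF \<mu>] S_Phi del: gk.simps)
  ultimately show ?thesis by (rule prod_eqI[rotated])
qed

lemma dom_sh: "sh y \<in> dom k \<longleftrightarrow> y \<in> dom (Suc k)"
  by (simp add: dom_def sh_def tr_S)

lemma bounded_linear_sh: "bounded_linear sh"
  unfolding sh_def[abs_def]
  by (intro bounded_linear_Pair bounded_linear_compose[OF bounded_linear_S] bounded_linear_components bounded_linear_snd)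

lemma ode_sol_sh:
  assumes "ode_sol (F (Suc k)) (dom (Suc k)) y0 T y"
  shows "ode_sol (F k) (dom k) (sh y0) T (\<lambda>t. sh (y t))"
  using assms bounded_linear.has_vector_derivative[OF bounded_linear_sh]
  unfolding ode_sol_def dom_sh F_sh by metis

lemma ode_sol_sh_funpow:
  "ode_sol (F (k + j)) (dom (k + j)) y0 T y \<Longrightarrow> ode_sol (F k) (dom k) ((sh ^^ j) y0) T (\<lambda>t. (sh ^^ j) (y t))"
proof (induction j arbitrary: y0 y)
  case (Suc j)
  from Suc.IH[OF ode_sol_sh[of "k + j"]] Suc.prems show ?case by (simp add: funpow_swap1)
qed simp

lemma sh_funpow: "(sh ^^ j) y = ((Sn j (cz y), Sn j (cw y), Sn j (cg y)), snd y)"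
  by (induction j) (auto simp: sh_def)

subsection \<open>Conserved constraints\<close>

text \<open>\<open>cst z w\<close> is \<open>(1 + w)(1 + \<epsilon>z) - 1\<close> and vanishes iff \<open>1 + w = 1/h\<close>. Along the flow both it and
  the defect of the trace condition satisfy homogeneous linear equations.\<close>

definition cst :: "h1 \<Rightarrow> h1 \<Rightarrow> h1" where "cst z w = w + \<epsilon> *\<^sub>R z + \<epsilon> *\<^sub>R (z * w)"

lemma ode_sol_components:
  assumes s: "ode_sol (F k) (dom k) y0 T y" and t: "t \<in> time_interval T"
  shows "((\<lambda>t. cz (y t)) has_vector_derivative - pc (cg (y t))) (at t within time_interval T)"
    "((\<lambda>t. cw (y t)) has_vector_derivative wt k (cw (y t)) (cg (y t))) (at t within time_interval T)"
    "((\<lambda>t. cg (y t)) has_vector_derivative (Lp * acc k (y t)) *\<^sub>R Ek \<mu> k - gk \<mu> k (Phi k (cz (y t)) (cw (y t)) (cg (y t)))) (at t within time_interval T)"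
    "((\<lambda>t. cb (y t)) has_vector_derivative cb1 (y t)) (at t within time_interval T)"
    "((\<lambda>t. cb1 (y t)) has_vector_derivative acc k (y t)) (at t within time_interval T)"
    "((\<lambda>t. cd (y t)) has_vector_derivative cb (y t) - \<kappa> * cd (y t)) (at t within time_interval T)"
proof -
  have d: "(y has_vector_derivative F k (y t)) (at t within time_interval T)"
    using s t by (simp add: ode_sol_def)
  note * = bounded_linear_components[THEN bounded_linear.has_vector_derivative, OF d]
  show "((\<lambda>t. cz (y t)) has_vector_derivative - pc (cg (y t))) (at t within time_interval T)"
    using *(1) by (simp add: F_def)
  show "((\<lambda>t. cw (y t)) has_vector_derivative wt k (cw (y t)) (cg (y t))) (at t within time_interval T)"
    using *(2) by (simp add: F_def)
  show "((\<lambda>t. cg (y t)) has_vector_derivative (Lp * acc k (y t)) *\<^sub>R Ek \<mu> k - gk \<mu> k (Phi k (cz (y t)) (cw (y t)) (cg (y t)))) (at t within time_interval T)"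
    using *(3) by (simp add: F_def)
  show "((\<lambda>t. cb (y t)) has_vector_derivative cb1 (y t)) (at t within time_interval T)"
    using *(4) by (simp add: F_def)
  show "((\<lambda>t. cb1 (y t)) has_vector_derivative acc k (y t)) (at t within time_interval T)"
    using *(5) by (simp add: F_def)
  show "((\<lambda>t. cd (y t)) has_vector_derivative cb (y t) - \<kappa> * cd (y t)) (at t within time_interval T)"
    using *(6) by (simp add: F_def)
qed

lemma cst_preserved_0:
  assumes s: "ode_sol (F 0) (dom 0) y0 T y" and t: "t \<in> time_interval T" and c0: "cst (cz y0) (cw y0) = 0"
  shows "cst (cz (y t)) (cw (y t)) = 0"
proof -
  have t0: "t \<ge> 0" using t by (simp add: time_interval_def)
  have sub: "{0..t} \<subseteq> time_interval T" by (rule time_interval_Icc[OF t])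
  define c where "c s = cst (cz (y s)) (cw (y s))" for s
  \<comment> \<open>\<open>m\<close> is \<open>\<epsilon> q_x / h\<close> when the constraint holds.
    The contributions of \<open>w_t\<close> and \<open>z_t\<close> factor through the constraint
    itself, which makes its equation homogeneous.\<close>
  define m where "m s = \<epsilon> *\<^sub>R (pc (cg (y s)) + pc (cg (y s)) * cw (y s))" for s
  have der: "(c has_vector_derivative m s * c s) (at s within {0..t})" if "s \<in> {0..t}" for s
  proof -
    let ?z = "cz (y s)" and ?w = "cw (y s)" and ?p = "pc (cg (y s))"
    have sT: "s \<in> time_interval T" using that sub by auto
    note d = ode_sol_components(1,2)[OF s sT, THEN has_vector_derivative_within_subset[OF _ sub]]
    have "(c has_vector_derivative wt 0 ?w (cg (y s)) + \<epsilon> *\<^sub>R (- ?p) + \<epsilon> *\<^sub>R (?z * wt 0 ?w (cg (y s)) + (- ?p) * ?w)) (at s within {0..t})"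
      unfolding c_def[abs_def] cst_def
      by (intro has_vector_derivative_add has_vector_derivative_mult d
          bounded_linear.has_vector_derivative[OF bounded_linear_scaleR_right])
    moreover have "wt 0 ?w (cg (y s)) + \<epsilon> *\<^sub>R (- ?p) + \<epsilon> *\<^sub>R (?z * wt 0 ?w (cg (y s)) + (- ?p) * ?w) = m s * c s"
      unfolding wt_def m_def c_def cst_def
      by (simp add: algebra_simps scaleR_2)
    ultimately show ?thesis by simp
  qed
  have cont: "continuous_on {0..t} y" using ode_sol_continuous_on[OF s] sub continuous_on_subset by blast
  have "continuous_on {0..t} (\<lambda>s. norm (m s))"
    unfolding m_def
    by (intro continuous_intros bounded_linear.continuous_on[OF bounded_linear_pc]
        bounded_linear.continuous_on[OF bounded_linear_components(2)] bounded_linear.continuous_on[OF bounded_linear_components(3)] cont)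
  then obtain u where "\<forall>s\<in>{0..t}. norm (m s) \<le> norm (m u)"
    using continuous_attains_sup[of "{0..t}" "\<lambda>s. norm (m s)"] t0 by (auto simp del: atLeastAtMost_iff)
  then have u: "\<And>s. s \<in> {0..t} \<Longrightarrow> norm (m s) \<le> norm (m u)" by blast
  have "c t = 0"
  proof (rule linear_ode_zero[of 0 t c "\<lambda>s. m s * c s" "norm (m u)"])
    fix s assume st: "s \<in> {0..t}"
    show "(c has_vector_derivative m s * c s) (at s within {0..t})" by (rule der[OF st])
    show "norm (m s * c s) \<le> norm (m u) * norm (c s)"
      by (rule order_trans[OF norm_mult_ineq]) (intro mult_right_mono u st norm_ge_zero)
  qed (use s c0 t0 in \<open>auto simp: c_def ode_sol_def\<close>)
  then show ?thesis by (simp add: c_def)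
qed

text \<open>Only level 0, where the product is the pointwise one, needs a computation. The general
  case descends to it along \<open>sh ^^ k\<close>.\<close>

lemma cst_preserved:
  assumes s: "ode_sol (F k) (dom k) y0 T y" and t: "t \<in> time_interval T"
    and c0: "cst (Sn k (cz y0)) (Sn k (cw y0)) = 0"
  shows "cst (Sn k (cz (y t))) (Sn k (cw (y t))) = 0"
  using cst_preserved_0[OF ode_sol_sh_funpow[of 0 k, simplified, OF s] t] c0 by (simp add: sh_funpow)

lemma cst_fn: "cst z w = 0 \<Longrightarrow> (1 + fn w x) * (1 + \<epsilon> * fn z x) = 1"
proof -
  assume "cst z w = 0"
  then have "fn (cst z w) x = 0" by simp
  then show ?thesis by (simp add: cst_def algebra_simps)
qed

text \<open>At the boundary \<open>Pop\<close> vanishes and \<open>expo \<mu>\<close> equals 1, so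
  the trace of \<open>q_t\<close> is \<open>Lp * acc k (y t)\<close>, which is also the derivative
  of \<open>Lp * cb1 (y t)\<close>. The defect has derivative zero.\<close>

lemma trace_preserved:
  assumes s: "ode_sol (F k) (dom k) y0 T y" and t: "t \<in> time_interval T"
    and c0: "fn (Sn (Suc k) (cg y0)) 0 = Lp * cb1 y0"
  shows "fn (Sn (Suc k) (cg (y t))) 0 = Lp * cb1 (y t)"
proof -
  have t0: "t \<ge> 0" using t by (simp add: time_interval_def)
  have sub: "{0..t} \<subseteq> time_interval T" by (rule time_interval_Icc[OF t])
  define c where "c s = tr (Suc k) (cg (y s)) - Lp * cb1 (y s)" for s
  have "c t = 0"
  proof (rule linear_ode_zero[of 0 t c "\<lambda>s. 0" 0])
    fix s assume st: "s \<in> {0..t}"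
    then have sT: "s \<in> time_interval T" using sub by auto
    note d = ode_sol_components(3,5)[OF s sT, THEN has_vector_derivative_within_subset[OF _ sub]]
    have "(c has_vector_derivative tr (Suc k) ((Lp * acc k (y s)) *\<^sub>R Ek \<mu> k - gk \<mu> k (Phi k (cz (y s)) (cw (y s)) (cg (y s)))) - Lp * acc k (y s)) (at s within {0..t})"
      unfolding c_def[abs_def]
      by (intro has_vector_derivative_diff bounded_linear.has_vector_derivative[OF bounded_linear_tr] d
          bounded_linear.has_vector_derivative[OF bounded_linear_mult_right])
    moreover have "tr (Suc k) ((Lp * acc k (y s)) *\<^sub>R Ek \<mu> k - gk \<mu> k (Phi k (cz (y s)) (cw (y s)) (cg (y s)))) = Lp * acc k (y s)"
      unfolding tr_def by (subst Sn_linear, subst Sn_linear, subst Sn_gk[OF \<mu>], subst Sn_Ek[OF \<mu>]) (simp add: Pop_0[OF \<mu>] \<mu>)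
    ultimately show "(c has_vector_derivative 0) (at s within {0..t})" by simp
  qed (use s c0 t0 in \<open>auto simp: c_def ode_sol_def tr_def\<close>)
  then show ?thesis by (simp add: c_def tr_def)
qed

end

section \<open>Continuation of solutions\<close>

definition sn :: "h1 \<Rightarrow> real" where "sn f = (SUP x\<in>{..0}. \<bar>fn f x\<bar>)"

lemma sn_upper: "x \<le> 0 \<Longrightarrow> \<bar>fn f x\<bar> \<le> sn f"
  unfolding sn_def by (rule cSUP_upper) (auto intro!: bdd_aboveI[of _ "norm f"] fn_norm)

lemma sn_least: "(\<And>x. x \<le> 0 \<Longrightarrow> \<bar>fn f x\<bar> \<le> M) \<Longrightarrow> sn f \<le> M"
  unfolding sn_def by (rule cSUP_least) auto

lemma sn_nonneg: "sn f \<ge> 0"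
  using sn_upper[of 0 f] by (meson abs_ge_zero order_refl order_trans)

lemma sn_add: "sn (f + g) \<le> sn f + sn g"
proof (rule sn_least)
  fix x :: real assume "x \<le> 0"
  then show "\<bar>fn (f + g) x\<bar> \<le> sn f + sn g"
    using sn_upper[of x f] sn_upper[of x g] abs_triangle_ineq[of "fn f x" "fn g x"] by simp
qed

lemma sn_scaleR: "sn (c *\<^sub>R f) \<le> \<bar>c\<bar> * sn f"
  by (rule sn_least) (simp add: abs_mult mult_left_mono sn_upper)

lemma sn_mult: "sn (f * g) \<le> sn f * sn g"
  by (rule sn_least) (simp add: abs_mult mult_mono sn_upper sn_nonneg)

text \<open>The symmetric tame estimate, linear in the full norm of each factor; it is the input of
  \<open>F_growth\<close> at level 0.\<close>

lemma norm_mult_sn: "norm (f * g) \<le> norm f * sn g + sn f * norm g"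
proof -
  have "norm (f * g) \<le> sn f * norm g + sn g * (2 * l2n hl (dv f))"
    by (rule norm_mult_tame) (auto simp: sn_upper sn_nonneg)
  also have "\<dots> \<le> sn f * norm g + sn g * norm f"
    by (intro add_left_mono mult_left_mono sn_nonneg) (simp add: norm_h1_def)
  finally show ?thesis by (simp add: algebra_simps)
qed

lemma fn_expo_le: "\<mu> > 0 \<Longrightarrow> \<bar>fn (expo \<mu>) x\<bar> \<le> 1"
  by (simp add: fn_expo divide_le_0_iff)

context wave_params
begin

text \<open>\<open>N\<close> will be the supremum norm at level \<open>k = 0\<close>, and \<open>f \<mapsto> norm (S f)\<close> at level \<open>k + 1\<close>: bounds
  on the solution propagate from each regularity to the next.\<close>

lemma F_growth:
  fixes N :: "h1 \<Rightarrow> real"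
  assumes Nnn: "\<And>f. N f \<ge> 0" and Nadd: "\<And>f g. N (f + g) \<le> N f + N g" and Nsc: "\<And>c f. N (c *\<^sub>R f) \<le> \<bar>c\<bar> * N f"
    and K: "K \<ge> 0" and Nm: "\<And>f g. N (mk k f g) \<le> K * (N f * N g)"
    and nm: "\<And>f g. norm (mk k f g) \<le> K * (norm f * N g + N f * norm g + N f * N g)"
    and M: "M \<ge> 0"
  obtains C where "C \<ge> 0"
    "\<And>y. N (cz y) \<le> M \<Longrightarrow> N (cw y) \<le> M \<Longrightarrow> N (S (cg y)) \<le> M \<Longrightarrow> N (pc (cg y)) \<le> M \<Longrightarrow> \<bar>acc k y\<bar> \<le> M
      \<Longrightarrow> norm (F k y) \<le> C * (1 + norm y)"
proof -
  define \<Omega> where "\<Omega> = {y. N (cz y) \<le> M \<and> N (cw y) \<le> M \<and> N (S (cg y)) \<le> M \<and> N (pc (cg y)) \<le> M \<and> \<bar>acc k y\<bar> \<le> M}"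
  \<comment> \<open>Functions of the state that grow at most linearly in norm and are bounded in
    \<open>N\<close> on \<open>\<Omega>\<close>. The class is closed under sums, multiples and, by
    the tame estimate, products; so it contains \<open>wt\<close> and \<open>Phi\<close> once it
    contains their arguments.\<close>
  define tb where "tb f \<longleftrightarrow> (\<exists>C\<ge>0. \<forall>y\<in>\<Omega>. norm (f y) \<le> C * (1 + norm y) \<and> N (f y) \<le> C)" for f :: "state \<Rightarrow> h1"
  have tb_lin: "tb f" if "\<And>y. norm (f y) \<le> C * norm y" "\<And>y. y \<in> \<Omega> \<Longrightarrow> N (f y) \<le> M" for f C
    unfolding tb_def
  proof (intro exI[of _ "\<bar>C\<bar> + M"] conjI ballI)
    fix y assume y: "y \<in> \<Omega>"
    have "norm (f y) \<le> \<bar>C\<bar> * norm y" by (rule order_trans[OF that(1)]) (simp add: mult_right_mono)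
    also have "\<dots> \<le> (\<bar>C\<bar> + M) * (1 + norm y)" by (intro mult_mono) (use M in auto)
    finally show "norm (f y) \<le> (\<bar>C\<bar> + M) * (1 + norm y)" .
    show "N (f y) \<le> \<bar>C\<bar> + M" using that(2)[OF y] by simp
  qed (use M in simp)
  have tb_add: "tb (\<lambda>y. f y + g y)" if f: "tb f" and g: "tb g" for f g
  proof -
    obtain C where C: "C \<ge> 0" "\<And>y. y \<in> \<Omega> \<Longrightarrow> norm (f y) \<le> C * (1 + norm y) \<and> N (f y) \<le> C" using f unfolding tb_def by blast
    obtain D where D: "D \<ge> 0" "\<And>y. y \<in> \<Omega> \<Longrightarrow> norm (g y) \<le> D * (1 + norm y) \<and> N (g y) \<le> D" using g unfolding tb_def by blast
    show ?thesis unfolding tb_def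
    proof (intro exI[of _ "C + D"] conjI ballI)
      fix y assume y: "y \<in> \<Omega>"
      show "norm (f y + g y) \<le> (C + D) * (1 + norm y)"
        unfolding distrib_right by (rule norm_triangle_le) (use C(2)[OF y] D(2)[OF y] in linarith)
      show "N (f y + g y) \<le> C + D" using C(2)[OF y] D(2)[OF y] Nadd[of "f y" "g y"] by linarith
    qed (use C D in simp)
  qed
  have tb_sc: "tb (\<lambda>y. c *\<^sub>R f y)" if f: "tb f" for f c
  proof -
    obtain C where C: "C \<ge> 0" "\<And>y. y \<in> \<Omega> \<Longrightarrow> norm (f y) \<le> C * (1 + norm y) \<and> N (f y) \<le> C" using f unfolding tb_def by blast
    show ?thesis unfolding tb_def
    proof (intro exI[of _ "\<bar>c\<bar> * C"] conjI ballI)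
      fix y assume y: "y \<in> \<Omega>"
      show "norm (c *\<^sub>R f y) \<le> \<bar>c\<bar> * C * (1 + norm y)"
        using C(2)[OF y] by (simp add: mult.assoc mult_left_mono)
      show "N (c *\<^sub>R f y) \<le> \<bar>c\<bar> * C"
        by (rule order_trans[OF Nsc]) (use C(2)[OF y] in \<open>simp add: mult_left_mono\<close>)
    qed (use C in simp)
  qed
  have tb_mk: "tb (\<lambda>y. mk k (f y) (g y))" if f: "tb f" and g: "tb g" for f g
  proof -
    obtain C where C: "C \<ge> 0" "\<And>y. y \<in> \<Omega> \<Longrightarrow> norm (f y) \<le> C * (1 + norm y) \<and> N (f y) \<le> C" using f unfolding tb_def by blast
    obtain D where D: "D \<ge> 0" "\<And>y. y \<in> \<Omega> \<Longrightarrow> norm (g y) \<le> D * (1 + norm y) \<and> N (g y) \<le> D" using g unfolding tb_def by blast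
    show ?thesis unfolding tb_def
    proof (intro exI[of _ "K * (3 * (C * D))"] conjI ballI)
      fix y assume y: "y \<in> \<Omega>"
      note CD = C(2)[OF y] D(2)[OF y]
      have 1: "norm (f y) * N (g y) \<le> (C * (1 + norm y)) * D" using CD C D Nnn by (intro mult_mono) auto
      have 2: "N (f y) * norm (g y) \<le> C * (D * (1 + norm y))" using CD C D Nnn by (intro mult_mono) auto
      have 3: "N (f y) * N (g y) \<le> C * D" using CD C D Nnn by (intro mult_mono) auto
      have 4: "C * D \<le> C * D * (1 + norm y)"
        using mult_left_mono[of 1 "1 + norm y" "C * D"] C D by simp
      have "norm (mk k (f y) (g y)) \<le> K * (norm (f y) * N (g y) + N (f y) * norm (g y) + N (f y) * N (g y))" by (rule nm)
      also have "\<dots> \<le> K * (3 * (C * D * (1 + norm y)))"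
        using 1 2 3 4 by (intro mult_left_mono K) (simp add: algebra_simps)
      finally show "norm (mk k (f y) (g y)) \<le> K * (3 * (C * D)) * (1 + norm y)" by (simp add: mult_ac)
      have "N (mk k (f y) (g y)) \<le> K * (N (f y) * N (g y))" by (rule Nm)
      also have "\<dots> \<le> K * (3 * (C * D))" by (rule mult_left_mono[OF _ K]) (use 3 mult_nonneg_nonneg[OF C(1) D(1)] in linarith)
      finally show "N (mk k (f y) (g y)) \<le> K * (3 * (C * D))" .
    qed (use C D K in simp)
  qed
  obtain Ks where Ks: "\<And>f. norm (S f) \<le> norm f * Ks" using bounded_linear.bounded[OF bounded_linear_S] by blast
  obtain Kp where Kp: "\<And>f. norm (pc f) \<le> norm f * Kp" using bounded_linear.bounded[OF bounded_linear_pc] by blast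
  obtain Kg where Kg: "Kg \<ge> 0" "\<And>f. norm (gk \<mu> k f) \<le> norm f * Kg"
    using bounded_linear.nonneg_bounded[OF bounded_linear_gk[OF \<mu>]] by blast
  have tz: "tb cz" by (rule tb_lin[of _ 1]) (auto simp: norm_components \<Omega>_def)
  have tw: "tb cw" by (rule tb_lin[of _ 1]) (auto simp: norm_components \<Omega>_def)
  have lin: "norm (h (cg y)) \<le> \<bar>Kh\<bar> * norm y" if "\<And>f. norm (h f) \<le> norm f * Kh" for h :: "h1 \<Rightarrow> h1" and Kh y
  proof -
    have "norm (h (cg y)) \<le> norm (cg y) * Kh" by (rule that)
    also have "\<dots> \<le> norm (cg y) * \<bar>Kh\<bar>" by (intro mult_left_mono) auto
    also have "\<dots> \<le> norm y * \<bar>Kh\<bar>" by (intro mult_right_mono norm_components) auto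
    finally show ?thesis by (simp add: mult.commute)
  qed
  have tq: "tb (\<lambda>y. S (cg y))" by (rule tb_lin[of _ "\<bar>Ks\<bar>"]) (auto simp: lin Ks \<Omega>_def)
  have tp: "tb (\<lambda>y. pc (cg y))" by (rule tb_lin[of _ "\<bar>Kp\<bar>"]) (auto simp: lin Kp \<Omega>_def)
  have "tb (\<lambda>y. wt k (cw y) (cg y))" unfolding wt_def by (intro tb_add tb_sc tb_mk tw tp)
  then obtain C1 where C1: "C1 \<ge> 0" "\<And>y. y \<in> \<Omega> \<Longrightarrow> norm (wt k (cw y) (cg y)) \<le> C1 * (1 + norm y)" unfolding tb_def by blast
  have "tb (\<lambda>y. Phi k (cz y) (cw y) (cg y))" unfolding Phi_def by (intro tb_add tb_sc tb_mk tz tw tq)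
  then obtain C2 where C2: "C2 \<ge> 0" "\<And>y. y \<in> \<Omega> \<Longrightarrow> norm (Phi k (cz y) (cw y) (cg y)) \<le> C2 * (1 + norm y)" unfolding tb_def by blast
  define C where "C = \<bar>Kp\<bar> + C1 + Lp * M * norm (Ek \<mu> k) + C2 * Kg + 1 + M + 1 + \<kappa>"
  have C0: "C \<ge> 0" using C1 C2 Kg Lp M \<kappa> by (simp add: C_def)
  show ?thesis
  proof (rule that[OF C0])
    fix y assume "N (cz y) \<le> M" "N (cw y) \<le> M" "N (S (cg y)) \<le> M" "N (pc (cg y)) \<le> M" "\<bar>acc k y\<bar> \<le> M"
    then have y: "y \<in> \<Omega>" by (simp add: \<Omega>_def)
    let ?n = "1 + norm y"
    have n1: "?n \<ge> 1" "norm y \<le> ?n" by auto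
    have c: "norm (cz (F k y)) \<le> \<bar>Kp\<bar> * ?n"
      using order_trans[OF lin[OF Kp, of y] mult_left_mono[OF n1(2), of "\<bar>Kp\<bar>"]] by (simp add: F_def)
    moreover have "norm (cw (F k y)) \<le> C1 * ?n" using C1(2)[OF y] by (simp add: F_def)
    moreover have "norm (cg (F k y)) \<le> Lp * M * norm (Ek \<mu> k) * ?n + C2 * Kg * ?n"
    proof -
      have "norm (cg (F k y)) \<le> norm ((Lp * acc k y) *\<^sub>R Ek \<mu> k) + norm (gk \<mu> k (Phi k (cz y) (cw y) (cg y)))"
        unfolding F_def by (simp add: norm_triangle_ineq4 del: norm_scaleR)
      also have "\<dots> \<le> Lp * M * norm (Ek \<mu> k) + (C2 * ?n) * Kg"
      proof (rule add_mono)
        show "norm ((Lp * acc k y) *\<^sub>R Ek \<mu> k) \<le> Lp * M * norm (Ek \<mu> k)"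
          using Lp \<open>\<bar>acc k y\<bar> \<le> M\<close> by (simp add: abs_mult mult_left_mono mult_right_mono)
        show "norm (gk \<mu> k (Phi k (cz y) (cw y) (cg y))) \<le> (C2 * ?n) * Kg"
          by (rule order_trans[OF Kg(2)]) (intro mult_right_mono C2(2)[OF y] Kg(1))
      qed
      also have "Lp * M * norm (Ek \<mu> k) \<le> Lp * M * norm (Ek \<mu> k) * ?n"
        using mult_left_mono[OF n1(1), of "Lp * M * norm (Ek \<mu> k)"] Lp M by simp
      finally show ?thesis by (simp add: mult_ac)
    qed
    moreover have "\<bar>cb (F k y)\<bar> \<le> 1 * ?n" using norm_components(5)[of y] by (simp add: F_def)
    moreover have "\<bar>cb1 (F k y)\<bar> \<le> M * ?n"
      using order_trans[OF \<open>\<bar>acc k y\<bar> \<le> M\<close>, of "M * ?n"] mult_left_mono[OF n1(1) M] by (simp add: F_def)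
    moreover have "\<bar>cd (F k y)\<bar> \<le> (1 + \<kappa>) * ?n"
    proof -
      have "\<bar>cb y - \<kappa> * cd y\<bar> \<le> \<bar>cb y\<bar> + \<kappa> * \<bar>cd y\<bar>" using \<kappa> abs_triangle_ineq4[of "cb y" "\<kappa> * cd y"] by (simp add: abs_mult)
      also have "\<dots> \<le> norm y + \<kappa> * norm y" by (intro add_mono mult_left_mono norm_components \<kappa>)
      also have "\<dots> \<le> (1 + \<kappa>) * ?n" using \<kappa> by (simp add: algebra_simps)
      finally show ?thesis by (simp add: F_def)
    qed
    ultimately have "norm (F k y) \<le> \<bar>Kp\<bar> * ?n + C1 * ?n + (Lp * M * norm (Ek \<mu> k) * ?n + C2 * Kg * ?n) + 1 * ?n + M * ?n + (1 + \<kappa>) * ?n"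
      using norm_state_le[of "F k y"] by linarith
    also have "\<dots> = C * ?n" by (simp add: C_def algebra_simps)
    finally show "norm (F k y) \<le> C * ?n" .
  qed
qed

lemma fn_Sn_Phi:
  "fn (Sn k (Phi k z w g)) x = fn (Sn k z) x + \<epsilon> / 2 * (fn (Sn k z) x)\<^sup>2
     + \<epsilon> * ((fn (Sn (Suc k) g) x)\<^sup>2 * (1 + fn (Sn k w) x))"
  unfolding Phi_def by (simp add: Sn_linear Sn_mk Sn_S power2_eq_square algebra_simps)

lemma Sn_pc_dr: "dr (Sn (Suc k) h) (Sn k (pc h))"
  using dr_S[of "Sn k h"] by (simp add: pc_def Sn_linear Sn_S)

text \<open>The space derivative of \<open>c e^{x/\<mu>} - \<partial> R1 \<phi>\<close>, in which
  the second derivative of \<open>R1 \<phi>\<close> is eliminated through the elliptic equation.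
  With \<open>c\<close> the scaled acceleration it is the time derivative of
  \<open>q_x\<close>.\<close>

lemma Sn_pc_eq:
  "Sn k (pc (c *\<^sub>R Ek \<mu> k - gk \<mu> k f)) = (c / \<mu>) *\<^sub>R expo \<mu> - (1 / \<mu>\<^sup>2) *\<^sub>R (Rop \<mu> (Sn k f) - Sn k f)"
proof (rule dr_unique[OF Sn_pc_dr])
  have "Sn (Suc k) (c *\<^sub>R Ek \<mu> k - gk \<mu> k f) = c *\<^sub>R expo \<mu> - Pop \<mu> (Sn k f)"
    by (subst Sn_linear, subst Sn_linear, subst Sn_gk[OF \<mu>], subst Sn_Ek[OF \<mu>]) simp
  moreover have "dr (c *\<^sub>R expo \<mu> - Pop \<mu> (Sn k f)) (c *\<^sub>R ((1 / \<mu>) *\<^sub>R expo \<mu>) - (1 / \<mu>\<^sup>2) *\<^sub>R (Rop \<mu> (Sn k f) - Sn k f))"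
    by (intro dr_diff dr_scaleR dr_expo dr_Pop \<mu>)
  ultimately show "dr (Sn (Suc k) (c *\<^sub>R Ek \<mu> k - gk \<mu> k f))
      ((c / \<mu>) *\<^sub>R expo \<mu> - (1 / \<mu>\<^sup>2) *\<^sub>R (Rop \<mu> (Sn k f) - Sn k f))" by simp
qed

lemma acc_sh_funpow: "acc k ((sh ^^ j) y) = acc (k + j) y"
  by (induction j arbitrary: y) (simp_all add: funpow_swap1 acc_sh)

text \<open>The bounds come in an order in which each uses only earlier ones: displacement and
  Duhamel integral, \<open>\<phi>\<close>, acceleration, \<open>q_x\<close>, the state at level 0,
  then one level after another up to \<open>k\<close>. A bounded velocity makes \<open>y\<close>
  Lipschitz in time, so completeness supplies the limit, and the lower bounds on \<open>h_wc\<close>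
  and on the boundary value of \<open>1 + w\<close> survive the passage to the limit.\<close>

lemma continuation:
  assumes s: "ode_sol (F k) (dom k) y0 (ereal T) y" and T: "T > 0"
    and cst0: "\<And>t. t \<in> {0..<T} \<Longrightarrow> cst (Sn k (cz (y t))) (Sn k (cw (y t))) = 0"
    and Mz: "\<And>t x. t \<in> {0..<T} \<Longrightarrow> x \<le> 0 \<Longrightarrow> \<bar>fn (Sn k (cz (y t))) x\<bar> \<le> M"
    and Mq: "\<And>t x. t \<in> {0..<T} \<Longrightarrow> x \<le> 0 \<Longrightarrow> \<bar>fn (Sn (Suc k) (cg (y t))) x\<bar> \<le> M"
    and Mw: "\<And>t x. t \<in> {0..<T} \<Longrightarrow> x \<le> 0 \<Longrightarrow> \<bar>1 + fn (Sn k (cw (y t))) x\<bar> \<le> M"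
    and Mb: "\<And>t. t \<in> {0..<T} \<Longrightarrow> \<bar>cb1 (y t)\<bar> \<le> M"
    and Mh: "\<And>t. t \<in> {0..<T} \<Longrightarrow> 1 / h_wc \<epsilon> \<eta>eq (cb (y t)) \<le> M"
  shows "\<exists>y1\<in>dom k. (y \<longlongrightarrow> y1) (at_left T)"
proof -
  have z0: "0 \<in> {0..<T}" using T by simp
  have M0: "M \<ge> 0" using Mb[OF z0] by linarith
  have sd: "y t \<in> dom k" if "t \<in> {0..<T}" for t using s that by (simp add: ode_sol_def)
  note comp = ode_sol_components[OF s, unfolded time_interval_real]
  obtain Bb where Bb: "Bb \<ge> 0" "\<And>t. t \<in> {0..<T} \<Longrightarrow> norm (cb (y t)) \<le> Bb"
  proof (rule linear_growth_bounded[of T "\<lambda>t. cb (y t)" "\<lambda>t. cb1 (y t)" M])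
    fix t assume t: "t \<in> {0..<T}"
    show "norm (cb1 (y t)) \<le> M * (1 + norm (cb (y t)))"
      using Mb[OF t] mult_left_mono[of 1 "1 + norm (cb (y t))" M] M0 by simp
  qed (use comp(4) in auto)
  obtain Bd where Bd: "Bd \<ge> 0" "\<And>t. t \<in> {0..<T} \<Longrightarrow> norm (cd (y t)) \<le> Bd"
  proof (rule linear_growth_bounded[of T "\<lambda>t. cd (y t)" "\<lambda>t. cb (y t) - \<kappa> * cd (y t)" "Bb + \<kappa>"])
    fix t assume t: "t \<in> {0..<T}"
    have "norm (cb (y t) - \<kappa> * cd (y t)) \<le> Bb + \<kappa> * norm (cd (y t))"
      using Bb(2)[OF t] \<kappa> abs_triangle_ineq4[of "cb (y t)" "\<kappa> * cd (y t)"] by (simp add: abs_mult)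
    also have "\<dots> \<le> (Bb + \<kappa>) * (1 + norm (cd (y t)))" using Bb(1) \<kappa> by (simp add: algebra_simps)
    finally show "norm (cb (y t) - \<kappa> * cd (y t)) \<le> (Bb + \<kappa>) * (1 + norm (cd (y t)))" .
  qed (use comp(6) in auto)
  define ph where "ph t = Sn k (Phi k (cz (y t)) (cw (y t)) (cg (y t)))" for t
  define M\<phi> where "M\<phi> = M + \<epsilon> / 2 * M\<^sup>2 + \<epsilon> * (M\<^sup>2 * M)"
  have sqle: "a\<^sup>2 \<le> M\<^sup>2" if "\<bar>a\<bar> \<le> M" for a :: real using that abs_le_square_iff[of a M] M0 by simp
  have phb: "\<bar>fn (ph t) x\<bar> \<le> M\<phi>" if t: "t \<in> {0..<T}" and x: "x \<le> 0" for t x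
  proof -
    let ?z = "fn (Sn k (cz (y t))) x" and ?q = "fn (Sn (Suc k) (cg (y t))) x" and ?w = "1 + fn (Sn k (cw (y t))) x"
    have "\<bar>fn (ph t) x\<bar> \<le> \<bar>?z\<bar> + \<bar>\<epsilon> / 2 * ?z\<^sup>2\<bar> + \<bar>\<epsilon> * (?q\<^sup>2 * ?w)\<bar>"
      unfolding ph_def fn_Sn_Phi by (intro order_trans[OF abs_triangle_ineq] add_right_mono abs_triangle_ineq)
    also have "\<bar>\<epsilon> / 2 * ?z\<^sup>2\<bar> = \<epsilon> / 2 * ?z\<^sup>2" using \<epsilon> by simp
    also have "\<bar>\<epsilon> * (?q\<^sup>2 * ?w)\<bar> = \<epsilon> * (?q\<^sup>2 * \<bar>?w\<bar>)" using \<epsilon> by (simp add: abs_mult)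
    also have "\<bar>?z\<bar> + \<epsilon> / 2 * ?z\<^sup>2 + \<epsilon> * (?q\<^sup>2 * \<bar>?w\<bar>) \<le> M\<phi>"
      unfolding M\<phi>_def using \<epsilon> by (intro add_mono mult_left_mono mult_mono sqle Mz Mq Mw t x) auto
    finally show ?thesis .
  qed
  have M\<phi>0: "M\<phi> \<ge> 0" using phb[OF z0, of 0] by linarith
  \<comment> \<open>The termwise bound of \<open>num\<close> divided by the lower bound
    \<open>Tbuo^2\<close> of \<open>T2\<close>. In \<open>M^2 + M^2\<close> one square is for the
    boundary value of \<open>1/h\<close>, the other for \<open>1/h_wc\<close>.\<close>
  define A where "A = ((1 + \<bar>P0\<bar>) * Bb + \<kappa> * \<bar>P0\<bar> * Bd + \<epsilon> * (Lp\<^sup>2 / 2 * (M\<^sup>2 + M\<^sup>2)) * M\<^sup>2 + M * (\<epsilon> * M\<^sup>2 / 2 + M\<phi>)) / Tbuo\<^sup>2"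
  have accb: "\<bar>acc k (y t)\<bar> \<le> A" if t: "t \<in> {0..<T}" for t
  proof -
    let ?w0 = "tr k (cw (y t))" and ?z0 = "tr k (cz (y t))" and ?b = "cb (y t)" and ?f0 = "fn (Rop \<mu> (ph t)) 0"
    let ?h = "h_wc \<epsilon> \<eta>eq ?b"
    have h: "?h > 0" "1 + ?w0 > 0" using sd[OF t] by (auto simp: dom_def)
    have f0: "\<bar>?f0\<bar> \<le> M\<phi>" by (rule Rop_sup[OF \<mu>]) (rule phb[OF t])
    have z0: "\<bar>?z0\<bar> \<le> M" "\<bar>1 + ?w0\<bar> \<le> M" unfolding tr_def using Mz[OF t] Mw[OF t] by auto
    have hh: "0 \<le> 1 / (3 * ?h\<^sup>2)" "1 / (3 * ?h\<^sup>2) \<le> M\<^sup>2"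
    proof -
      have "(1 / ?h)\<^sup>2 \<le> M\<^sup>2" using Mh[OF t] h by (intro power_mono) auto
      moreover have "1 / (3 * ?h\<^sup>2) \<le> (1 / ?h)\<^sup>2" using h by (simp add: power_divide field_simps)
      ultimately show "1 / (3 * ?h\<^sup>2) \<le> M\<^sup>2" by linarith
    qed simp
    have be: "\<bar>- (1 + ?w0)\<^sup>2 + 1 / (3 * ?h\<^sup>2)\<bar> \<le> M\<^sup>2 + M\<^sup>2"
      using hh sqle[OF z0(2)] zero_le_power2[of "1 + ?w0"] by linarith
    have "\<bar>num ?z0 ?w0 ?f0 (snd (y t))\<bar> \<le> \<bar>- (1 + P0) * ?b\<bar> + \<bar>\<kappa> * P0 * cd (y t)\<bar>
        + \<bar>\<epsilon> * (Lp\<^sup>2 / 2 * (- (1 + ?w0)\<^sup>2 + 1 / (3 * ?h\<^sup>2))) * (cb1 (y t))\<^sup>2\<bar> + \<bar>(1 + ?w0) * (\<epsilon> * ?z0\<^sup>2 / 2 + ?f0)\<bar>"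
      unfolding num_def split_beta by (intro order_trans[OF abs_triangle_ineq] add_right_mono abs_triangle_ineq)
    also have "\<bar>- (1 + P0) * ?b\<bar> \<le> (1 + \<bar>P0\<bar>) * Bb"
      unfolding abs_mult using Bb(2)[OF t] by (intro mult_mono) auto
    also have "\<bar>\<kappa> * P0 * cd (y t)\<bar> \<le> \<kappa> * \<bar>P0\<bar> * Bd"
      unfolding abs_mult using Bd(2)[OF t] \<kappa> by (intro mult_mono) auto
    also have "\<bar>\<epsilon> * (Lp\<^sup>2 / 2 * (- (1 + ?w0)\<^sup>2 + 1 / (3 * ?h\<^sup>2))) * (cb1 (y t))\<^sup>2\<bar> \<le> \<epsilon> * (Lp\<^sup>2 / 2 * (M\<^sup>2 + M\<^sup>2)) * M\<^sup>2"
    proof -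
      have "\<bar>\<epsilon> * (Lp\<^sup>2 / 2 * (- (1 + ?w0)\<^sup>2 + 1 / (3 * ?h\<^sup>2))) * (cb1 (y t))\<^sup>2\<bar>
          = \<epsilon> * (Lp\<^sup>2 / 2 * \<bar>- (1 + ?w0)\<^sup>2 + 1 / (3 * ?h\<^sup>2)\<bar>) * (cb1 (y t))\<^sup>2"
        using \<epsilon> by (simp only: abs_mult) simp
      also have "\<dots> \<le> \<epsilon> * (Lp\<^sup>2 / 2 * (M\<^sup>2 + M\<^sup>2)) * M\<^sup>2"
        using \<epsilon> be sqle[OF Mb[OF t]] by (intro mult_mono mult_left_mono) auto
      finally show ?thesis .
    qed
    also have "\<bar>(1 + ?w0) * (\<epsilon> * ?z0\<^sup>2 / 2 + ?f0)\<bar> \<le> M * (\<epsilon> * M\<^sup>2 / 2 + M\<phi>)"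
    proof -
      have "\<bar>\<epsilon> * ?z0\<^sup>2 / 2 + ?f0\<bar> \<le> \<epsilon> * ?z0\<^sup>2 / 2 + \<bar>?f0\<bar>" using \<epsilon> abs_triangle_ineq[of "\<epsilon> * ?z0\<^sup>2 / 2" ?f0] by simp
      also have "\<dots> \<le> \<epsilon> * M\<^sup>2 / 2 + M\<phi>"
        using \<epsilon> sqle[OF z0(1)] f0 by (intro add_mono divide_right_mono mult_left_mono) auto
      finally show ?thesis unfolding abs_mult by (intro mult_mono z0 M0) auto
    qed
    finally have n: "\<bar>num ?z0 ?w0 ?f0 (snd (y t))\<bar> \<le> A * Tbuo\<^sup>2" using Tbuo by (simp add: A_def)
    have "\<bar>acc k (y t)\<bar> = \<bar>num ?z0 ?w0 ?f0 (snd (y t))\<bar> / T2 ?w0 ?b"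
      using T2_pos[OF sd[OF t]] by (simp add: acc_def ph_def)
    also have "\<dots> \<le> (A * Tbuo\<^sup>2) / Tbuo\<^sup>2"
      using n T2_ge[OF h] Tbuo by (intro frac_le) auto
    finally show ?thesis using Tbuo by simp
  qed
  have A0: "A \<ge> 0" using accb[OF z0] by linarith
  \<comment> \<open>The bound for the time derivative of \<open>q_x\<close> at a fixed point:
    \<open>expo\<close> is at most 1, and \<open>\<phi>\<close> and \<open>Rop \<phi>\<close> are
    both at most \<open>M\<phi>\<close>.\<close>
  define Cp where "Cp = Lp * A / \<mu> + (1 / \<mu>\<^sup>2) * (M\<phi> + M\<phi>)"
  define Mp where "Mp = norm (Sn k (pc (cg (y 0)))) + Cp * T"
  have Cp0: "Cp \<ge> 0" using Lp A0 \<mu> M\<phi>0 by (simp add: Cp_def)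
  have pb: "\<bar>fn (Sn k (pc (cg (y t)))) x\<bar> \<le> Mp" if t: "t \<in> {0..<T}" and x: "x \<le> 0" for t x
  proof -
    define D where "D s = fn (Sn k (pc ((Lp * acc k (y s)) *\<^sub>R Ek \<mu> k - gk \<mu> k (Phi k (cz (y s)) (cw (y s)) (cg (y s)))))) x" for s
    have "norm (fn (Sn k (pc (cg (y t)))) x - fn (Sn k (pc (cg (y 0)))) x) \<le> Cp * (t - 0)"
    proof (rule vector_derivative_bound[where y' = D])
      fix u assume u: "u \<in> {0..t}"
      then have uT: "u \<in> {0..<T}" using t by auto
      show "((\<lambda>t. fn (Sn k (pc (cg (y t)))) x) has_vector_derivative D u) (at u within {0..t})"
        unfolding D_def
        by (intro bounded_linear.has_vector_derivative[OF bounded_linear_fn] bounded_linear.has_vector_derivative[OF bounded_linear_Sn]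
            bounded_linear.has_vector_derivative[OF bounded_linear_pc] has_vector_derivative_within_subset[OF comp(3)])
           (use uT t in auto)
      have "D u = Lp * acc k (y u) / \<mu> * fn (expo \<mu>) x - (1 / \<mu>\<^sup>2) * (fn (Rop \<mu> (ph u)) x - fn (ph u) x)"
        unfolding D_def Sn_pc_eq by (simp add: ph_def)
      also have "\<bar>\<dots>\<bar> \<le> \<bar>Lp * acc k (y u) / \<mu> * fn (expo \<mu>) x\<bar> + \<bar>(1 / \<mu>\<^sup>2) * (fn (Rop \<mu> (ph u)) x - fn (ph u) x)\<bar>"
        by (rule abs_triangle_ineq4)
      also have "\<bar>Lp * acc k (y u) / \<mu> * fn (expo \<mu>) x\<bar> \<le> Lp * A / \<mu> * 1"
      proof -
        have "\<bar>Lp * acc k (y u) / \<mu>\<bar> \<le> Lp * A / \<mu>"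
          using Lp \<mu> accb[OF uT] by (simp add: abs_mult divide_right_mono)
        then show ?thesis unfolding abs_mult[of "Lp * acc k (y u) / \<mu>"]
          using fn_expo_le[OF \<mu>, of x] Lp A0 \<mu> by (intro mult_mono) simp_all
      qed
      also have "\<bar>(1 / \<mu>\<^sup>2) * (fn (Rop \<mu> (ph u)) x - fn (ph u) x)\<bar> \<le> (1 / \<mu>\<^sup>2) * (M\<phi> + M\<phi>)"
      proof -
        have "\<bar>fn (Rop \<mu> (ph u)) x - fn (ph u) x\<bar> \<le> M\<phi> + M\<phi>"
          using Rop_sup[OF \<mu>, of "ph u" M\<phi> x] phb[OF uT] x by (smt (verit, best))
        then show ?thesis unfolding abs_mult by (simp add: divide_right_mono)
      qed
      finally show "norm (D u) \<le> Cp" by (simp add: Cp_def)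
    qed (use t in simp)
    also have "Cp * (t - 0) \<le> Cp * T" using t Cp0 by (intro mult_left_mono) auto
    finally have "\<bar>fn (Sn k (pc (cg (y t)))) x - fn (Sn k (pc (cg (y 0)))) x\<bar> \<le> Cp * T" by simp
    then show ?thesis using fn_norm[of "Sn k (pc (cg (y 0)))" x] unfolding Mp_def by linarith
  qed
  \<comment> \<open>The same trajectory seen at regularity \<open>j\<close>. The acceleration does
    not depend on the level, so its bound serves at all of them.\<close>
  define Y where "Y j t = (sh ^^ (k - j)) (y t)" for j t
  have Ysol: "ode_sol (F j) (dom j) (Y j 0) (ereal T) (Y j)" if "j \<le> k" for j
  proof -
    have "y 0 = y0" using s by (simp add: ode_sol_def)
    then show ?thesis using ode_sol_sh_funpow[of j "k - j" y0 "ereal T" y] s that by (simp add: Y_def[abs_def])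
  qed
  have Yacc: "acc j (Y j t) = acc k (y t)" if "j \<le> k" for j t using that by (simp add: Y_def acc_sh_funpow)
  have claim: "\<exists>B\<ge>0. \<forall>t\<in>{0..<T}. norm (Y j t) \<le> B \<and> norm (F j (Y j t)) \<le> B" if "j \<le> k" for j
    using that
  proof (induction j)
    case 0
    \<comment> \<open>The 1 accounts for
      \<open>\<bar>w\<bar> \<le> \<bar>1 + w\<bar> + 1\<close>.\<close>
    define M1 where "M1 = M + 1 + Mp + A"
    have Mp0: "Mp \<ge> 0" using pb[OF z0, of 0] by linarith
    have M10: "M1 \<ge> 0" using M0 Mp0 A0 by (simp add: M1_def)
    obtain C where C: "C \<ge> 0" "\<And>y. sn (cz y) \<le> M1 \<Longrightarrow> sn (cw y) \<le> M1 \<Longrightarrow> sn (S (cg y)) \<le> M1 \<Longrightarrow> sn (pc (cg y)) \<le> M1 \<Longrightarrow> \<bar>acc 0 y\<bar> \<le> M1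
      \<Longrightarrow> norm (F 0 y) \<le> C * (1 + norm y)"
    proof (rule F_growth[of sn 1 0 M1])
      show "norm (mk 0 f g) \<le> 1 * (norm f * sn g + sn f * norm g + sn f * sn g)" for f g
        using norm_mult_sn[of f g] mult_nonneg_nonneg[OF sn_nonneg[of f] sn_nonneg[of g]] by simp
    qed (use M10 sn_nonneg sn_add sn_scaleR sn_mult in auto)
    have gr: "norm (F 0 (Y 0 t)) \<le> C * (1 + norm (Y 0 t))" if t: "t \<in> {0..<T}" for t
    proof (rule C(2))
      have c: "cz (Y 0 t) = Sn k (cz (y t))" "cw (Y 0 t) = Sn k (cw (y t))" "cg (Y 0 t) = Sn k (cg (y t))"
        by (auto simp: Y_def sh_funpow)
      show "sn (cz (Y 0 t)) \<le> M1" unfolding c by (rule sn_least) (use Mz[OF t] Mp0 A0 in \<open>force simp: M1_def\<close>)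
      show "sn (cw (Y 0 t)) \<le> M1" unfolding c
      proof (rule sn_least)
        fix x :: real assume "x \<le> 0"
        from Mw[OF t this] show "\<bar>fn (Sn k (cw (y t))) x\<bar> \<le> M1" using Mp0 A0 unfolding M1_def by linarith
      qed
      show "sn (S (cg (Y 0 t))) \<le> M1" unfolding c
      proof (rule sn_least)
        fix x :: real assume "x \<le> 0"
        from Mq[OF t this] show "\<bar>fn (S (Sn k (cg (y t)))) x\<bar> \<le> M1" using Mp0 A0 unfolding M1_def by simp
      qed
      show "sn (pc (cg (Y 0 t))) \<le> M1" unfolding c
      proof (rule sn_least)
        fix x :: real assume "x \<le> 0"
        moreover have "pc (Sn k (cg (y t))) = Sn k (pc (cg (y t)))" by (simp add: pc_def Sn_linear Sn_S)
        ultimately show "\<bar>fn (pc (Sn k (cg (y t)))) x\<bar> \<le> M1" using pb[OF t, of x] M0 A0 unfolding M1_def by simp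
      qed
      show "\<bar>acc 0 (Y 0 t)\<bar> \<le> M1" using accb[OF t] M0 Mp0 by (simp add: Yacc M1_def)
    qed
    obtain B where B: "B \<ge> 0" "\<And>t. t \<in> {0..<T} \<Longrightarrow> norm (Y 0 t) \<le> B"
    proof (rule linear_growth_bounded[of T "Y 0" "\<lambda>t. F 0 (Y 0 t)" C])
      show "(Y 0 has_vector_derivative F 0 (Y 0 t)) (at t within {0..<T})" if "t \<in> {0..<T}" for t
        using Ysol[of 0] that by (simp add: ode_sol_def)
    qed (use gr in auto)
    have "norm (F 0 (Y 0 t)) \<le> C * (1 + B)" if t: "t \<in> {0..<T}" for t
      by (rule order_trans[OF gr[OF t]]) (intro mult_left_mono C(1), use B(2)[OF t] in simp)
    then show ?case using B C(1)
      by (intro exI[of _ "B + C * (1 + B)"]) (auto intro: order_trans add_increasing add_increasing2)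
  next
    case (Suc j)
    then obtain B0 where B0: "B0 \<ge> 0" "\<And>t. t \<in> {0..<T} \<Longrightarrow> norm (Y j t) \<le> B0" by auto
    have Yj: "Y j t = sh (Y (Suc j) t)" for t
      using Suc.prems by (simp add: Y_def Suc_diff_Suc[symmetric])
    obtain K where K: "K \<ge> 0" "\<And>u v. norm (mk (Suc j) u v) \<le> K * (norm u * norm (S v) + norm (S u) * norm v + norm (S u) * norm (S v))"
      using mk_Suc_tame by blast
    obtain K' where K': "K' \<ge> 0" "\<And>u v. norm (mk j u v) \<le> norm u * norm v * K'"
      using bounded_bilinear.nonneg_bounded[OF bounded_bilinear_mk] by blast
    obtain Ks where Ks: "Ks \<ge> 0" "\<And>f. norm (S f) \<le> norm f * Ks" using bounded_linear.nonneg_bounded[OF bounded_linear_S] by blast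
    obtain Kp where Kp: "Kp \<ge> 0" "\<And>f. norm (pc f) \<le> norm f * Kp" using bounded_linear.nonneg_bounded[OF bounded_linear_pc] by blast
    \<comment> \<open>\<open>B0\<close> bounds the state at level \<open>j\<close>, hence the
      \<open>S\<close>-images of the components at level \<open>Suc j\<close>. The factors
      \<open>Ks\<close> and \<open>Kp\<close> are for the additional \<open>S\<close> or
      \<open>pc\<close> on the discharge component.\<close>
    define M1 where "M1 = B0 + B0 * Ks + B0 * Kp + A"
    have M10: "M1 \<ge> 0" using B0(1) Ks(1) Kp(1) A0 by (simp add: M1_def)
    obtain C where C: "C \<ge> 0" "\<And>y. norm (S (cz y)) \<le> M1 \<Longrightarrow> norm (S (cw y)) \<le> M1 \<Longrightarrow> norm (S (S (cg y))) \<le> M1 \<Longrightarrow> norm (S (pc (cg y))) \<le> M1 \<Longrightarrow> \<bar>acc (Suc j) y\<bar> \<le> M1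
      \<Longrightarrow> norm (F (Suc j) y) \<le> C * (1 + norm y)"
    proof (rule F_growth[of "\<lambda>f. norm (S f)" "K + K'" "Suc j" M1])
      fix f g
      show "norm (S (mk (Suc j) f g)) \<le> (K + K') * (norm (S f) * norm (S g))"
        unfolding S_mk_Suc by (rule order_trans[OF K'(2)]) (use K in \<open>simp add: algebra_simps\<close>)
      show "norm (mk (Suc j) f g) \<le> (K + K') * (norm f * norm (S g) + norm (S f) * norm g + norm (S f) * norm (S g))"
        by (rule order_trans[OF K(2)], rule mult_right_mono) (use K' in auto)
      show "norm (S (f + g)) \<le> norm (S f) + norm (S g)" by (simp add: S_linear norm_triangle_ineq)
    qed (use M10 K K' in \<open>auto simp: S_linear\<close>)
    have gr: "norm (F (Suc j) (Y (Suc j) t)) \<le> C * (1 + norm (Y (Suc j) t))" if t: "t \<in> {0..<T}" for t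
    proof (rule C(2))
      have n: "norm (S (cz (Y (Suc j) t))) \<le> B0" "norm (S (cw (Y (Suc j) t))) \<le> B0" "norm (S (cg (Y (Suc j) t))) \<le> B0"
        using norm_components(1-3)[of "Y j t"] B0(2)[OF t] unfolding Yj sh_def by auto
      show "norm (S (cz (Y (Suc j) t))) \<le> M1" "norm (S (cw (Y (Suc j) t))) \<le> M1"
        using n(1,2) B0(1) Ks(1) Kp(1) A0 by (auto simp: M1_def intro!: add_increasing2)
      have "norm (S (S (cg (Y (Suc j) t)))) \<le> B0 * Ks" by (rule order_trans[OF Ks(2)]) (intro mult_right_mono n Ks)
      then show "norm (S (S (cg (Y (Suc j) t)))) \<le> M1" using B0(1) Kp(1) A0 by (simp add: M1_def add_increasing add_increasing2)
      have "norm (S (pc (cg (Y (Suc j) t)))) \<le> B0 * Kp"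
        unfolding S_pc by (rule order_trans[OF Kp(2)]) (intro mult_right_mono n Kp)
      then show "norm (S (pc (cg (Y (Suc j) t)))) \<le> M1" using B0(1) Ks(1) A0 by (simp add: M1_def add_increasing add_increasing2)
      show "\<bar>acc (Suc j) (Y (Suc j) t)\<bar> \<le> M1"
        using accb[OF t] B0(1) Ks(1) Kp(1) Suc.prems by (simp add: Yacc M1_def add_increasing)
    qed
    obtain B where B: "B \<ge> 0" "\<And>t. t \<in> {0..<T} \<Longrightarrow> norm (Y (Suc j) t) \<le> B"
    proof (rule linear_growth_bounded[of T "Y (Suc j)" "\<lambda>t. F (Suc j) (Y (Suc j) t)" C])
      show "(Y (Suc j) has_vector_derivative F (Suc j) (Y (Suc j) t)) (at t within {0..<T})" if "t \<in> {0..<T}" for t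
        using Ysol[OF Suc.prems] that by (simp add: ode_sol_def)
    qed (use gr in auto)
    have "norm (F (Suc j) (Y (Suc j) t)) \<le> C * (1 + B)" if t: "t \<in> {0..<T}" for t
      by (rule order_trans[OF gr[OF t]]) (intro mult_left_mono C(1), use B(2)[OF t] in simp)
    then show ?case using B C(1)
      by (intro exI[of _ "B + C * (1 + B)"]) (auto intro: order_trans add_increasing add_increasing2)
  qed
  from claim[of k] obtain B where B: "B \<ge> 0" "\<And>t. t \<in> {0..<T} \<Longrightarrow> norm (F k (y t)) \<le> B"
    by (auto simp: Y_def)
  have lip: "B-lipschitz_on {0..<T} y"
  proof (rule lipschitz_on_leI[OF _ B(1)])
    fix a b assume ab: "a \<in> {0..<T}" "b \<in> {0..<T}" "a \<le> b"
    have "norm (y b - y a) \<le> B * (b - a)"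
    proof (rule vector_derivative_bound[OF ab(3), where y' = "\<lambda>t. F k (y t)"])
      fix t assume "t \<in> {a..b}"
      then have tT: "t \<in> {0..<T}" using ab by auto
      show "norm (F k (y t)) \<le> B" by (rule B(2)[OF tT])
      have "(y has_vector_derivative F k (y t)) (at t within {0..<T})" using s tT by (simp add: ode_sol_def)
      then show "(y has_vector_derivative F k (y t)) (at t within {a..b})"
        by (rule has_vector_derivative_within_subset) (use ab in auto)
    qed
    then show "dist (y a) (y b) \<le> B * dist a b" using ab(3) by (simp add: dist_norm norm_minus_commute)
  qed
  have "uniformly_continuous_on {0..<T} y" by (rule lipschitz_on_uniformly_continuous[OF lip])
  moreover have "T \<in> closure {0..<T}" using T by simp
  ultimately obtain y1 where y1: "(y \<longlongrightarrow> y1) (at T within {0..<T})"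
    using uniformly_continuous_on_extension_at_closure by blast
  have at: "at T within {0..<T} = at_left T"
    by (rule at_within_nhd[of _ "{0<..}"]) (use T in auto)
  have lim: "(y \<longlongrightarrow> y1) (at_left T)" using y1 by (simp add: at)
  have ev: "\<forall>\<^sub>F t in at_left T. t \<in> {0..<T}"
    using T by (auto simp: eventually_at_left intro!: exI[of _ 0])
  have M1: "M > 0"
    using Mh[OF z0] sd[OF z0] by (auto simp: dom_def intro: less_le_trans[of 0 "1 / h_wc \<epsilon> \<eta>eq (cb (y 0))" M])
  have "h_wc \<epsilon> \<eta>eq (cb y1) \<ge> 1 / M"
  proof (rule tendsto_lowerbound[OF _ _ trivial_limit_at_left_real])
    show "((\<lambda>t. h_wc \<epsilon> \<eta>eq (cb (y t))) \<longlongrightarrow> h_wc \<epsilon> \<eta>eq (cb y1)) (at_left T)"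
      unfolding h_wc_def by (intro tendsto_intros bounded_linear.tendsto[OF bounded_linear_components(4)] lim)
    show "\<forall>\<^sub>F t in at_left T. 1 / M \<le> h_wc \<epsilon> \<eta>eq (cb (y t))"
      using ev
    proof eventually_elim
      case (elim t)
      then show ?case using Mh[OF elim] sd[OF elim] M1 by (simp add: dom_def field_simps)
    qed
  qed
  \<comment> \<open>The upper bound on \<open>\<zeta>\<close> bounds \<open>h\<close> from above and
    so \<open>1/h\<close> from below; the constraint identifies \<open>1/h\<close> with
    \<open>1 + w\<close>.\<close>
  moreover have "1 + tr k (cw y1) \<ge> 1 / (1 + \<epsilon> * M)"
  proof (rule tendsto_lowerbound[OF _ _ trivial_limit_at_left_real])
    show "((\<lambda>t. 1 + tr k (cw (y t))) \<longlongrightarrow> 1 + tr k (cw y1)) (at_left T)"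
      by (intro tendsto_intros bounded_linear.tendsto[OF bounded_linear_tr] bounded_linear.tendsto[OF bounded_linear_components(2)] lim)
    show "\<forall>\<^sub>F t in at_left T. 1 / (1 + \<epsilon> * M) \<le> 1 + tr k (cw (y t))"
      using ev
    proof eventually_elim
      case (elim t)
      define a where "a = 1 + \<epsilon> * tr k (cz (y t))"
      have eq: "(1 + tr k (cw (y t))) * a = 1" using cst_fn[OF cst0[OF elim], of 0] by (simp add: tr_def a_def)
      have w: "1 + tr k (cw (y t)) > 0" using sd[OF elim] by (simp add: dom_def)
      then have a: "a > 0" using eq by (metis zero_less_mult_pos zero_less_one)
      have "\<epsilon> * tr k (cz (y t)) \<le> \<epsilon> * M"
        using Mz[OF elim, of 0] \<epsilon> by (intro mult_left_mono) (auto simp: tr_def)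
      then have "a \<le> 1 + \<epsilon> * M" by (simp add: a_def)
      then have "1 / (1 + \<epsilon> * M) \<le> 1 / a" using a by (simp add: frac_le)
      also have "1 / a = 1 + tr k (cw (y t))" using eq a by (simp add: field_simps)
      finally show ?case .
    qed
  qed
  ultimately have "y1 \<in> dom k"
    using M1 \<epsilon> unfolding dom_def
    by (auto intro: less_le_trans[rotated] simp: add_pos_nonneg)
  then show ?thesis using lim by blast
qed

end

section \<open>Test functions and weak derivatives\<close>

text \<open>Differentiability of order \<open>n\<close> with a free witness for the derivative at
  each stage. Closure under sums, products and affine changes then goes by induction on
  \<open>n\<close>, without computing iterates of \<open>deriv\<close>.\<close>

fun nd :: "nat \<Rightarrow> (real \<Rightarrow> real) \<Rightarrow> bool" where
  "nd 0 f \<longleftrightarrow> True"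
| "nd (Suc n) f \<longleftrightarrow> (\<exists>f'. (\<forall>x. (f has_real_derivative f' x) (at x)) \<and> nd n f')"

lemma nd_Suc_deriv: "nd (Suc n) f \<Longrightarrow> (\<forall>x. (f has_real_derivative deriv f x) (at x)) \<and> nd n (deriv f)"
proof -
  assume "nd (Suc n) f"
  then obtain f' where f': "\<And>x. (f has_real_derivative f' x) (at x)" "nd n f'" by auto
  then have "deriv f = f'" by (auto simp: fun_eq_iff intro: DERIV_imp_deriv)
  then show ?thesis using f' by simp
qed

lemma nd_mono: "nd (Suc n) f \<Longrightarrow> nd n f"
  by (induction n arbitrary: f) (simp, metis nd.simps(2))

lemma smooth_iff_nd: "(\<forall>n x. (deriv ^^ n) f field_differentiable at x) \<longleftrightarrow> (\<forall>n. nd n f)"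
proof
  assume *: "\<forall>n x. (deriv ^^ n) f field_differentiable at x"
  have "nd n ((deriv ^^ j) f)" for n j
  proof (induction n arbitrary: j)
    case (Suc n)
    have "\<forall>x. ((deriv ^^ j) f has_real_derivative (deriv ^^ Suc j) f x) (at x)"
      using * by (simp add: DERIV_deriv_iff_field_differentiable)
    moreover have "nd n ((deriv ^^ Suc j) f)" by (rule Suc)
    ultimately show ?case by (simp only: nd.simps) blast
  qed simp
  from this[of _ 0] show "\<forall>n. nd n f" by simp
next
  have *: "nd (Suc n) f \<Longrightarrow> (deriv ^^ n) f field_differentiable at x" for n x f
  proof (induction n arbitrary: f)
    case 0 then show ?case by (auto simp: field_differentiable_def)
  next
    case (Suc n)
    then have "nd (Suc n) (deriv f)" using nd_Suc_deriv by blast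
    from Suc.IH[OF this] show ?case by (simp add: funpow_swap1)
  qed
  assume "\<forall>n. nd n f" then show "\<forall>n x. (deriv ^^ n) f field_differentiable at x" using * by blast
qed

lemma nd_const: "nd n (\<lambda>x. c)"
  by (induction n arbitrary: c) (auto intro!: exI[of _ "\<lambda>x. 0"] derivative_eq_intros)

lemma nd_add: "nd n f \<Longrightarrow> nd n g \<Longrightarrow> nd n (\<lambda>x. f x + g x)"
proof (induction n arbitrary: f g)
  case (Suc n)
  then obtain f' g' where "\<And>x. (f has_real_derivative f' x) (at x)" "nd n f'"
    "\<And>x. (g has_real_derivative g' x) (at x)" "nd n g'" by auto
  with Suc.IH show ?case by (auto intro!: exI[of _ "\<lambda>x. f' x + g' x"] derivative_intros)
qed simp

lemma nd_mult: "nd n f \<Longrightarrow> nd n g \<Longrightarrow> nd n (\<lambda>x. f x * g x)"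
proof (induction n arbitrary: f g)
  case (Suc n)
  then obtain f' g' where d: "\<And>x. (f has_real_derivative f' x) (at x)" "nd n f'"
    "\<And>x. (g has_real_derivative g' x) (at x)" "nd n g'" by auto
  have "nd n f" "nd n g" using Suc.prems nd_mono by blast+
  then have "nd n (\<lambda>x. f' x * g x + g' x * f x)" by (intro nd_add Suc.IH d)
  moreover have "((\<lambda>x. f x * g x) has_real_derivative f' x * g x + g' x * f x) (at x)" for x
    by (rule DERIV_mult[OF d(1,3)])
  ultimately show ?case unfolding nd.simps by (intro exI[of _ "\<lambda>x. f' x * g x + g' x * f x"] conjI allI)
qed simp

lemma nd_affine: "nd n f \<Longrightarrow> nd n (\<lambda>x. f (c * x + d))"
proof (induction n arbitrary: f)
  case (Suc n)
  then obtain f' where d: "\<And>x. (f has_real_derivative f' x) (at x)" "nd n f'" by auto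
  have "nd n (\<lambda>x. f' (c * x + d) * c)" by (intro nd_mult nd_const Suc.IH d)
  moreover have "((\<lambda>x. f (c * x + d)) has_real_derivative f' (c * x + d) * c) (at x)" for x
    by (rule DERIV_chain2[OF d(1)]) (auto intro!: derivative_eq_intros)
  ultimately show ?case unfolding nd.simps by (intro exI[of _ "\<lambda>x. f' (c * x + d) * c"] conjI allI)
qed simp

text \<open>The derivatives of \<open>exp (-1/x)\<close> are of the form \<open>p (1/x) exp (-1/x)\<close> with polynomials \<open>p\<close>.\<close>

definition ebump :: "real poly \<Rightarrow> real \<Rightarrow> real" where
  "ebump p x = (if x > 0 then poly p (1 / x) * exp (- (1 / x)) else 0)"

lemma poly_exp_tendsto_0: "((\<lambda>y::real. poly p y * exp (- y)) \<longlongrightarrow> 0) at_top"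
proof -
  have "((\<lambda>y::real. \<Sum>i\<le>degree p. coeff p i * (y ^ i / exp y)) \<longlongrightarrow> (\<Sum>i\<le>degree p. coeff p i * 0)) at_top"
    by (intro tendsto_sum tendsto_mult tendsto_const tendsto_power_div_exp_0)
  moreover have "(\<Sum>i\<le>degree p. coeff p i * (y ^ i / exp y)) = poly p y * exp (- y)" for y :: real
    by (simp add: poly_altdef exp_minus sum_distrib_left sum_distrib_right divide_inverse mult_ac)
  ultimately show ?thesis by simp
qed

lemma ebump_tendsto: "(ebump p \<longlongrightarrow> 0) (at_right 0)"
proof -
  have "((\<lambda>x. poly p (inverse x) * exp (- inverse x)) \<longlongrightarrow> 0) (at_right 0)"
    using filterlim_compose[OF poly_exp_tendsto_0 filterlim_inverse_at_top_right] .
  moreover have "\<forall>\<^sub>F x in at_right 0. poly p (inverse x) * exp (- inverse x) = ebump p x"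
    by (auto simp: eventually_at_right_field ebump_def divide_inverse intro!: exI[of _ 1])
  ultimately show ?thesis by (rule Lim_transform_eventually)
qed

text \<open>With \<open>y = 1/x\<close> and \<open>dy/dx = - y^2\<close>, the derivative of
  \<open>p(y) e^{-y}\<close> is \<open>y^2 (p - p')(y) e^{-y}\<close>; the factor
  \<open>[:0, 0, 1:]\<close> is \<open>y^2\<close>.\<close>

lemma ebump_deriv: "(ebump p has_real_derivative ebump ([:0, 0, 1:] * (p - pderiv p)) x) (at x)"
proof -
  consider "x > 0" | "x < 0" | "x = 0" by linarith
  then show ?thesis
  proof cases
    case 1
    have "((\<lambda>x. poly p (1 / x) * exp (- (1 / x))) has_real_derivative ebump ([:0, 0, 1:] * (p - pderiv p)) x) (at x)"
      using 1 by (auto intro!: derivative_eq_intros simp: ebump_def power2_eq_square field_simps)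
    then show ?thesis
      by (rule has_field_derivative_transform_within_open[of _ _ _ "{0<..}"]) (use 1 in \<open>auto simp: ebump_def\<close>)
  next
    case 2
    have "((\<lambda>x. 0) has_real_derivative ebump ([:0, 0, 1:] * (p - pderiv p)) x) (at x)"
      using 2 by (simp add: ebump_def)
    then show ?thesis
      by (rule has_field_derivative_transform_within_open[of _ _ _ "{..<0}"]) (use 2 in \<open>auto simp: ebump_def\<close>)
  next
    case 3
    \<comment> \<open>Dividing by \<open>h\<close> multiplies the polynomial by \<open>y\<close>,
      that is, turns \<open>p\<close> into \<open>pCons 0 p\<close>; the difference quotient at 0 is
      again of the same form.\<close>
    have r: "((\<lambda>h. ebump p h / h) \<longlongrightarrow> 0) (at_right 0)"
    proof (rule Lim_transform_eventually[OF ebump_tendsto[of "pCons 0 p"]])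
      show "\<forall>\<^sub>F x in at_right 0. ebump (pCons 0 p) x = ebump p x / x"
        by (auto simp: eventually_at_right_field ebump_def intro!: exI[of _ 1])
    qed
    have l: "((\<lambda>h. ebump p h / h) \<longlongrightarrow> 0) (at_left 0)"
      by (rule tendsto_eventually) (auto simp: eventually_at_left_field ebump_def intro!: exI[of _ "-1"])
    have "((\<lambda>h. ebump p h / h) \<longlongrightarrow> 0) (at 0)" using r l by (simp add: filterlim_at_split)
    then have "(ebump p has_real_derivative 0) (at 0)" by (simp add: DERIV_def) (simp add: ebump_def)
    then show ?thesis using 3 by (simp add: ebump_def)
  qed
qed

lemma nd_ebump: "nd n (ebump p)"
  by (induction n arbitrary: p) (auto intro: ebump_deriv)

text \<open>Scaling by \<open>n + 1\<close> sends both factors to 1 at every interior point, because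
  \<open>exp (- 1/(n d))\<close> tends to 1, while the support stays in \<open>[a, b]\<close>.
  Indicators of intervals are thus almost-everywhere limits of test functions bounded by 1.\<close>

definition bump :: "real \<Rightarrow> real \<Rightarrow> nat \<Rightarrow> real \<Rightarrow> real" where
  "bump a b n x = ebump 1 (real (Suc n) * x + - (real (Suc n) * a)) * ebump 1 (- real (Suc n) * x + real (Suc n) * b)"

lemma bump_test_function:
  assumes "{a..b} \<subseteq> E" shows "test_function E (bump a b n)"
  unfolding test_function_def smooth_iff_nd
proof (intro conjI allI)
  show "nd j (bump a b n)" for j
    unfolding bump_def[abs_def] by (intro nd_mult nd_affine nd_ebump)
  have "bump a b n x = 0" if "x \<notin> {a..b}" for x
  proof -
    have "real (Suc n) * (x - a) \<le> 0 \<or> real (Suc n) * (b - x) \<le> 0"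
      using that by (auto simp: mult_nonneg_nonpos)
    then show ?thesis by (auto simp: bump_def ebump_def algebra_simps)
  qed
  then show "\<exists>K. compact K \<and> K \<subseteq> E \<and> (\<forall>x. x \<notin> K \<longrightarrow> bump a b n x = 0)"
    using assms by (intro exI[of _ "{a..b}"]) auto
qed

lemma ebump_1_bounds: "0 \<le> ebump 1 x" "ebump 1 x \<le> 1"
  by (auto simp: ebump_def)

lemma bump_bounds: "0 \<le> bump a b n x" "bump a b n x \<le> 1" "x \<notin> {a..b} \<Longrightarrow> bump a b n x = 0"
proof -
  show "0 \<le> bump a b n x" "bump a b n x \<le> 1"
    unfolding bump_def using ebump_1_bounds by (auto intro: mult_le_one)
  assume "x \<notin> {a..b}"
  then have "real (Suc n) * (x - a) \<le> 0 \<or> real (Suc n) * (b - x) \<le> 0"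
    by (auto simp: mult_nonneg_nonpos)
  then show "bump a b n x = 0" by (auto simp: bump_def ebump_def algebra_simps)
qed

lemma bump_tendsto: "a < x \<Longrightarrow> x < b \<Longrightarrow> (\<lambda>n. bump a b n x) \<longlonglongrightarrow> 1"
proof -
  have e: "(\<lambda>n. ebump 1 (real (Suc n) * d)) \<longlonglongrightarrow> 1" if d: "d > 0" for d
  proof -
    have "(\<lambda>n. exp (- (inverse (real (Suc n)) * (1 / d)))) \<longlonglongrightarrow> exp (- (0 * (1 / d)))"
      by (intro tendsto_intros LIMSEQ_inverse_real_of_nat)
    moreover have "exp (- (inverse (real (Suc n)) * (1 / d))) = ebump 1 (real (Suc n) * d)" for n
      using d by (simp add: ebump_def divide_inverse)
    ultimately show ?thesis by simp
  qed
  assume "a < x" "x < b"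
  then have "(\<lambda>n. ebump 1 (real (Suc n) * (x - a)) * ebump 1 (real (Suc n) * (b - x))) \<longlonglongrightarrow> 1 * 1"
    by (intro tendsto_mult e) auto
  moreover have "ebump 1 (real (Suc n) * (x - a)) * ebump 1 (real (Suc n) * (b - x)) = bump a b n x" for n
    by (simp add: bump_def algebra_simps)
  ultimately show ?thesis by simp
qed

lemma test_function_deriv:
  assumes "test_function E \<phi>"
  shows "(\<phi> has_real_derivative deriv \<phi> x) (at x)" "test_function E (deriv \<phi>)"
proof -
  obtain K where K: "compact K" "K \<subseteq> E" "\<And>x. x \<notin> K \<Longrightarrow> \<phi> x = 0" using assms by (auto simp: test_function_def)
  have s: "\<And>n x. (deriv ^^ n) \<phi> field_differentiable at x" using assms by (simp add: test_function_def)
  show "(\<phi> has_real_derivative deriv \<phi> x) (at x)"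
    using s[of 0 x] by (simp add: DERIV_deriv_iff_field_differentiable)
  have "(deriv ^^ n) (deriv \<phi>) field_differentiable at x" for n x
    using s[of "Suc n" x] by (simp add: funpow_swap1)
  moreover have "deriv \<phi> x = 0" if "x \<notin> K" for x
  proof -
    have "((\<lambda>x. 0) has_real_derivative 0) (at x)" by simp
    then have "(\<phi> has_real_derivative 0) (at x)"
      by (rule has_field_derivative_transform_within_open[of _ _ _ "- K"])
         (use that K in \<open>auto simp: compact_imp_closed open_Compl\<close>)
    then show ?thesis by (rule DERIV_imp_deriv)
  qed
  ultimately show "test_function E (deriv \<phi>)" using K unfolding test_function_def by blast
qed

lemma test_function_continuous: "test_function E \<phi> \<Longrightarrow> continuous_on A \<phi>"
  using test_function_deriv(1) by (meson DERIV_isCont continuous_at_imp_continuous_on)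

lemma test_function_lincomb:
  assumes "test_function E \<phi>" "test_function E \<psi>"
  shows "test_function E (\<lambda>x. \<phi> x + c * \<psi> x)"
proof -
  obtain K L where K: "compact K" "K \<subseteq> E" "\<And>x. x \<notin> K \<Longrightarrow> \<phi> x = 0"
    and L: "compact L" "L \<subseteq> E" "\<And>x. x \<notin> L \<Longrightarrow> \<psi> x = 0"
    using assms unfolding test_function_def by metis
  have "\<forall>n. nd n (\<lambda>x. \<phi> x + c * \<psi> x)"
    using assms by (auto simp: test_function_def smooth_iff_nd intro!: nd_add nd_mult nd_const)
  moreover have "\<phi> x + c * \<psi> x = 0" if "x \<notin> K \<union> L" for x using that K L by auto
  ultimately show ?thesis unfolding test_function_def smooth_iff_nd
    using K L by (intro conjI exI[of _ "K \<union> L"]) auto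
qed

section \<open>The fundamental lemma and weakly constant functions\<close>

lemma borel_imp_lebesgue_measurable: "f \<in> borel_measurable borel \<Longrightarrow> f \<in> borel_measurable lebesgue"
  by (rule measurable_completion) (simp only: measurable_lborel2)

lemma locally_integrable_mult:
  assumes g: "locally_integrable E g" and K: "compact K" "K \<subseteq> E" and E: "E \<in> sets lebesgue"
    and c: "continuous_on UNIV \<phi>" and z: "\<And>x. x \<notin> K \<Longrightarrow> \<phi> x = 0"
  shows "integrable (lebesgue_on E) (\<lambda>x. g x * \<phi> x)"
    "(LINT x|lebesgue_on E. g x * \<phi> x) = (LINT x|lebesgue. indicator K x * (g x * \<phi> x))"
proof -
  have "compact (\<phi> ` K)" by (intro compact_continuous_image continuous_on_subset[OF c] K) auto
  then have "bounded (\<phi> ` K)" by (rule compact_imp_bounded)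
  then obtain C where C: "\<And>x. x \<in> K \<Longrightarrow> \<bar>\<phi> x\<bar> \<le> C" unfolding bounded_iff by auto
  have gK: "integrable lebesgue (\<lambda>x. indicator K x * g x)"
    using g K by (auto simp: locally_integrable_def set_integrable_def)
  have "\<phi> \<in> borel_measurable lebesgue"
    using borel_measurable_continuous_onI[OF c] by (rule borel_imp_lebesgue_measurable)
  then have m: "(\<lambda>x. (indicator K x * g x) * \<phi> x) \<in> borel_measurable lebesgue"
    using borel_measurable_integrable[OF gK] by (rule_tac borel_measurable_times)
  have "integrable lebesgue (\<lambda>x. (indicator K x * g x) * \<phi> x)"
  proof (rule Bochner_Integration.integrable_bound[of _ "\<lambda>x. C * (indicator K x * g x)"])
    show "AE x in lebesgue. norm (indicator K x * g x * \<phi> x) \<le> norm (C * (indicator K x * g x))"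
      by (rule AE_I2) (use C in \<open>auto simp: indicator_def abs_mult mult.commute intro!: mult_right_mono order_trans[OF C abs_ge_self]\<close>)
  qed (use gK m in auto)
  moreover have eq: "(indicator K x * g x) * \<phi> x = indicator E x *\<^sub>R (g x * \<phi> x)" for x
    using K z[of x] by (cases "x \<in> K") (auto simp: indicator_def)
  ultimately show "integrable (lebesgue_on E) (\<lambda>x. g x * \<phi> x)"
    using E by (simp add: integrable_restrict_space)
  show "(LINT x|lebesgue_on E. g x * \<phi> x) = (LINT x|lebesgue. indicator K x * (g x * \<phi> x))"
  proof -
    have "(LINT x|lebesgue_on E. g x * \<phi> x) = (LINT x|lebesgue. indicator E x *\<^sub>R (g x * \<phi> x))"
      using E by (intro integral_restrict_space) simp
    then show ?thesis by (simp only: eq[symmetric] mult.assoc)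
  qed
qed

text \<open>Testing with the bumps over \<open>[a, b]\<close> yields, by dominated convergence, zero
  integral over every compact interval below \<open>c\<close>. The criterion for vanishing concerns
  Borel functions, so it is applied to a Borel version \<open>G\<close> of the truncated
  function.\<close>

lemma du_Bois_Reymond:
  assumes g: "locally_integrable {..<c} g"
    and z: "\<And>\<phi>. test_function {..<c} \<phi> \<Longrightarrow> (LINT x|lebesgue_on {..<c}. g x * \<phi> x) = 0"
  shows "AE x in lebesgue_on {..<c}. g x = 0"
proof -
  have gK: "integrable lebesgue (\<lambda>x. indicator {a..b} x * g x)" if "b < c" for a b
    using g that by (auto simp: locally_integrable_def set_integrable_def subset_iff)
  have int0: "(LINT x|lebesgue. indicator {a..b} x * g x) = 0" if b: "b < c" for a b
  proof -
    have "(\<lambda>n. LINT x|lebesgue. indicator {a..b} x * (g x * bump a b n x)) \<longlonglongrightarrow> (LINT x|lebesgue. indicator {a..b} x * g x)"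
    proof (rule integral_dominated_convergence[where w = "\<lambda>x. \<bar>indicator {a..b} x * g x\<bar>"])
      show "AE x in lebesgue. (\<lambda>n. indicator {a..b} x * (g x * bump a b n x)) \<longlonglongrightarrow> indicator {a..b} x * g x"
      proof -
        have "AE x in lebesgue. x \<noteq> a" "AE x in lebesgue. x \<noteq> b"
          by (auto intro!: AE_completion AE_lborel_singleton)
        then show ?thesis
        proof eventually_elim
          case (elim x)
          show ?case
          proof (cases "x \<in> {a<..<b}")
            case True
            then have "(\<lambda>n. indicator {a..b} x * (g x * bump a b n x)) \<longlonglongrightarrow> indicator {a..b} x * (g x * 1)"
              by (intro tendsto_intros bump_tendsto) auto
            then show ?thesis by simp
          qed (use elim in \<open>auto simp: indicator_def\<close>)
        qed
      qed
      show "\<And>n. AE x in lebesgue. norm (indicator {a..b} x * (g x * bump a b n x)) \<le> \<bar>indicator {a..b} x * g x\<bar>"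
        by (rule AE_I2) (auto simp: indicator_def abs_mult bump_bounds intro!: mult_left_le)
      have "bump a b n \<in> borel_measurable lebesgue" for n
        using borel_measurable_continuous_onI[OF test_function_continuous[OF bump_test_function[OF subset_UNIV]]]
        by (rule borel_imp_lebesgue_measurable)
      then have "(\<lambda>x. (indicator {a..b} x * g x) * bump a b n x) \<in> borel_measurable lebesgue" for n
        using borel_measurable_integrable[OF gK[OF b]] by (rule_tac borel_measurable_times)
      then show "\<And>n. (\<lambda>x. indicator {a..b} x * (g x * bump a b n x)) \<in> borel_measurable lebesgue"
        by (simp add: mult.assoc)
      show "(\<lambda>x. indicator {a..b} x * g x) \<in> borel_measurable lebesgue"
        using borel_measurable_integrable[OF gK[OF b]] .
      show "integrable lebesgue (\<lambda>x. \<bar>indicator {a..b} x * g x\<bar>)" using gK[OF b] by (rule integrable_abs)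
    qed
    moreover have "(LINT x|lebesgue. indicator {a..b} x * (g x * bump a b n x)) = 0" for n
    proof -
      have t: "test_function {..<c} (bump a b n)" by (rule bump_test_function) (use b in auto)
      have "(LINT x|lebesgue_on {..<c}. g x * bump a b n x) = (LINT x|lebesgue. indicator {a..b} x * (g x * bump a b n x))"
        by (rule locally_integrable_mult(2)[OF g]) (use b bump_bounds(3) test_function_continuous[OF t] in auto)
      then show ?thesis using z[OF t] by simp
    qed
    ultimately show ?thesis by (simp add: LIMSEQ_const_iff)
  qed
  have ae: "AE x in lebesgue. indicator {a..b} x * g x = 0" if b: "b < c" for a b
  proof -
    obtain G where G: "G \<in> borel_measurable lborel" "AE x in lborel. indicator {a..b} x * g x = G x"
      using completion_ex_borel_measurable_real[OF borel_measurable_integrable[OF gK[OF b, of a]]] by blast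
    have GL: "AE x in lebesgue. indicator {a..b} x * g x = G x" by (rule AE_completion[OF G(2)])
    have Gm: "G \<in> borel_measurable lebesgue" by (rule measurable_completion[OF G(1)])
    have "integrable lebesgue G"
      by (rule integrable_cong_AE_imp[OF gK[OF b] Gm GL])
    then have Gi: "integrable lborel G" using G(1) by (simp add: integrable_completion)
    have "AE x in lborel. G x = 0"
    proof (rule AE_zero_if_interval_integrals_zero[OF Gi])
      fix s t
      have "(LINT x:{s..t}|lborel. G x) = (LINT x|lebesgue. indicator {s..t} x * G x)"
        unfolding set_lebesgue_integral_def using G(1) by (subst integral_completion) auto
      also have "\<dots> = (LINT x|lebesgue. indicator {max s a..min t b} x * g x)"
      proof (rule integral_cong_AE)
        have ind: "indicator {u..v} \<in> borel_measurable lebesgue" for u v :: real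
          by (rule borel_imp_lebesgue_measurable) simp
        show "AE x in lebesgue. indicator {s..t} x * G x = indicator {max s a..min t b} x * g x"
          using GL by eventually_elim (auto simp: indicator_def split: if_splits)
        have "(\<lambda>x. indicator {max s a..min t b} x * (indicator {a..b} x * g x)) \<in> borel_measurable lebesgue"
          by (rule borel_measurable_times[OF ind borel_measurable_integrable[OF gK[OF b]]])
        moreover have "indicator {max s a..min t b} x * (indicator {a..b} x * g x) = indicator {max s a..min t b} x * g x" for x
          by (auto simp: indicator_def)
        ultimately show "(\<lambda>x. indicator {max s a..min t b} x * g x) \<in> borel_measurable lebesgue" by simp
        show "(\<lambda>x. indicator {s..t} x * G x) \<in> borel_measurable lebesgue"
          by (rule borel_measurable_times[OF ind Gm])
      qed
      also have "\<dots> = 0" by (rule int0) (use b in auto)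
      finally show "(LINT x:{s..t}|lborel. G x) = 0" .
    qed
    then have "AE x in lebesgue. G x = 0" by (rule AE_completion)
    with GL show ?thesis by eventually_elim simp
  qed
  \<comment> \<open>These compact intervals stay below \<open>c\<close> and exhaust the open
    half-line.\<close>
  have "AE x in lebesgue. \<forall>n. indicator {c - real n..c - inverse (real (Suc n))} x * g x = 0"
    unfolding AE_all_countable by (intro allI ae) simp
  then have "AE x in lebesgue. x \<in> {..<c} \<longrightarrow> g x = 0"
  proof eventually_elim
    case (elim x)
    show ?case
    proof
      assume x: "x \<in> {..<c}"
      obtain N1 where N1: "inverse (real (Suc N1)) < c - x" using reals_Archimedean[of "c - x"] x by auto
      obtain N2 where N2: "c - x < real N2" using reals_Archimedean2 by blast
      define n where "n = max N1 N2"
      have "inverse (real (Suc n)) \<le> inverse (real (Suc N1))" by (simp add: n_def)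
      moreover have "real N2 \<le> real n" by (simp add: n_def)
      ultimately have "x \<in> {c - real n..c - inverse (real (Suc n))}"
        using N1 N2 unfolding atLeastAtMost_iff by linarith
      then show "g x = 0" using elim by (auto dest: spec[of _ n])
    qed
  qed
  then show ?thesis by (simp add: AE_restrict_space_iff)
qed

lemma locally_integrable_const: "locally_integrable E (\<lambda>x. c)"
  unfolding locally_integrable_def
proof (intro allI impI)
  fix K :: "real set" assume "compact K \<and> K \<subseteq> E"
  then have "K \<in> lmeasurable" by (simp add: lmeasurable_compact)
  then show "set_integrable lebesgue K (\<lambda>x. c)"
    unfolding set_integrable_def by (auto simp: fmeasurable_def)
qed

lemma locally_integrable_diff:
  "locally_integrable E f \<Longrightarrow> locally_integrable E g \<Longrightarrow> locally_integrable E (\<lambda>x. f x - g x)"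
  unfolding locally_integrable_def by (auto intro: set_integral_diff)

lemma test_integrable:
  assumes "locally_integrable {..<c} g" "test_function {..<c} \<phi>"
  shows "integrable (lebesgue_on {..<c}) (\<lambda>x. g x * \<phi> x)"
proof -
  obtain K where "compact K" "K \<subseteq> {..<c}" "\<And>x. x \<notin> K \<Longrightarrow> \<phi> x = 0" using assms(2) by (auto simp: test_function_def)
  then show ?thesis
    by (intro locally_integrable_mult(1)[OF assms(1)]) (auto intro: test_function_continuous[OF assms(2)])
qed

text \<open>The antiderivative that vanishes to the left of the support is constant to its right,
  and that constant is the integral of \<theta>.\<close>

lemma test_function_antiderivative:
  assumes \<theta>: "test_function {..<c} \<theta>" and I: "(LINT x|lebesgue_on {..<c}. \<theta> x) = 0"
  obtains \<phi> where "test_function {..<c} \<phi>" "deriv \<phi> = \<theta>"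
proof -
  obtain K where K: "compact K" "K \<subseteq> {..<c}" "\<And>x. x \<notin> K \<Longrightarrow> \<theta> x = 0" using \<theta> by (auto simp: test_function_def)
  have cont: "continuous_on A \<theta>" for A by (rule test_function_continuous[OF \<theta>])
  obtain A0 where A0: "\<And>x. x \<in> K \<Longrightarrow> A0 \<le> x" using K(1) compact_imp_bounded bounded_imp_bdd_below unfolding bdd_below_def by metis
  obtain B where B: "B < c" "\<And>x. x \<in> K \<Longrightarrow> x \<le> B"
  proof (cases "K = {}")
    case True then show ?thesis using that[of "c - 1"] by auto
  next
    case False
    then obtain b where "b \<in> K" "\<forall>x\<in>K. x \<le> b" using compact_attains_sup[OF K(1)] by blast
    then show ?thesis using that[of b] K(2) by auto
  qed
  \<comment> \<open>The minimum ensures \<open>A \<le> B\<close> even if the support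
    \<open>K\<close> is empty.\<close>
  define A where "A = min A0 B"
  have AB: "A \<le> B" "K \<subseteq> {A..B}" using A0 B by (auto simp: A_def min_le_iff_disj)
  have z: "\<theta> x = 0" if "x \<notin> {A..B}" for x using that AB K(3) by blast
  have "isCont \<theta> x" for x using cont[of UNIV] by (simp add: continuous_on_eq_continuous_at)
  then obtain F0 where F0: "\<And>x. (F0 has_vector_derivative \<theta> x) (at x)"
    using einterval_antiderivative[of "-\<infinity>" \<infinity> \<theta>] by auto
  define \<phi> where "\<phi> x = F0 x - F0 A" for x
  have d: "(\<phi> has_real_derivative \<theta> x) (at x)" for x
    unfolding \<phi>_def[abs_def] using F0[of x]
    by (auto simp: has_real_derivative_iff_has_vector_derivative intro!: derivative_eq_intros)
  have ABint: "integral {A..B} \<theta> = \<phi> B"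
  proof -
    have "(\<theta> has_integral (\<phi> B - \<phi> A)) {A..B}"
      by (rule fundamental_theorem_of_calculus[OF AB(1)])
         (use d in \<open>auto simp: has_real_derivative_iff_has_vector_derivative intro: has_vector_derivative_at_within\<close>)
    then show ?thesis by (simp add: integral_unique \<phi>_def)
  qed
  have "(LINT x|lebesgue_on {..<c}. 1 * \<theta> x) = (LINT x|lebesgue. indicator {A..B} x * (1 * \<theta> x))"
    by (rule locally_integrable_mult(2)[OF locally_integrable_const]) (use B z cont in auto)
  also have "\<dots> = (LINT x:{A..B}|lborel. \<theta> x)"
    unfolding set_lebesgue_integral_def using borel_measurable_continuous_onI[OF cont]
    by (subst integral_completion) auto
  also have "\<dots> = integral {A..B} \<theta>"
    by (rule set_borel_integral_eq_integral[OF borel_integrable_atLeastAtMost'[OF cont]])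
  finally have B0: "\<phi> B = 0" using I ABint by simp
  have const: "\<phi> x = \<phi> y" if zz: "\<And>t. t \<in> {x..y} \<Longrightarrow> t \<noteq> x \<Longrightarrow> t \<noteq> y \<Longrightarrow> \<theta> t = 0" and xy: "x \<le> y" for x y
  proof (cases "x = y")
    case False
    then have "x < y" using xy by simp
    then show ?thesis
    proof (rule DERIV_isconst_end[symmetric])
      show "continuous_on {x..y} \<phi>" using d by (meson DERIV_isCont continuous_at_imp_continuous_on)
      show "DERIV \<phi> t :> 0" if "x < t" "t < y" for t using d[of t] zz[of t] that by simp
    qed
  qed simp
  have out: "\<phi> x = 0" if "x \<notin> {A..B}" for x
  proof (cases "x < A")
    case True
    have "\<phi> x = \<phi> A" by (rule const) (use True z in auto)
    then show ?thesis by (simp add: \<phi>_def)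
  next
    case False
    then have "B < x" using that by simp
    have "\<phi> B = \<phi> x" by (rule const) (use \<open>B < x\<close> z in auto)
    then show ?thesis using B0 by simp
  qed
  have dd: "deriv \<phi> = \<theta>" using d by (auto intro: DERIV_imp_deriv)
  have "(deriv ^^ n) \<phi> field_differentiable at x" for n x
  proof (cases n)
    case 0 then show ?thesis using d by (auto simp: field_differentiable_def)
  next
    case (Suc j)
    then have "(deriv ^^ n) \<phi> = (deriv ^^ j) \<theta>" using dd by (simp add: funpow_swap1)
    then show ?thesis using \<theta> by (simp add: test_function_def)
  qed
  then have "test_function {..<c} \<phi>" unfolding test_function_def
    using out B(1) by (auto intro!: exI[of _ "{A..B}"])
  with dd show ?thesis using that by blast
qed

text \<open>A test function minus a suitable multiple of one fixed bump \<rho> has integral zero and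
  is therefore the derivative of a test function. Hence \<open>g\<close> tests like a constant,
  namely the integral of \<open>g \<rho>\<close> divided by that of \<rho>.\<close>

lemma weak_deriv_zero_const:
  assumes g: "locally_integrable {..<c} g"
    and z: "\<And>\<phi>. test_function {..<c} \<phi> \<Longrightarrow> (LINT x|lebesgue_on {..<c}. g x * deriv \<phi> x) = 0"
  obtains C where "AE x in lebesgue_on {..<c}. g x = C"
proof -
  let ?L = "lebesgue_on {..<c}"
  define \<rho> where "\<rho> = bump (c - 3) (c - 1) 0"
  have \<rho>: "test_function {..<c} \<rho>" unfolding \<rho>_def by (rule bump_test_function) auto
  have i1: "integrable ?L \<psi>" if "test_function {..<c} \<psi>" for \<psi>
    using test_integrable[OF locally_integrable_const[of _ 1] that] by simp
  define I where "I = (LINT x|?L. \<rho> x)"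
  have "I \<noteq> 0"
  proof
    assume "I = 0"
    then have "AE x in ?L. \<rho> x = 0"
      using integral_nonneg_eq_0_iff_AE[OF i1[OF \<rho>]] by (simp add: I_def \<rho>_def bump_bounds)
    then have "AE x in lebesgue. x \<notin> {c - 3<..<c - 1}"
      unfolding AE_restrict_space_iff[of "{..<c}" lebesgue, simplified]
    proof eventually_elim
      case (elim x)
      have "\<rho> x > 0" if "x \<in> {c - 3<..<c - 1}" using that by (simp add: \<rho>_def bump_def ebump_def)
      then show ?case using elim by auto
    qed
    then have "{c - 3<..<c - 1} \<in> null_sets lebesgue" by (subst (asm) AE_iff_null_sets[symmetric]) auto
    then show False by (simp add: null_sets_def)
  qed
  define C where "C = (LINT x|?L. g x * \<rho> x) / I"
  have "AE x in ?L. g x - C = 0"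
  proof (rule du_Bois_Reymond)
    show "locally_integrable {..<c} (\<lambda>x. g x - C)" by (intro locally_integrable_diff g locally_integrable_const)
    fix \<psi> assume \<psi>: "test_function {..<c} \<psi>"
    define k where "k = (LINT x|?L. \<psi> x) / I"
    define \<theta> where "\<theta> x = \<psi> x + - k * \<rho> x" for x
    have \<theta>: "test_function {..<c} \<theta>" unfolding \<theta>_def[abs_def] by (rule test_function_lincomb[OF \<psi> \<rho>])
    have "(LINT x|?L. \<theta> x) = (LINT x|?L. \<psi> x) - k * I"
      unfolding \<theta>_def I_def using i1[OF \<psi>] i1[OF \<rho>] by simp
    also have "\<dots> = 0" using \<open>I \<noteq> 0\<close> by (simp add: k_def)
    finally obtain \<phi> where "test_function {..<c} \<phi>" "deriv \<phi> = \<theta>" using test_function_antiderivative[OF \<theta>] by blast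
    with z[of \<phi>] have "0 = (LINT x|?L. g x * \<psi> x - k * (g x * \<rho> x))"
      by (simp add: \<theta>_def algebra_simps)
    also have "\<dots> = (LINT x|?L. g x * \<psi> x) - k * (LINT x|?L. g x * \<rho> x)"
      using test_integrable[OF g \<psi>] test_integrable[OF g \<rho>] by simp
    also have "k * (LINT x|?L. g x * \<rho> x) = (LINT x|?L. C * \<psi> x)"
      by (simp add: k_def C_def)
    also have "(LINT x|?L. g x * \<psi> x) - (LINT x|?L. C * \<psi> x) = (LINT x|?L. (g x - C) * \<psi> x)"
      using test_integrable[OF g \<psi>] i1[OF \<psi>] by (simp add: left_diff_distrib)
    finally show "(LINT x|?L. (g x - C) * \<psi> x) = 0" by simp
  qed
  then show ?thesis using that[of C] by simp
qed

section \<open>Sobolev spaces on the exterior half-line\<close>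

text \<open>The right-hand side has the shape of the limit in \<open>C1_sobolev\<close>, so that
  only the norm has to be exchanged.\<close>

lemma vector_derivative_iff_quotient:
  fixes f :: "real \<Rightarrow> 'a::real_normed_vector"
  shows "(f has_vector_derivative d) (at t within I) \<longleftrightarrow>
    ((\<lambda>s. norm ((1 / (s - t)) *\<^sub>R (f s - f t) - d)) \<longlongrightarrow> 0) (at t within I)"
proof -
  have "(f has_vector_derivative d) (at t within I) \<longleftrightarrow>
      ((\<lambda>s. norm (f s - f t - (s - t) *\<^sub>R d) / norm (s - t)) \<longlongrightarrow> 0) (at t within I)"
    unfolding has_vector_derivative_def has_derivative_iff_norm by (simp add: bounded_linear_scaleR_left)
  also have "\<dots> \<longleftrightarrow> ((\<lambda>s. norm ((1 / (s - t)) *\<^sub>R (f s - f t) - d)) \<longlongrightarrow> 0) (at t within I)"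
  proof (rule filterlim_cong[OF refl refl])
    have "norm (f s - f t - (s - t) *\<^sub>R d) / norm (s - t) = norm ((1 / (s - t)) *\<^sub>R (f s - f t) - d)" if "s \<noteq> t" for s
    proof -
      have "(1 / (s - t)) *\<^sub>R (f s - f t) - d = (1 / (s - t)) *\<^sub>R (f s - f t - (s - t) *\<^sub>R d)"
        using that by (simp add: scaleR_diff_right)
      then show ?thesis by (simp add: divide_inverse mult.commute)
    qed
    then show "\<forall>\<^sub>F s in at t within I. norm (f s - f t - (s - t) *\<^sub>R d) / norm (s - t) = norm ((1 / (s - t)) *\<^sub>R (f s - f t) - d)"
      by (auto simp: eventually_at_filter)
  qed
  finally show ?thesis .
qed

section \<open>Transfer between the exterior domain and the shifted half-line\<close>

abbreviation LE :: "real \<Rightarrow> real measure" where "LE r \<equiv> lebesgue_on (Eminus r)"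

text \<open>Lebesgue measure is complete. This provides measurability for expressions in
  \<open>weak_deriv\<close>, which are identified only almost everywhere.\<close>

lemma lebesgue_measurable_cong_AE:
  fixes f g :: "real \<Rightarrow> real"
  assumes ae: "AE x in lebesgue. f x = g x" and f: "f \<in> borel_measurable lebesgue"
  shows "g \<in> borel_measurable lebesgue"
proof (rule measurableI)
  fix A :: "real set" assume A: "A \<in> sets borel"
  have "f -` A \<inter> space lebesgue \<in> sets lebesgue" by (rule measurable_sets[OF f A])
  moreover have "AE x in lebesgue. x \<in> f -` A \<inter> space lebesgue \<longleftrightarrow> x \<in> g -` A \<inter> space lebesgue"
    using ae by eventually_elim auto
  ultimately show "g -` A \<inter> space lebesgue \<in> sets lebesgue"
    by (rule_tac completion.in_sets_AE) auto
qed simp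

lemma AE_lborel_shift:
  assumes "AE x in lborel. P x" shows "AE x in lborel. P (x + c :: real)"
proof -
  obtain N where N: "{x. \<not> P x} \<subseteq> N" "N \<in> sets borel" "emeasure lborel N = 0"
    using AE_E[OF assms] by auto
  have "(+) c -` N \<in> sets borel"
    using measurable_sets[of "(+) c" borel borel N] N(2) by simp
  moreover have "emeasure lborel ((+) c -` N) = emeasure (distr lborel borel ((+) c)) N"
    using N(2) by (subst emeasure_distr) auto
  ultimately have "(+) c -` N \<in> null_sets lborel"
    using N(3) by (auto simp: null_sets_def lborel_distr_plus)
  moreover have "{x. \<not> P (x + c)} \<subseteq> (+) c -` N" using N(1) by (auto simp: add.commute)
  ultimately show ?thesis by (intro AE_I') auto
qed

lemma AE_LE: "(AE x in LE r. P x) \<longleftrightarrow> (AE y in hl. P (y - r))"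
proof -
  have "(AE x in LE r. P x) \<longleftrightarrow> (AE x in lborel. x < - r \<longrightarrow> P x)"
    by (simp add: AE_restrict_space_iff AE_completion_iff)
  also have "\<dots> \<longleftrightarrow> (AE y in lborel. y < 0 \<longrightarrow> P (y - r))"
  proof
    assume "AE x in lborel. x < - r \<longrightarrow> P x"
    from AE_lborel_shift[OF this, of "- r"] show "AE y in lborel. y < 0 \<longrightarrow> P (y - r)" by simp
  next
    assume "AE y in lborel. y < 0 \<longrightarrow> P (y - r)"
    from AE_lborel_shift[OF this, of r] show "AE x in lborel. x < - r \<longrightarrow> P x" by eventually_elim auto
  qed
  finally show ?thesis by (simp add: AE_hl)
qed

lemma integral_LE:
  fixes f :: "real \<Rightarrow> real"
  assumes f: "f \<in> borel_measurable borel"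
  shows "integrable (LE r) (\<lambda>x. f (x + r)) \<longleftrightarrow> integrable hl f"
    "(LINT x|LE r. f (x + r)) = (LINT x|hl. f x)"
proof -
  have e: "indicator (Eminus r) x *\<^sub>R f (x + r) = (\<lambda>y. indicator {..<0} y *\<^sub>R f y) (r + 1 * x)" for x
    by (auto simp: indicator_def add.commute)
  have m: "(\<lambda>x. indicator (Eminus r) x *\<^sub>R f (x + r)) \<in> borel_measurable lborel"
    "(\<lambda>y. indicator {..<0} y *\<^sub>R f y) \<in> borel_measurable borel" using f by auto
  have "integrable (LE r) (\<lambda>x. f (x + r)) \<longleftrightarrow> integrable lborel (\<lambda>x. indicator (Eminus r) x *\<^sub>R f (x + r))"
    using m(1) by (simp add: integrable_restrict_space integrable_completion del: real_scaleR_def)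
  also have "\<dots> \<longleftrightarrow> integrable lborel (\<lambda>y. indicator {..<0} y *\<^sub>R f y)"
    unfolding e by (rule lborel_integrable_real_affine_iff) simp
  finally show "integrable (LE r) (\<lambda>x. f (x + r)) \<longleftrightarrow> integrable hl f"
    by (simp add: integrable_hl[OF f] set_integrable_def)
  have "(LINT x|LE r. f (x + r)) = (LINT x|lborel. indicator (Eminus r) x *\<^sub>R f (x + r))"
    using m(1) by (simp add: integral_restrict_space integral_completion del: real_scaleR_def)
  also have "\<dots> = (LINT y|lborel. indicator {..<0} y *\<^sub>R f y)"
    unfolding e using lborel_integral_real_affine[of 1 "\<lambda>y. indicator {..<0} y *\<^sub>R f y" r] by simp
  finally show "(LINT x|LE r. f (x + r)) = (LINT x|hl. f x)"
    by (simp add: integral_hl[OF f] set_lebesgue_integral_def)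
qed

lemma borel_shift_measurable_LE:
  assumes "f \<in> borel_measurable borel" shows "(\<lambda>x. f (x + r)) \<in> borel_measurable (LE r)"
proof -
  have "(\<lambda>x. f (x + r)) \<in> borel_measurable borel" using assms by measurable
  then show ?thesis by (intro measurable_restrict_space1 borel_imp_lebesgue_measurable)
qed

lemma L2_shift: "square_integrable hl f \<Longrightarrow> (\<lambda>x. f (x + r)) \<in> L2 (Eminus r)"
  using integral_LE(1)[of "\<lambda>x. (f x)\<^sup>2" r] borel_shift_measurable_LE[of f r]
  by (auto simp: L2_def square_integrable_def)

lemma L2_iff: "u \<in> L2 E \<longleftrightarrow> square_integrable (lebesgue_on E) u"
  by (simp add: L2_def square_integrable_def)

text \<open>The calculus of \<open>prim\<close> and \<open>hl\<close> is Borel, whereas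
  \<open>L2\<close> admits all Lebesgue measurable functions; a Borel representative mediates
  between the two.\<close>

lemma L2_borel_representative:
  assumes u: "u \<in> L2 (Eminus r)"
  obtains f where "square_integrable hl f" "AE x in LE r. u x = f (x + r)"
proof -
  have um: "u \<in> borel_measurable (LE r)" using u by (simp add: L2_def)
  have "(\<lambda>x. indicator (Eminus r) x *\<^sub>R u x) \<in> borel_measurable lebesgue"
    using um by (subst (asm) borel_measurable_restrict_space_iff) auto
  then obtain g where g: "g \<in> borel_measurable lborel" "AE x in lborel. indicator (Eminus r) x *\<^sub>R u x = g x"
    using completion_ex_borel_measurable_real by blast
  define f where "f y = g (y - r)" for y
  have fm: "f \<in> borel_measurable borel" unfolding f_def using g(1) by measurable
  have ae: "AE x in LE r. u x = f (x + r)"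
  proof -
    have "AE x in lebesgue. x \<in> Eminus r \<longrightarrow> u x = f (x + r)"
      using AE_completion[OF g(2)] by eventually_elim (auto simp: f_def indicator_def)
    then show ?thesis by (simp add: AE_restrict_space_iff)
  qed
  have "square_integrable (LE r) (\<lambda>x. f (x + r))"
    by (rule square_integrable_cong_AE[OF _ borel_shift_measurable_LE[OF fm] ae]) (use u in \<open>simp add: L2_iff\<close>)
  then have "square_integrable hl f"
    using integral_LE(1)[of "\<lambda>x. (f x)\<^sup>2" r] fm by (auto simp: square_integrable_def)
  then show ?thesis using that ae by blast
qed

lemma locally_integrable_shift:
  assumes v: "\<And>a b. a \<le> b \<Longrightarrow> b \<le> 0 \<Longrightarrow> set_integrable lborel {a..b} v" and vm: "v \<in> borel_measurable borel"
  shows "locally_integrable (Eminus r) (\<lambda>x. v (x + r))"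
  unfolding locally_integrable_def
proof (intro allI impI)
  fix K assume K: "compact K \<and> K \<subseteq> Eminus r"
  then have "bdd_below K" by (simp add: compact_imp_bounded bounded_imp_bdd_below)
  then obtain A where A: "\<And>x. x \<in> K \<Longrightarrow> A \<le> x" unfolding bdd_below_def by blast
  define a where "a = min (A + r) 0"
  have "set_integrable lborel {a..0} v" by (rule v) (auto simp: a_def)
  then have "integrable lborel (\<lambda>x. (\<lambda>y. indicator {a..0} y *\<^sub>R v y) (r + 1 * x))"
    unfolding set_integrable_def by (rule lborel_integrable_real_affine) simp
  then have "integrable lborel (\<lambda>x. indicator {a - r.. - r} x *\<^sub>R v (x + r))"
    by (rule back_subst[of "integrable lborel"]) (auto simp: fun_eq_iff indicator_def add.commute)
  then have 1: "set_integrable lebesgue {a - r.. - r} (\<lambda>x. v (x + r))"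
    unfolding set_integrable_def by (subst integrable_completion) (auto dest: borel_measurable_integrable)
  have "K \<in> sets borel" using K by (simp add: compact_imp_closed borel_closed)
  then have "K \<in> sets lebesgue" by simp
  moreover have "K \<subseteq> {a - r.. - r}"
  proof
    fix x assume "x \<in> K"
    then have "A \<le> x" "x < - r" using K A by auto
    then show "x \<in> {a - r.. - r}" by (simp add: a_def min_def)
  qed
  ultimately show "set_integrable lebesgue K (\<lambda>x. v (x + r))" using 1 set_integrable_subset by blast
qed

text \<open>The product of \<open>V\<close> with a test function is again a primitive, and it
  vanishes at both ends of \<open>[A, 0]\<close>; so the product rule integrates to zero.\<close>

lemma prim_has_weak_deriv:
  assumes p: "prim V v"
  shows "has_weak_deriv (Eminus r) 1 (\<lambda>x. V (x + r)) (\<lambda>x. v (x + r))"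
  unfolding has_weak_deriv_def
proof (intro conjI allI impI)
  have Vc: "continuous_on A V" for A using prim_continuous[OF p] continuous_on_subset by blast
  note [measurable] = primD(1)[OF p] prim_measurable[OF p]
  show "locally_integrable (Eminus r) (\<lambda>x. V (x + r))"
    by (rule locally_integrable_shift[OF borel_integrable_atLeastAtMost'[OF Vc]]) simp
  show "locally_integrable (Eminus r) (\<lambda>x. v (x + r))"
    by (rule locally_integrable_shift[OF primD(3)[OF p]]) simp_all
  fix \<phi> assume \<phi>: "test_function (Eminus r) \<phi>"
  then obtain K where K: "compact K" "K \<subseteq> Eminus r" "\<And>x. x \<notin> K \<Longrightarrow> \<phi> x = 0" by (auto simp: test_function_def)
  then have "bdd_below K" by (simp add: compact_imp_bounded bounded_imp_bdd_below)
  then obtain A0 where A0: "\<And>x. x \<in> K \<Longrightarrow> A0 \<le> x" unfolding bdd_below_def by blast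
  \<comment> \<open>One unit to the left of the shifted support, and never above 0, so that the test
    function and its derivative vanish at and before \<open>A\<close>.\<close>
  define A where "A = min (A0 + r) 0 - 1"
  define f where "f y = \<phi> (y - r)" for y
  define f' where "f' y = deriv \<phi> (y - r)" for y
  have d: "(f has_real_derivative f' x) (at x)" for x
  proof -
    have "((\<lambda>y. y - r) has_real_derivative 1) (at x)" by (auto intro!: derivative_eq_intros)
    from DERIV_chain2[OF test_function_deriv(1)[OF \<phi>, of "x - r"] this] show ?thesis
      by (simp add: f_def[abs_def] f'_def)
  qed
  have f'c: "continuous_on UNIV f'" unfolding f'_def[abs_def]
    by (rule continuous_on_compose2[OF test_function_continuous[OF test_function_deriv(2)[OF \<phi>], of UNIV]])
       (auto intro!: continuous_intros)
  have [measurable]: "f' \<in> borel_measurable borel" by (rule borel_measurable_continuous_onI[OF f'c])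
  have f0: "f x = 0" if "x \<ge> 0 \<or> x \<le> A" for x
  proof -
    have "x - r \<notin> K" using that K(2) A0 unfolding A_def by force
    then show ?thesis by (simp add: f_def K(3))
  qed
  have f'0: "f' x = 0" if "x \<ge> 0 \<or> x < A" for x
  proof -
    obtain L where L: "compact L" "L \<subseteq> Eminus r" "\<And>x. x \<notin> L \<Longrightarrow> deriv \<phi> x = 0"
      using test_function_deriv(2)[OF \<phi>] by (auto simp: test_function_def)
    show ?thesis
    proof (cases "x \<ge> 0")
      case True
      then have "x - r \<notin> L" using L(2) by force
      then show ?thesis by (simp add: f'_def L(3))
    next
      case False
      then have xA: "x < A" using that by simp
      have "((\<lambda>x. 0) has_real_derivative 0) (at x)" by simp
      then have "(f has_real_derivative 0) (at x)"
        by (rule has_field_derivative_transform_within_open[of _ _ _ "{..<A}"]) (use xA f0 in auto)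
      then show ?thesis using d DERIV_unique by blast
    qed
  qed
  have fm: "f \<in> borel_measurable borel"
    using d by (intro borel_measurable_continuous_onI) (meson DERIV_isCont continuous_at_imp_continuous_on)
  note [measurable] = fm
  have pf: "prim f f'"
    by (rule prim_C1[OF has_field_derivative_at_within[OF d] f'c]) (use f0 in auto)
  have A: "A \<le> 0" by (simp add: A_def)
  note pm = primD(3,4)[OF prim_mult[OF p pf] A order_refl]
  have i2: "set_integrable lborel {A..0} (\<lambda>x. V x * f' x)"
    by (rule borel_integrable_atLeastAtMost') (intro continuous_intros Vc continuous_on_subset[OF f'c], auto)
  have i1: "set_integrable lborel {A..0} (\<lambda>x. v x * f x)"
    using set_integral_diff(1)[OF pm(1) i2] by simp
  have "(LINT x:{A..0}|lborel. v x * f x + V x * f' x) = 0"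
    using pm(2) f0 by simp
  then have eq: "(LINT x:{A..0}|lborel. V x * f' x) = - (LINT x:{A..0}|lborel. v x * f x)"
    using set_integral_add(2)[OF i1 i2] by simp
  have cut: "(LINT x|hl. h x) = (LINT x:{A..0}|lborel. h x)" if h: "h \<in> borel_measurable borel" "\<And>x. x < A \<Longrightarrow> h x = 0"
    for h :: "real \<Rightarrow> real"
  proof -
    have "AE x in lborel. indicator {..<0} x *\<^sub>R h x = indicator {A..0} x *\<^sub>R h x"
      using AE_lborel_singleton[of 0] by eventually_elim (use h(2) in \<open>auto simp: indicator_def\<close>)
    then show ?thesis unfolding integral_hl[OF h(1)] set_lebesgue_integral_def
      by (rule integral_cong_AE[rotated 2]) (use h(1) in auto)
  qed
  have "(LINT x|LE r. V (x + r) * deriv \<phi> x) = (LINT x|LE r. (\<lambda>y. V y * f' y) (x + r))" by (simp add: f'_def)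
  also have "\<dots> = (LINT x:{A..0}|lborel. V x * f' x)"
    by (subst integral_LE(2)) (auto intro!: cut f'0)
  also have "\<dots> = - (LINT x|LE r. (\<lambda>y. v y * f y) (x + r))"
    unfolding eq by (subst integral_LE(2)) (auto intro!: cut[symmetric] f0)
  finally show "(LINT x|LE r. V (x + r) * (deriv ^^ 1) \<phi> x) = (- 1) ^ 1 * (LINT x|LE r. v (x + r) * \<phi> x)"
    by (simp add: f_def)
qed

section \<open>Calculus of weak derivatives\<close>

lemma has_weak_deriv_unique:
  assumes "has_weak_deriv (Eminus r) k u v" "has_weak_deriv (Eminus r) k u w"
  shows "AE x in LE r. v x = w x"
proof -
  have l: "locally_integrable (Eminus r) v" "locally_integrable (Eminus r) w"
    using assms by (auto simp: has_weak_deriv_def)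
  have "AE x in LE r. v x - w x = 0"
  proof (rule du_Bois_Reymond[OF locally_integrable_diff[OF l]])
    fix \<phi> assume \<phi>: "test_function (Eminus r) \<phi>"
    have "(LINT x|LE r. u x * (deriv ^^ k) \<phi> x) = (- 1) ^ k * (LINT x|LE r. v x * \<phi> x)"
      "(LINT x|LE r. u x * (deriv ^^ k) \<phi> x) = (- 1) ^ k * (LINT x|LE r. w x * \<phi> x)"
      using assms \<phi> unfolding has_weak_deriv_def by blast+
    then have "(LINT x|LE r. v x * \<phi> x) = (LINT x|LE r. w x * \<phi> x)" by simp
    then show "(LINT x|LE r. (v x - w x) * \<phi> x) = 0"
      using test_integrable[OF l(1) \<phi>] test_integrable[OF l(2) \<phi>] by (simp add: left_diff_distrib)
  qed
  then show ?thesis by simp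
qed

lemma weak_deriv_AE:
  assumes "has_weak_deriv (Eminus r) k u v" shows "AE x in LE r. weak_deriv (Eminus r) k u x = v x"
  unfolding weak_deriv_def
  by (rule has_weak_deriv_unique[OF someI[of "has_weak_deriv (Eminus r) k u", OF assms] assms])

lemma has_weak_deriv_cong:
  assumes w: "has_weak_deriv (Eminus r) k u v" and m: "u' \<in> borel_measurable (LE r)"
    and ae: "AE x in LE r. u' x = u x"
  shows "has_weak_deriv (Eminus r) k u' v"
  unfolding has_weak_deriv_def
proof (intro conjI allI impI)
  have l: "locally_integrable (Eminus r) u" using w by (simp add: has_weak_deriv_def)
  show l': "locally_integrable (Eminus r) u'"
    unfolding locally_integrable_def
  proof (intro allI impI)
    fix K assume K: "compact K \<and> K \<subseteq> Eminus r"
    then have i: "integrable lebesgue (\<lambda>x. indicator K x *\<^sub>R u x)"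
      using l by (auto simp: locally_integrable_def set_integrable_def)
    have Kb: "K \<in> sets borel" using K by (simp add: compact_imp_closed borel_closed)
    have iE: "(\<lambda>x. indicator (Eminus r) x *\<^sub>R u' x) \<in> borel_measurable lebesgue"
      using m by (subst (asm) borel_measurable_restrict_space_iff) auto
    have "(\<lambda>x. indicator K x * (indicator (Eminus r) x *\<^sub>R u' x)) \<in> borel_measurable lebesgue"
      by (rule borel_measurable_times[OF borel_imp_lebesgue_measurable[OF borel_measurable_indicator[OF Kb]] iE])
    moreover have "(\<lambda>x. indicator K x * (indicator (Eminus r) x *\<^sub>R u' x)) = (\<lambda>x. indicator K x *\<^sub>R u' x)"
      using K by (auto simp: fun_eq_iff indicator_def)
    ultimately have m': "(\<lambda>x. indicator K x *\<^sub>R u' x) \<in> borel_measurable lebesgue" by simp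
    have "AE x in lebesgue. x \<in> Eminus r \<longrightarrow> u' x = u x" using ae by (simp add: AE_restrict_space_iff)
    then have "AE x in lebesgue. indicator K x *\<^sub>R u x = indicator K x *\<^sub>R u' x"
      by eventually_elim (use K in \<open>auto simp: indicator_def\<close>)
    then show "set_integrable lebesgue K u'" unfolding set_integrable_def
      by (rule integrable_cong_AE_imp[OF i m'])
  qed
  show "locally_integrable (Eminus r) v" using w by (simp add: has_weak_deriv_def)
  fix \<phi> assume \<phi>: "test_function (Eminus r) \<phi>"
  have dk: "test_function (Eminus r) ((deriv ^^ k) \<phi>)"
    by (induction k) (auto simp: \<phi> intro: test_function_deriv)
  have "(LINT x|LE r. u' x * (deriv ^^ k) \<phi> x) = (LINT x|LE r. u x * (deriv ^^ k) \<phi> x)"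
  proof (rule integral_cong_AE)
    show "AE x in LE r. u' x * (deriv ^^ k) \<phi> x = u x * (deriv ^^ k) \<phi> x" using ae by eventually_elim simp
  qed (use borel_measurable_integrable[OF test_integrable[OF l dk]] borel_measurable_integrable[OF test_integrable[OF l' dk]] in auto)
  then show "(LINT x|LE r. u' x * (deriv ^^ k) \<phi> x) = (- 1) ^ k * (LINT x|LE r. v x * \<phi> x)"
    using w \<phi> by (simp add: has_weak_deriv_def)
qed

lemma test_function_funpow: "test_function E \<phi> \<Longrightarrow> test_function E ((deriv ^^ k) \<phi>)"
  by (induction k) (auto intro: test_function_deriv)

lemma has_weak_deriv_trans:
  assumes "has_weak_deriv E j u w" "has_weak_deriv E 1 w z" shows "has_weak_deriv E (Suc j) u z"
  unfolding has_weak_deriv_def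
proof (intro conjI allI impI)
  fix \<phi> assume \<phi>: "test_function E \<phi>"
  have "(LINT x|lebesgue_on E. u x * (deriv ^^ j) (deriv \<phi>) x) = (- 1) ^ j * (LINT x|lebesgue_on E. w x * deriv \<phi> x)"
    using assms(1) test_function_deriv(2)[OF \<phi>] by (simp add: has_weak_deriv_def)
  also have "(LINT x|lebesgue_on E. w x * deriv \<phi> x) = - (LINT x|lebesgue_on E. z x * \<phi> x)"
    using assms(2) \<phi> by (simp add: has_weak_deriv_def)
  finally show "(LINT x|lebesgue_on E. u x * (deriv ^^ Suc j) \<phi> x) = (- 1) ^ Suc j * (LINT x|lebesgue_on E. z x * \<phi> x)"
    by (simp add: funpow_swap1)
qed (use assms in \<open>auto simp: has_weak_deriv_def\<close>)

lemma has_weak_deriv_of_deriv: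
  assumes "has_weak_deriv E 1 u w" "has_weak_deriv E (Suc j) u z" shows "has_weak_deriv E j w z"
  unfolding has_weak_deriv_def
proof (intro conjI allI impI)
  fix \<phi> assume \<phi>: "test_function E \<phi>"
  have "(LINT x|lebesgue_on E. u x * deriv ((deriv ^^ j) \<phi>) x) = - (LINT x|lebesgue_on E. w x * (deriv ^^ j) \<phi> x)"
    using assms(1) test_function_funpow[OF \<phi>, of j] by (simp add: has_weak_deriv_def)
  moreover have "(LINT x|lebesgue_on E. u x * (deriv ^^ Suc j) \<phi> x) = (- 1) ^ Suc j * (LINT x|lebesgue_on E. z x * \<phi> x)"
    using assms(2) \<phi> unfolding has_weak_deriv_def by blast
  ultimately show "(LINT x|lebesgue_on E. w x * (deriv ^^ j) \<phi> x) = (- 1) ^ j * (LINT x|lebesgue_on E. z x * \<phi> x)"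
    by simp
qed (use assms in \<open>auto simp: has_weak_deriv_def\<close>)

definition ext :: "real \<Rightarrow> h1 \<Rightarrow> real \<Rightarrow> real" where "ext r f x = fn f (x + r)"

lemma ext_L2: "ext r f \<in> L2 (Eminus r)"
  unfolding ext_def[abs_def] by (rule L2_shift[OF sq_fn])

lemma ext_measurable: "ext r f \<in> borel_measurable (LE r)"
  unfolding ext_def[abs_def] by (rule borel_shift_measurable_LE[OF fn_measurable])

lemma ext_weak_deriv: "has_weak_deriv (Eminus r) 1 (ext r f) (\<lambda>x. dv f (x + r))"
  unfolding ext_def[abs_def] by (rule prim_has_weak_deriv[OF prim_dv])

lemma ext_weak_deriv_dr: "dr f g \<Longrightarrow> has_weak_deriv (Eminus r) 1 (ext r f) (ext r g)"
  unfolding ext_def[abs_def] dr_def by (rule prim_has_weak_deriv)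

lemma ext_AE_inject: "AE x in LE r. ext r f x = ext r g x \<Longrightarrow> f = g"
  by (rule fn_AE_eqI) (simp add: AE_LE ext_def)

text \<open>\<open>u\<close> differs from the primitive \<open>V\<close> of a Borel version of
  \<open>v\<close> by a weakly constant function, hence by a constant \<open>C\<close>. Then
  \<open>V + C\<close> is the continuous representative of \<open>u\<close>, and square
  integrability of \<open>u\<close> and \<open>v\<close> puts it into \<open>h1\<close>.\<close>

lemma weak_deriv_L2_h1:
  assumes u: "u \<in> L2 (Eminus r)" and v: "v \<in> L2 (Eminus r)" and w: "has_weak_deriv (Eminus r) 1 u v"
  obtains f where "AE x in LE r. u x = ext r f x" "AE x in LE r. v x = dv f (x + r)"
proof -
  obtain u0 where u0: "square_integrable hl u0" "AE x in LE r. u x = u0 (x + r)" using L2_borel_representative[OF u] by blast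
  obtain v0 where v0: "square_integrable hl v0" "AE x in LE r. v x = v0 (x + r)" using L2_borel_representative[OF v] by blast
  have [measurable]: "v0 \<in> borel_measurable borel" using v0(1) by (simp add: square_integrable_def)
  have vi: "set_integrable lborel {a..b} v0" if "b \<le> 0" for a b
  proof (cases "a \<le> b")
    case True
    have "integrable hl (\<lambda>x. indicator {a..b} x * v0 x)"
      by (rule square_integrable_mult[OF hl_indicator(1)[OF True that] v0(1)])
    then have "set_integrable lborel {a..b} (\<lambda>x. indicator {a..b} x * v0 x)"
      by (rule hl_set_integrable) (use that in auto)
    then show ?thesis unfolding set_integrable_def by (simp flip: mult.assoc indicator_inter_arith)
  qed (simp add: set_integrable_def)
  define V where "V x = - (LINT y:{min x 0..0}|lborel. v0 y)" for x
  have p: "prim V v0"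
    unfolding prim_def
  proof (intro conjI allI impI)
    fix a b :: real assume ab: "a \<le> b \<and> b \<le> 0"
    show "set_integrable lborel {a..b} v0" by (rule vi) (use ab in simp)
    have "{a..0} = {a..b} \<union> {b..0}" using ab by auto
    moreover have ae: "AE x in lborel. \<not> (x \<in> {a..b} \<and> x \<in> {b..0})"
      using AE_lborel_singleton[of b] by eventually_elim auto
    ultimately have "(LINT y:{a..0}|lborel. v0 y) = (LINT y:{a..b}|lborel. v0 y) + (LINT y:{b..0}|lborel. v0 y)"
      using set_integral_Un_AE[OF ae _ _ vi[of b a] vi[of 0 b]] ab by simp
    then show "V b - V a = (LINT x:{a..b}|lborel. v0 x)" using ab by (simp add: V_def min_absorb1)
  qed (simp_all add: V_def)
  have wV: "has_weak_deriv (Eminus r) 1 (\<lambda>x. V (x + r)) (\<lambda>x. v0 (x + r))" by (rule prim_has_weak_deriv[OF p])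
  have lu: "locally_integrable (Eminus r) u" "locally_integrable (Eminus r) v" using w by (auto simp: has_weak_deriv_def)
  have lV: "locally_integrable (Eminus r) (\<lambda>x. V (x + r))" "locally_integrable (Eminus r) (\<lambda>x. v0 (x + r))"
    using wV by (auto simp: has_weak_deriv_def)
  obtain C where C: "AE x in LE r. u x - V (x + r) = C"
  proof (rule weak_deriv_zero_const[OF locally_integrable_diff[OF lu(1) lV(1)]])
    fix \<phi> assume \<phi>: "test_function (Eminus r) \<phi>"
    note dp = test_function_deriv(2)[OF \<phi>]
    have "(LINT x|LE r. (u x - V (x + r)) * deriv \<phi> x) = (LINT x|LE r. u x * deriv \<phi> x) - (LINT x|LE r. V (x + r) * deriv \<phi> x)"
      using test_integrable[OF lu(1) dp] test_integrable[OF lV(1) dp] by (simp add: left_diff_distrib)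
    also have "\<dots> = (LINT x|LE r. v0 (x + r) * \<phi> x) - (LINT x|LE r. v x * \<phi> x)"
      using w wV \<phi> by (simp add: has_weak_deriv_def)
    also have "(LINT x|LE r. v x * \<phi> x) = (LINT x|LE r. v0 (x + r) * \<phi> x)"
    proof (rule integral_cong_AE)
      show "AE x in LE r. v x * \<phi> x = v0 (x + r) * \<phi> x" using v0(2) by eventually_elim simp
    qed (use borel_measurable_integrable[OF test_integrable[OF lu(2) \<phi>]] borel_measurable_integrable[OF test_integrable[OF lV(2) \<phi>]] in auto)
    finally show "(LINT x|LE r. (u x - V (x + r)) * deriv \<phi> x) = 0" by simp
  qed
  have p': "prim (\<lambda>x. V x + C) (\<lambda>x. v0 x + 0)" by (rule prim_add[OF p prim_const])
  have uV: "AE x in LE r. u0 (x + r) = V (x + r) + C" using u0(2) C by eventually_elim simp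
  have "square_integrable hl (\<lambda>x. V x + C)"
    by (rule square_integrable_cong_AE[OF u0(1)])
       (use prim_measurable[OF p'] uV in \<open>simp_all add: AE_LE\<close>)
  then obtain f where f: "fn f = (\<lambda>x. V x + C)" "AE x in hl. dv f x = v0 x + 0"
    using h1_obtain[OF p'] v0(1) by auto
  have "AE x in LE r. u x = ext r f x" using C by eventually_elim (simp add: ext_def f)
  moreover have "AE x in LE r. v x = dv f (x + r)"
  proof -
    have "AE x in LE r. dv f (x + r) = v0 (x + r)" using f(2) by (simp add: AE_LE)
    with v0(2) show ?thesis by eventually_elim simp
  qed
  ultimately show ?thesis using that by blast
qed

section \<open>Sobolev spaces as images of the powers of \<open>S\<close>\<close>

lemma sobolevD:
  assumes "u \<in> sobolev E m"
  shows "u \<in> L2 E" "j \<le> m \<Longrightarrow> \<exists>v\<in>L2 E. has_weak_deriv E j u v"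
  using assms unfolding sobolev_def by blast+

lemma sobolevI:
  "u \<in> L2 E \<Longrightarrow> (\<And>j. j \<le> m \<Longrightarrow> \<exists>v\<in>L2 E. has_weak_deriv E j u v) \<Longrightarrow> u \<in> sobolev E m"
  unfolding sobolev_def by blast

text \<open>Surjectivity of \<open>Sn k\<close> from \<open>h1\<close> onto \<open>H^{k+1}\<close>.
  Inductively both \<open>u\<close> and \<open>u'\<close> are images under one power less, and
  \<open>u = S (u + u')\<close> supplies the missing power.\<close>

lemma sobolev_imp_h1:
  assumes "u \<in> sobolev (Eminus r) (Suc k)"
  shows "\<exists>f. AE x in LE r. u x = ext r (Sn k f) x"
  using assms
proof (induction k arbitrary: u)
  case 0
  obtain v where v: "v \<in> L2 (Eminus r)" "has_weak_deriv (Eminus r) 1 u v"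
    using sobolevD(2)[OF 0, of 1] by auto
  obtain f where "AE x in LE r. u x = ext r f x"
    using weak_deriv_L2_h1[OF sobolevD(1)[OF 0] v] by blast
  then show ?case by (intro exI[of _ f]) simp
next
  case (Suc k)
  have u: "u \<in> L2 (Eminus r)" and d: "\<And>j. j \<le> Suc (Suc k) \<Longrightarrow> \<exists>v\<in>L2 (Eminus r). has_weak_deriv (Eminus r) j u v"
    using sobolevD[OF Suc.prems] by auto
  obtain v where v: "v \<in> L2 (Eminus r)" "has_weak_deriv (Eminus r) 1 u v" using d[of 1] by auto
  have "v \<in> sobolev (Eminus r) (Suc k)"
  proof (rule sobolevI[OF v(1)])
    fix j assume "j \<le> Suc k"
    then obtain z where "z \<in> L2 (Eminus r)" "has_weak_deriv (Eminus r) (Suc j) u z" using d[of "Suc j"] by auto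
    then show "\<exists>v'\<in>L2 (Eminus r). has_weak_deriv (Eminus r) j v v'"
      using has_weak_deriv_of_deriv[OF v(2)] by blast
  qed
  with Suc.IH obtain b where b: "AE x in LE r. v x = ext r (Sn k b) x" by blast
  have "u \<in> sobolev (Eminus r) (Suc k)" by (rule sobolevI[OF u]) (rule d, simp)
  with Suc.IH obtain a where a: "AE x in LE r. u x = ext r (Sn k a) x" by blast
  obtain f where f: "AE x in LE r. u x = ext r f x" "AE x in LE r. v x = dv f (x + r)"
    using weak_deriv_L2_h1[OF u v] by blast
  have "AE x in LE r. ext r f x = ext r (Sn k a) x" using f(1) a by eventually_elim simp
  then have fa: "f = Sn k a" by (rule ext_AE_inject)
  have "AE x in LE r. dv f (x + r) = fn (Sn k b) (x + r)" using f(2) b by eventually_elim (simp add: ext_def)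
  then have "AE x in hl. dv f x = fn (Sn k b) x" by (simp add: AE_LE)
  then have "dr f (Sn k b)" unfolding dr_def by (rule prim_cong_AE[OF prim_dv fn_measurable])
  from S_eqI[OF this] have "f = Sn (Suc k) (a + b)" by (simp add: fa Sn_linear)
  then show ?case using f(1) by blast
qed

text \<open>Since \<open>pc\<close> is \<open>\<partial> S\<close>, the derivative of order
  \<open>j \<le> k\<close> of \<open>Sn k f\<close> is \<open>pcn j (Sn (k - j) f)\<close>, a
  bounded operator applied to \<open>f\<close>.\<close>

abbreviation pcn :: "nat \<Rightarrow> h1 \<Rightarrow> h1" where "pcn j \<equiv> pc ^^ j"

lemma bounded_linear_pcn: "bounded_linear (pcn j)"
  by (rule bounded_linear_funpow[OF bounded_linear_pc])

lemma pcn_S: "pcn j (S f) = S (pcn j f)"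
  by (induction j) (simp_all add: S_pc)

lemma pcn_dr: "dr (pcn j (S f)) (pcn (Suc j) f)"
  using dr_S[of "pcn j f"] by (simp add: pcn_S pc_def)

lemma ext_weak_derivs:
  "j \<le> k \<Longrightarrow> has_weak_deriv (Eminus r) j (ext r (Sn k f)) (ext r (pcn j (Sn (k - j) f)))"
proof (induction j)
  case 0
  have "has_weak_deriv (Eminus r) 0 (ext r (Sn k f)) (ext r (Sn k f))"
    using ext_weak_deriv[of r "Sn k f"] by (simp add: has_weak_deriv_def)
  then show ?case by simp
next
  case (Suc j)
  then have "k - j = Suc (k - Suc j)" by simp
  then have "pcn j (Sn (k - j) f) = pcn j (S (Sn (k - Suc j) f))" by simp
  then have "has_weak_deriv (Eminus r) 1 (ext r (pcn j (Sn (k - j) f))) (ext r (pcn (Suc j) (Sn (k - Suc j) f)))"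
    using ext_weak_deriv_dr[OF pcn_dr] by simp
  with Suc show ?case by (intro has_weak_deriv_trans[of _ j _ "ext r (pcn j (Sn (k - j) f))"]) auto
qed

lemma ext_weak_deriv_top:
  "has_weak_deriv (Eminus r) (Suc k) (ext r (Sn k f)) (\<lambda>x. dv (pcn k f) (x + r))"
  using has_weak_deriv_trans[OF ext_weak_derivs[of k k r f] ext_weak_deriv] by simp

lemma ext_sobolev: "ext r (Sn k f) \<in> sobolev (Eminus r) (Suc k)"
proof (rule sobolevI[OF ext_L2])
  fix j assume j: "j \<le> Suc k"
  show "\<exists>v\<in>L2 (Eminus r). has_weak_deriv (Eminus r) j (ext r (Sn k f)) v"
  proof (cases "j \<le> k")
    case True then show ?thesis using ext_weak_derivs ext_L2 by blast
  next
    case False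
    then have "j = Suc k" using j by simp
    then show ?thesis using ext_weak_deriv_top L2_shift[OF sq_dv] by blast
  qed
qed

lemma sobolev_norm_ext:
  assumes m: "u \<in> borel_measurable (LE r)" and ae: "AE x in LE r. u x = ext r (Sn k f) x"
  shows "(sobolev_norm (Eminus r) (Suc k) u)\<^sup>2
    = (\<Sum>j\<le>k. (l2n hl (fn (pcn j (Sn (k - j) f))))\<^sup>2) + (l2n hl (dv (pcn k f)))\<^sup>2"
proof -
  have eq: "(LINT x|LE r. (weak_deriv (Eminus r) j u x)\<^sup>2) = (l2n hl g)\<^sup>2"
    if h: "has_weak_deriv (Eminus r) j (ext r (Sn k f)) (\<lambda>x. g (x + r))" and g: "g \<in> borel_measurable borel" for j g
  proof -
    have w: "has_weak_deriv (Eminus r) j u (\<lambda>x. g (x + r))" by (rule has_weak_deriv_cong[OF h m ae])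
    note ae' = weak_deriv_AE[OF w]
    have "(LINT x|LE r. (weak_deriv (Eminus r) j u x)\<^sup>2) = (LINT x|LE r. (g (x + r))\<^sup>2)"
    proof (rule integral_cong_AE)
      show gm: "(\<lambda>x. (g (x + r))\<^sup>2) \<in> borel_measurable (LE r)"
        using borel_shift_measurable_LE[OF g] by simp
      show ae2: "AE x in LE r. (weak_deriv (Eminus r) j u x)\<^sup>2 = (g (x + r))\<^sup>2" using ae' by eventually_elim simp
      show "(\<lambda>x. (weak_deriv (Eminus r) j u x)\<^sup>2) \<in> borel_measurable (LE r)"
      proof -
        have "AE x in lebesgue. indicator (Eminus r) x *\<^sub>R (g (x + r))\<^sup>2 = indicator (Eminus r) x *\<^sub>R (weak_deriv (Eminus r) j u x)\<^sup>2"
        proof -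
          have "AE x in lebesgue. x \<in> Eminus r \<longrightarrow> (weak_deriv (Eminus r) j u x)\<^sup>2 = (g (x + r))\<^sup>2"
            using ae2 by (simp add: AE_restrict_space_iff)
          then show ?thesis by eventually_elim (auto simp: indicator_def)
        qed
        moreover have "(\<lambda>x. indicator (Eminus r) x *\<^sub>R (g (x + r))\<^sup>2) \<in> borel_measurable lebesgue"
          using gm by (subst (asm) borel_measurable_restrict_space_iff) auto
        ultimately have "(\<lambda>x. indicator (Eminus r) x *\<^sub>R (weak_deriv (Eminus r) j u x)\<^sup>2) \<in> borel_measurable lebesgue"
          by (rule lebesgue_measurable_cong_AE)
        then show ?thesis by (subst borel_measurable_restrict_space_iff) auto
      qed
    qed
    also have "\<dots> = (LINT x|hl. (g x)\<^sup>2)" using integral_LE(2)[of "\<lambda>x. (g x)\<^sup>2" r] g by simp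
    finally show ?thesis by (simp add: l2n_sq)
  qed
  have lo: "(LINT x|LE r. (weak_deriv (Eminus r) j u x)\<^sup>2) = (l2n hl (fn (pcn j (Sn (k - j) f))))\<^sup>2" if "j \<le> k" for j
    by (rule eq) (use ext_weak_derivs[OF that] in \<open>simp_all add: ext_def[abs_def]\<close>)
  have hi: "(LINT x|LE r. (weak_deriv (Eminus r) (Suc k) u x)\<^sup>2) = (l2n hl (dv (pcn k f)))\<^sup>2"
    by (rule eq[OF ext_weak_deriv_top dv_measurable])
  have "(sobolev_norm (Eminus r) (Suc k) u)\<^sup>2 = (\<Sum>j\<le>Suc k. LINT x|LE r. (weak_deriv (Eminus r) j u x)\<^sup>2)"
    unfolding sobolev_norm_def by (simp add: sum_nonneg)
  also have "\<dots> = (\<Sum>j\<le>k. (l2n hl (fn (pcn j (Sn (k - j) f))))\<^sup>2) + (l2n hl (dv (pcn k f)))\<^sup>2"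
    using lo hi by simp
  finally show ?thesis .
qed

lemma sobolev_norm_nonneg: "sobolev_norm E m u \<ge> 0"
  unfolding sobolev_norm_def by (simp add: sum_nonneg)

lemma sobolev_norm_le:
  obtains C where "C \<ge> 0" "\<And>u f. u \<in> borel_measurable (LE r) \<Longrightarrow> AE x in LE r. u x = ext r (Sn k f) x \<Longrightarrow>
    sobolev_norm (Eminus r) (Suc k) u \<le> C * norm f"
proof -
  have "\<exists>K\<ge>0. \<forall>f. norm (pcn j (Sn (k - j) f)) \<le> norm f * K" for j
    using bounded_linear.nonneg_bounded[OF bounded_linear_compose[OF bounded_linear_pcn bounded_linear_Sn]] by blast
  then obtain K where K: "\<And>j. K j \<ge> 0" "\<And>j f. norm (pcn j (Sn (k - j) f)) \<le> norm f * K j" by metis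
  define C where "C = sqrt ((\<Sum>j\<le>k. (K j)\<^sup>2) + (K k)\<^sup>2)"
  have "sobolev_norm (Eminus r) (Suc k) u \<le> C * norm f"
    if m: "u \<in> borel_measurable (LE r)" and ae: "AE x in LE r. u x = ext r (Sn k f) x" for u f
  proof (rule power2_le_imp_le)
    have a: "(l2n hl (fn (pcn j (Sn (k - j) f))))\<^sup>2 \<le> (norm f * K j)\<^sup>2" for j
      by (intro power_mono order_trans[OF h1_norm_le(1) K(2)]) simp
    have b: "(l2n hl (dv (pcn k f)))\<^sup>2 \<le> (norm f * K k)\<^sup>2"
      using K(2)[of k f] by (intro power_mono order_trans[OF h1_norm_le(2)]) simp_all
    have "(sobolev_norm (Eminus r) (Suc k) u)\<^sup>2 \<le> (\<Sum>j\<le>k. (norm f * K j)\<^sup>2) + (norm f * K k)\<^sup>2"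
      unfolding sobolev_norm_ext[OF m ae] by (intro add_mono sum_mono a b)
    also have "\<dots> = (C * norm f)\<^sup>2"
      by (simp add: C_def power_mult_distrib sum_nonneg sum_distrib_left algebra_simps)
    finally show "(sobolev_norm (Eminus r) (Suc k) u)\<^sup>2 \<le> (C * norm f)\<^sup>2" .
  qed (simp add: C_def sum_nonneg)
  moreover have "C \<ge> 0" by (simp add: C_def sum_nonneg)
  ultimately show ?thesis using that by blast
qed

text \<open>Applying \<open>f = pc f + S f\<close> repeatedly writes \<open>f\<close> as a sum of
  \<open>2^k\<close> terms \<open>pcn i (Sn j f)\<close> with \<open>i + j = k\<close>. The norm of
  each is twice the sum of two \<open>L^2\<close> norms, those of the derivatives of
  \<open>Sn k f\<close> of orders \<open>i\<close> and \<open>i + 1\<close>; hence the factor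
  4.\<close>

lemma norm_le_sobolev_norm:
  assumes m: "u \<in> borel_measurable (LE r)" and ae: "AE x in LE r. u x = ext r (Sn k f) x"
  shows "norm f \<le> 2 ^ k * (4 * sobolev_norm (Eminus r) (Suc k) u)"
proof -
  define s where "s = sobolev_norm (Eminus r) (Suc k) u"
  have s0: "s \<ge> 0" by (simp add: s_def sobolev_norm_nonneg)
  have le: "l2n hl (fn (pcn j (Sn (k - j) f))) \<le> s" if "j \<le> k" for j
  proof (rule power2_le_imp_le[OF _ s0])
    have "(l2n hl (fn (pcn j (Sn (k - j) f))))\<^sup>2 \<le> (\<Sum>j\<le>k. (l2n hl (fn (pcn j (Sn (k - j) f))))\<^sup>2)"
      using that by (intro member_le_sum) auto
    then show "(l2n hl (fn (pcn j (Sn (k - j) f))))\<^sup>2 \<le> s\<^sup>2"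
      unfolding s_def sobolev_norm_ext[OF m ae] by (simp add: add_increasing2)
  qed
  have top: "l2n hl (dv (pcn k f)) \<le> s"
    by (rule power2_le_imp_le[OF _ s0]) (simp add: s_def sobolev_norm_ext[OF m ae] sum_nonneg)
  have "norm (pcn i (Sn j f)) \<le> 2 ^ d * (4 * s)" if "i + j + d = k" for i j d
    using that
  proof (induction d arbitrary: i j)
    case 0
    then have j: "j = k - i" and i: "i \<le> k" by auto
    have "l2n hl (dv (pcn i (Sn j f))) \<le> s"
    proof (cases "i = k")
      case True then show ?thesis using top j by simp
    next
      case False
      then have "j = Suc (k - Suc i)" using j i by simp
      then have "dr (pcn i (Sn j f)) (pcn (Suc i) (Sn (k - Suc i) f))" using pcn_dr by simp
      from dr_dv[OF this] have "l2n hl (dv (pcn i (Sn j f))) = l2n hl (fn (pcn (Suc i) (Sn (k - Suc i) f)))"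
        by (intro l2n_cong_AE) auto
      then show ?thesis using le[of "Suc i"] False i by simp
    qed
    then show ?case using le[OF i] by (simp add: norm_h1_def j)
  next
    case (Suc d)
    have "pcn i (Sn j f) = pcn (Suc i) (Sn j f) + pcn i (Sn (Suc j) f)"
      by (simp add: pcn_S) (simp add: pc_def)
    then have "norm (pcn i (Sn j f)) \<le> norm (pcn (Suc i) (Sn j f)) + norm (pcn i (Sn (Suc j) f))"
      by (metis norm_triangle_ineq)
    also have "\<dots> \<le> 2 ^ d * (4 * s) + 2 ^ d * (4 * s)" by (intro add_mono Suc.IH) (use Suc.prems in auto)
    finally show ?case by (simp add: mult_ac)
  qed
  from this[of 0 0 k] show ?thesis by (simp add: s_def)
qed

text \<open>Only convergence to zero is transported, for which equivalence of the two norms is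
  enough; the norm of \<open>h1\<close> need not match the Sobolev norm exactly.\<close>

lemma sobolev_tendsto_iff:
  assumes m: "\<And>s. s \<in> I \<Longrightarrow> u s \<in> borel_measurable (LE r)"
    and ae: "\<And>s. s \<in> I \<Longrightarrow> AE x in LE r. u s x = ext r (Sn k (f s)) x"
  shows "((\<lambda>s. sobolev_norm (Eminus r) (Suc k) (u s)) \<longlongrightarrow> 0) (at t within I) \<longleftrightarrow> ((\<lambda>s. norm (f s)) \<longlongrightarrow> 0) (at t within I)"
proof -
  obtain C where C: "C \<ge> 0" "\<And>u f. u \<in> borel_measurable (LE r) \<Longrightarrow> AE x in LE r. u x = ext r (Sn k f) x \<Longrightarrow>
    sobolev_norm (Eminus r) (Suc k) u \<le> C * norm f" using sobolev_norm_le by blast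
  have ev: "\<forall>\<^sub>F s in at t within I. s \<in> I" by (simp add: eventually_at_filter)
  show ?thesis
  proof
    assume "((\<lambda>s. sobolev_norm (Eminus r) (Suc k) (u s)) \<longlongrightarrow> 0) (at t within I)"
    then have "((\<lambda>s. 2 ^ k * (4 * sobolev_norm (Eminus r) (Suc k) (u s))) \<longlongrightarrow> 2 ^ k * (4 * 0)) (at t within I)"
      by (intro tendsto_intros)
    then have l: "((\<lambda>s. 2 ^ k * (4 * sobolev_norm (Eminus r) (Suc k) (u s))) \<longlongrightarrow> 0) (at t within I)" by simp
    show "((\<lambda>s. norm (f s)) \<longlongrightarrow> 0) (at t within I)"
      by (rule Lim_null_comparison[OF _ l]) (use ev in \<open>eventually_elim, use norm_le_sobolev_norm m ae in auto\<close>)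
  next
    assume "((\<lambda>s. norm (f s)) \<longlongrightarrow> 0) (at t within I)"
    then have l: "((\<lambda>s. C * norm (f s)) \<longlongrightarrow> 0) (at t within I)" using tendsto_mult_right_zero by blast
    show "((\<lambda>s. sobolev_norm (Eminus r) (Suc k) (u s)) \<longlongrightarrow> 0) (at t within I)"
      by (rule Lim_null_comparison[OF _ l])
         (use ev in \<open>eventually_elim, use C(2) m ae sobolev_norm_nonneg in auto\<close>)
  qed
qed

lemma L2_measurable: "u \<in> L2 E \<Longrightarrow> u \<in> borel_measurable (lebesgue_on E)"
  by (simp add: L2_def)

lemma sobolev_measurable: "u \<in> sobolev E m \<Longrightarrow> u \<in> borel_measurable (lebesgue_on E)"
  by (rule L2_measurable[OF sobolevD(1)])

lemma ext_linear:
  "ext r (f + g) x = ext r f x + ext r g x" "ext r (f - g) x = ext r f x - ext r g x"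
  "ext r (c *\<^sub>R f) x = c * ext r f x" "ext r (- f) x = - ext r f x" "ext r (f * g) x = ext r f x * ext r g x"
  by (simp_all add: ext_def)

text \<open>The coordinates \<open>z\<close> are chosen at each time separately. They are
  nevertheless differentiable, because the difference quotients converge in the Sobolev norm and the
  coordinate map is linear and injective.\<close>

lemma C1_sobolev_imp_derivative:
  assumes C1: "C1_sobolev (Eminus r) (Suc k) I u ut"
  obtains z zt where "\<And>t. t \<in> I \<Longrightarrow> AE x in LE r. u t x = ext r (Sn k (z t)) x"
    "\<And>t. t \<in> I \<Longrightarrow> AE x in LE r. ut t x = ext r (Sn k (zt t)) x"
    "\<And>t. t \<in> I \<Longrightarrow> (z has_vector_derivative zt t) (at t within I)"
proof -
  have mem: "u t \<in> sobolev (Eminus r) (Suc k)" "ut t \<in> sobolev (Eminus r) (Suc k)" if "t \<in> I" for t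
    using C1 that by (auto simp: C1_sobolev_def)
  define z where "z t = (SOME f. AE x in LE r. u t x = ext r (Sn k f) x)" for t
  define zt where "zt t = (SOME f. AE x in LE r. ut t x = ext r (Sn k f) x)" for t
  have z: "AE x in LE r. u t x = ext r (Sn k (z t)) x" if "t \<in> I" for t
    unfolding z_def by (rule someI_ex[OF sobolev_imp_h1[OF mem(1)[OF that]]])
  have zt: "AE x in LE r. ut t x = ext r (Sn k (zt t)) x" if "t \<in> I" for t
    unfolding zt_def by (rule someI_ex[OF sobolev_imp_h1[OF mem(2)[OF that]]])
  have "(z has_vector_derivative zt t) (at t within I)" if t: "t \<in> I" for t
    unfolding vector_derivative_iff_quotient
  proof (rule sobolev_tendsto_iff[THEN iffD1])
    show "((\<lambda>s. sobolev_norm (Eminus r) (Suc k) (\<lambda>x. (u s x - u t x) / (s - t) - ut t x)) \<longlongrightarrow> 0) (at t within I)"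
      using C1 t by (simp add: C1_sobolev_def)
    fix s assume s: "s \<in> I"
    note [measurable] = sobolev_measurable[OF mem(1)[OF s]] sobolev_measurable[OF mem(1)[OF t]] sobolev_measurable[OF mem(2)[OF t]]
    show "(\<lambda>x. (u s x - u t x) / (s - t) - ut t x) \<in> borel_measurable (LE r)" by measurable
    show "AE x in LE r. (u s x - u t x) / (s - t) - ut t x = ext r (Sn k ((1 / (s - t)) *\<^sub>R (z s - z t) - zt t)) x"
      using z[OF s] z[OF t] zt[OF t] by eventually_elim (simp add: Sn_linear ext_linear)
  qed
  then show ?thesis using that z zt by blast
qed

lemma derivative_imp_C1_sobolev:
  assumes d: "\<And>t. t \<in> I \<Longrightarrow> (z has_vector_derivative zt t) (at t within I)" and c: "continuous_on I zt"
  shows "C1_sobolev (Eminus r) (Suc k) I (\<lambda>t. ext r (Sn k (z t))) (\<lambda>t. ext r (Sn k (zt t)))"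
  unfolding C1_sobolev_def
proof (intro ballI conjI ext_sobolev)
  fix t assume t: "t \<in> I"
  note [measurable] = ext_measurable
  show "((\<lambda>s. sobolev_norm (Eminus r) (Suc k) (\<lambda>x. (ext r (Sn k (z s)) x - ext r (Sn k (z t)) x) / (s - t) - ext r (Sn k (zt t)) x)) \<longlongrightarrow> 0) (at t within I)"
  proof (rule sobolev_tendsto_iff[THEN iffD2, OF _ _ d[OF t, unfolded vector_derivative_iff_quotient]])
    fix s
    show "(\<lambda>x. (ext r (Sn k (z s)) x - ext r (Sn k (z t)) x) / (s - t) - ext r (Sn k (zt t)) x) \<in> borel_measurable (LE r)"
      by measurable
  qed (simp add: Sn_linear ext_linear)
  have l: "((\<lambda>s. norm (zt s - zt t)) \<longlongrightarrow> 0) (at t within I)"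
    using c t by (intro tendsto_norm_zero LIM_zero) (auto simp: continuous_on_def)
  show "((\<lambda>s. sobolev_norm (Eminus r) (Suc k) (\<lambda>x. ext r (Sn k (zt s)) x - ext r (Sn k (zt t)) x)) \<longlongrightarrow> 0) (at t within I)"
  proof (rule sobolev_tendsto_iff[THEN iffD2, OF _ _ l])
    fix s
    show "(\<lambda>x. ext r (Sn k (zt s)) x - ext r (Sn k (zt t)) x) \<in> borel_measurable (LE r)" by measurable
  qed (simp add: Sn_linear ext_linear)
qed

section \<open>Traces, decay and the Neumann resolvent\<close>

lemma bdry_trace_eq:
  assumes c: "continuous_on UNIV v" and ae: "AE x in LE r. u x = v (x + r)"
  shows "bdry_trace r u = v 0"
  unfolding bdry_trace_def
proof (rule the_equality)
  show "\<exists>w. continuous_on {.. - r} w \<and> (AE x in LE r. w x = u x) \<and> w (- r) = v 0"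
  proof (intro exI[of _ "\<lambda>x. v (x + r)"] conjI)
    show "continuous_on {.. - r} (\<lambda>x. v (x + r))"
      by (rule continuous_on_compose2[OF c]) (auto intro!: continuous_intros)
    show "AE x in LE r. v (x + r) = u x" using ae by eventually_elim simp
  qed simp
  fix a assume "\<exists>w. continuous_on {.. - r} w \<and> (AE x in LE r. w x = u x) \<and> w (- r) = a"
  then obtain w where w: "continuous_on {.. - r} w" "AE x in LE r. w x = u x" "w (- r) = a" by blast
  \<comment> \<open>Clamping the argument extends both representatives continuously to the whole
    line without changing them up to the boundary.\<close>
  define w1 where "w1 y = w (min y 0 - r)" for y
  define v1 where "v1 y = v (min y 0)" for y
  have "w1 0 = v1 0"
  proof (rule AE_hl_continuous_eq[of w1 v1])
    show "continuous_on UNIV w1" unfolding w1_def[abs_def]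
      by (rule continuous_on_compose2[OF w(1)]) (auto intro!: continuous_intros)
    show "continuous_on UNIV v1" unfolding v1_def[abs_def]
      by (rule continuous_on_compose2[OF c]) (auto intro!: continuous_intros)
    have "AE x in LE r. w x = v (x + r)" using w(2) ae by eventually_elim simp
    then have "AE y in lborel. y < 0 \<longrightarrow> w (y - r) = v y" by (simp add: AE_LE AE_hl)
    then have "AE y in lborel. y < 0 \<longrightarrow> w (min y 0 - r) = v (min y 0)"
      by eventually_elim auto
    then show "AE y in hl. w1 y = v1 y" by (simp add: AE_hl w1_def v1_def)
  qed simp
  then show "a = v 0" using w(3) by (simp add: w1_def v1_def)
qed

lemma bdry_trace_ext: "AE x in LE r. u x = ext r f x \<Longrightarrow> bdry_trace r u = fn f 0"
  by (rule bdry_trace_eq[OF fn_continuous]) (simp add: ext_def)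

lemma vanishes_ext:
  assumes "AE x in LE r. u x = ext r f x" shows "vanishes_at_minus_infinity r u"
  unfolding vanishes_at_minus_infinity_def
proof (intro allI impI)
  fix e :: real assume "e > 0"
  then obtain M where M: "\<And>x. x < M \<Longrightarrow> \<bar>fn f x\<bar> < e" using prim_vanishes[OF prim_dv sq_fn sq_dv] by blast
  have "AE x in LE r. x < M - r \<longrightarrow> \<bar>u x\<bar> < e" using assms by eventually_elim (auto simp: ext_def intro: M)
  then show "\<exists>M. AE x in LE r. x < M \<longrightarrow> \<bar>u x\<bar> < e" by blast
qed

text \<open>The description behind \<open>R1\<close> determines its solution up to null sets: a
  candidate satisfies it exactly if its representative in \<open>h1\<close> is
  \<open>Rop \<mu> f\<close>. Since \<open>Rop \<mu> f\<close> itself is a candidate, the choice is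
  meaningful.\<close>

lemma R1_AE:
  assumes \<mu>: "\<mu> > 0" and v: "AE x in LE r. v x = ext r f x"
  shows "AE x in LE r. R1 r \<mu> v x = ext r (Rop \<mu> f) x"
proof -
  define P where "P u \<longleftrightarrow> u \<in> sobolev (Eminus r) 2 \<and>
      (AE x in LE r. u x - \<mu>\<^sup>2 * weak_deriv (Eminus r) 2 u x = v x) \<and>
      vanishes_at_minus_infinity r (weak_deriv (Eminus r) 1 u) \<and>
      bdry_trace r (weak_deriv (Eminus r) 1 u) = 0" for u
  have P_char: "P u \<longleftrightarrow> U = Rop \<mu> f" if u: "u \<in> sobolev (Eminus r) 2" and U: "AE x in LE r. u x = ext r U x" and dU: "dr U V" for u U V
  proof -
    have m: "u \<in> borel_measurable (LE r)" by (rule sobolev_measurable[OF u])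
    have w1: "has_weak_deriv (Eminus r) 1 u (ext r V)" by (rule has_weak_deriv_cong[OF ext_weak_deriv_dr[OF dU] m U])
    have w2: "has_weak_deriv (Eminus r) 2 u (\<lambda>x. dv V (x + r))"
      using has_weak_deriv_trans[OF w1 ext_weak_deriv] by (simp add: numeral_2_eq_2)
    note a1 = weak_deriv_AE[OF w1] and a2 = weak_deriv_AE[OF w2]
    have eq: "(AE x in LE r. u x - \<mu>\<^sup>2 * weak_deriv (Eminus r) 2 u x = v x) \<longleftrightarrow> (AE y in hl. fn U y - \<mu>\<^sup>2 * dv V y = fn f y)"
    proof -
      have "(AE y in hl. fn U y - \<mu>\<^sup>2 * dv V y = fn f y) \<longleftrightarrow> (AE x in LE r. ext r U x - \<mu>\<^sup>2 * dv V (x + r) = ext r f x)"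
        by (simp add: AE_LE ext_def)
      also have "\<dots> \<longleftrightarrow> (AE x in LE r. u x - \<mu>\<^sup>2 * weak_deriv (Eminus r) 2 u x = v x)"
      proof
        assume "AE x in LE r. ext r U x - \<mu>\<^sup>2 * dv V (x + r) = ext r f x"
        then show "AE x in LE r. u x - \<mu>\<^sup>2 * weak_deriv (Eminus r) 2 u x = v x" using U a2 v by eventually_elim simp
      next
        assume "AE x in LE r. u x - \<mu>\<^sup>2 * weak_deriv (Eminus r) 2 u x = v x"
        then show "AE x in LE r. ext r U x - \<mu>\<^sup>2 * dv V (x + r) = ext r f x" using U a2 v by eventually_elim simp
      qed
      finally show ?thesis by simp
    qed
    have tr: "bdry_trace r (weak_deriv (Eminus r) 1 u) = fn V 0" by (rule bdry_trace_ext[OF a1])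
    show ?thesis
    proof
      assume "P u"
      then have 1: "AE y in hl. fn U y - \<mu>\<^sup>2 * dv V y = fn f y" and 2: "fn V 0 = 0"
        using eq tr by (auto simp: P_def)
      have "AE y in hl. dv V y = fn ((1 / \<mu>\<^sup>2) *\<^sub>R (U - f)) y"
        using 1 by eventually_elim (use \<mu> in \<open>simp add: field_simps\<close>)
      then have "dr V ((1 / \<mu>\<^sup>2) *\<^sub>R (U - f))"
        unfolding dr_def by (rule prim_cong_AE[OF prim_dv fn_measurable])
      then show "U = Rop \<mu> f" using Rop_unique[OF \<mu> dU] 2 by blast
    next
      assume R: "U = Rop \<mu> f"
      then have V: "V = Pop \<mu> f" using dr_unique dU dr_Rop[OF \<mu>] by blast
      have "AE y in hl. fn U y - \<mu>\<^sup>2 * dv V y = fn f y"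
        using dr_dv[OF dr_Pop[OF \<mu>, of f]] unfolding V R by eventually_elim (use \<mu> in simp)
      then show "P u" unfolding P_def using eq tr V Pop_0[OF \<mu>] u vanishes_ext[OF a1] by simp
    qed
  qed
  \<comment> \<open>This puts \<open>Rop \<mu> f\<close> in the range of \<open>S\<close>, that is,
    in \<open>H^2\<close>.\<close>
  have Sf: "Rop \<mu> f = S (Rop \<mu> f + Pop \<mu> f)" by (rule S_eqI[OF dr_Rop[OF \<mu>]])
  have "ext r (Sn 1 (Rop \<mu> f + Pop \<mu> f)) \<in> sobolev (Eminus r) (Suc 1)" by (rule ext_sobolev)
  then have "ext r (Rop \<mu> f) \<in> sobolev (Eminus r) 2" using Sf by (simp add: numeral_2_eq_2)
  then have "P (ext r (Rop \<mu> f))" using P_char[of "ext r (Rop \<mu> f)" "Rop \<mu> f" "Pop \<mu> f"] dr_Rop[OF \<mu>] by simp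
  then have P: "P (R1 r \<mu> v)" unfolding R1_def P_def[symmetric] by (rule someI[of P])
  then have s: "R1 r \<mu> v \<in> sobolev (Eminus r) (Suc 1)" by (simp add: P_def numeral_2_eq_2)
  from sobolev_imp_h1[OF this] obtain g where g: "AE x in LE r. R1 r \<mu> v x = ext r (S g) x" by auto
  have "S g = Rop \<mu> f" using P_char[OF _ g dr_S] s P by (simp add: numeral_2_eq_2)
  then show ?thesis using g by simp
qed

subsection \<open>Reciprocals\<close>

lemma prim_limit:
  assumes p: "\<And>n. prim (u n) (v n)" and U: "\<And>x. (\<lambda>n. u n x) \<longlonglongrightarrow> U x" and V: "\<And>x. (\<lambda>n. v n x) \<longlonglongrightarrow> V x"
    and G: "\<And>n x. \<bar>v n x\<bar> \<le> G x" "\<And>a b. a \<le> b \<Longrightarrow> b \<le> 0 \<Longrightarrow> set_integrable lborel {a..b} G" and Vm: "V \<in> borel_measurable borel"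
  shows "prim U V"
  unfolding prim_def
proof (intro conjI allI impI)
  show "U x = U 0" if "x > 0" for x
  proof -
    have "u n x = u n 0" for n by (rule primD(2)[OF p that])
    then show ?thesis using U[of x] U[of 0] LIMSEQ_unique by simp
  qed
  fix a b :: real assume ab: "a \<le> b \<and> b \<le> 0"
  have vm: "v n \<in> borel_measurable borel" for n by (rule primD(1)[OF p])
  have Gi: "integrable lborel (\<lambda>x. indicator {a..b} x *\<^sub>R G x)" using G(2) ab by (auto simp: set_integrable_def)
  have dom: "AE x in lborel. norm (indicator {a..b} x *\<^sub>R v n x) \<le> indicator {a..b} x *\<^sub>R G x" for n
    by (rule AE_I2) (auto simp: indicator_def G)
  have lim: "AE x in lborel. (\<lambda>n. indicator {a..b} x *\<^sub>R v n x) \<longlonglongrightarrow> indicator {a..b} x *\<^sub>R V x"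
    by (rule AE_I2) (intro tendsto_intros V)
  have ms: "(\<lambda>x. indicator {a..b} x *\<^sub>R V x) \<in> borel_measurable lborel" "\<And>n. (\<lambda>x. indicator {a..b} x *\<^sub>R v n x) \<in> borel_measurable lborel"
    using vm Vm by auto
  show "set_integrable lborel {a..b} V" unfolding set_integrable_def
    by (rule integrable_dominated_convergence[OF ms Gi lim dom])
  have "(\<lambda>n. LINT x|lborel. indicator {a..b} x *\<^sub>R v n x) \<longlonglongrightarrow> (LINT x|lborel. indicator {a..b} x *\<^sub>R V x)"
    by (rule integral_dominated_convergence[OF ms Gi lim dom])
  moreover have "(LINT x|lborel. indicator {a..b} x *\<^sub>R v n x) = u n b - u n a" for n
    using primD(4)[OF p, of a b n] ab by (simp add: set_lebesgue_integral_def)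
  moreover have "(\<lambda>n. u n b - u n a) \<longlonglongrightarrow> U b - U a" by (intro tendsto_diff U)
  ultimately show "U b - U a = (LINT x:{a..b}|lborel. V x)"
    unfolding set_lebesgue_integral_def using LIMSEQ_unique by simp
qed (fact Vm)

lemma prim_power:
  assumes p: "prim \<theta> \<theta>'" shows "prim (\<lambda>x. \<theta> x ^ Suc n) (\<lambda>x. real (Suc n) * \<theta> x ^ n * \<theta>' x)"
proof (induction n)
  case 0 show ?case using p by simp
next
  case (Suc n)
  have "prim (\<lambda>x. \<theta> x ^ Suc n * \<theta> x) (\<lambda>x. real (Suc n) * \<theta> x ^ n * \<theta>' x * \<theta> x + \<theta> x ^ Suc n * \<theta>' x)"
    by (rule prim_mult[OF Suc p])
  moreover have "real (Suc n) * \<theta> x ^ n * \<theta>' x * \<theta> x + \<theta> x ^ Suc n * \<theta>' x = real (Suc (Suc n)) * \<theta> x ^ Suc n * \<theta>' x" for x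
    by (simp add: algebra_simps)
  ultimately show ?case by (simp add: mult.commute)
qed

lemma prim_sum:
  fixes N :: nat
  assumes "\<And>n. prim (u n) (v n)" shows "prim (\<lambda>x. \<Sum>n<N. u n x) (\<lambda>x. \<Sum>n<N. v n x)"
  by (induction N) (auto intro!: prim_add assms prim_const[of 0, simplified])

text \<open>The chain rule for \<open>1/h\<close> is obtained from the Neumann series in \<open>\<theta> = 1 - h/K\<close>, \<open>K \<ge> sup h\<close>.\<close>

lemma prim_inverse:
  assumes p: "prim h h'" and c: "c > 0" "\<And>x. c \<le> h x" and K: "\<And>x. h x \<le> K"
  shows "prim (\<lambda>x. 1 / h x) (\<lambda>x. - h' x / (h x)\<^sup>2)"
proof -
  have K0: "K > 0" using c K[of 0] c(2)[of 0] by linarith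
  define \<theta> where "\<theta> x = 1 + - (1 / K) * h x" for x
  define \<theta>' where "\<theta>' x = 0 + - (1 / K) * h' x" for x
  have pt: "prim \<theta> \<theta>'" unfolding \<theta>_def[abs_def] \<theta>'_def[abs_def] by (intro prim_add prim_const prim_scale p)
  define \<rho> where "\<rho> = 1 - c / K"
  have cK: "c \<le> K" using c(2)[of 0] K[of 0] by linarith
  have th: "0 \<le> \<theta> x" "\<theta> x \<le> \<rho>" for x
    using c(2)[of x] K[of x] K0 by (simp_all add: \<theta>_def \<rho>_def divide_right_mono field_simps)
  have \<rho>: "0 \<le> \<rho>" "\<rho> < 1" using c cK K0 by (simp_all add: \<rho>_def field_simps)
  have t1: "1 - \<theta> x = h x / K" for x by (simp add: \<theta>_def)
  have gs: "(\<lambda>n. real (Suc n) * x ^ n) sums (1 / (1 - x)\<^sup>2)" if "0 \<le> x" "x \<le> \<rho>" for x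
    using geometric_deriv_sums[of x] that \<rho> by simp
  have "prim (\<lambda>x. \<theta> x / (1 - \<theta> x)) (\<lambda>x. 1 / (1 - \<theta> x)\<^sup>2 * \<theta>' x)"
  proof (rule prim_limit[where u = "\<lambda>N x. \<Sum>n<N. \<theta> x ^ Suc n" and v = "\<lambda>N x. \<Sum>n<N. real (Suc n) * \<theta> x ^ n * \<theta>' x"
        and G = "\<lambda>x. 1 / (1 - \<rho>)\<^sup>2 * \<bar>\<theta>' x\<bar>"])
    show "prim (\<lambda>x. \<Sum>n<N. \<theta> x ^ Suc n) (\<lambda>x. \<Sum>n<N. real (Suc n) * \<theta> x ^ n * \<theta>' x)" for N
      by (intro prim_sum prim_power pt)
    fix x
    have t: "norm (\<theta> x) < 1" using th[of x] \<rho> by simp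
    have "(\<lambda>n. \<theta> x * \<theta> x ^ n) sums (\<theta> x * (1 / (1 - \<theta> x)))" by (intro sums_mult geometric_sums t)
    then show "(\<lambda>N. \<Sum>n<N. \<theta> x ^ Suc n) \<longlonglongrightarrow> \<theta> x / (1 - \<theta> x)" by (simp add: sums_def)
    have "(\<lambda>N. (\<Sum>n<N. real (Suc n) * \<theta> x ^ n) * \<theta>' x) \<longlonglongrightarrow> 1 / (1 - \<theta> x)\<^sup>2 * \<theta>' x"
      using gs[OF th] unfolding sums_def by (intro tendsto_intros)
    then show "(\<lambda>N. \<Sum>n<N. real (Suc n) * \<theta> x ^ n * \<theta>' x) \<longlonglongrightarrow> 1 / (1 - \<theta> x)\<^sup>2 * \<theta>' x"
      by (simp only: sum_distrib_right)
    fix N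
    have "(\<Sum>n<N. real (Suc n) * \<theta> x ^ n) \<le> (\<Sum>n<N. real (Suc n) * \<rho> ^ n)"
      using th[of x] by (intro sum_mono mult_left_mono power_mono) auto
    also have "\<dots> \<le> 1 / (1 - \<rho>)\<^sup>2"
      using sum_le_suminf[OF sums_summable[OF gs[OF \<rho>(1)]], of "{..<N}"] sums_unique[OF gs[OF \<rho>(1)]] \<rho> by auto
    finally have b: "(\<Sum>n<N. real (Suc n) * \<theta> x ^ n) \<le> 1 / (1 - \<rho>)\<^sup>2" .
    have "\<bar>(\<Sum>n<N. real (Suc n) * \<theta> x ^ n) * \<theta>' x\<bar> \<le> 1 / (1 - \<rho>)\<^sup>2 * \<bar>\<theta>' x\<bar>"
      unfolding abs_mult using b th[of x] by (intro mult_right_mono) (auto simp: abs_of_nonneg sum_nonneg)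
    then show "\<bar>\<Sum>n<N. real (Suc n) * \<theta> x ^ n * \<theta>' x\<bar> \<le> 1 / (1 - \<rho>)\<^sup>2 * \<bar>\<theta>' x\<bar>"
      by (simp only: sum_distrib_right)
  next
    fix a b :: real assume "a \<le> b" "b \<le> 0"
    then show "set_integrable lborel {a..b} (\<lambda>x. 1 / (1 - \<rho>)\<^sup>2 * \<bar>\<theta>' x\<bar>)"
      using primD(3)[OF pt, of a b] by (intro set_integrable_mult_right set_integrable_abs) auto
  next
    note [measurable] = prim_measurable[OF pt] primD(1)[OF pt]
    show "(\<lambda>x. 1 / (1 - \<theta> x)\<^sup>2 * \<theta>' x) \<in> borel_measurable borel" by measurable
  qed
  \<comment> \<open>The series started with the first power of \<open>\<theta>\<close>; the zeroth
    one is restored by the constant \<open>1 / K\<close>.\<close>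
  then have "prim (\<lambda>x. 1 / K + (1 / K) * (\<theta> x / (1 - \<theta> x))) (\<lambda>x. 0 + (1 / K) * (1 / (1 - \<theta> x)\<^sup>2 * \<theta>' x))"
    by (intro prim_add prim_const prim_scale)
  moreover have "1 / K + (1 / K) * (\<theta> x / (1 - \<theta> x)) = 1 / h x" for x
  proof -
    have "h x > 0" using c(1) c(2)[of x] by linarith
    then show ?thesis unfolding t1 using K0 by (simp add: \<theta>_def field_simps)
  qed
  moreover have "0 + (1 / K) * (1 / (1 - \<theta> x)\<^sup>2 * \<theta>' x) = - h' x / (h x)\<^sup>2" for x
    unfolding t1 using K0 by (simp add: \<theta>'_def power2_eq_square field_simps)
  ultimately show ?thesis by simp
qed

context wave_params
begin

text \<open>Here \<open>w = 1/h - 1 = - \<epsilon> z / h\<close> and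
  \<open>w' = - \<epsilon> z' / h^2\<close>. Both are square integrable because \<open>1/h\<close>
  is bounded by \<open>1/c\<close>.\<close>

lemma inverse_depth_0:
  assumes c: "c > 0" "\<And>x. x \<le> 0 \<Longrightarrow> c \<le> 1 + \<epsilon> * fn z x"
  shows "\<exists>w. cst z w = 0"
proof -
  define h where "h x = 1 + \<epsilon> * fn z x" for x
  have ch: "c \<le> h x" for x using c(2)[of x] c(2)[of 0] fn_pos[of x z] by (cases "x \<le> 0") (auto simp: h_def)
  have hK: "h x \<le> 1 + \<epsilon> * norm z" for x
    using fn_norm[of z x] \<epsilon> by (auto simp: h_def abs_le_iff)
  have ph: "prim h (\<lambda>x. 0 + \<epsilon> * dv z x)" unfolding h_def[abs_def] by (intro prim_add prim_const prim_scale prim_dv)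
  note pi = prim_inverse[OF ph c(1) ch hK]
  have hp: "h x > 0" for x using ch[of x] c(1) by linarith
  have b1: "\<bar>1 / h x\<bar> \<le> 1 / c" for x using ch[of x] c(1) hp[of x] by (simp add: frac_le)
  define u where "u x = 1 / h x + - 1" for x
  have pu: "prim u (\<lambda>x. - (0 + \<epsilon> * dv z x) / (h x)\<^sup>2 + 0)" unfolding u_def[abs_def] by (intro prim_add pi prim_const)
  have hm [measurable]: "h \<in> borel_measurable borel" by (rule prim_measurable[OF ph])
  have "square_integrable hl (\<lambda>x. (1 / h x) * (- \<epsilon> * fn z x))"
    by (rule l2n_mult_bounded(1)[OF square_integrable_scale(1)[OF sq_fn], of _ "1 / c"]) (use b1 c(1) in auto)
  moreover have "(1 / h x) * (- \<epsilon> * fn z x) = u x" for x using hp[of x] by (simp add: u_def h_def field_simps)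
  ultimately have su: "square_integrable hl u" by simp
  have "square_integrable hl (\<lambda>x. (1 / h x * (1 / h x)) * (- \<epsilon> * dv z x))"
  proof (rule l2n_mult_bounded(1)[OF square_integrable_scale(1)[OF sq_dv], of _ "1 / c * (1 / c)"])
    show "AE x in hl. \<bar>1 / h x * (1 / h x)\<bar> \<le> 1 / c * (1 / c)"
      unfolding abs_mult using b1 c(1) by (intro AE_I2 mult_mono) auto
  qed (use c(1) in auto)
  moreover have "(1 / h x * (1 / h x)) * (- \<epsilon> * dv z x) = - (0 + \<epsilon> * dv z x) / (h x)\<^sup>2 + 0" for x
    by (simp add: power2_eq_square)
  ultimately have sv: "square_integrable hl (\<lambda>x. - (0 + \<epsilon> * dv z x) / (h x)\<^sup>2 + 0)" by (simp only:)
  obtain w where w: "fn w = u" using h1_obtain[OF pu su sv] by blast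
  have "cst z w = 0"
  proof (rule h1_eqI)
    fix x :: real
    have "(1 + u x) * h x = 1" using hp[of x] by (simp add: u_def)
    then show "fn (cst z w) x = fn 0 x" by (simp add: cst_def w h_def algebra_simps)
  qed
  then show ?thesis by blast
qed

text \<open>Bootstrapping: \<open>w' = - \<epsilon> \<zeta>_x (1 + w)^2\<close> involves only
  functions already in the range of \<open>Sn k\<close>, which is closed under products. So
  \<open>w = S (w + w')\<close> gains one power of \<open>S\<close>.\<close>

lemma inverse_depth:
  assumes c: "c > 0" "\<And>x. x \<le> 0 \<Longrightarrow> c \<le> 1 + \<epsilon> * fn (Sn k z) x"
  shows "\<exists>w. cst (Sn k z) (Sn k w) = 0"
  using c(2)
proof (induction k arbitrary: z)
  case 0 then show ?case using inverse_depth_0[OF c(1)] by simp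
next
  case (Suc k)
  have "\<exists>w. cst (Sn k (S z)) (Sn k w) = 0" by (rule Suc.IH) (use Suc.prems in \<open>simp add: Sn_S\<close>)
  then obtain w0 where w0: "cst (Sn (Suc k) z) (Sn k w0) = 0" by (auto simp: Sn_S)
  define w where "w = Sn k w0"
  define p where "p = Sn k (pc z)"
  define w1 where "w1 = - \<epsilon> *\<^sub>R (p + 2 *\<^sub>R (p * w) + p * w * w)"
  note dz = dr_dv[OF Sn_pc_dr[of k z], folded p_def]
  have cw: "cst (Sn (Suc k) z) w = 0" using w0 by (simp add: w_def)
  have "AE x in hl. dv (cst (Sn (Suc k) z) w) x = dv w x + \<epsilon> * dv (Sn (Suc k) z) x
      + \<epsilon> * (dv (Sn (Suc k) z) x * fn w x + fn (Sn (Suc k) z) x * dv w x)"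
    by (rule dv_AE) (auto simp: cst_def intro!: prim_add prim_scale prim_mult prim_dv)
  then have "AE x in hl. dv w x = fn w1 x"
    using dz dv_zero unfolding cw
  proof eventually_elim
    case (elim x)
    define a where "a = 1 + \<epsilon> * fn (Sn (Suc k) z) x"
    have one: "(1 + fn w x) * a = 1" unfolding a_def by (rule cst_fn[OF cw])
    have "dv w x * a = - \<epsilon> * fn p x * (1 + fn w x)"
      using elim by (simp add: a_def algebra_simps)
    then have "(1 + fn w x) * (dv w x * a) = (1 + fn w x) * (- \<epsilon> * fn p x * (1 + fn w x))" by simp
    moreover have "(1 + fn w x) * (dv w x * a) = dv w x * ((1 + fn w x) * a)" by simp
    ultimately have "dv w x = (1 + fn w x) * (- \<epsilon> * fn p x * (1 + fn w x))" using one by simp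
    then show ?case by (simp add: w1_def algebra_simps)
  qed
  then have "dr w w1" unfolding dr_def by (rule prim_cong_AE[OF prim_dv fn_measurable])
  from S_eqI[OF this] have "w = S (w + w1)" .
  also have "w + w1 = Sn k (w0 - \<epsilon> *\<^sub>R (pc z + 2 *\<^sub>R mk k (pc z) w0 + mk k (mk k (pc z) w0) w0))"
    by (simp add: w1_def w_def p_def Sn_linear Sn_mk)
  finally have "w = Sn (Suc k) (w0 - \<epsilon> *\<^sub>R (pc z + 2 *\<^sub>R mk k (pc z) w0 + mk k (mk k (pc z) w0) w0))" by simp
  then show ?case using cw by metis
qed

end

section \<open>Equivalence of the system with the differential equation\<close>

locale wave_system = wave_params "l - r" \<alpha> Tbuo P0 \<kappa> \<eta>eq \<epsilon> \<mu>
  for r l \<alpha> Tbuo P0 \<kappa> \<eta>eq \<epsilon> \<mu> :: real +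
  fixes k :: nat
begin

section \<open>Dictionary between functions and states at a fixed time\<close>

definition represents :: "(real \<Rightarrow> real) \<Rightarrow> (real \<Rightarrow> real) \<Rightarrow> h1 \<Rightarrow> h1 \<Rightarrow> h1 \<Rightarrow> bool" where
  "represents \<zeta> q z w g \<longleftrightarrow> \<zeta> \<in> borel_measurable (LE r) \<and> q \<in> borel_measurable (LE r) \<and>
     (AE x in LE r. \<zeta> x = ext r (Sn k z) x) \<and> (AE x in LE r. q x = ext r (Sn (Suc k) g) x) \<and>
     cst (Sn k z) (Sn k w) = 0"

context
  fixes \<zeta> q z w g
  assumes rep: "represents \<zeta> q z w g"
begin

lemma represents_simps:
  "\<zeta> \<in> borel_measurable (LE r)" "q \<in> borel_measurable (LE r)"
  "AE x in LE r. \<zeta> x = ext r (Sn k z) x" "AE x in LE r. q x = ext r (Sn (Suc k) g) x"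
  "(1 + fn (Sn k w) x) * (1 + \<epsilon> * fn (Sn k z) x) = 1"
  using rep cst_fn by (simp_all only: represents_def)

lemma inverse_depth_AE: "AE x in LE r. 1 / depth \<epsilon> \<zeta> x = 1 + fn (Sn k w) (x + r)"
  using represents_simps(3)
proof eventually_elim
  case (elim x)
  have "depth \<epsilon> \<zeta> x = 1 + \<epsilon> * fn (Sn k z) (x + r)" by (simp add: depth_def elim ext_def)
  then show ?case using represents_simps(5)[of "x + r"] by (metis mult_eq_0_iff nonzero_eq_divide_eq one_neq_zero)
qed

lemma bdry_trace_depth: "bdry_trace r (depth \<epsilon> \<zeta>) = 1 / (1 + tr k w)"
proof -
  have "bdry_trace r (depth \<epsilon> \<zeta>) = 1 + \<epsilon> * fn (Sn k z) 0"
  proof (rule bdry_trace_eq[where v = "\<lambda>x. 1 + \<epsilon> * fn (Sn k z) x"])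
    show "continuous_on UNIV (\<lambda>x. 1 + \<epsilon> * fn (Sn k z) x)" by (intro continuous_intros fn_continuous)
    show "AE x in LE r. depth \<epsilon> \<zeta> x = 1 + \<epsilon> * fn (Sn k z) (x + r)"
      using represents_simps(3) by eventually_elim (simp add: depth_def ext_def)
  qed
  then show ?thesis using represents_simps(5)[of 0] unfolding tr_def
    by (metis mult.commute mult_eq_0_iff nonzero_eq_divide_eq one_neq_zero)
qed

lemma phi_AE: "AE x in LE r. phi \<epsilon> \<zeta> q x = ext r (Sn k (Phi k z w g)) x"
  using represents_simps(3,4) inverse_depth_AE
proof eventually_elim
  case (elim x)
  have "phi \<epsilon> \<zeta> q x = \<zeta> x + \<epsilon> / 2 * (\<zeta> x)\<^sup>2 + \<epsilon> * ((q x)\<^sup>2 * (1 / depth \<epsilon> \<zeta> x))" by (simp add: phi_def)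
  then show ?case unfolding elim(3) by (simp only: elim(1,2) ext_def fn_Sn_Phi)
qed

lemma bdry_trace_forcing:
  "bdry_trace r (forcing r \<epsilon> \<mu> \<zeta> q) =
    (1 + tr k w) * (\<epsilon> * (tr k z)\<^sup>2 / 2 + fn (Rop \<mu> (Sn k (Phi k z w g))) 0)"
  unfolding tr_def
proof (rule bdry_trace_eq[where v = "\<lambda>x. (1 + fn (Sn k w) x) * (\<epsilon> * (fn (Sn k z) x)\<^sup>2 / 2 + fn (Rop \<mu> (Sn k (Phi k z w g))) x)"])
  show "continuous_on UNIV (\<lambda>x. (1 + fn (Sn k w) x) * (\<epsilon> * (fn (Sn k z) x)\<^sup>2 / 2 + fn (Rop \<mu> (Sn k (Phi k z w g))) x))"
    by (intro continuous_intros fn_continuous) simp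
  show "AE x in LE r. forcing r \<epsilon> \<mu> \<zeta> q x =
      (1 + fn (Sn k w) (x + r)) * (\<epsilon> * (fn (Sn k z) (x + r))\<^sup>2 / 2 + fn (Rop \<mu> (Sn k (Phi k z w g))) (x + r))"
    using represents_simps(3) inverse_depth_AE R1_AE[OF \<mu> phi_AE]
    by eventually_elim (simp only: forcing_def ext_def)
qed

text \<open>All traces in the oscillator equation are rewritten through the state; since
  \<open>T2\<close> is positive the equation can then be solved for the acceleration.\<close>

lemma acceleration_iff:
  assumes "h_wc \<epsilon> \<eta>eq b > 0" "1 + tr k w > 0"
  shows "period_sq r (l - r) \<alpha> Tbuo \<mu> (depth \<epsilon> \<zeta>) (h_wc \<epsilon> \<eta>eq b) * b2 =
             - (1 + P0) * b + \<kappa> * P0 * d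
             + \<epsilon> * beta r (l - r) (depth \<epsilon> \<zeta>) (h_wc \<epsilon> \<eta>eq b) * b1\<^sup>2
             + bdry_trace r (forcing r \<epsilon> \<mu> \<zeta> q) \<longleftrightarrow> b2 = acc k ((z, w, g), (b, b1, d))"
proof -
  have p: "period_sq r (l - r) \<alpha> Tbuo \<mu> (depth \<epsilon> \<zeta>) (h_wc \<epsilon> \<eta>eq b) = T2 (tr k w) b"
    by (simp add: period_sq_def T2_def bdry_trace_depth)
  have b: "beta r (l - r) (depth \<epsilon> \<zeta>) (h_wc \<epsilon> \<eta>eq b) =
      (l - r)\<^sup>2 / 2 * (- (1 + tr k w)\<^sup>2 + 1 / (3 * (h_wc \<epsilon> \<eta>eq b)\<^sup>2))"
    by (simp add: beta_def bdry_trace_depth power_divide)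
  have "T2 (tr k w) b > 0" using T2_ge[OF assms] Tbuo by linarith
  then show ?thesis unfolding p b bdry_trace_forcing
    by (simp add: acc_def num_def bdry_trace_forcing eq_divide_eq mult.commute[of _ b2])
qed

lemma continuity_iff:
  assumes "AE x in LE r. \<zeta>t x = ext r (Sn k zt) x"
  shows "(AE x in LE r. \<zeta>t x + weak_deriv (Eminus r) 1 q x = 0) \<longleftrightarrow> zt = - pc g"
proof -
  have "has_weak_deriv (Eminus r) 1 q (ext r (Sn k (pc g)))"
    by (rule has_weak_deriv_cong[OF ext_weak_deriv_dr[OF Sn_pc_dr] represents_simps(2,4)])
  note w = weak_deriv_AE[OF this]
  show ?thesis
  proof
    assume "AE x in LE r. \<zeta>t x + weak_deriv (Eminus r) 1 q x = 0"
    then have "AE x in LE r. ext r (Sn k zt) x = ext r (Sn k (- pc g)) x"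
      using w assms by eventually_elim (simp add: Sn_linear ext_linear)
    from ext_AE_inject[OF this] show "zt = - pc g" by (rule Sn_inject)
  next
    assume zt: "zt = - pc g"
    show "AE x in LE r. \<zeta>t x + weak_deriv (Eminus r) 1 q x = 0"
      using w assms by eventually_elim (simp add: zt Sn_linear ext_linear)
  qed
qed

lemma flux_AE:
  defines "A \<equiv> Sn (Suc k) g * Sn (Suc k) g + Sn (Suc k) g * Sn (Suc k) g * Sn k w"
  shows "AE x in LE r. weak_deriv (Eminus r) 1 (\<lambda>y. (q y)\<^sup>2 / depth \<epsilon> \<zeta> y) x = dv A (x + r)"
proof (rule weak_deriv_AE, rule has_weak_deriv_cong[OF ext_weak_deriv])
  note [measurable] = represents_simps(1,2)
  show "(\<lambda>y. (q y)\<^sup>2 / depth \<epsilon> \<zeta> y) \<in> borel_measurable (LE r)" unfolding depth_def by measurable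
  show "AE x in LE r. (q x)\<^sup>2 / depth \<epsilon> \<zeta> x = ext r A x"
    using represents_simps(4) inverse_depth_AE
  proof eventually_elim
    case (elim x)
    have "(q x)\<^sup>2 / depth \<epsilon> \<zeta> x = (q x)\<^sup>2 * (1 / depth \<epsilon> \<zeta> x)" by simp
    then show ?case unfolding elim(2) by (simp only: elim(1)) (simp add: A_def ext_def algebra_simps power2_eq_square)
  qed
qed

text \<open>\<open>h \<zeta>_x\<close> is the derivative of
  \<open>\<zeta> + \<epsilon> \<zeta>^2 / 2\<close>; together with the flux term it makes up the
  derivative of \<open>\<phi>\<close>.\<close>

lemma momentum_flux_AE:
  "AE x in LE r. \<epsilon> * weak_deriv (Eminus r) 1 (\<lambda>y. (q y)\<^sup>2 / depth \<epsilon> \<zeta> y) x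
       + depth \<epsilon> \<zeta> x * weak_deriv (Eminus r) 1 \<zeta> x = dv (Sn k (Phi k z w g)) (x + r)"
proof -
  define Z where "Z = Sn k z"
  define G where "G = Sn (Suc k) g"
  define A where "A = G * G + G * G * Sn k w"
  have Phi: "Sn k (Phi k z w g) = Z + (\<epsilon> / 2) *\<^sub>R (Z * Z) + \<epsilon> *\<^sub>R A"
    by (rule h1_eqI, subst fn_Sn_Phi) (simp add: Z_def G_def A_def power2_eq_square algebra_simps)
  have "AE y in hl. dv (Sn k (Phi k z w g)) y = dv Z y + \<epsilon> * fn Z y * dv Z y + \<epsilon> * dv A y"
    unfolding Phi using dv_add[of "Z + (\<epsilon> / 2) *\<^sub>R (Z * Z)" "\<epsilon> *\<^sub>R A"] dv_add[of Z "(\<epsilon> / 2) *\<^sub>R (Z * Z)"]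
      dv_scaleR[of \<epsilon> A] dv_scaleR[of "\<epsilon> / 2" "Z * Z"] dv_mult[of Z Z]
    by eventually_elim (simp add: algebra_simps)
  then have d: "AE x in LE r. dv (Sn k (Phi k z w g)) (x + r) = dv Z (x + r) + \<epsilon> * fn Z (x + r) * dv Z (x + r) + \<epsilon> * dv A (x + r)"
    by (simp add: AE_LE)
  have "has_weak_deriv (Eminus r) 1 \<zeta> (\<lambda>x. dv Z (x + r))"
    unfolding Z_def by (rule has_weak_deriv_cong[OF ext_weak_deriv represents_simps(1,3)])
  note wz = weak_deriv_AE[OF this]
  show ?thesis using d wz flux_AE represents_simps(3)
    unfolding A_def[symmetric] G_def[symmetric] Z_def[symmetric]
    by eventually_elim (simp add: depth_def ext_def algebra_simps)
qed

text \<open>The momentum equation says that \<open>q_t\<close> plus the derivative of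
  \<open>R1 \<phi>\<close> solves the homogeneous elliptic equation, so by
  \<open>elliptic_kernel\<close> it is a multiple of the boundary layer. The derivative of
  \<open>R1 \<phi>\<close> vanishes at 0, so the factor is the trace of \<open>q_t\<close>. Its
  value stays free here; the boundary condition is what fixes it.\<close>

lemma momentum_iff:
  assumes qt: "qt \<in> borel_measurable (LE r)" "AE x in LE r. qt x = ext r (Sn (Suc k) gt) x"
  shows "(AE x in LE r. (qt x - \<mu>\<^sup>2 * weak_deriv (Eminus r) 2 qt x)
              + \<epsilon> * weak_deriv (Eminus r) 1 (\<lambda>y. (q y)\<^sup>2 / depth \<epsilon> \<zeta> y) x
              + depth \<epsilon> \<zeta> x * weak_deriv (Eminus r) 1 \<zeta> x = 0)
    \<longleftrightarrow> gt = tr (Suc k) gt *\<^sub>R Ek \<mu> k - gk \<mu> k (Phi k z w g)" (is "?M \<longleftrightarrow> _")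
proof -
  define Q where "Q = Sn (Suc k) gt"
  define Q' where "Q' = Sn k (pc gt)"
  define \<phi> where "\<phi> = Sn k (Phi k z w g)"
  have dQ: "dr Q Q'" unfolding Q_def Q'_def by (rule Sn_pc_dr)
  have w1: "has_weak_deriv (Eminus r) 1 qt (ext r Q')"
    by (rule has_weak_deriv_cong[OF ext_weak_deriv_dr[OF dQ] qt(1)]) (use qt(2) in \<open>simp only: Q_def\<close>)
  have "has_weak_deriv (Eminus r) 2 qt (\<lambda>x. dv Q' (x + r))"
    using has_weak_deriv_trans[OF w1 ext_weak_deriv] by (simp add: numeral_2_eq_2)
  note w2 = weak_deriv_AE[OF this]
  have "?M \<longleftrightarrow> (AE x in LE r. ext r Q x - \<mu>\<^sup>2 * dv Q' (x + r) + dv \<phi> (x + r) = 0)"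
  proof
    assume ?M
    then show "AE x in LE r. ext r Q x - \<mu>\<^sup>2 * dv Q' (x + r) + dv \<phi> (x + r) = 0"
      using w2 qt(2) momentum_flux_AE unfolding Q_def[symmetric] \<phi>_def[symmetric]
      by eventually_elim simp
  next
    assume "AE x in LE r. ext r Q x - \<mu>\<^sup>2 * dv Q' (x + r) + dv \<phi> (x + r) = 0"
    then show ?M
      using w2 qt(2) momentum_flux_AE unfolding Q_def[symmetric] \<phi>_def[symmetric]
      by eventually_elim simp
  qed
  also have "\<dots> \<longleftrightarrow> (AE y in hl. fn Q y - \<mu>\<^sup>2 * dv Q' y + dv \<phi> y = 0)"
    by (simp add: AE_LE ext_def)
  also have "\<dots> \<longleftrightarrow> Q = fn Q 0 *\<^sub>R expo \<mu> - Pop \<mu> \<phi>"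
  proof
    assume eq: "AE y in hl. fn Q y - \<mu>\<^sup>2 * dv Q' y + dv \<phi> y = 0"
    define W where "W = Q + Pop \<mu> \<phi>"
    define V where "V = Q' + (1 / \<mu>\<^sup>2) *\<^sub>R (Rop \<mu> \<phi> - \<phi>)"
    have WV: "dr W V" unfolding W_def V_def by (intro dr_add dQ dr_Pop[OF \<mu>])
    have "AE y in hl. dv V y = fn ((1 / \<mu>\<^sup>2) *\<^sub>R W) y"
      unfolding V_def W_def
      using eq dv_add[of Q' "(1 / \<mu>\<^sup>2) *\<^sub>R (Rop \<mu> \<phi> - \<phi>)"] dv_scaleR[of "1 / \<mu>\<^sup>2" "Rop \<mu> \<phi> - \<phi>"]
        dv_diff[of "Rop \<mu> \<phi>" \<phi>] dr_dv[OF dr_Rop[OF \<mu>, of \<phi>]]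
      by eventually_elim (use \<mu> in \<open>simp add: field_simps\<close>)
    then have "dr V ((1 / \<mu>\<^sup>2) *\<^sub>R W)"
      unfolding dr_def by (rule prim_cong_AE[OF prim_dv fn_measurable])
    from elliptic_kernel(1)[OF \<mu> WV this] have W: "W = fn W 0 *\<^sub>R expo \<mu>" .
    have "fn W 0 = fn Q 0" by (simp add: W_def Pop_0[OF \<mu>])
    note W[unfolded this]
    then show "Q = fn Q 0 *\<^sub>R expo \<mu> - Pop \<mu> \<phi>" by (simp add: W_def algebra_simps)
  next
    assume Q: "Q = fn Q 0 *\<^sub>R expo \<mu> - Pop \<mu> \<phi>"
    have "dr (fn Q 0 *\<^sub>R expo \<mu> - Pop \<mu> \<phi>) (fn Q 0 *\<^sub>R ((1 / \<mu>) *\<^sub>R expo \<mu>) - (1 / \<mu>\<^sup>2) *\<^sub>R (Rop \<mu> \<phi> - \<phi>))"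
      by (intro dr_diff dr_scaleR dr_expo[OF \<mu>] dr_Pop[OF \<mu>])
    then have Q': "Q' = fn Q 0 *\<^sub>R ((1 / \<mu>) *\<^sub>R expo \<mu>) - (1 / \<mu>\<^sup>2) *\<^sub>R (Rop \<mu> \<phi> - \<phi>)"
      using dQ dr_unique Q by metis
    have "AE y in hl. dv Q' y = fn Q 0 / \<mu> * dv (expo \<mu>) y - (1 / \<mu>\<^sup>2) * (dv (Rop \<mu> \<phi>) y - dv \<phi> y)"
      unfolding Q' using dv_diff[of "fn Q 0 *\<^sub>R ((1 / \<mu>) *\<^sub>R expo \<mu>)" "(1 / \<mu>\<^sup>2) *\<^sub>R (Rop \<mu> \<phi> - \<phi>)"]
        dv_scaleR[of "fn Q 0" "(1 / \<mu>) *\<^sub>R expo \<mu>"] dv_scaleR[of "1 / \<mu>" "expo \<mu>"]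
        dv_scaleR[of "1 / \<mu>\<^sup>2" "Rop \<mu> \<phi> - \<phi>"] dv_diff[of "Rop \<mu> \<phi>" \<phi>]
      by eventually_elim simp
    then show "AE y in hl. fn Q y - \<mu>\<^sup>2 * dv Q' y + dv \<phi> y = 0"
      using dr_dv[OF dr_Rop[OF \<mu>, of \<phi>]] dr_dv[OF dr_expo[OF \<mu>]]
    proof eventually_elim
      case (elim y)
      have "fn Q y = fn Q 0 * fn (expo \<mu>) y - fn (Pop \<mu> \<phi>) y" using arg_cong[OF Q, of "\<lambda>f. fn f y"] by simp
      then show ?case using elim \<mu> by (simp add: field_simps power2_eq_square)
    qed
  qed
  also have "\<dots> \<longleftrightarrow> gt = tr (Suc k) gt *\<^sub>R Ek \<mu> k - gk \<mu> k (Phi k z w g)"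
  proof -
    have "fn Q 0 *\<^sub>R expo \<mu> - Pop \<mu> \<phi> = Sn (Suc k) (tr (Suc k) gt *\<^sub>R Ek \<mu> k - gk \<mu> k (Phi k z w g))"
      unfolding Q_def \<phi>_def tr_def
      by (subst Sn_linear(2), subst Sn_linear(3), subst Sn_gk[OF \<mu>], subst Sn_Ek[OF \<mu>]) (rule refl)
    then show ?thesis using Sn_inject[of "Suc k"] unfolding Q_def by metis
  qed
  finally show ?thesis .
qed

end

end

section \<open>The Duhamel integral and the evolution of \<open>1/h\<close>\<close>

lemma time_interval_extend:
  assumes "t \<in> time_interval T"
  obtains t2 where "t < t2" "ereal t2 < T"
  using assms ereal_dense2[of "ereal t" T] by (auto simp: time_interval_def)

text \<open>Uniqueness of derivatives within the interval, one-sided at 0, requires limit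
  points.\<close>

lemma at_within_time_interval_nontrivial:
  assumes t: "t \<in> time_interval T" shows "at t within time_interval T \<noteq> bot"
proof -
  obtain t2 where t2: "t < t2" "ereal t2 < T" using time_interval_extend[OF t] .
  have "{t<..<t2} \<subseteq> time_interval T"
  proof
    fix s assume s: "s \<in> {t<..<t2}"
    then have "ereal s < ereal t2" by simp
    also have "\<dots> < T" by fact
    finally show "s \<in> time_interval T" using s t by (simp add: time_interval_def)
  qed
  then have "t islimpt time_interval T" using islimpt_greaterThanLessThan1[OF t2(1)] islimpt_subset by blast
  then show ?thesis by (simp add: trivial_limit_within)
qed

text \<open>Factoring \<open>exp (- \<kappa> * u)\<close> out of the kernel leaves an indefinite
  integral. In this differential form the memory term becomes one more unknown of an autonomous
  system.\<close>

lemma duhamel_has_derivative: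
  assumes f: "continuous_on (time_interval T) f" and t: "t \<in> time_interval T"
  shows "(duhamel \<kappa> f has_vector_derivative f t - \<kappa> * duhamel \<kappa> f t) (at t within time_interval T)"
proof -
  obtain t2 where t2: "t < t2" "ereal t2 < T" using time_interval_extend[OF t] .
  have t0: "t \<ge> 0" using t by (simp add: time_interval_def)
  have sub: "{0..t2} \<subseteq> time_interval T" by (rule time_interval_Icc) (use t2 t0 in \<open>simp add: time_interval_def\<close>)
  define G where "G u = integral {0..u} (\<lambda>s. exp (\<kappa> * s) * f s)" for u
  have eq: "duhamel \<kappa> f = (\<lambda>u. exp (- \<kappa> * u) * G u)"
  proof
    fix u
    have "(\<lambda>s. exp (- \<kappa> * (u - s)) * f s) = (\<lambda>s. exp (- \<kappa> * u) * (exp (\<kappa> * s) * f s))"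
      by (simp add: algebra_simps exp_add[symmetric] fun_eq_iff mult_exp_exp)
    then show "duhamel \<kappa> f u = exp (- \<kappa> * u) * G u" by (simp add: duhamel_def G_def)
  qed
  have G: "(G has_vector_derivative exp (\<kappa> * t) * f t) (at t within {0..t2})"
    unfolding G_def[abs_def]
    by (rule integral_has_vector_derivative)
       (use t0 t2 in \<open>auto intro!: continuous_intros continuous_on_subset[OF f sub]\<close>)
  have E: "((\<lambda>u. exp (- \<kappa> * u)) has_vector_derivative - \<kappa> * exp (- \<kappa> * t)) (at t within {0..t2})"
    unfolding has_real_derivative_iff_has_vector_derivative[symmetric]
    by (auto intro!: derivative_eq_intros)
  have ex: "exp (- \<kappa> * t) * exp (\<kappa> * t) = (1::real)" by (simp add: mult_exp_exp)
  have "(duhamel \<kappa> f has_vector_derivative exp (- \<kappa> * t) * (exp (\<kappa> * t) * f t) + - \<kappa> * exp (- \<kappa> * t) * G t) (at t within {0..t2})"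
    unfolding eq by (rule has_vector_derivative_mult[OF E G])
  also have "exp (- \<kappa> * t) * (exp (\<kappa> * t) * f t) = f t" using ex by (simp add: mult.assoc[symmetric])
  finally have "(duhamel \<kappa> f has_vector_derivative f t - \<kappa> * duhamel \<kappa> f t) (at t within {0..t2})"
    unfolding eq by (simp add: algebra_simps)
  then have "(duhamel \<kappa> f has_vector_derivative f t - \<kappa> * duhamel \<kappa> f t) (at t within time_interval (ereal t2))"
    by (rule has_vector_derivative_within_subset) auto
  moreover have "at t within time_interval T = at t within time_interval (ereal t2)"
    by (rule at_within_time_interval) (use t2 t0 in auto)
  ultimately show ?thesis by simp
qed

lemma duhamel_0: "duhamel \<kappa> f 0 = 0"
  by (simp add: duhamel_def)

lemma duhamel_unique:
  assumes f: "continuous_on (time_interval T) f" and t: "t \<in> time_interval T" and d0: "d 0 = 0"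
    and d: "\<And>s. s \<in> time_interval T \<Longrightarrow> (d has_vector_derivative f s - \<kappa> * d s) (at s within time_interval T)"
  shows "d t = duhamel \<kappa> f t"
proof -
  have t0: "t \<ge> 0" using t by (simp add: time_interval_def)
  have sub: "{0..t} \<subseteq> time_interval T" by (rule time_interval_Icc[OF t])
  have "d t - duhamel \<kappa> f t = 0"
  proof (rule linear_ode_zero[of 0 t "\<lambda>s. d s - duhamel \<kappa> f s" "\<lambda>s. (f s - \<kappa> * d s) - (f s - \<kappa> * duhamel \<kappa> f s)" "\<bar>\<kappa>\<bar>"])
    fix s assume "s \<in> {0..t}"
    then have "s \<in> time_interval T" using sub by blast
    then show "((\<lambda>s. d s - duhamel \<kappa> f s) has_vector_derivative (f s - \<kappa> * d s) - (f s - \<kappa> * duhamel \<kappa> f s)) (at s within {0..t})"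
      by (intro has_vector_derivative_diff has_vector_derivative_within_subset[OF d sub]
          has_vector_derivative_within_subset[OF duhamel_has_derivative[OF f] sub])
    have "(f s - \<kappa> * d s) - (f s - \<kappa> * duhamel \<kappa> f s) = - \<kappa> * (d s - duhamel \<kappa> f s)" by (simp add: algebra_simps)
    then show "norm ((f s - \<kappa> * d s) - (f s - \<kappa> * duhamel \<kappa> f s)) \<le> \<bar>\<kappa>\<bar> * norm (d s - duhamel \<kappa> f s)"
      by (simp add: abs_mult)
  qed (use t0 d0 in \<open>auto simp: duhamel_0\<close>)
  then show ?thesis by simp
qed

text \<open>The inequality is the equation \<open>min u v = u\<close>, to which the result for
  equalities applies.\<close>

lemma AE_hl_continuous_le:
  fixes u v :: "real \<Rightarrow> real"
  assumes "continuous_on UNIV u" "continuous_on UNIV v" "AE x in hl. u x \<le> v x" "x \<le> 0"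
  shows "u x \<le> v x"
proof -
  have "min (u x) (v x) = u x"
  proof (rule AE_hl_continuous_eq[of "\<lambda>x. min (u x) (v x)" u])
    show "AE x in hl. min (u x) (v x) = u x" using assms(3) by eventually_elim simp
  qed (intro continuous_intros assms)+
  then show ?thesis by linarith
qed

context wave_params
begin

lemma cst_unique:
  assumes "cst z w = 0" "cst z w' = 0" shows "w = w'"
proof (rule h1_eqI)
  fix x show "fn w x = fn w' x"
    using cst_fn[OF assms(1), of x] cst_fn[OF assms(2), of x]
    by (metis add_left_cancel mult_right_cancel mult_zero_right zero_neq_one)
qed

text \<open>\<open>1 + w\<close> has the inverse \<open>1 + \<epsilon> z\<close> and never vanishes.
  Positive at the boundary, it keeps its sign by the intermediate value theorem.\<close>

lemma cst_pos:
  assumes c: "cst z w = 0" and p: "1 + fn w 0 > 0" shows "1 + fn w x > 0"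
proof (cases "x \<le> 0")
  case True
  show ?thesis
  proof (rule ccontr)
    assume "\<not> 1 + fn w x > 0"
    then have "\<exists>y\<ge>x. y \<le> 0 \<and> 1 + fn w y = 0"
      using p True by (intro IVT') (auto intro!: continuous_intros fn_continuous)
    then obtain y where "1 + fn w y = 0" by blast
    then show False using cst_fn[OF c, of y] by simp
  qed
next
  case False then show ?thesis using p fn_pos[of x w] by simp
qed

lemma wt_eq:
  assumes D: "D = - \<epsilon> *\<^sub>R (p + mk k p w)" and p: "p = - pc g"
  shows "D + mk k D w = wt k w g"
  unfolding D p wt_def
  by (rule Sn_inject[of k], rule h1_eqI) (simp add: Sn_linear Sn_mk algebra_simps)

text \<open>For a given solution of the system \<open>\<omega>\<close> is defined at each time by
  the constraint, so its differentiability has to be proved. The identity \<open>\<omega> s -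
  \<omega> t = \<delta> s + mk k (\<delta> s) (\<omega> s)\<close>, with \<open>\<delta> s\<close>
  explicit in \<open>z s - z t\<close>, gives continuity and, after division by
  \<open>s - t\<close>, the derivative.\<close>

lemma inverse_depth_has_derivative:
  assumes z: "(z has_vector_derivative - pc g) (at t within I)" and t: "t \<in> I"
    and c: "\<And>s. s \<in> I \<Longrightarrow> cst (Sn k (z s)) (Sn k (\<omega> s)) = 0"
  shows "(\<omega> has_vector_derivative wt k (\<omega> t) g) (at t within I)"
proof -
  interpret m: bounded_bilinear "mk k" by (rule bounded_bilinear_mk)
  obtain K where K: "K > 0" "\<And>a b. norm (mk k a b) \<le> norm a * norm b * K" using m.pos_bounded by blast
  define \<delta> where "\<delta> s = - \<epsilon> *\<^sub>R ((z s - z t) + mk k (z s - z t) (\<omega> t))" for s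
  define e where "e s = \<delta> s + mk k (\<delta> s) (\<omega> t)" for s
  have diff: "\<omega> s - \<omega> t = \<delta> s + mk k (\<delta> s) (\<omega> s)" if s: "s \<in> I" for s
  proof (rule Sn_inject[of k], rule h1_eqI)
    fix x
    define a b \<zeta> \<eta> where "a = fn (Sn k (\<omega> s)) x" and "b = fn (Sn k (\<omega> t)) x" and "\<zeta> = fn (Sn k (z s)) x" and "\<eta> = fn (Sn k (z t)) x"
    have 1: "(1 + a) * (1 + \<epsilon> * \<zeta>) = 1" and 2: "(1 + b) * (1 + \<epsilon> * \<eta>) = 1"
      unfolding a_def b_def \<zeta>_def \<eta>_def by (rule cst_fn[OF c[OF s]], rule cst_fn[OF c[OF t]])
    have "a - b = (1 + a) * ((1 + b) * (1 + \<epsilon> * \<eta>)) - (1 + b) * ((1 + a) * (1 + \<epsilon> * \<zeta>))"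
      unfolding 1 2 by simp
    also have "\<dots> = - \<epsilon> * ((\<zeta> - \<eta>) + (\<zeta> - \<eta>) * b) + - \<epsilon> * ((\<zeta> - \<eta>) + (\<zeta> - \<eta>) * b) * a"
      by (simp add: algebra_simps)
    finally show "fn (Sn k (\<omega> s - \<omega> t)) x = fn (Sn k (\<delta> s + mk k (\<delta> s) (\<omega> s))) x"
      by (simp add: \<delta>_def Sn_linear Sn_mk a_def b_def \<zeta>_def \<eta>_def)
  qed
  have ev: "\<forall>\<^sub>F s in at t within I. s \<in> I" by (simp add: eventually_at_filter)
  have zc: "(z \<longlongrightarrow> z t) (at t within I)" using has_vector_derivative_continuous[OF z] by (simp add: continuous_within)
  then have dz: "((\<lambda>s. z s - z t) \<longlongrightarrow> 0) (at t within I)" using LIM_zero by blast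
  have "(\<delta> \<longlongrightarrow> - \<epsilon> *\<^sub>R (0 + mk k 0 (\<omega> t))) (at t within I)"
    unfolding \<delta>_def by (intro tendsto_intros m.tendsto dz)
  then have d0: "(\<delta> \<longlongrightarrow> 0) (at t within I)" by (simp add: m.zero_left)
  have "(e \<longlongrightarrow> 0 + mk k 0 (\<omega> t)) (at t within I)"
    unfolding e_def by (intro tendsto_intros m.tendsto d0)
  then have e0: "((\<lambda>s. 2 * norm (e s)) \<longlongrightarrow> 0) (at t within I)"
    by (intro tendsto_mult_right_zero tendsto_norm_zero) (simp add: m.zero_left)
  have small: "\<forall>\<^sub>F s in at t within I. norm (\<delta> s) < 1 / (2 * K)"
    using tendstoD[OF d0, of "1 / (2 * K)"] K by simp
  \<comment> \<open>No bound on \<open>\<omega> s\<close> is available at this point. Once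
    \<open>norm (\<delta> s) * K\<close> is at most 1/2, the term containing
    \<open>\<omega> s - \<omega> t\<close> is absorbed into the left-hand side.\<close>
  have "((\<lambda>s. \<omega> s - \<omega> t) \<longlongrightarrow> 0) (at t within I)"
  proof (rule Lim_null_comparison[OF _ e0], use ev small in eventually_elim)
    case (elim s)
    have "\<omega> s - \<omega> t = e s + mk k (\<delta> s) (\<omega> s - \<omega> t)"
      unfolding e_def m.diff_right using diff[OF elim(1)] by (simp add: algebra_simps)
    then have "norm (\<omega> s - \<omega> t) \<le> norm (e s) + norm (mk k (\<delta> s) (\<omega> s - \<omega> t))"
      by (metis norm_triangle_ineq)
    also have "norm (mk k (\<delta> s) (\<omega> s - \<omega> t)) \<le> norm (\<omega> s - \<omega> t) * (norm (\<delta> s) * K)"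
      using K(2)[of "\<delta> s" "\<omega> s - \<omega> t"] by (simp add: mult_ac)
    also have "\<dots> \<le> norm (\<omega> s - \<omega> t) * (1 / 2)"
      by (intro mult_left_mono) (use elim(2) K in \<open>auto simp: field_simps\<close>)
    finally show ?case by simp
  qed
  then have wc: "(\<omega> \<longlongrightarrow> \<omega> t) (at t within I)" by (simp add: LIM_zero_iff)
  define Q where "Q s = (1 / (s - t)) *\<^sub>R (z s - z t)" for s
  define D where "D s = - \<epsilon> *\<^sub>R (Q s + mk k (Q s) (\<omega> t))" for s
  define P where "P = - \<epsilon> *\<^sub>R (- pc g + mk k (- pc g) (\<omega> t))"
  have "(Q \<longlongrightarrow> - pc g) (at t within I)"
    using z unfolding vector_derivative_iff_quotient Q_def by (simp only: tendsto_norm_zero_iff LIM_zero_iff)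
  then have "(D \<longlongrightarrow> P) (at t within I)"
    unfolding D_def P_def by (intro tendsto_intros m.tendsto)
  then have "((\<lambda>s. D s + mk k (D s) (\<omega> s)) \<longlongrightarrow> P + mk k P (\<omega> t)) (at t within I)"
    by (intro tendsto_intros m.tendsto wc)
  also have "P + mk k P (\<omega> t) = wt k (\<omega> t) g" by (rule wt_eq[OF P_def refl])
  finally have lim: "((\<lambda>s. D s + mk k (D s) (\<omega> s)) \<longlongrightarrow> wt k (\<omega> t) g) (at t within I)" .
  have "\<forall>\<^sub>F s in at t within I. D s + mk k (D s) (\<omega> s) = (1 / (s - t)) *\<^sub>R (\<omega> s - \<omega> t)"
    using ev
  proof eventually_elim
    case (elim s)
    have "D s = (1 / (s - t)) *\<^sub>R \<delta> s"
      unfolding D_def Q_def \<delta>_def by (simp only: m.scaleR_left scaleR_right_distrib scaleR_left_commute)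
    then show ?case unfolding diff[OF elim] by (simp only: m.scaleR_left scaleR_right_distrib)
  qed
  then have "((\<lambda>s. (1 / (s - t)) *\<^sub>R (\<omega> s - \<omega> t)) \<longlongrightarrow> wt k (\<omega> t) g) (at t within I)"
    using lim by (rule Lim_transform_eventually[rotated])
  then show ?thesis
    unfolding vector_derivative_iff_quotient by (intro tendsto_norm_zero LIM_zero)
qed

end

context wave_system
begin

section \<open>Passage between solutions of the two problems\<close>

definition initial_state :: "(real \<Rightarrow> real) \<Rightarrow> (real \<Rightarrow> real) \<Rightarrow> real \<Rightarrow> real \<Rightarrow> state \<Rightarrow> bool" where
  "initial_state \<zeta>in qin bin b1in y0 \<longleftrightarrow>
     (AE x in LE r. ext r (Sn k (cz y0)) x = \<zeta>in x) \<and> (AE x in LE r. ext r (Sn (Suc k) (cg y0)) x = qin x) \<and>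
     cst (Sn k (cz y0)) (Sn k (cw y0)) = 0 \<and> fn (Sn (Suc k) (cg y0)) 0 = (l - r) * cb1 y0 \<and>
     snd y0 = (bin, b1in, 0)"

lemma ode_sol_imp_solution:
  assumes y0: "initial_state \<zeta>in qin bin b1in y0" and s: "ode_sol (F k) (dom k) y0 T y"
  shows "wave_structure_solution r l \<alpha> Tbuo P0 \<kappa> \<eta>eq \<epsilon> \<mu> (Suc k) \<zeta>in qin bin b1in T
    (\<lambda>t. ext r (Sn k (cz (y t)))) (\<lambda>t. ext r (Sn (Suc k) (cg (y t)))) (\<lambda>t. cb (y t))"
proof -
  define I where "I = time_interval T"
  define gt where "gt t = ((l - r) * acc k (y t)) *\<^sub>R Ek \<mu> k - gk \<mu> k (Phi k (cz (y t)) (cw (y t)) (cg (y t)))" for t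
  note d = ode_sol_components[OF s]
  have yc: "continuous_on I y" unfolding I_def by (rule ode_sol_continuous_on[OF s])
  have dom: "y t \<in> dom k" if "t \<in> I" for t using s that by (simp add: ode_sol_def I_def)
  have Fc: "continuous_on I (\<lambda>t. F k (y t))"
    by (rule continuous_on_compose2[OF loclip_on_continuous_on[OF loclip_F open_dom] yc]) (use dom in auto)
  note comp = bounded_linear_components[THEN bounded_linear.continuous_on, OF Fc]
  have C1z: "C1_sobolev (Eminus r) (Suc k) I (\<lambda>t. ext r (Sn k (cz (y t)))) (\<lambda>t. ext r (Sn k (- pc (cg (y t)))))"
    by (rule derivative_imp_C1_sobolev) (use d(1) comp(1) in \<open>simp_all add: I_def F_def\<close>)
  have C1g: "C1_sobolev (Eminus r) (Suc (Suc k)) I (\<lambda>t. ext r (Sn (Suc k) (cg (y t)))) (\<lambda>t. ext r (Sn (Suc k) (gt t)))"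
    by (rule derivative_imp_C1_sobolev) (use d(3) comp(3) in \<open>simp_all add: I_def F_def gt_def\<close>)
  have acc: "continuous_on I (\<lambda>t. acc k (y t))" using comp(5) by (simp add: F_def)
  have bc: "continuous_on (time_interval T) (\<lambda>t. cb (y t))"
    using bounded_linear.continuous_on[OF bounded_linear_components(4) yc] by (simp add: I_def)
  have main: "positive_infimum r (depth \<epsilon> (ext r (Sn k (cz (y t))))) \<and>
           h_wc \<epsilon> \<eta>eq (cb (y t)) > 0 \<and>
           (AE x in LE r. ext r (Sn k (- pc (cg (y t)))) x + weak_deriv (Eminus r) 1 (ext r (Sn (Suc k) (cg (y t)))) x = 0) \<and>
           (AE x in LE r.
              (ext r (Sn (Suc k) (gt t)) x - \<mu>\<^sup>2 * weak_deriv (Eminus r) 2 (ext r (Sn (Suc k) (gt t))) x)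
              + \<epsilon> * weak_deriv (Eminus r) 1 (\<lambda>x. (ext r (Sn (Suc k) (cg (y t))) x)\<^sup>2 / depth \<epsilon> (ext r (Sn k (cz (y t)))) x) x
              + depth \<epsilon> (ext r (Sn k (cz (y t)))) x * weak_deriv (Eminus r) 1 (ext r (Sn k (cz (y t)))) x = 0) \<and>
           vanishes_at_minus_infinity r (ext r (Sn k (cz (y t)))) \<and>
           vanishes_at_minus_infinity r (ext r (Sn (Suc k) (cg (y t)))) \<and>
           bdry_trace r (ext r (Sn (Suc k) (cg (y t)))) = cb1 (y t) * (l - r) \<and>
           period_sq r (l - r) \<alpha> Tbuo \<mu> (depth \<epsilon> (ext r (Sn k (cz (y t))))) (h_wc \<epsilon> \<eta>eq (cb (y t))) * acc k (y t) =
             - (1 + P0) * cb (y t) + \<kappa> * P0 * duhamel \<kappa> (\<lambda>t. cb (y t)) t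
             + \<epsilon> * beta r (l - r) (depth \<epsilon> (ext r (Sn k (cz (y t))))) (h_wc \<epsilon> \<eta>eq (cb (y t))) * (cb1 (y t))\<^sup>2
             + bdry_trace r (forcing r \<epsilon> \<mu> (ext r (Sn k (cz (y t)))) (ext r (Sn (Suc k) (cg (y t)))))"
    if t: "t \<in> I" for t
  proof -
    have tT: "t \<in> time_interval T" using t by (simp add: I_def)
    have c: "cst (Sn k (cz (y t))) (Sn k (cw (y t))) = 0"
      by (rule cst_preserved[OF s tT]) (use y0 in \<open>simp add: initial_state_def\<close>)
    have rep: "represents (ext r (Sn k (cz (y t)))) (ext r (Sn (Suc k) (cg (y t)))) (cz (y t)) (cw (y t)) (cg (y t))"
      unfolding represents_def using c ext_measurable by blast
    have hw: "h_wc \<epsilon> \<eta>eq (cb (y t)) > 0" and w0: "1 + tr k (cw (y t)) > 0" using dom[OF t] by (auto simp: dom_def)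
    have pos: "positive_infimum r (depth \<epsilon> (ext r (Sn k (cz (y t)))))"
      unfolding positive_infimum_def
    proof (intro exI conjI AE_I2)
      define W where "W = Sn k (cw (y t))"
      \<comment> \<open>A uniform lower bound for \<open>h\<close> is the reciprocal of an upper
        bound for \<open>1/h\<close>, and \<open>1 + norm W\<close> bounds
        \<open>1 + w\<close>.\<close>
      show "1 / (1 + norm W) > 0" by (simp add: add_pos_nonneg)
      fix x
      have p: "1 + fn W (x + r) > 0" unfolding W_def by (rule cst_pos[OF c w0[unfolded tr_def]])
      have "(1 + fn W (x + r)) * depth \<epsilon> (ext r (Sn k (cz (y t)))) x = 1"
        unfolding depth_def ext_def W_def by (rule cst_fn[OF c])
      then have "depth \<epsilon> (ext r (Sn k (cz (y t)))) x = 1 / (1 + fn W (x + r))" using p by (simp add: field_simps)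
      moreover have "1 + fn W (x + r) \<le> 1 + norm W" using fn_norm[of W "x + r"] by linarith
      ultimately show "1 / (1 + norm W) \<le> depth \<epsilon> (ext r (Sn k (cz (y t)))) x"
        using p by (simp add: frac_le)
    qed
    have tr: "fn (Sn (Suc k) (cg (y t))) 0 = (l - r) * cb1 (y t)"
      by (rule trace_preserved[OF s tT]) (use y0 in \<open>simp add: initial_state_def\<close>)
    have dh: "cd (y t) = duhamel \<kappa> (\<lambda>t. cb (y t)) t"
      by (rule duhamel_unique[OF bc tT _ d(6)]) (use s y0 in \<open>auto simp: ode_sol_def initial_state_def\<close>)
    \<comment> \<open>\<open>momentum_iff\<close> leaves the trace of \<open>q_t\<close> free; the
      flow assigns it the acceleration times the length.\<close>
    have trg: "tr (Suc k) (gt t) = (l - r) * acc k (y t)"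
      unfolding gt_def tr_def
      by (subst Sn_linear, subst Sn_linear, subst Sn_gk[OF \<mu>], subst Sn_Ek[OF \<mu>]) (simp add: Pop_0[OF \<mu>] \<mu>)
    have yt: "((cz (y t), cw (y t), cg (y t)), (cb (y t), cb1 (y t), duhamel \<kappa> (\<lambda>t. cb (y t)) t)) = y t"
      by (simp add: dh[symmetric])
    show ?thesis
      unfolding acceleration_iff[OF rep hw w0] yt
    proof (intro conjI pos hw refl)
      show "AE x in LE r. ext r (Sn k (- pc (cg (y t)))) x + weak_deriv (Eminus r) 1 (ext r (Sn (Suc k) (cg (y t)))) x = 0"
        by (subst continuity_iff[OF rep]) auto
      show "AE x in LE r.
              (ext r (Sn (Suc k) (gt t)) x - \<mu>\<^sup>2 * weak_deriv (Eminus r) 2 (ext r (Sn (Suc k) (gt t))) x)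
              + \<epsilon> * weak_deriv (Eminus r) 1 (\<lambda>x. (ext r (Sn (Suc k) (cg (y t))) x)\<^sup>2 / depth \<epsilon> (ext r (Sn k (cz (y t)))) x) x
              + depth \<epsilon> (ext r (Sn k (cz (y t)))) x * weak_deriv (Eminus r) 1 (ext r (Sn k (cz (y t)))) x = 0"
        by (subst momentum_iff[OF rep ext_measurable, where gt = "gt t"]) (rule AE_I2, rule refl, simp only: trg, simp only: gt_def)
      show "bdry_trace r (ext r (Sn (Suc k) (cg (y t)))) = cb1 (y t) * (l - r)"
        using bdry_trace_ext[where u = "ext r (Sn (Suc k) (cg (y t)))" and f = "Sn (Suc k) (cg (y t))" and r = r] tr by (simp add: mult.commute)
    qed (rule vanishes_ext, rule AE_I2, rule refl)+
  qed
  show ?thesis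
    unfolding wave_structure_solution_def Suc_eq_plus1[symmetric]
  proof (intro exI conjI)
    show "C1_sobolev (Eminus r) (Suc k) (time_interval T) (\<lambda>t. ext r (Sn k (cz (y t)))) (\<lambda>t. ext r (Sn k (- pc (cg (y t)))))"
      using C1z by (simp only: I_def)
    show "C1_sobolev (Eminus r) (Suc (Suc k)) (time_interval T) (\<lambda>t. ext r (Sn (Suc k) (cg (y t)))) (\<lambda>t. ext r (Sn (Suc k) (gt t)))"
      using C1g by (simp only: I_def)
    show "\<forall>t\<in>time_interval T. ((\<lambda>t. cb (y t)) has_real_derivative cb1 (y t)) (at t within time_interval T)"
      using d(4) by (simp add: has_real_derivative_iff_has_vector_derivative)
    show "\<forall>t\<in>time_interval T. ((\<lambda>t. cb1 (y t)) has_real_derivative acc k (y t)) (at t within time_interval T)"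
      using d(5) by (simp add: has_real_derivative_iff_has_vector_derivative)
    show "continuous_on (time_interval T) (\<lambda>t. acc k (y t))" using acc by (simp only: I_def)
  qed (rule ballI, erule main[unfolded I_def], use s y0 in \<open>simp_all add: ode_sol_def initial_state_def\<close>)
qed

end

context wave_system
begin

text \<open>The infimum condition holds almost everywhere; by continuity it extends up to the
  boundary, where it makes \<open>1 + w\<close> positive.\<close>

lemma inverse_depth_exists:
  assumes z: "AE x in LE r. \<zeta> x = ext r (Sn k z) x" and p: "positive_infimum r (depth \<epsilon> \<zeta>)"
  shows "\<exists>w. cst (Sn k z) (Sn k w) = 0 \<and> 1 + tr k w > 0"
proof -
  obtain c where c: "c > 0" "AE x in LE r. c \<le> depth \<epsilon> \<zeta> x"
    using p unfolding positive_infimum_def by blast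
  have "AE x in LE r. c \<le> 1 + \<epsilon> * fn (Sn k z) (x + r)"
    using c(2) z by eventually_elim (simp add: depth_def ext_def)
  then have ae: "AE x in hl. c \<le> 1 + \<epsilon> * fn (Sn k z) x" by (simp add: AE_LE)
  have le: "c \<le> 1 + \<epsilon> * fn (Sn k z) x" if "x \<le> 0" for x
    by (rule AE_hl_continuous_le[OF _ _ ae that]) (intro continuous_intros fn_continuous)+
  obtain w where w: "cst (Sn k z) (Sn k w) = 0" using inverse_depth[OF c(1) le] by blast
  have "1 + fn (Sn k w) 0 > 0"
    using cst_fn[OF w, of 0] le[of 0] c(1) zero_less_mult_pos2[of "1 + fn (Sn k w) 0" "1 + \<epsilon> * fn (Sn k z) 0"]
    by (simp add: le_less_trans)
  then show ?thesis using w by (auto simp: tr_def)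
qed

text \<open>Through this direction uniqueness and the maximality of the existence time pass from the
  differential equation to the system. The component \<open>w\<close> is recovered from the
  constraint, the Duhamel component from \<open>b\<close>.\<close>

lemma solution_imp_ode_sol:
  assumes y0: "initial_state \<zeta>in qin bin b1in y0" and T: "T > 0"
    and sol: "wave_structure_solution r l \<alpha> Tbuo P0 \<kappa> \<eta>eq \<epsilon> \<mu> (Suc k) \<zeta>in qin bin b1in T \<zeta> q b"
  obtains y where "ode_sol (F k) (dom k) y0 T y"
    "\<And>t. t \<in> time_interval T \<Longrightarrow> AE x in LE r. \<zeta> t x = ext r (Sn k (cz (y t))) x"
    "\<And>t. t \<in> time_interval T \<Longrightarrow> AE x in LE r. q t x = ext r (Sn (Suc k) (cg (y t))) x"
    "\<And>t. t \<in> time_interval T \<Longrightarrow> b t = cb (y t)"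
proof -
  define I where "I = time_interval T"
  obtain \<zeta>t qt b' b'' where
    Cz: "C1_sobolev (Eminus r) (Suc k) I \<zeta> \<zeta>t" and Cg: "C1_sobolev (Eminus r) (Suc (Suc k)) I q qt"
    and db: "\<forall>t\<in>I. (b has_real_derivative b' t) (at t within I)"
    and db': "\<forall>t\<in>I. (b' has_real_derivative b'' t) (at t within I)"
    and eqs: "\<forall>t\<in>I. positive_infimum r (depth \<epsilon> (\<zeta> t)) \<and> h_wc \<epsilon> \<eta>eq (b t) > 0 \<and>
           (AE x in LE r. \<zeta>t t x + weak_deriv (Eminus r) 1 (q t) x = 0) \<and>
           (AE x in LE r. (qt t x - \<mu>\<^sup>2 * weak_deriv (Eminus r) 2 (qt t) x)
              + \<epsilon> * weak_deriv (Eminus r) 1 (\<lambda>y. (q t y)\<^sup>2 / depth \<epsilon> (\<zeta> t) y) x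
              + depth \<epsilon> (\<zeta> t) x * weak_deriv (Eminus r) 1 (\<zeta> t) x = 0) \<and>
           vanishes_at_minus_infinity r (\<zeta> t) \<and> vanishes_at_minus_infinity r (q t) \<and>
           bdry_trace r (q t) = b' t * (l - r) \<and>
           period_sq r (l - r) \<alpha> Tbuo \<mu> (depth \<epsilon> (\<zeta> t)) (h_wc \<epsilon> \<eta>eq (b t)) * b'' t =
             - (1 + P0) * b t + \<kappa> * P0 * duhamel \<kappa> b t
             + \<epsilon> * beta r (l - r) (depth \<epsilon> (\<zeta> t)) (h_wc \<epsilon> \<eta>eq (b t)) * (b' t)\<^sup>2
             + bdry_trace r (forcing r \<epsilon> \<mu> (\<zeta> t) (q t))"
    and ini: "AE x in LE r. \<zeta> 0 x = \<zeta>in x" "AE x in LE r. q 0 x = qin x" "b 0 = bin" "b' 0 = b1in"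
    using sol[unfolded wave_structure_solution_def Suc_eq_plus1[symmetric], folded I_def]
    by (elim exE conjE) (rule that; assumption)
  obtain z zt where z: "\<And>t. t \<in> I \<Longrightarrow> AE x in LE r. \<zeta> t x = ext r (Sn k (z t)) x"
    "\<And>t. t \<in> I \<Longrightarrow> AE x in LE r. \<zeta>t t x = ext r (Sn k (zt t)) x"
    "\<And>t. t \<in> I \<Longrightarrow> (z has_vector_derivative zt t) (at t within I)"
    by (rule C1_sobolev_imp_derivative[OF Cz], rule that; assumption)
  obtain g gt where g: "\<And>t. t \<in> I \<Longrightarrow> AE x in LE r. q t x = ext r (Sn (Suc k) (g t)) x"
    "\<And>t. t \<in> I \<Longrightarrow> AE x in LE r. qt t x = ext r (Sn (Suc k) (gt t)) x"
    "\<And>t. t \<in> I \<Longrightarrow> (g has_vector_derivative gt t) (at t within I)"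
    by (rule C1_sobolev_imp_derivative[OF Cg], rule that; assumption)
  have meas: "\<zeta> t \<in> borel_measurable (LE r)" "q t \<in> borel_measurable (LE r)" "qt t \<in> borel_measurable (LE r)"
    if "t \<in> I" for t
    using Cz Cg that by (auto simp: C1_sobolev_def intro: sobolev_measurable)
  have "\<exists>w. cst (Sn k (z t)) (Sn k w) = 0 \<and> 1 + tr k w > 0" if t: "t \<in> I" for t
    by (rule inverse_depth_exists[OF z(1)[OF t]]) (use eqs t in blast)
  then obtain \<omega> where \<omega>: "\<And>t. t \<in> I \<Longrightarrow> cst (Sn k (z t)) (Sn k (\<omega> t)) = 0" "\<And>t. t \<in> I \<Longrightarrow> 1 + tr k (\<omega> t) > 0"
    by metis
  have rep: "represents (\<zeta> t) (q t) (z t) (\<omega> t) (g t)" if t: "t \<in> I" for t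
    unfolding represents_def using meas[OF t] z(1)[OF t] g(1)[OF t] \<omega>(1)[OF t] by blast
  have zt: "zt t = - pc (g t)" if t: "t \<in> I" for t
    using continuity_iff[OF rep[OF t] z(2)[OF t]] eqs t by blast
  define y where "y t = ((z t, \<omega> t, g t), (b t, b' t, duhamel \<kappa> b t))" for t
  have hw: "h_wc \<epsilon> \<eta>eq (b t) > 0" if "t \<in> I" for t using eqs that by blast
  have b'': "b'' t = acc k (y t)" if t: "t \<in> I" for t
    using acceleration_iff[OF rep[OF t] hw[OF t] \<omega>(2)[OF t]] eqs t unfolding y_def by blast
  have tg: "tr (Suc k) (g t) = b' t * (l - r)" if t: "t \<in> I" for t
    using bdry_trace_ext[OF g(1)[OF t]] eqs t by (simp only: tr_def)
  have dbv: "(b has_vector_derivative b' t) (at t within I)" "(b' has_vector_derivative b'' t) (at t within I)"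
    if "t \<in> I" for t
    using db db' that by (simp_all add: has_real_derivative_iff_has_vector_derivative)
  \<comment> \<open>The boundary condition holds at all times and may be differentiated in time.
    This fixes the factor of the boundary layer that \<open>momentum_iff\<close> leaves
    open.\<close>
  have tgt: "tr (Suc k) (gt t) = (l - r) * acc k (y t)" if t: "t \<in> I" for t
  proof -
    have "((\<lambda>s. b' s * (l - r)) has_vector_derivative b'' t * (l - r)) (at t within I)"
      by (rule bounded_linear.has_vector_derivative[OF bounded_linear_mult_left dbv(2)[OF t]])
    moreover have "((\<lambda>s. b' s * (l - r)) has_vector_derivative tr (Suc k) (gt t)) (at t within I)"
      by (rule has_vector_derivative_transform[OF t _ bounded_linear.has_vector_derivative[OF bounded_linear_tr g(3)[OF t]]])
         (simp only: tg)
    ultimately have "b'' t * (l - r) = tr (Suc k) (gt t)"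
      using vector_derivative_unique_within at_within_time_interval_nontrivial t unfolding I_def by blast
    then show ?thesis using b''[OF t] by (simp add: mult.commute)
  qed
  have gt: "gt t = ((l - r) * acc k (y t)) *\<^sub>R Ek \<mu> k - gk \<mu> k (Phi k (z t) (\<omega> t) (g t))" if t: "t \<in> I" for t
    using momentum_iff[OF rep[OF t] meas(3)[OF t] g(2)[OF t]] eqs t unfolding tgt[OF t] by blast
  have bc: "continuous_on I b"
    using dbv(1) has_vector_derivative_continuous continuous_on_eq_continuous_within by blast
  have dd: "(duhamel \<kappa> b has_vector_derivative b t - \<kappa> * duhamel \<kappa> b t) (at t within I)" if "t \<in> I" for t
    using duhamel_has_derivative[of T b t] bc that unfolding I_def by blast
  have d\<omega>: "(\<omega> has_vector_derivative wt k (\<omega> t) (g t)) (at t within I)" if t: "t \<in> I" for t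
    by (rule inverse_depth_has_derivative[OF _ t \<omega>(1)]) (use z(3)[OF t] zt[OF t] in simp_all)
  have I0: "0 \<in> I" using T by (simp add: I_def time_interval_def zero_ereal_def)
  have y_0: "y 0 = y0"
  proof -
    have "AE x in LE r. ext r (Sn k (z 0)) x = ext r (Sn k (cz y0)) x"
      using z(1)[OF I0] ini(1) y0[unfolded initial_state_def, THEN conjunct1] by eventually_elim simp
    from ext_AE_inject[OF this] have z0: "z 0 = cz y0" by (rule Sn_inject)
    have "AE x in LE r. ext r (Sn (Suc k) (g 0)) x = ext r (Sn (Suc k) (cg y0)) x"
      using g(1)[OF I0] ini(2) y0[unfolded initial_state_def, THEN conjunct2, THEN conjunct1] by eventually_elim simp
    from ext_AE_inject[OF this] have g0: "g 0 = cg y0" by (rule Sn_inject)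
    have "cst (Sn k (z 0)) (Sn k (cw y0)) = 0" using y0 z0 by (simp add: initial_state_def)
    from cst_unique[OF \<omega>(1)[OF I0] this] have "\<omega> 0 = cw y0" by (rule Sn_inject)
    moreover have "snd y0 = (b 0, b' 0, duhamel \<kappa> b 0)" using y0 ini by (simp add: initial_state_def duhamel_0)
    ultimately show ?thesis using z0 g0 by (simp add: y_def prod_eq_iff)
  qed
  have "ode_sol (F k) (dom k) y0 T y"
    unfolding ode_sol_def I_def[symmetric]
  proof (intro conjI ballI y_0)
    fix t assume t: "t \<in> I"
    show "y t \<in> dom k" using hw[OF t] \<omega>(2)[OF t] by (simp add: dom_def y_def)
    have "(y has_vector_derivative ((zt t, wt k (\<omega> t) (g t), gt t), (b' t, b'' t, b t - \<kappa> * duhamel \<kappa> b t))) (at t within I)"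
      unfolding y_def[abs_def] by (intro has_vector_derivative_Pair z(3) d\<omega> g(3) dbv dd t)
    then show "(y has_vector_derivative F k (y t)) (at t within I)"
      by (simp add: F_def y_def zt[OF t] gt[OF t] b''[OF t])
  qed
  then show ?thesis by (rule that) (use z(1) g(1) in \<open>simp_all add: y_def I_def\<close>)
qed

end

section \<open>Blow-up in the supremum norm\<close>

lemma AE_LE_const_le:
  fixes a b :: real
  assumes "AE x in LE r. a \<le> b" shows "a \<le> b"
  using AE_hl_continuous_le[of "\<lambda>x. a" "\<lambda>x. b" 0] assms by (simp add: AE_LE)

lemma Linf_norm_bound:
  assumes "Linf_norm (Eminus r) f < ereal K"
  shows "AE x in LE r. norm (f x) \<le> K"
  using esssup_AE[of "\<lambda>x. ereal (norm (f x))" "LE r"]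
proof eventually_elim
  case (elim x)
  then have "ereal (norm (f x)) < ereal K" using assms unfolding Linf_norm_def by (rule order.strict_trans1)
  then show ?case by simp
qed

text \<open>An essential supremum over a null space would be minus infinity; here a negative bound
  is impossible because the half-line has positive measure. Nonnegativity allows each summand of the
  criterion to be bounded by the whole sum.\<close>

lemma Linf_norm_nonneg: "Linf_norm (Eminus r) f \<ge> 0"
proof (rule ccontr)
  assume "\<not> Linf_norm (Eminus r) f \<ge> 0"
  then have "Linf_norm (Eminus r) f < 0" by simp
  then obtain K where K: "Linf_norm (Eminus r) f < ereal K" "ereal K < 0" using ereal_dense2 by blast
  have "AE x in LE r. 0 \<le> K"
    using Linf_norm_bound[OF K(1)] by eventually_elim (meson norm_ge_zero order_trans)
  from AE_LE_const_le[OF this] K(2) show False by simp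
qed

lemma AE_LE_bound_imp_bound:
  assumes c: "continuous_on UNIV v" and ae: "AE x in LE r. u x = v (x + r)" "AE x in LE r. \<bar>u x\<bar> \<le> K" and "x \<le> 0"
  shows "\<bar>v x\<bar> \<le> (K::real)"
proof (rule AE_hl_continuous_le[of "\<lambda>x. \<bar>v x\<bar>" "\<lambda>x. K"])
  have "AE x in LE r. \<bar>v (x + r)\<bar> \<le> K" using ae by eventually_elim simp
  then show "AE x in hl. \<bar>v x\<bar> \<le> K" by (simp add: AE_LE)
qed (intro continuous_intros c assms)+

lemma norm_triple:
  "norm a \<le> norm (a, b, c)" "norm b \<le> norm (a, b, c)" "norm c \<le> norm (a, b, c)"
  by (rule norm_fst_le, rule order_trans[OF norm_fst_le norm_snd_le], rule order_trans[OF norm_snd_le norm_snd_le])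

context wave_system
begin

text \<open>A finite upper limit bounds every quantity required by \<open>continuation\<close> on
  some \<open>(t0, T)\<close>, and compactness bounds them on \<open>[0, t0]\<close>. The limit
  obtained in this way is what \<open>no_lim\<close> excludes.\<close>

lemma blow_up:
  assumes y0: "initial_state \<zeta>in qin bin b1in y0" and s: "ode_sol (F k) (dom k) y0 (ereal T) y" and T: "T > 0"
    and no_lim: "\<And>y1. y1 \<in> dom k \<Longrightarrow> \<not> (y \<longlongrightarrow> y1) (at_left T)"
  shows "Limsup (at_left T)
      (\<lambda>t. Linf_norm (Eminus r) (\<lambda>x. (ext r (Sn k (cz (y t))) x, ext r (Sn (Suc k) (cg (y t))) x, 1 / depth \<epsilon> (ext r (Sn k (cz (y t)))) x))
           + ereal \<bar>deriv (\<lambda>t. cb (y t)) t\<bar> + ereal \<bar>1 / h_wc \<epsilon> \<eta>eq (cb (y t))\<bar>) = \<infinity>"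
    (is "Limsup _ ?\<Lambda> = \<infinity>")
proof (rule ccontr)
  assume "Limsup (at_left T) ?\<Lambda> \<noteq> \<infinity>"
  then obtain K :: nat where "Limsup (at_left T) ?\<Lambda> < ereal (real K)" unfolding less_PInf_Ex_of_nat by blast
  then have "\<forall>\<^sub>F t in at_left T. ?\<Lambda> t < ereal (real K)" by (rule Limsup_lessD)
  then obtain t1 where t1: "t1 < T" "\<And>t. t1 < t \<Longrightarrow> t < T \<Longrightarrow> ?\<Lambda> t < ereal (real K)"
    unfolding eventually_at_left_field by blast
  define t0 where "t0 = max t1 0"
  have t0: "0 \<le> t0" "t0 < T" using t1 T by (auto simp: t0_def)
  have c: "cst (Sn k (cz (y t))) (Sn k (cw (y t))) = 0" if "t \<in> {0..<T}" for t
    by (rule cst_preserved[OF s]) (use that y0 in \<open>simp_all add: initial_state_def\<close>)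
  have dom: "y t \<in> dom k" if "t \<in> {0..<T}" for t using s that by (simp add: ode_sol_def)
  have late: "(\<forall>x\<le>0. \<bar>fn (Sn k (cz (y t))) x\<bar> \<le> K) \<and> (\<forall>x\<le>0. \<bar>fn (Sn (Suc k) (cg (y t))) x\<bar> \<le> K) \<and>
      (\<forall>x\<le>0. \<bar>1 + fn (Sn k (cw (y t))) x\<bar> \<le> K) \<and> \<bar>cb1 (y t)\<bar> \<le> K \<and> 1 / h_wc \<epsilon> \<eta>eq (cb (y t)) \<le> K"
    if t: "t0 < t" "t < T" for t
  proof -
    define f where "f x = (ext r (Sn k (cz (y t))) x, ext r (Sn (Suc k) (cg (y t))) x, 1 / depth \<epsilon> (ext r (Sn k (cz (y t)))) x)" for x
    have tT: "t \<in> time_interval (ereal T)" using t t0 by simp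
    \<comment> \<open>Times after \<open>t0 \<ge> 0\<close> are interior, so \<open>deriv\<close> in
      the criterion is the derivative along the flow.\<close>
    have "at t within {0..<T} = at t"
      by (rule at_within_interior) (use t t0 in \<open>simp add: interior_atLeastLessThan\<close>)
    then have "((\<lambda>t. cb (y t)) has_real_derivative cb1 (y t)) (at t)"
      using ode_sol_components(4)[OF s tT] by (simp add: has_real_derivative_iff_has_vector_derivative)
    then have db: "deriv (\<lambda>t. cb (y t)) t = cb1 (y t)" by (rule DERIV_imp_deriv)
    have le: "Linf_norm (Eminus r) f + ereal \<bar>cb1 (y t)\<bar> + ereal \<bar>1 / h_wc \<epsilon> \<eta>eq (cb (y t))\<bar> < ereal K"
      using t1(2)[of t] t unfolding f_def[abs_def] db by (simp add: t0_def)
    have A0: "Linf_norm (Eminus r) f \<ge> 0" by (rule Linf_norm_nonneg)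
    obtain a where a: "Linf_norm (Eminus r) f = ereal a" using le A0 by (cases "Linf_norm (Eminus r) f") auto
    have sum: "a + \<bar>cb1 (y t)\<bar> + \<bar>1 / h_wc \<epsilon> \<eta>eq (cb (y t))\<bar> < K" "a \<ge> 0" using le A0 by (simp_all add: a)
    then have "a < K" by linarith
    then have "Linf_norm (Eminus r) f < ereal K" by (simp add: a)
    from Linf_norm_bound[OF this] have n: "AE x in LE r. norm (f x) \<le> K" .
    have "t \<in> {0..<T}" using t t0 by simp
    then have rep: "represents (ext r (Sn k (cz (y t)))) (ext r (Sn (Suc k) (cg (y t)))) (cz (y t)) (cw (y t)) (cg (y t))"
      unfolding represents_def using c ext_measurable by blast
    have n1: "AE x in LE r. \<bar>ext r (Sn k (cz (y t))) x\<bar> \<le> K"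
      using n by eventually_elim (unfold f_def real_norm_def[symmetric], rule order_trans[OF norm_triple(1)])
    have n2: "AE x in LE r. \<bar>ext r (Sn (Suc k) (cg (y t))) x\<bar> \<le> K"
      using n by eventually_elim (unfold f_def real_norm_def[symmetric], rule order_trans[OF norm_triple(2)])
    have n3: "AE x in LE r. \<bar>1 / depth \<epsilon> (ext r (Sn k (cz (y t)))) x\<bar> \<le> K"
      using n by eventually_elim (unfold f_def real_norm_def[symmetric], rule order_trans[OF norm_triple(3)])
    have e1: "\<bar>fn (Sn k (cz (y t))) x\<bar> \<le> K" if "x \<le> 0" for x
      by (rule AE_LE_bound_imp_bound[OF fn_continuous _ n1 that]) (simp add: ext_def)
    have e2: "\<bar>fn (Sn (Suc k) (cg (y t))) x\<bar> \<le> K" if "x \<le> 0" for x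
      by (rule AE_LE_bound_imp_bound[OF fn_continuous _ n2 that]) (simp add: ext_def)
    have e3: "\<bar>1 + fn (Sn k (cw (y t))) x\<bar> \<le> K" if "x \<le> 0" for x
      by (rule AE_LE_bound_imp_bound[OF _ inverse_depth_AE[OF rep] n3 that]) (intro continuous_intros fn_continuous)
    have e4: "\<bar>cb1 (y t)\<bar> \<le> K" "1 / h_wc \<epsilon> \<eta>eq (cb (y t)) \<le> K" using sum by linarith+
    show ?thesis by (intro conjI allI impI e1 e2 e3 e4)
  qed
  \<comment> \<open>A continuous function on the compact interval \<open>[0, t0]\<close> that
    majorises all the quantities at once.\<close>
  define N where "N t = norm (Sn k (cz (y t))) + norm (Sn (Suc k) (cg (y t))) + (1 + norm (Sn k (cw (y t))))
      + \<bar>cb1 (y t)\<bar> + 1 / h_wc \<epsilon> \<eta>eq (cb (y t))" for t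
  have sub: "{0..t0} \<subseteq> {0..<T}" using t0 by auto
  have yc: "continuous_on {0..t0} y" using ode_sol_continuous_on[OF s] sub continuous_on_subset by auto
  have hw: "h_wc \<epsilon> \<eta>eq (cb (y t)) > 0" if "t \<in> {0..<T}" for t using dom[OF that] by (simp add: dom_def)
  have nz: "1 + \<epsilon> * \<eta>eq + \<epsilon> * cb (y t) \<noteq> 0" if "t \<in> {0..t0}" for t
    using hw[of t] that t0 by (simp add: h_wc_def)
  have "continuous_on {0..t0} N"
    unfolding N_def[abs_def] h_wc_def
    by (intro continuous_intros bounded_linear.continuous_on[OF bounded_linear_Sn] yc)
       (rule ballI, erule nz)
  then have "bounded (N ` {0..t0})"
    by (intro compact_imp_bounded compact_continuous_image) auto
  then obtain B where "\<forall>v\<in>N ` {0..t0}. norm v \<le> B" unfolding bounded_iff by blast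
  then have B: "N t \<le> B" if "t \<in> {0..t0}" for t using that by (force simp del: atLeastAtMost_iff)
  have early: "(\<forall>x\<le>0. \<bar>fn (Sn k (cz (y t))) x\<bar> \<le> B) \<and> (\<forall>x\<le>0. \<bar>fn (Sn (Suc k) (cg (y t))) x\<bar> \<le> B) \<and>
      (\<forall>x\<le>0. \<bar>1 + fn (Sn k (cw (y t))) x\<bar> \<le> B) \<and> \<bar>cb1 (y t)\<bar> \<le> B \<and> 1 / h_wc \<epsilon> \<eta>eq (cb (y t)) \<le> B"
    if t: "t \<in> {0..t0}" for t
  proof -
    have h: "1 / h_wc \<epsilon> \<eta>eq (cb (y t)) > 0" using hw[of t] t sub by auto
    have e1: "\<bar>fn (Sn k (cz (y t))) x\<bar> \<le> B" for x
      using B[OF t] h fn_norm[of "Sn k (cz (y t))" x] norm_ge_zero[of "Sn (Suc k) (cg (y t))"] norm_ge_zero[of "Sn k (cw (y t))"]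
      unfolding N_def by linarith
    have e2: "\<bar>fn (Sn (Suc k) (cg (y t))) x\<bar> \<le> B" for x
      using B[OF t] h fn_norm[of "Sn (Suc k) (cg (y t))" x] norm_ge_zero[of "Sn k (cz (y t))"] norm_ge_zero[of "Sn k (cw (y t))"]
      unfolding N_def by linarith
    have e3: "\<bar>1 + fn (Sn k (cw (y t))) x\<bar> \<le> B" for x
      using B[OF t] h fn_norm[of "Sn k (cw (y t))" x] norm_ge_zero[of "Sn k (cz (y t))"] norm_ge_zero[of "Sn (Suc k) (cg (y t))"]
      unfolding N_def by linarith
    have e4: "\<bar>cb1 (y t)\<bar> \<le> B" "1 / h_wc \<epsilon> \<eta>eq (cb (y t)) \<le> B"
      using B[OF t] h norm_ge_zero[of "Sn k (cz (y t))"] norm_ge_zero[of "Sn (Suc k) (cg (y t))"] norm_ge_zero[of "Sn k (cw (y t))"]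
      unfolding N_def by linarith+
    show ?thesis by (intro conjI allI impI e1 e2 e3 e4)
  qed
  define M where "M = max (real K) B"
  have all: "(\<forall>x\<le>0. \<bar>fn (Sn k (cz (y t))) x\<bar> \<le> M) \<and> (\<forall>x\<le>0. \<bar>fn (Sn (Suc k) (cg (y t))) x\<bar> \<le> M) \<and>
      (\<forall>x\<le>0. \<bar>1 + fn (Sn k (cw (y t))) x\<bar> \<le> M) \<and> \<bar>cb1 (y t)\<bar> \<le> M \<and> 1 / h_wc \<epsilon> \<eta>eq (cb (y t)) \<le> M"
    if t: "t \<in> {0..<T}" for t
  proof (cases "t \<le> t0")
    case True then show ?thesis using early[of t] t unfolding M_def by (auto simp: le_max_iff_disj)
  next
    case False then show ?thesis using late[of t] t unfolding M_def by (auto simp: le_max_iff_disj)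
  qed
  have "\<exists>y1\<in>dom k. (y \<longlongrightarrow> y1) (at_left T)"
    by (rule continuation[OF s T c, of M]) (use all in blast)+
  then show False using no_lim by blast
qed

end

section \<open>Well-posedness\<close>

theorem theorem5p9:
  fixes r l \<alpha> Tbuo P0 \<kappa> \<eta>eq \<epsilon> \<mu> bin b1in :: real
    and m :: nat
    and \<zeta>in qin :: "real \<Rightarrow> real"
  assumes "0 < r" and "r < l"
    and "\<alpha> > 0" and "Tbuo\<^sup>2 > 0" and "P0 > 0" and "\<kappa> \<ge> 0" and "\<eta>eq < 0"
    and "m \<ge> 1"
    and "0 < \<epsilon>" and "\<epsilon> \<le> 1" and "\<mu> > 0"
    and "\<zeta>in \<in> sobolev (Eminus r) m" and "qin \<in> sobolev (Eminus r) (m + 1)"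
    and "positive_infimum r (depth \<epsilon> \<zeta>in)"
    and "h_wc \<epsilon> \<eta>eq bin > 0"
    and "bdry_trace r qin = (l - r) * b1in"
  shows
    "let Sol = wave_structure_solution r l \<alpha> Tbuo P0 \<kappa> \<eta>eq \<epsilon> \<mu> m \<zeta>in qin bin b1in;
         Tmax = max_existence_time Sol
     in (\<exists>T::real. T > 0 \<and> (\<exists>\<zeta> q b. is_unique_solution r Sol (ereal T) \<zeta> q b)) \<and>
        (\<exists>\<zeta> q b. is_unique_solution r Sol Tmax \<zeta> q b \<and>
           (Tmax < \<infinity> \<longrightarrow>
              Limsup (at_left (real_of_ereal Tmax))
                (\<lambda>t. Linf_norm (Eminus r) (\<lambda>x. (\<zeta> t x, q t x, 1 / depth \<epsilon> (\<zeta> t) x))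
                     + ereal \<bar>deriv b t\<bar>
                     + ereal \<bar>1 / h_wc \<epsilon> \<eta>eq (b t)\<bar>) = \<infinity>))"
proof -
  \<comment> \<open>\<open>H^m\<close> is the image of \<open>h1\<close> under \<open>Sn k\<close>,
    so \<open>m = 1\<close> is level 0.\<close>
  obtain k where m: "m = Suc k" using \<open>m \<ge> 1\<close> by (cases m) auto
  interpret wave_system r l \<alpha> Tbuo P0 \<kappa> \<eta>eq \<epsilon> \<mu> k
    by unfold_locales (use assms in auto)
  define Sol where "Sol = wave_structure_solution r l \<alpha> Tbuo P0 \<kappa> \<eta>eq \<epsilon> \<mu> m \<zeta>in qin bin b1in"
  obtain z0 where z0: "AE x in LE r. \<zeta>in x = ext r (Sn k z0) x"
    using sobolev_imp_h1 assms(12) unfolding m by blast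
  obtain g0 where g0: "AE x in LE r. qin x = ext r (Sn (Suc k) g0) x"
    using sobolev_imp_h1 assms(13) unfolding m Suc_eq_plus1[symmetric] by blast
  obtain w0 where w0: "cst (Sn k z0) (Sn k w0) = 0" "1 + tr k w0 > 0"
    using inverse_depth_exists[OF z0 assms(14)] by blast
  define y0 :: state where "y0 = ((z0, w0, g0), (bin, b1in, 0))"
  have "fn (Sn (Suc k) g0) 0 = (l - r) * b1in" using bdry_trace_ext[OF g0] assms(16) by (simp only:)
  moreover have "AE x in LE r. ext r (Sn k z0) x = \<zeta>in x" "AE x in LE r. ext r (Sn (Suc k) g0) x = qin x"
    using z0 g0 by (auto elim: eventually_mono simp del: funpow.simps)
  ultimately have y0: "initial_state \<zeta>in qin bin b1in y0"
    unfolding initial_state_def y0_def fst_conv snd_conv using w0(1) by blast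
  have "y0 \<in> dom k" using w0(2) assms(15) by (simp add: dom_def y0_def)
  from maximal_ode_sol[OF open_dom loclip_F this]
  obtain Tm y where Tm: "Tm > 0" and y: "ode_sol (F k) (dom k) y0 Tm y"
    and max: "\<And>T z. T > 0 \<Longrightarrow> ode_sol (F k) (dom k) y0 T z \<Longrightarrow> T \<le> Tm"
    and no_lim: "\<And>T y1. Tm = ereal T \<Longrightarrow> y1 \<in> dom k \<Longrightarrow> \<not> (y \<longlongrightarrow> y1) (at_left T)"
    by blast
  define Z where "Z t = ext r (Sn k (cz (y t)))" for t
  define Q where "Q t = ext r (Sn (Suc k) (cg (y t)))" for t
  define B where "B t = cb (y t)" for t
  have unique: "is_unique_solution r Sol T Z Q B" if T: "0 < T" "T \<le> Tm" for T
    unfolding is_unique_solution_def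
  proof (intro conjI allI impI)
    have yT: "ode_sol (F k) (dom k) y0 T y" by (rule ode_sol_restrict[OF y T(2)])
    show "Sol T Z Q B"
      unfolding Sol_def m Z_def[abs_def] Q_def[abs_def] B_def[abs_def] by (rule ode_sol_imp_solution[OF y0 yT])
    fix \<zeta>2 q2 b2 assume "Sol T \<zeta>2 q2 b2"
    then have "wave_structure_solution r l \<alpha> Tbuo P0 \<kappa> \<eta>eq \<epsilon> \<mu> (Suc k) \<zeta>in qin bin b1in T \<zeta>2 q2 b2"
      by (simp only: Sol_def m)
    from solution_imp_ode_sol[OF y0 T(1) this] obtain y2 where y2: "ode_sol (F k) (dom k) y0 T y2"
      "\<And>t. t \<in> time_interval T \<Longrightarrow> AE x in LE r. \<zeta>2 t x = ext r (Sn k (cz (y2 t))) x"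
      "\<And>t. t \<in> time_interval T \<Longrightarrow> AE x in LE r. q2 t x = ext r (Sn (Suc k) (cg (y2 t))) x"
      "\<And>t. t \<in> time_interval T \<Longrightarrow> b2 t = cb (y2 t)" by blast
    show "\<forall>t\<in>time_interval T. (AE x in LE r. \<zeta>2 t x = Z t x) \<and> (AE x in LE r. q2 t x = Q t x) \<and> b2 t = B t"
    proof
      fix t assume t: "t \<in> time_interval T"
      have "y2 t = y t" by (rule ode_sol_unique[OF open_dom loclip_F y2(1) yT t])
      then show "(AE x in LE r. \<zeta>2 t x = Z t x) \<and> (AE x in LE r. q2 t x = Q t x) \<and> b2 t = B t"
        using y2(2-4)[OF t] by (simp only: Z_def Q_def B_def)
    qed
  qed
  \<comment> \<open>Both suprema are over the same times, since solutions of the system and of the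
    differential equation correspond to each other on every interval.\<close>
  have Tmax: "max_existence_time Sol = Tm"
    unfolding max_existence_time_def
  proof (rule Sup_eqI)
    fix T assume "T \<in> {T. 0 < T \<and> (\<exists>\<zeta> q b. Sol T \<zeta> q b)}"
    then obtain \<zeta> q b where T: "0 < T" and "Sol T \<zeta> q b" by blast
    then have "wave_structure_solution r l \<alpha> Tbuo P0 \<kappa> \<eta>eq \<epsilon> \<mu> (Suc k) \<zeta>in qin bin b1in T \<zeta> q b"
      by (simp only: Sol_def m)
    from solution_imp_ode_sol[OF y0 T this] obtain y2 where "ode_sol (F k) (dom k) y0 T y2" .
    then show "T \<le> Tm" by (rule max[OF T])
  next
    fix T assume "\<And>S. S \<in> {T. 0 < T \<and> (\<exists>\<zeta> q b. Sol T \<zeta> q b)} \<Longrightarrow> S \<le> T"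
    then show "Tm \<le> T" using Tm unique[OF Tm] unfolding is_unique_solution_def by blast
  qed
  \<comment> \<open>\<open>Tm\<close> may be infinite, whereas a real time is wanted; uniqueness
    holds on every shorter interval as well.\<close>
  obtain T where "0 < ereal T" "ereal T < Tm" using ereal_dense2[OF Tm] by blast
  then have ex: "\<exists>T::real. T > 0 \<and> (\<exists>\<zeta> q b. is_unique_solution r Sol (ereal T) \<zeta> q b)"
    by (intro exI[of _ T] conjI exI[of _ Z] exI[of _ Q] exI[of _ B] unique) simp_all
  have lim: "Limsup (at_left (real_of_ereal Tm))
      (\<lambda>t. Linf_norm (Eminus r) (\<lambda>x. (Z t x, Q t x, 1 / depth \<epsilon> (Z t) x))
           + ereal \<bar>deriv B t\<bar> + ereal \<bar>1 / h_wc \<epsilon> \<eta>eq (B t)\<bar>) = \<infinity>" if fin: "Tm < \<infinity>"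
  proof -
    obtain T where T: "Tm = ereal T" using Tm fin by (cases Tm) auto
    have yT: "ode_sol (F k) (dom k) y0 (ereal T) y" and T0: "T > 0" using y Tm unfolding T by simp_all
    show ?thesis unfolding T real_of_ereal.simps Z_def Q_def B_def[abs_def]
      by (rule blow_up[OF y0 yT T0]) (rule no_lim[OF T])
  qed
  show ?thesis
    unfolding Let_def Sol_def[symmetric] Tmax
    by (intro conjI ex exI[of _ Z] exI[of _ Q] exI[of _ B] unique Tm order_refl impI lim)
qed

end
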